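(* Assume the coefficient regularity assumption (C), the well-posedness assumption (W) and the uniform neural bounds assumption (N) stated in the context. Then: (a) For every fixed $p\ge1$ there exists a constant $\Lambda_p>0$, independent of the partition $\pi$, such that (for every partition $\pi$) $$\|(X^{\pi,p}-X,\,Y^{\pi,p}-Y,\,Z^{\pi,p}-Z)\|_{\mathcal E}^2\le\Lambda_p\bigl(|\pi|+\mathcal L_T^{\pi,p}+\mathcal R_{\rm term}^{\pi,p}+\mathcal R_{\rm path}^{\pi,p}\bigr)+2\mathcal E_{dec}^p.$$ (b) Moreover, for every $\zeta>0$ there exists a sequence of positive constants $(A_{p,\zeta})_{p\ge1}$, independent of $\pi$, such that for every partition $\pi$ and every $p\ge1$, $$\|(X^{\pi,p}-X,\,Y^{\pi,p}-Y,\,Z^{\pi,p}-Z)\|_{\mathcal E}^2\le A_{p,\zeta}\bigl(|\pi|+\mathcal L_T^{\pi,p}+\mathcal R_{\rm term}^{\pi,p}\bigr)+\frac{\Gamma_\zeta}{p}\sum_{j=0}^{p-1}\mathfrak X_j^\pi+2\mathcal E_{dec}^p,$$ where $\Gamma_\zeta:=2(1+\zeta)K_B(1+K_F)$.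
   Context: Spaces and norms. $(\Omega,\mathcal F,\mathbb F,\mathbb P)$ is a complete filtered probability space carrying a standard $d$-dimensional Brownian motion $W$ with natural filtration $\mathbb F$; $T>0$, $x_0\in\mathbb{R}^d$ deterministic. $|\cdot|$ is the Euclidean norm, $\|\cdot\|$ the Frobenius norm, $\|\cdot\|_2$ the induced matrix 2-norm. $\mathcal S^2_{\mathbb F}(0,T;\mathbb H)$: $\mathbb F$-adapted a.s. continuous processes with $\mathbb E[\sup_{t\le T}|X_t|^2]<\infty$; $\mathcal L^2_{\mathbb F}(0,T;\mathbb H)$: $\mathbb F$-adapted processes with $\mathbb E\int_0^T|X_t|^2\,dt<\infty$. Coefficients $b:[0,T]\times\mathbb{R}^d\times\mathbb{R}^m\times\mathbb{R}^{m\times d}\to\mathbb{R}^d$, $\sigma:[0,T]\times\mathbb{R}^d\times\mathbb{R}^m\to\mathbb{R}^{d\times d}$, $f:[0,T]\times\mathbb{R}^d\times\mathbb{R}^m\times\mathbb{R}^{m\times d}\to\mathbb{R}^m$, $g:\mathbb{R}^d\to\mathbb{R}^m$ are measurable. Coupled FBSDE (solution $(X,Y,Z)$): $X_t=x_0+\int_0^tb(s,X_s,Y_s,Z_s)ds+\int_0^t\sigma(s,X_s,Y_s)dW_s$, $\;Y_t=g(X_T)+\int_t^Tf(s,X_s,Y_s,Z_s)ds-\int_t^TZ_sdW_s$. Auxiliary decoupling systems. Given an initial reference process $\mathcal X^0$, for $p\ge1$ let $(X^p,Y^p,Z^p)$ solve $X^p_t=x_0+\int_0^tb(s,X^p_s,Y^p_s,Z^p_s)ds+\int_0^t\sigma(s,X^p_s,Y^p_s)dW_s$,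 $\;Y^p_t=g(\mathcal X^{p-1}_T)+\int_t^Tf(s,\mathcal X^{p-1}_s,Y^p_s,Z^p_s)ds-\int_t^TZ^p_sdW_s$, and set $\mathcal X^p_t:=\frac p{p+1}\mathcal X^{p-1}_t+\frac1{p+1}X^p_t$. Discrete scheme. For a partition $\pi:0=t_0<\dots<t_N=T$ let $\Delta t_n=t_{n+1}-t_n$, $\Delta W_n=W_{t_{n+1}}-W_{t_n}$, $|\pi|=\max_n\Delta t_n$. For each $\pi$ one is given, for all $p\ge0$ and $0\le n\le N-1$, deterministic $\theta_{u_0}^p\in\mathbb{R}^m$ and deterministic functions $\phi_n(\cdot;\theta_n^p):\mathbb{R}^d\to\mathbb{R}^m$ (they may depend on $\pi$). Step $p=0$: $\widetilde X^0_0=x_0$, $\widetilde Y^0_0=\theta^0_{u_0}$, and for $n=0,\dots,N-1$: $\widehat Y^0_n=\phi_n(\widetilde X^0_n;\theta^0_n)$, $\widetilde Z^0_n=\partial_x\phi_n(\widetilde X^0_n;\theta^0_n)\sigma(t_n,\widetilde X^0_n,\widehat Y^0_n)$, $\widetilde Y^0_{n+1}=\widetilde Y^0_n-f(t_n,\widetilde X^0_n,\widetilde Y^0_n,\widetilde Z^0_n)\Delta t_n+\widetilde Z^0_n\Delta W_n$, $\widetilde X^0_{n+1}=\widetilde X^0_n+b(t_n,\widetilde X^0_n,\widetilde Y^0_n,\widetilde Z^0_n)\Delta t_n+\sigma(t_n,\widetilde X^0_n,\widetilde Y^0_n)\Delta W_n$; put $\widetilde{\mathcal X}^0_n:=\widetilde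 X^0_n$ ($0\le n\le N$). Step $p\ge1$: $\widetilde X^p_0=x_0$, $\widetilde Y^p_0=\theta^{p-1}_{u_0}$, and for $n=0,\dots,N-1$: $\widehat Y^p_n=\phi_n(\widetilde{\mathcal X}^{p-1}_n;\theta^{p-1}_n)$, $\widetilde Z^p_n=\partial_x\phi_n(\widetilde{\mathcal X}^{p-1}_n;\theta^{p-1}_n)\sigma(t_n,\widetilde{\mathcal X}^{p-1}_n,\widehat Y^p_n)$, $\widetilde Y^p_{n+1}=\widetilde Y^p_n-f(t_n,\widetilde{\mathcal X}^{p-1}_n,\widetilde Y^p_n,\widetilde Z^p_n)\Delta t_n+\widetilde Z^p_n\Delta W_n$, $\widetilde X^p_{n+1}=\widetilde X^p_n+b(t_n,\widetilde X^p_n,\widetilde Y^p_n,\widetilde Z^p_n)\Delta t_n+\sigma(t_n,\widetilde X^p_n,\widetilde Y^p_n)\Delta W_n$; put $\widetilde{\mathcal X}^p_n:=\frac p{p+1}\widetilde{\mathcal X}^{p-1}_n+\frac1{p+1}\widetilde X^p_n$ ($0\le n\le N$). Interpolations: for $t\in[t_n,t_{n+1})$, $X^{\pi,p}_t=\widetilde X^p_n$, $Y^{\pi,p}_t=\widetilde Y^p_n$, $Z^{\pi,p}_t=\widetilde Z^p_n$, $\mathcal X^{\pi,p}_t=\widetilde{\mathcal X}^p_n$ ($p\ge0$); $X^{\pi,p}_T=\widetilde X^p_N$, $Y^{\pi,p}_T=\widetilde Y^p_N$, $\mathcal X^{\pi,p}_T=\widetilde{\mathcal X}^p_N$. Error quantities.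 $\|(U,V,W)\|_{\mathcal E}^2:=\sup_{0\le t\le T}\mathbb E[|U_t|^2+|V_t|^2]+\mathbb E\int_0^T\|W_t\|^2dt$. For $p\ge1$: $\mathcal E_{dec}^p:=\|(X^p-X,Y^p-Y,Z^p-Z)\|_{\mathcal E}^2$; $\mathfrak X_p^\pi:=\sup_t\mathbb E|X^{\pi,p}_t-X^p_t|^2$; $\mathcal L_T^{\pi,p}:=\mathbb E|g(X^{\pi,p}_T)-Y^{\pi,p}_T|^2$; $\mathcal R_{\rm term}^{\pi,p}:=\mathbb E|g(X^{\pi,p}_T)-g(\mathcal X^{\pi,p-1}_T)|^2$; $\mathcal R_{\rm path}^{\pi,p}:=\sup_t\mathbb E|\mathcal X^{\pi,p-1}_t-\mathcal X^{p-1}_t|^2$. Also $\mathfrak X_0^\pi:=\sup_t\mathbb E|\mathcal X^{\pi,0}_t-\mathcal X^0_t|^2$. (C) There are nonnegative constants $L_b^x,L_b^y,L_b^z,L_\sigma^x,L_\sigma^y,L_f^x,L_f^y,L_f^z,L_g,L_b^t,L_\sigma^t,L_f^t$ and $L_0>0$ such that for all arguments: $|b(t,x,y,z)-b(t,x',y',z')|\le L_b^x|x-x'|+L_b^y|y-y'|+L_b^z\|z-z'\|$; $\|\sigma(t,x,y)-\sigma(t,x',y')\|\le L_\sigma^x|x-x'|+L_\sigma^y|y-y'|$; $|f(t,x,y,z)-f(t,x',y',z')|\le L_f^x|x-x'|+L_f^y|y-y'|+L_f^z\|z-z'\|$; $|g(x)-g(x')|\le L_g|x-x'|$; $\sup_t(|b(t,0,0,0)|+\|\sigma(t,0,0)\|+|f(t,0,0,0)|)+|g(0)|\le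 L_0$; $|b(t,x,y,z)-b(s,x,y,z)|\le L_b^t(1+|x|+|y|+\|z\|)|t-s|^{1/2}$; $\|\sigma(t,x,y)-\sigma(s,x,y)\|\le L_\sigma^t(1+|x|+|y|)|t-s|^{1/2}$; $|f(t,x,y,z)-f(s,x,y,z)|\le L_f^t(1+|x|+|y|+\|z\|)|t-s|^{1/2}$. (W) The coupled FBSDE and, for every $p\ge1$, the $p$-th auxiliary system admit unique adapted solutions; $\mathcal X^0\in\mathcal S^2_{\mathbb F}(0,T;\mathbb{R}^d)$, and all these solutions belong to $\mathcal S^2_{\mathbb F}(0,T;\mathbb{R}^d)\times\mathcal S^2_{\mathbb F}(0,T;\mathbb{R}^m)\times\mathcal L^2_{\mathbb F}(0,T;\mathbb{R}^{m\times d})$. (N) There are $K_{\rm nn},K_\phi>0$, independent of $\pi,p,n$, such that for every $p\ge0$: $|\theta^p_{u_0}|+\sup_{0\le n\le N-1}|\phi_n(0;\theta^p_n)|\le K_{\rm nn}$ and $\sup_{0\le n\le N-1}\sup_{x}\|\partial_x\phi_n(x;\theta^p_n)\|_2\le K_\phi$, where each $x\mapsto\phi_n(x;\theta^p_n)$ is differentiable. Constants. $\kappa_x:=12T(L_b^x)^2+8(L_\sigma^x)^2$, $\kappa_y:=12T(L_b^y)^2+8(L_\sigma^y)^2$, $\kappa_z:=12T(L_b^z)^2$, $\beta_f:=2L_f^y+2(L_f^z)^2+2$, $K_F:=e^{\kappa_xT}\max\{\kappa_yT,\kappa_z\}$, $K_B:=3e^{\beta_fT}[L_g^2+T(L_f^x)^2]$.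 *)

theory Defs
  imports "HOL-Probability.Probability"
begin

section \<open>Brownian motion and its filtration\<close>

text \<open>Stochastic processes on the time interval from \<open>0\<close> to \<open>T\<close> are functions
  \<^typ>\<open>real \<Rightarrow> 'a \<Rightarrow> 'b\<close>; their values outside that interval are irrelevant. The filtration is the
  natural one of \<open>W\<close>, augmented by the null sets of \<open>M\<close>.\<close>

definition aug_filtration :: "'a measure \<Rightarrow> (real \<Rightarrow> 'a \<Rightarrow> 'b::topological_space) \<Rightarrow> real \<Rightarrow> 'a measure"
  where "aug_filtration M W t =
    sigma (space M) ((\<Union>s\<in>{0..t}. {W s -` A \<inter> space M | A. A \<in> sets borel}) \<union> null_sets M)"

definition adapted :: "(real \<Rightarrow> 'a measure) \<Rightarrow> real \<Rightarrow> (real \<Rightarrow> 'a \<Rightarrow> 'b::topological_space) \<Rightarrow> bool"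
  where "adapted F T X \<longleftrightarrow> (\<forall>t\<in>{0..T}. X t \<in> borel_measurable (F t))"

definition brownian_motion :: "'a measure \<Rightarrow> real \<Rightarrow> (real \<Rightarrow> 'a \<Rightarrow> real^'d) \<Rightarrow> bool"
  where "brownian_motion M T W \<longleftrightarrow>
    (\<forall>t\<in>{0..T}. W t \<in> borel_measurable M) \<and>
    (AE \<omega> in M. W 0 \<omega> = 0) \<and>
    (AE \<omega> in M. continuous_on {0..T} (\<lambda>t. W t \<omega>)) \<and>
    (\<forall>s t. 0 \<le> s \<and> s < t \<and> t \<le> T \<longrightarrow>
      prob_space.indep_set M (sets (aug_filtration M W s))
        {(\<lambda>\<omega>. W t \<omega> - W s \<omega>) -` A \<inter> space M | A. A \<in> sets borel} \<and>
      prob_space.indep_vars M (\<lambda>_. borel) (\<lambda>i \<omega>. (W t \<omega> - W s \<omega>) $ i) UNIV \<and>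
      (\<forall>i. distributed M lborel (\<lambda>\<omega>. (W t \<omega> - W s \<omega>) $ i) (normal_density 0 (sqrt (t - s)))))"


section \<open>Spaces of processes\<close>

definition mean_square :: "'a measure \<Rightarrow> ('a \<Rightarrow> 'b::real_normed_vector) \<Rightarrow> ennreal"
  where "mean_square M U = (\<integral>\<^sup>+ \<omega>. ennreal ((norm (U \<omega>))\<^sup>2) \<partial>M)"

definition int_mean_square :: "'a measure \<Rightarrow> real \<Rightarrow> (real \<Rightarrow> 'a \<Rightarrow> 'b::real_normed_vector) \<Rightarrow> ennreal"
  where "int_mean_square M T H = (\<integral>\<^sup>+ \<omega>. (\<integral>\<^sup>+ t \<in> {0..T}. ennreal ((norm (H t \<omega>))\<^sup>2) \<partial>lborel) \<partial>M)"

definition space_S2 ::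
    "'a measure \<Rightarrow> (real \<Rightarrow> 'a measure) \<Rightarrow> real \<Rightarrow> (real \<Rightarrow> 'a \<Rightarrow> 'b::real_normed_vector) set"
  where "space_S2 M F T = {X. adapted F T X \<and> (AE \<omega> in M. continuous_on {0..T} (\<lambda>t. X t \<omega>)) \<and>
    (\<integral>\<^sup>+ \<omega>. (SUP t\<in>{0..T}. ennreal ((norm (X t \<omega>))\<^sup>2)) \<partial>M) < \<infinity>}"

text \<open>Joint measurability is implicit in the time integral of an adapted process that need not be
  continuous.\<close>

definition space_L2 ::
    "'a measure \<Rightarrow> (real \<Rightarrow> 'a measure) \<Rightarrow> real \<Rightarrow> (real \<Rightarrow> 'a \<Rightarrow> 'b::real_normed_vector) set"
  where "space_L2 M F T = {H. adapted F T H \<and>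
    (\<lambda>(t, \<omega>). H t \<omega>) \<in> borel_measurable (restrict_space borel {0..T} \<Otimes>\<^sub>M M) \<and>
    int_mean_square M T H < \<infinity>}"


section \<open>Partitions and interpolation\<close>

text \<open>A partition \<open>0 = t\<^sub>0 < \<dots> < t\<^sub>N = T\<close> is the list of its \<open>N + 1\<close> points.\<close>

definition is_partition :: "real \<Rightarrow> real list \<Rightarrow> bool"
  where "is_partition T \<pi> \<longleftrightarrow> 2 \<le> length \<pi> \<and> sorted_wrt (<) \<pi> \<and> hd \<pi> = 0 \<and> last \<pi> = T"

abbreviation cells :: "real list \<Rightarrow> nat"
  where "cells \<pi> \<equiv> length \<pi> - 1"

definition mesh :: "real list \<Rightarrow> real"
  where "mesh \<pi> = Max ((\<lambda>n. \<pi> ! Suc n - \<pi> ! n) ` {..<cells \<pi>})"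

definition interpolate :: "real list \<Rightarrow> (nat \<Rightarrow> 'a \<Rightarrow> 'b) \<Rightarrow> real \<Rightarrow> 'a \<Rightarrow> 'b"
  where "interpolate \<pi> U t = U (GREATEST n. n < length \<pi> \<and> \<pi> ! n \<le> t)"

lemma interpolate_eq:
  assumes "is_partition T \<pi>" and n: "n < cells \<pi>" and t: "t \<in> {\<pi> ! n..<\<pi> ! Suc n}"
  shows "interpolate \<pi> U t = U n"
proof -
  have srt: "sorted \<pi>"
    using assms(1) by (simp add: is_partition_def strict_sorted_iff)
  have "(GREATEST n. n < length \<pi> \<and> \<pi> ! n \<le> t) = n"
  proof (rule Greatest_equality)
    fix k assume k: "k < length \<pi> \<and> \<pi> ! k \<le> t"
    show "k \<le> n"
    proof (rule ccontr)
      assume "\<not> k \<le> n"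
      then have "\<pi> ! Suc n \<le> \<pi> ! k"
        using k srt by (intro sorted_nth_mono) auto
      with k t show False by auto
    qed
  qed (use n t in auto)
  then show ?thesis by (simp add: interpolate_def)
qed

lemma interpolate_end:
  assumes "is_partition T \<pi>"
  shows "interpolate \<pi> U T = U (cells \<pi>)"
proof -
  have ne: "\<pi> \<noteq> []"
    using assms by (auto simp: is_partition_def)
  moreover have "\<pi> ! cells \<pi> = T"
    using assms ne by (simp add: is_partition_def last_conv_nth)
  ultimately have "(GREATEST n. n < length \<pi> \<and> \<pi> ! n \<le> T) = cells \<pi>"
    by (intro Greatest_equality) auto
  then show ?thesis by (simp add: interpolate_def)
qed


section \<open>Ito integral\<close>

text \<open>The Ito integral of an \<open>L\<^sup>2\<close> integrand is the continuous adapted process that is the \<open>L\<^sup>2\<close> limit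
  of the elementary integrals of bounded adapted step processes approximating the integrand.
  It is unique only up to indistinguishability, hence a relation between integrand and integral.\<close>

definition step_process :: "real list \<Rightarrow> (nat \<Rightarrow> 'a \<Rightarrow> 'b::real_vector) \<Rightarrow> real \<Rightarrow> 'a \<Rightarrow> 'b"
  where "step_process s \<xi> t \<omega> = (\<Sum>j<cells s. indicator {s ! j<..s ! Suc j} t *\<^sub>R \<xi> j \<omega>)"

definition step_integral ::
    "(real \<Rightarrow> 'a \<Rightarrow> real^'d) \<Rightarrow> real list \<Rightarrow> (nat \<Rightarrow> 'a \<Rightarrow> real^'d^'k) \<Rightarrow> real \<Rightarrow> 'a \<Rightarrow> real^'k"
  where "step_integral W s \<xi> t \<omega> =
    (\<Sum>j<cells s. \<xi> j \<omega> *v (W (min t (s ! Suc j)) \<omega> - W (min t (s ! j)) \<omega>))"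

definition simple_integrand ::
    "(real \<Rightarrow> 'a measure) \<Rightarrow> real \<Rightarrow> real list \<Rightarrow> (nat \<Rightarrow> 'a \<Rightarrow> 'b::real_normed_vector) \<Rightarrow> bool"
  where "simple_integrand F T s \<xi> \<longleftrightarrow> is_partition T s \<and>
    (\<forall>j<cells s. \<xi> j \<in> borel_measurable (F (s ! j)) \<and> (\<exists>C. \<forall>\<omega>. norm (\<xi> j \<omega>) \<le> C))"

definition has_ito_integral ::
    "'a measure \<Rightarrow> (real \<Rightarrow> 'a \<Rightarrow> real^'d) \<Rightarrow> real \<Rightarrow>
     (real \<Rightarrow> 'a \<Rightarrow> real^'d^'k) \<Rightarrow> (real \<Rightarrow> 'a \<Rightarrow> real^'k) \<Rightarrow> bool"
  where "has_ito_integral M W T H I \<longleftrightarrow>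
    adapted (aug_filtration M W) T I \<and>
    (AE \<omega> in M. continuous_on {0..T} (\<lambda>t. I t \<omega>)) \<and>
    (\<exists>s \<xi>. (\<forall>n. simple_integrand (aug_filtration M W) T (s n) (\<xi> n)) \<and>
      (\<lambda>n. int_mean_square M T (\<lambda>t \<omega>. step_process (s n) (\<xi> n) t \<omega> - H t \<omega>)) \<longlonglongrightarrow> 0 \<and>
      (\<forall>t\<in>{0..T}. (\<lambda>n. mean_square M (\<lambda>\<omega>. step_integral W (s n) (\<xi> n) t \<omega> - I t \<omega>)) \<longlonglongrightarrow> 0))"


section \<open>Coupled FBSDE and auxiliary decoupling systems\<close>

text \<open>\<open>m \<times> d\<close> matrices have type \<^typ>\<open>real^'d^'m\<close>, whose \<^const>\<open>norm\<close> is the Frobenius norm.\<close>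

record ('d, 'm) fbsde =
  horizon :: real
  start :: "real^'d"
  drift :: "real \<Rightarrow> real^'d \<Rightarrow> real^'m \<Rightarrow> real^'d^'m \<Rightarrow> real^'d"
  diffusion :: "real \<Rightarrow> real^'d \<Rightarrow> real^'m \<Rightarrow> real^'d^'d"
  driver :: "real \<Rightarrow> real^'d \<Rightarrow> real^'m \<Rightarrow> real^'d^'m \<Rightarrow> real^'m"
  terminal :: "real^'d \<Rightarrow> real^'m"

definition measurable_coefficients :: "('d::finite, 'm::finite) fbsde \<Rightarrow> bool"
  where "measurable_coefficients P \<longleftrightarrow>
    (\<lambda>(t, x, y, z). drift P t x y z) \<in> borel_measurable (restrict_space borel ({0..horizon P} \<times> UNIV)) \<and>
    (\<lambda>(t, x, y). diffusion P t x y) \<in> borel_measurable (restrict_space borel ({0..horizon P} \<times> UNIV)) \<and>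
    (\<lambda>(t, x, y, z). driver P t x y z) \<in> borel_measurable (restrict_space borel ({0..horizon P} \<times> UNIV)) \<and>
    terminal P \<in> borel_measurable borel"

definition forward_sde ::
    "'a measure \<Rightarrow> (real \<Rightarrow> 'a \<Rightarrow> real^'d) \<Rightarrow> ('d::finite, 'm::finite) fbsde \<Rightarrow>
     (real \<Rightarrow> 'a \<Rightarrow> real^'d) \<Rightarrow> (real \<Rightarrow> 'a \<Rightarrow> real^'m) \<Rightarrow> (real \<Rightarrow> 'a \<Rightarrow> real^'d^'m) \<Rightarrow> bool"
  where "forward_sde M W P X Y Z \<longleftrightarrow>
    (AE \<omega> in M. set_integrable lborel {0..horizon P} (\<lambda>s. drift P s (X s \<omega>) (Y s \<omega>) (Z s \<omega>))) \<and>
    (\<exists>I. has_ito_integral M W (horizon P) (\<lambda>s \<omega>. diffusion P s (X s \<omega>) (Y s \<omega>)) I \<and>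
      (AE \<omega> in M. \<forall>t\<in>{0..horizon P}.
        X t \<omega> = start P + (LBINT s:{0..t}. drift P s (X s \<omega>) (Y s \<omega>) (Z s \<omega>)) + I t \<omega>))"

text \<open>The process \<open>R\<close> is inserted for the forward component in driver and terminal condition.\<close>

definition backward_sde ::
    "'a measure \<Rightarrow> (real \<Rightarrow> 'a \<Rightarrow> real^'d) \<Rightarrow> ('d::finite, 'm::finite) fbsde \<Rightarrow>
     (real \<Rightarrow> 'a \<Rightarrow> real^'d) \<Rightarrow> (real \<Rightarrow> 'a \<Rightarrow> real^'m) \<Rightarrow> (real \<Rightarrow> 'a \<Rightarrow> real^'d^'m) \<Rightarrow> bool"
  where "backward_sde M W P R Y Z \<longleftrightarrow>
    (AE \<omega> in M. set_integrable lborel {0..horizon P} (\<lambda>s. driver P s (R s \<omega>) (Y s \<omega>) (Z s \<omega>))) \<and>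
    (\<exists>I. has_ito_integral M W (horizon P) Z I \<and>
      (AE \<omega> in M. \<forall>t\<in>{0..horizon P}.
        Y t \<omega> = terminal P (R (horizon P) \<omega>)
          + (LBINT s:{t..horizon P}. driver P s (R s \<omega>) (Y s \<omega>) (Z s \<omega>))
          - (I (horizon P) \<omega> - I t \<omega>)))"

definition in_solution_space ::
    "'a measure \<Rightarrow> (real \<Rightarrow> 'a \<Rightarrow> real^'d) \<Rightarrow> real \<Rightarrow>
     (real \<Rightarrow> 'a \<Rightarrow> real^'d) \<Rightarrow> (real \<Rightarrow> 'a \<Rightarrow> real^'m) \<Rightarrow> (real \<Rightarrow> 'a \<Rightarrow> real^'d^'m) \<Rightarrow> bool"
  where "in_solution_space M W T X Y Z \<longleftrightarrow>
    X \<in> space_S2 M (aug_filtration M W) T \<and> Y \<in> space_S2 M (aug_filtration M W) T \<and>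
    Z \<in> space_L2 M (aug_filtration M W) T"

definition coupled_solution ::
    "'a measure \<Rightarrow> (real \<Rightarrow> 'a \<Rightarrow> real^'d) \<Rightarrow> ('d::finite, 'm::finite) fbsde \<Rightarrow>
     (real \<Rightarrow> 'a \<Rightarrow> real^'d) \<Rightarrow> (real \<Rightarrow> 'a \<Rightarrow> real^'m) \<Rightarrow> (real \<Rightarrow> 'a \<Rightarrow> real^'d^'m) \<Rightarrow> bool"
  where "coupled_solution M W P X Y Z \<longleftrightarrow> in_solution_space M W (horizon P) X Y Z \<and>
    forward_sde M W P X Y Z \<and> backward_sde M W P X Y Z"

definition auxiliary_solution ::
    "'a measure \<Rightarrow> (real \<Rightarrow> 'a \<Rightarrow> real^'d) \<Rightarrow> ('d::finite, 'm::finite) fbsde \<Rightarrow> (real \<Rightarrow> 'a \<Rightarrow> real^'d) \<Rightarrow>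
     (real \<Rightarrow> 'a \<Rightarrow> real^'d) \<Rightarrow> (real \<Rightarrow> 'a \<Rightarrow> real^'m) \<Rightarrow> (real \<Rightarrow> 'a \<Rightarrow> real^'d^'m) \<Rightarrow> bool"
  where "auxiliary_solution M W P R X Y Z \<longleftrightarrow> in_solution_space M W (horizon P) X Y Z \<and>
    forward_sde M W P X Y Z \<and> backward_sde M W P R Y Z"

text \<open>Uniqueness is up to indistinguishability for the continuous components and up to
  \<open>dt \<otimes> d\<P>\<close>-null sets for the last one.\<close>

definition unique_solution ::
    "'a measure \<Rightarrow> real \<Rightarrow>
     ((real \<Rightarrow> 'a \<Rightarrow> real^'d) \<Rightarrow> (real \<Rightarrow> 'a \<Rightarrow> real^'m) \<Rightarrow> (real \<Rightarrow> 'a \<Rightarrow> real^'d^'m) \<Rightarrow> bool) \<Rightarrow>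
     (real \<Rightarrow> 'a \<Rightarrow> real^'d) \<Rightarrow> (real \<Rightarrow> 'a \<Rightarrow> real^'m) \<Rightarrow> (real \<Rightarrow> 'a \<Rightarrow> real^'d^'m) \<Rightarrow> bool"
  where "unique_solution M T S X Y Z \<longleftrightarrow> S X Y Z \<and>
    (\<forall>X' Y' Z'. S X' Y' Z' \<longrightarrow>
      (AE \<omega> in M. \<forall>t\<in>{0..T}. X' t \<omega> = X t \<omega> \<and> Y' t \<omega> = Y t \<omega>) \<and>
      (AE \<omega> in M. AE t in lborel. t \<in> {0..T} \<longrightarrow> Z' t \<omega> = Z t \<omega>))"

text \<open>\<open>reference_process R\<^sub>0 Xs p\<close> is the averaged process with initial process \<open>R\<^sub>0\<close>; the value
  \<open>Xs 0\<close> is not used.\<close>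

primrec reference_process ::
    "(real \<Rightarrow> 'a \<Rightarrow> 'b::real_vector) \<Rightarrow> (nat \<Rightarrow> real \<Rightarrow> 'a \<Rightarrow> 'b) \<Rightarrow> nat \<Rightarrow> real \<Rightarrow> 'a \<Rightarrow> 'b"
where
  "reference_process R\<^sub>0 Xs 0 = R\<^sub>0"
| "reference_process R\<^sub>0 Xs (Suc q) = (\<lambda>t \<omega>.
     (real (Suc q) / (real (Suc q) + 1)) *\<^sub>R reference_process R\<^sub>0 Xs q t \<omega>
     + (1 / (real (Suc q) + 1)) *\<^sub>R Xs (Suc q) t \<omega>)"


section \<open>Assumptions\<close>

text \<open>The field \<open>L\<close> + function + argument is the Lipschitz constant (\<open>1/2\<close>-Hoelder constant for \<open>t\<close>) of
  \<open>b\<close>, \<open>\<sigma>\<close> (written \<open>s\<close>), \<open>f\<close>, \<open>g\<close> in that argument.\<close>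

record reg_consts =
  Lbx :: real
  Lby :: real
  Lbz :: real
  Lsx :: real
  Lsy :: real
  Lfx :: real
  Lfy :: real
  Lfz :: real
  Lg :: real
  Lbt :: real
  Lst :: real
  Lft :: real
  L0 :: real

definition coefficient_regularity :: "('d::finite, 'm::finite) fbsde \<Rightarrow> reg_consts \<Rightarrow> bool"
  where "coefficient_regularity P L \<longleftrightarrow>
    (\<forall>c\<in>{Lbx L, Lby L, Lbz L, Lsx L, Lsy L, Lfx L, Lfy L, Lfz L, Lg L, Lbt L, Lst L, Lft L}. 0 \<le> c) \<and>
    0 < L0 L \<and>
    (\<forall>t\<in>{0..horizon P}. \<forall>x x' y y' z z'.
      norm (drift P t x y z - drift P t x' y' z')
        \<le> Lbx L * norm (x - x') + Lby L * norm (y - y') + Lbz L * norm (z - z')) \<and>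
    (\<forall>t\<in>{0..horizon P}. \<forall>x x' y y'.
      norm (diffusion P t x y - diffusion P t x' y') \<le> Lsx L * norm (x - x') + Lsy L * norm (y - y')) \<and>
    (\<forall>t\<in>{0..horizon P}. \<forall>x x' y y' z z'.
      norm (driver P t x y z - driver P t x' y' z')
        \<le> Lfx L * norm (x - x') + Lfy L * norm (y - y') + Lfz L * norm (z - z')) \<and>
    (\<forall>x x'. norm (terminal P x - terminal P x') \<le> Lg L * norm (x - x')) \<and>
    (\<forall>t\<in>{0..horizon P}.
      norm (drift P t 0 0 0) + norm (diffusion P t 0 0) + norm (driver P t 0 0 0) + norm (terminal P 0)
        \<le> L0 L) \<and>
    (\<forall>t\<in>{0..horizon P}. \<forall>s\<in>{0..horizon P}. \<forall>x y z.
      norm (drift P t x y z - drift P s x y z)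
        \<le> Lbt L * (1 + norm x + norm y + norm z) * sqrt \<bar>t - s\<bar>) \<and>
    (\<forall>t\<in>{0..horizon P}. \<forall>s\<in>{0..horizon P}. \<forall>x y.
      norm (diffusion P t x y - diffusion P s x y) \<le> Lst L * (1 + norm x + norm y) * sqrt \<bar>t - s\<bar>) \<and>
    (\<forall>t\<in>{0..horizon P}. \<forall>s\<in>{0..horizon P}. \<forall>x y z.
      norm (driver P t x y z - driver P s x y z)
        \<le> Lft L * (1 + norm x + norm y + norm z) * sqrt \<bar>t - s\<bar>)"

definition well_posedness ::
    "'a measure \<Rightarrow> (real \<Rightarrow> 'a \<Rightarrow> real^'d) \<Rightarrow> ('d::finite, 'm::finite) fbsde \<Rightarrow>
     (real \<Rightarrow> 'a \<Rightarrow> real^'d) \<Rightarrow> (real \<Rightarrow> 'a \<Rightarrow> real^'m) \<Rightarrow> (real \<Rightarrow> 'a \<Rightarrow> real^'d^'m) \<Rightarrow>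
     (real \<Rightarrow> 'a \<Rightarrow> real^'d) \<Rightarrow> (nat \<Rightarrow> real \<Rightarrow> 'a \<Rightarrow> real^'d) \<Rightarrow> (nat \<Rightarrow> real \<Rightarrow> 'a \<Rightarrow> real^'m) \<Rightarrow>
     (nat \<Rightarrow> real \<Rightarrow> 'a \<Rightarrow> real^'d^'m) \<Rightarrow> bool"
  where "well_posedness M W P X Y Z R\<^sub>0 Xs Ys Zs \<longleftrightarrow>
    unique_solution M (horizon P) (coupled_solution M W P) X Y Z \<and>
    R\<^sub>0 \<in> space_S2 M (aug_filtration M W) (horizon P) \<and>
    (\<forall>p\<ge>1. unique_solution M (horizon P)
      (auxiliary_solution M W P (reference_process R\<^sub>0 Xs (p - 1))) (Xs p) (Ys p) (Zs p))"

text \<open>\<open>\<phi> \<pi> p n\<close> is the network \<open>\<phi>\<^sub>n(\<cdot>; \<theta>\<^sub>n\<^sup>p)\<close> and \<open>\<theta> \<pi> p\<close> the initial value \<open>\<theta>\<^sub>u\<^sub>0\<^sup>p\<close> belonging to the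
  partition \<open>\<pi>\<close>; the supremum over \<open>n\<close> in the first bound is spelled out pointwise.\<close>

definition uniform_neural_bounds ::
    "real \<Rightarrow> (real list \<Rightarrow> nat \<Rightarrow> nat \<Rightarrow> real^'d \<Rightarrow> real^'m) \<Rightarrow> (real list \<Rightarrow> nat \<Rightarrow> real^'m) \<Rightarrow> bool"
  where "uniform_neural_bounds T \<phi> \<theta> \<longleftrightarrow>
    (\<exists>K\<^sub>n\<^sub>n > 0. \<exists>K\<^sub>\<phi> > 0. \<forall>\<pi>. is_partition T \<pi> \<longrightarrow> (\<forall>p. \<forall>n<cells \<pi>.
      norm (\<theta> \<pi> p) + norm (\<phi> \<pi> p n 0) \<le> K\<^sub>n\<^sub>n \<and>
      (\<forall>x. \<phi> \<pi> p n differentiable (at x) \<and> onorm ((*v) (jacobian (\<phi> \<pi> p n) (at x))) \<le> K\<^sub>\<phi>)))"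


section \<open>Discrete scheme\<close>

text \<open>In this section the partition is fixed: \<open>\<phi> p n\<close> and \<open>\<theta> p\<close> are the networks and initial values
  at \<open>\<pi>\<close>. \<open>z_approx\<close> is \<open>\<partial>\<^sub>x\<phi>\<^sub>n(r) \<sigma>(t\<^sub>n, r, \<phi>\<^sub>n(r))\<close>.\<close>

definition z_approx ::
    "('d::finite, 'm::finite) fbsde \<Rightarrow> real list \<Rightarrow> (nat \<Rightarrow> real^'d \<Rightarrow> real^'m) \<Rightarrow> nat \<Rightarrow> real^'d \<Rightarrow> real^'d^'m"
  where "z_approx P \<pi> \<phi> n r = jacobian (\<phi> n) (at r) ** diffusion P (\<pi> ! n) r (\<phi> n r)"

definition euler_step ::
    "('d::finite, 'm::finite) fbsde \<Rightarrow> (real \<Rightarrow> 'a \<Rightarrow> real^'d) \<Rightarrow> real list \<Rightarrow> (nat \<Rightarrow> real^'d \<Rightarrow> real^'m) \<Rightarrow>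
     nat \<Rightarrow> 'a \<Rightarrow> real^'d \<Rightarrow> (real^'d) \<times> (real^'m) \<Rightarrow> (real^'d) \<times> (real^'m)"
  where "euler_step P W \<pi> \<phi> n \<omega> r = (\<lambda>(x, y).
    let t = \<pi> ! n; dt = \<pi> ! Suc n - \<pi> ! n; dW = W (\<pi> ! Suc n) \<omega> - W (\<pi> ! n) \<omega>;
        z = z_approx P \<pi> \<phi> n r
    in (x + dt *\<^sub>R drift P t x y z + diffusion P t x y *v dW,
        y - dt *\<^sub>R driver P t r y z + z *v dW))"

text \<open>The pairs \<open>(X\<^sub>n, Y\<^sub>n)\<close> at the initial iteration, which uses its own forward component as
  reference, and at a later iteration, with given reference \<open>R\<close>.\<close>

primrec initial_iterate ::
    "('d::finite, 'm::finite) fbsde \<Rightarrow> (real \<Rightarrow> 'a \<Rightarrow> real^'d) \<Rightarrow> real list \<Rightarrow>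
     (nat \<Rightarrow> real^'d \<Rightarrow> real^'m) \<Rightarrow> real^'m \<Rightarrow> nat \<Rightarrow> 'a \<Rightarrow> (real^'d) \<times> (real^'m)"
where
  "initial_iterate P W \<pi> \<phi> \<theta> 0 \<omega> = (start P, \<theta>)"
| "initial_iterate P W \<pi> \<phi> \<theta> (Suc n) \<omega> =
     euler_step P W \<pi> \<phi> n \<omega> (fst (initial_iterate P W \<pi> \<phi> \<theta> n \<omega>)) (initial_iterate P W \<pi> \<phi> \<theta> n \<omega>)"

primrec next_iterate ::
    "('d::finite, 'm::finite) fbsde \<Rightarrow> (real \<Rightarrow> 'a \<Rightarrow> real^'d) \<Rightarrow> real list \<Rightarrow>
     (nat \<Rightarrow> real^'d \<Rightarrow> real^'m) \<Rightarrow> real^'m \<Rightarrow> (nat \<Rightarrow> 'a \<Rightarrow> real^'d) \<Rightarrow>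
     nat \<Rightarrow> 'a \<Rightarrow> (real^'d) \<times> (real^'m)"
where
  "next_iterate P W \<pi> \<phi> \<theta> R 0 \<omega> = (start P, \<theta>)"
| "next_iterate P W \<pi> \<phi> \<theta> R (Suc n) \<omega> =
     euler_step P W \<pi> \<phi> n \<omega> (R n \<omega>) (next_iterate P W \<pi> \<phi> \<theta> R n \<omega>)"

primrec scheme_reference ::
    "('d::finite, 'm::finite) fbsde \<Rightarrow> (real \<Rightarrow> 'a \<Rightarrow> real^'d) \<Rightarrow> real list \<Rightarrow>
     (nat \<Rightarrow> nat \<Rightarrow> real^'d \<Rightarrow> real^'m) \<Rightarrow> (nat \<Rightarrow> real^'m) \<Rightarrow> nat \<Rightarrow> nat \<Rightarrow> 'a \<Rightarrow> real^'d"
where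
  "scheme_reference P W \<pi> \<phi> \<theta> 0 = (\<lambda>n \<omega>. fst (initial_iterate P W \<pi> (\<phi> 0) (\<theta> 0) n \<omega>))"
| "scheme_reference P W \<pi> \<phi> \<theta> (Suc q) = (\<lambda>n \<omega>.
     (real (Suc q) / (real (Suc q) + 1)) *\<^sub>R scheme_reference P W \<pi> \<phi> \<theta> q n \<omega>
     + (1 / (real (Suc q) + 1)) *\<^sub>R
         fst (next_iterate P W \<pi> (\<phi> q) (\<theta> q) (scheme_reference P W \<pi> \<phi> \<theta> q) n \<omega>))"

definition scheme_XY ::
    "('d::finite, 'm::finite) fbsde \<Rightarrow> (real \<Rightarrow> 'a \<Rightarrow> real^'d) \<Rightarrow> real list \<Rightarrow>
     (nat \<Rightarrow> nat \<Rightarrow> real^'d \<Rightarrow> real^'m) \<Rightarrow> (nat \<Rightarrow> real^'m) \<Rightarrow> nat \<Rightarrow> nat \<Rightarrow> 'a \<Rightarrow> (real^'d) \<times> (real^'m)"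
  where "scheme_XY P W \<pi> \<phi> \<theta> p = (case p of
    0 \<Rightarrow> initial_iterate P W \<pi> (\<phi> 0) (\<theta> 0)
  | Suc q \<Rightarrow> next_iterate P W \<pi> (\<phi> q) (\<theta> q) (scheme_reference P W \<pi> \<phi> \<theta> q))"

definition scheme_Z ::
    "('d::finite, 'm::finite) fbsde \<Rightarrow> (real \<Rightarrow> 'a \<Rightarrow> real^'d) \<Rightarrow> real list \<Rightarrow>
     (nat \<Rightarrow> nat \<Rightarrow> real^'d \<Rightarrow> real^'m) \<Rightarrow> (nat \<Rightarrow> real^'m) \<Rightarrow> nat \<Rightarrow> nat \<Rightarrow> 'a \<Rightarrow> real^'d^'m"
  where "scheme_Z P W \<pi> \<phi> \<theta> p n \<omega> = (case p of
    0 \<Rightarrow> z_approx P \<pi> (\<phi> 0) n (fst (scheme_XY P W \<pi> \<phi> \<theta> 0 n \<omega>))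
  | Suc q \<Rightarrow> z_approx P \<pi> (\<phi> q) n (scheme_reference P W \<pi> \<phi> \<theta> q n \<omega>))"

text \<open>Interpolated processes; here \<open>\<phi>\<close> and \<open>\<theta>\<close> again depend on the partition. The value of \<open>Z_pi\<close>
  at the end point \<open>T\<close> carries no meaning; \<open>Z_pi\<close> only occurs under time integrals.\<close>

definition X_pi ::
    "('d::finite, 'm::finite) fbsde \<Rightarrow> (real \<Rightarrow> 'a \<Rightarrow> real^'d) \<Rightarrow>
     (real list \<Rightarrow> nat \<Rightarrow> nat \<Rightarrow> real^'d \<Rightarrow> real^'m) \<Rightarrow> (real list \<Rightarrow> nat \<Rightarrow> real^'m) \<Rightarrow>
     real list \<Rightarrow> nat \<Rightarrow> real \<Rightarrow> 'a \<Rightarrow> real^'d"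
  where "X_pi P W \<phi> \<theta> \<pi> p = interpolate \<pi> (\<lambda>n \<omega>. fst (scheme_XY P W \<pi> (\<phi> \<pi>) (\<theta> \<pi>) p n \<omega>))"

definition Y_pi ::
    "('d::finite, 'm::finite) fbsde \<Rightarrow> (real \<Rightarrow> 'a \<Rightarrow> real^'d) \<Rightarrow>
     (real list \<Rightarrow> nat \<Rightarrow> nat \<Rightarrow> real^'d \<Rightarrow> real^'m) \<Rightarrow> (real list \<Rightarrow> nat \<Rightarrow> real^'m) \<Rightarrow>
     real list \<Rightarrow> nat \<Rightarrow> real \<Rightarrow> 'a \<Rightarrow> real^'m"
  where "Y_pi P W \<phi> \<theta> \<pi> p = interpolate \<pi> (\<lambda>n \<omega>. snd (scheme_XY P W \<pi> (\<phi> \<pi>) (\<theta> \<pi>) p n \<omega>))"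

definition Z_pi ::
    "('d::finite, 'm::finite) fbsde \<Rightarrow> (real \<Rightarrow> 'a \<Rightarrow> real^'d) \<Rightarrow>
     (real list \<Rightarrow> nat \<Rightarrow> nat \<Rightarrow> real^'d \<Rightarrow> real^'m) \<Rightarrow> (real list \<Rightarrow> nat \<Rightarrow> real^'m) \<Rightarrow>
     real list \<Rightarrow> nat \<Rightarrow> real \<Rightarrow> 'a \<Rightarrow> real^'d^'m"
  where "Z_pi P W \<phi> \<theta> \<pi> p = interpolate \<pi> (scheme_Z P W \<pi> (\<phi> \<pi>) (\<theta> \<pi>) p)"

definition reference_pi ::
    "('d::finite, 'm::finite) fbsde \<Rightarrow> (real \<Rightarrow> 'a \<Rightarrow> real^'d) \<Rightarrow>
     (real list \<Rightarrow> nat \<Rightarrow> nat \<Rightarrow> real^'d \<Rightarrow> real^'m) \<Rightarrow> (real list \<Rightarrow> nat \<Rightarrow> real^'m) \<Rightarrow>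
     real list \<Rightarrow> nat \<Rightarrow> real \<Rightarrow> 'a \<Rightarrow> real^'d"
  where "reference_pi P W \<phi> \<theta> \<pi> p = interpolate \<pi> (scheme_reference P W \<pi> (\<phi> \<pi>) (\<theta> \<pi>) p)"


section \<open>Error quantities\<close>

text \<open>All errors are values in \<^typ>\<open>ennreal\<close>, so that no expectation or supremum needs a finiteness
  proviso. \<open>err_sq\<close> is the squared norm of the difference of two triples.\<close>

definition err_sq ::
    "'a measure \<Rightarrow> real \<Rightarrow>
     (real \<Rightarrow> 'a \<Rightarrow> real^'d) \<Rightarrow> (real \<Rightarrow> 'a \<Rightarrow> real^'m) \<Rightarrow> (real \<Rightarrow> 'a \<Rightarrow> real^'d^'m) \<Rightarrow>
     (real \<Rightarrow> 'a \<Rightarrow> real^'d) \<Rightarrow> (real \<Rightarrow> 'a \<Rightarrow> real^'m) \<Rightarrow> (real \<Rightarrow> 'a \<Rightarrow> real^'d^'m) \<Rightarrow> ennreal"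
  where "err_sq M T X Y Z X' Y' Z' =
    (SUP t\<in>{0..T}. \<integral>\<^sup>+ \<omega>. ennreal ((norm (X t \<omega> - X' t \<omega>))\<^sup>2 + (norm (Y t \<omega> - Y' t \<omega>))\<^sup>2) \<partial>M)
    + int_mean_square M T (\<lambda>t \<omega>. Z t \<omega> - Z' t \<omega>)"

definition sup_mean_square :: "'a measure \<Rightarrow> real \<Rightarrow> (real \<Rightarrow> 'a \<Rightarrow> 'b::real_normed_vector) \<Rightarrow> ennreal"
  where "sup_mean_square M T U = (SUP t\<in>{0..T}. mean_square M (U t))"

definition terminal_loss ::
    "'a measure \<Rightarrow> ('d::finite, 'm::finite) fbsde \<Rightarrow> (real \<Rightarrow> 'a \<Rightarrow> real^'d) \<Rightarrow>
     (real list \<Rightarrow> nat \<Rightarrow> nat \<Rightarrow> real^'d \<Rightarrow> real^'m) \<Rightarrow> (real list \<Rightarrow> nat \<Rightarrow> real^'m) \<Rightarrow>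
     real list \<Rightarrow> nat \<Rightarrow> ennreal"
  where "terminal_loss M P W \<phi> \<theta> \<pi> p = mean_square M
    (\<lambda>\<omega>. terminal P (X_pi P W \<phi> \<theta> \<pi> p (horizon P) \<omega>) - Y_pi P W \<phi> \<theta> \<pi> p (horizon P) \<omega>)"

definition terminal_residual ::
    "'a measure \<Rightarrow> ('d::finite, 'm::finite) fbsde \<Rightarrow> (real \<Rightarrow> 'a \<Rightarrow> real^'d) \<Rightarrow>
     (real list \<Rightarrow> nat \<Rightarrow> nat \<Rightarrow> real^'d \<Rightarrow> real^'m) \<Rightarrow> (real list \<Rightarrow> nat \<Rightarrow> real^'m) \<Rightarrow>
     real list \<Rightarrow> nat \<Rightarrow> ennreal"
  where "terminal_residual M P W \<phi> \<theta> \<pi> p = mean_square M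
    (\<lambda>\<omega>. terminal P (X_pi P W \<phi> \<theta> \<pi> p (horizon P) \<omega>)
      - terminal P (reference_pi P W \<phi> \<theta> \<pi> (p - 1) (horizon P) \<omega>))"

definition path_residual ::
    "'a measure \<Rightarrow> ('d::finite, 'm::finite) fbsde \<Rightarrow> (real \<Rightarrow> 'a \<Rightarrow> real^'d) \<Rightarrow>
     (real list \<Rightarrow> nat \<Rightarrow> nat \<Rightarrow> real^'d \<Rightarrow> real^'m) \<Rightarrow> (real list \<Rightarrow> nat \<Rightarrow> real^'m) \<Rightarrow>
     (real \<Rightarrow> 'a \<Rightarrow> real^'d) \<Rightarrow> (nat \<Rightarrow> real \<Rightarrow> 'a \<Rightarrow> real^'d) \<Rightarrow> real list \<Rightarrow> nat \<Rightarrow> ennreal"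
  where "path_residual M P W \<phi> \<theta> R\<^sub>0 Xs \<pi> p = sup_mean_square M (horizon P)
    (\<lambda>t \<omega>. reference_pi P W \<phi> \<theta> \<pi> (p - 1) t \<omega> - reference_process R\<^sub>0 Xs (p - 1) t \<omega>)"

definition forward_error ::
    "'a measure \<Rightarrow> ('d::finite, 'm::finite) fbsde \<Rightarrow> (real \<Rightarrow> 'a \<Rightarrow> real^'d) \<Rightarrow>
     (real list \<Rightarrow> nat \<Rightarrow> nat \<Rightarrow> real^'d \<Rightarrow> real^'m) \<Rightarrow> (real list \<Rightarrow> nat \<Rightarrow> real^'m) \<Rightarrow>
     (real \<Rightarrow> 'a \<Rightarrow> real^'d) \<Rightarrow> (nat \<Rightarrow> real \<Rightarrow> 'a \<Rightarrow> real^'d) \<Rightarrow> real list \<Rightarrow> nat \<Rightarrow> ennreal"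
  where "forward_error M P W \<phi> \<theta> R\<^sub>0 Xs \<pi> j = sup_mean_square M (horizon P) (if j = 0
    then (\<lambda>t \<omega>. reference_pi P W \<phi> \<theta> \<pi> 0 t \<omega> - R\<^sub>0 t \<omega>)
    else (\<lambda>t \<omega>. X_pi P W \<phi> \<theta> \<pi> j t \<omega> - Xs j t \<omega>))"


section \<open>Constants\<close>

definition kappa_x :: "real \<Rightarrow> reg_consts \<Rightarrow> real"
  where "kappa_x T L = 12 * T * (Lbx L)\<^sup>2 + 8 * (Lsx L)\<^sup>2"

definition kappa_y :: "real \<Rightarrow> reg_consts \<Rightarrow> real"
  where "kappa_y T L = 12 * T * (Lby L)\<^sup>2 + 8 * (Lsy L)\<^sup>2"

definition kappa_z :: "real \<Rightarrow> reg_consts \<Rightarrow> real"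
  where "kappa_z T L = 12 * T * (Lbz L)\<^sup>2"

definition beta_f :: "reg_consts \<Rightarrow> real"
  where "beta_f L = 2 * Lfy L + 2 * (Lfz L)\<^sup>2 + 2"

definition K_F :: "real \<Rightarrow> reg_consts \<Rightarrow> real"
  where "K_F T L = exp (kappa_x T L * T) * max (kappa_y T L * T) (kappa_z T L)"

definition K_B :: "real \<Rightarrow> reg_consts \<Rightarrow> real"
  where "K_B T L = 3 * exp (beta_f L * T) * ((Lg L)\<^sup>2 + T * (Lfx L)\<^sup>2)"

definition Gamma_const :: "real \<Rightarrow> reg_consts \<Rightarrow> real \<Rightarrow> real"
  where "Gamma_const T L \<zeta> = 2 * (1 + \<zeta>) * K_B T L * (1 + K_F T L)"

end

theory Submission imports Defs
begin

text \<open>The error splits at the auxiliary system: the squared distance of the scheme to the coupled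
  solution is at most twice the squared distance to the \<open>p\<close>-th auxiliary solution plus twice
  \<open>err_sq\<close> of the two exact solutions. The work lies in the first distance, which compares one
  backward-then-forward sweep of the scheme with one auxiliary system; in both the backward equation is
  decoupled from the forward one by a given reference process.

  Write \<open>E\<close> for the expectation. Interpolate the scheme by the paths \<open>X'\<close>, \<open>Y'\<close> that follow the
  coefficients frozen at the last grid point (\<open>euler_path\<close>). They differ from the step processes by
  \<open>O(|\<pi>|)\<close> in mean square, because the network bounds give second moments of the scheme that are
  uniform in the partition (\<open>scheme_run_moments\<close>). The difference \<open>D = Y' - Y\<close> satisfies a linear
  backward equation whose drift is bounded by a local error, the distance of the references, \<open>|D|\<close>, and
  the error \<open>H\<close> of the control. The energy identity
  \<open>E|D\<^sub>T|\<^sup>2 = E|D\<^sub>t|\<^sup>2 + \<integral> E|H\<^sub>s|\<^sup>2 ds - 2 \<integral> E\<langle>D\<^sub>s, \<phi>\<^sub>s\<rangle> ds\<close>, the integrals taken over \<open>[t, T]\<close>,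
  with Young's and Gronwall's inequalities bounds \<open>Y' - Y\<close> and the control
  (\<open>backward_stability\<close>, constant \<open>K_B\<close>); Cauchy-Schwarz, the Ito isometry and Gronwall's inequality
  carry the bound over to the forward component (\<open>forward_stability\<close>, constant \<open>K_F\<close>). The terminal
  value of \<open>D\<close> splits into the terminal loss, the terminal residual, and the distance of the references
  at \<open>T\<close>. Giving the last of these the weight \<open>1 + \<delta>\<close>, and the same weight to \<open>D\<close> when passing from
  \<open>Y'\<close> back to the step process, yields the factor \<open>(1 + \<delta>)\<^sup>2 = 1 + \<zeta>\<close> in front of the path residual
  (\<open>scheme_stability\<close>).

  Ito's formula is avoided. The energy identity only involves expectations, and it follows from the
  isometry, the orthogonality of increments to the past, and Fubini's theorem. The stochastic integral
  is therefore only used through the mean-square closure of elementary integrals (\<open>ito\<close>).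

  Finally the path residual is the error of a running average, hence at most the average of the
  forward errors of the previous iterations by convexity (\<open>path_residual_le_average\<close>).\<close>

section \<open>Square-integrable functions\<close>

definition sq_int :: "'a measure \<Rightarrow> ('a \<Rightarrow> 'b::euclidean_space) \<Rightarrow> bool"
  where "sq_int N U \<longleftrightarrow> U \<in> borel_measurable N \<and> integrable N (\<lambda>x. (norm (U x))\<^sup>2)"

definition msq :: "'a measure \<Rightarrow> ('a \<Rightarrow> 'b::euclidean_space) \<Rightarrow> real"
  where "msq N U = (\<integral>x. (norm (U x))\<^sup>2 \<partial>N)"

lemma sq_int_measurable[measurable_dest]: "sq_int N U \<Longrightarrow> U \<in> borel_measurable N"
  by (simp add: sq_int_def)

lemma sq_int_integrable: "sq_int N U \<Longrightarrow> integrable N (\<lambda>x. (norm (U x))\<^sup>2)"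
  by (simp add: sq_int_def)

lemma msq_nonneg[simp]: "0 \<le> msq N U"
  by (simp add: msq_def)

lemma sq_int_dominated:
  assumes "U \<in> borel_measurable N" "integrable N g" "\<And>x. x \<in> space N \<Longrightarrow> (norm (U x))\<^sup>2 \<le> g x"
  shows "sq_int N U"
  unfolding sq_int_def using assms
  by (auto intro!: Bochner_Integration.integrable_bound[OF assms(2)] AE_I2 order_trans[OF _ abs_ge_self])

lemma msq_le_integral:
  assumes "integrable N g" "\<And>x. x \<in> space N \<Longrightarrow> (norm (U x))\<^sup>2 \<le> g x"
  shows "msq N U \<le> (\<integral>x. g x \<partial>N)"
proof (cases "integrable N (\<lambda>x. (norm (U x))\<^sup>2)")
  case True
  then show ?thesis unfolding msq_def using assms by (intro integral_mono) auto
next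
  case False
  have "0 \<le> (\<integral>x. g x \<partial>N)"
    using assms(2) by (intro integral_nonneg_AE AE_I2) (meson order_trans zero_le_power2)
  with False show ?thesis by (simp add: msq_def not_integrable_integral_eq)
qed

lemma norm_add_sq_le: "(norm (a + b))\<^sup>2 \<le> 2 * (norm a)\<^sup>2 + 2 * (norm (b::'b::real_normed_vector))\<^sup>2"
proof -
  have "(norm (a + b))\<^sup>2 \<le> (norm a + norm b)\<^sup>2"
    by (intro power_mono norm_triangle_ineq) auto
  also have "\<dots> \<le> 2 * (norm a)\<^sup>2 + 2 * (norm b)\<^sup>2"
    using zero_le_power2[of "norm a - norm b"] by (simp add: power2_sum power2_diff)
  finally show ?thesis .
qed

lemma sq_int_zero[simp, intro]: "sq_int N (\<lambda>x. 0)"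
  by (simp add: sq_int_def)

lemma sq_int_add[intro]:
  assumes "sq_int N U" "sq_int N V" shows "sq_int N (\<lambda>x. U x + V x)"
proof (rule sq_int_dominated)
  show "integrable N (\<lambda>x. 2 * (norm (U x))\<^sup>2 + 2 * (norm (V x))\<^sup>2)"
    using assms by (auto simp: sq_int_def)
qed (use assms in \<open>auto simp: sq_int_def norm_add_sq_le\<close>)

lemma sq_int_scaleR[intro]:
  assumes "sq_int N U" shows "sq_int N (\<lambda>x. c *\<^sub>R U x)"
  using assms by (auto simp: sq_int_def power_mult_distrib)

lemma msq_scaleR: "msq N (\<lambda>x. c *\<^sub>R U x) = c\<^sup>2 * msq N U"
  by (simp add: msq_def power_mult_distrib)

lemma sq_int_uminus[intro]: "sq_int N U \<Longrightarrow> sq_int N (\<lambda>x. - U x)"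
  using sq_int_scaleR[of N U "-1"] by simp

lemma sq_int_diff[intro]:
  assumes "sq_int N U" "sq_int N V" shows "sq_int N (\<lambda>x. U x - V x)"
  using sq_int_add[OF assms(1) sq_int_uminus[OF assms(2)]] by simp

lemma sq_int_sum[intro]: "(\<And>i. i \<in> I \<Longrightarrow> sq_int N (U i)) \<Longrightarrow> sq_int N (\<lambda>x. \<Sum>i\<in>I. U i x)"
  by (induction I rule: infinite_finite_induct) auto

lemma msq_minus_commute: "msq N (\<lambda>x. U x - V x) = msq N (\<lambda>x. V x - U x)"
  by (simp add: msq_def norm_minus_commute)

lemma sq_int_norm[intro]: "sq_int N U \<Longrightarrow> sq_int N (\<lambda>x. norm (U x))"
  by (auto simp: sq_int_def)

lemma msq_norm[simp]: "msq N (\<lambda>x. norm (U x)) = msq N U"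
  by (simp add: msq_def)

lemma sq_int_cong_AE:
  assumes "sq_int N U" "V \<in> borel_measurable N" "AE x in N. U x = V x"
  shows "sq_int N V"
  using assms unfolding sq_int_def
  by (auto intro!: Bochner_Integration.integrable_cong_AE_imp[of N "\<lambda>x. (norm (U x))\<^sup>2"])

lemma msq_cong_AE:
  assumes "U \<in> borel_measurable N" "V \<in> borel_measurable N" "AE x in N. U x = V x"
  shows "msq N U = msq N V"
  using assms unfolding msq_def by (auto intro!: integral_cong_AE)

lemma integrable_inner:
  assumes "sq_int N U" "sq_int N V" shows "integrable N (\<lambda>x. U x \<bullet> V x)"
proof (rule Bochner_Integration.integrable_bound)
  show "integrable N (\<lambda>x. (norm (U x))\<^sup>2 + (norm (V x))\<^sup>2)"
    using assms by (auto simp: sq_int_def)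
  show "AE x in N. norm (U x \<bullet> V x) \<le> norm ((norm (U x))\<^sup>2 + (norm (V x))\<^sup>2)"
  proof (rule AE_I2)
    fix x
    have "\<bar>U x \<bullet> V x\<bar> \<le> norm (U x) * norm (V x)" by (rule Cauchy_Schwarz_ineq2)
    also have "\<dots> \<le> (norm (U x))\<^sup>2 + (norm (V x))\<^sup>2"
      using sum_squares_bound[of "norm (U x)" "norm (V x)"]
        mult_nonneg_nonneg[OF norm_ge_zero[of "U x"] norm_ge_zero[of "V x"]] by linarith
    finally show "norm (U x \<bullet> V x) \<le> norm ((norm (U x))\<^sup>2 + (norm (V x))\<^sup>2)" by simp
  qed
qed (use assms in \<open>auto simp: sq_int_def\<close>)

lemma norm_add_sq: "(norm (a + b))\<^sup>2 = (norm a)\<^sup>2 + 2 * (a \<bullet> b) + (norm (b::'b::real_inner))\<^sup>2"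
  unfolding power2_norm_eq_inner by (simp add: inner_simps inner_commute)

lemma msq_add:
  assumes "sq_int N U" "sq_int N V"
  shows "msq N (\<lambda>x. U x + V x) = msq N U + 2 * (\<integral>x. U x \<bullet> V x \<partial>N) + msq N V"
  unfolding msq_def norm_add_sq
  using sq_int_integrable[OF assms(1)] sq_int_integrable[OF assms(2)] integrable_inner[OF assms] by simp

lemma msq_diff:
  assumes "sq_int N U" "sq_int N V"
  shows "msq N (\<lambda>x. U x - V x) = msq N U - 2 * (\<integral>x. U x \<bullet> V x \<partial>N) + msq N V"
  using msq_add[OF assms(1) sq_int_uminus[OF assms(2)]] by (simp add: msq_def)

lemma msq_add_weighted:
  assumes "sq_int N U" "sq_int N V" "0 < c"
  shows "msq N (\<lambda>x. U x + V x) \<le> (1 + c) * msq N U + (1 + 1 / c) * msq N V"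
proof -
  have "0 \<le> msq N (\<lambda>x. c *\<^sub>R U x - V x)" by simp
  also have "\<dots> = c\<^sup>2 * msq N U - 2 * (c * (\<integral>x. U x \<bullet> V x \<partial>N)) + msq N V"
    by (subst msq_diff) (use assms in \<open>auto simp: msq_scaleR\<close>)
  finally have "2 * (c * (\<integral>x. U x \<bullet> V x \<partial>N)) \<le> c\<^sup>2 * msq N U + msq N V" by simp
  then have "2 * (\<integral>x. U x \<bullet> V x \<partial>N) \<le> c * msq N U + msq N V / c"
    using assms(3) by (simp add: field_simps power2_eq_square)
  then show ?thesis
    unfolding msq_add[OF assms(1,2)] by (simp add: algebra_simps)
qed

lemma msq_add_le:
  assumes "sq_int N U" "sq_int N V"
  shows "msq N (\<lambda>x. U x + V x) \<le> 2 * msq N U + 2 * msq N V"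
  using msq_add_weighted[OF assms, of 1] by simp

lemma msq_diff_le:
  assumes "sq_int N U" "sq_int N V"
  shows "msq N (\<lambda>x. U x - V x) \<le> 2 * msq N U + 2 * msq N V"
  using msq_add_le[OF assms(1) sq_int_uminus[OF assms(2)]] by (simp add: msq_def)

lemma inner_integral_le:
  assumes "sq_int N U" "sq_int N V"
  shows "\<bar>\<integral>x. U x \<bullet> V x \<partial>N\<bar> \<le> sqrt (msq N U) * sqrt (msq N V)"
proof -
  let ?i = "\<integral>x. U x \<bullet> V x \<partial>N"
  have pos: "0 \<le> s\<^sup>2 * msq N U - 2 * (s * ?i) + msq N V" for s
  proof -
    have "0 \<le> msq N (\<lambda>x. s *\<^sub>R U x - V x)" by simp
    also have "\<dots> = s\<^sup>2 * msq N U - 2 * (s * ?i) + msq N V"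
      by (subst msq_diff) (use assms in \<open>auto simp: msq_scaleR\<close>)
    finally show ?thesis .
  qed
  have "?i\<^sup>2 \<le> msq N U * msq N V"
  proof (cases "msq N U = 0")
    case True
    have "?i = 0"
    proof (rule ccontr)
      assume "?i \<noteq> 0"
      then show False using pos[of "(msq N V + 1) / ?i"] True msq_nonneg[of N V] by simp
    qed
    then show ?thesis using True by simp
  next
    case False
    then have "0 < msq N U" using msq_nonneg[of N U] by linarith
    then show ?thesis using pos[of "?i / msq N U"]
      by (simp add: field_simps power2_eq_square)
  qed
  then show ?thesis by (metis real_sqrt_abs real_sqrt_le_mono real_sqrt_mult)
qed

lemma inner_integral_tendsto:
  assumes sq: "\<And>n. sq_int N (Us n)" "\<And>n. sq_int N (Vs n)" "sq_int N U" "sq_int N V"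
    and lim: "(\<lambda>n. msq N (\<lambda>x. Us n x - U x)) \<longlonglongrightarrow> 0" "(\<lambda>n. msq N (\<lambda>x. Vs n x - V x)) \<longlonglongrightarrow> 0"
  shows "(\<lambda>n. \<integral>x. Us n x \<bullet> Vs n x \<partial>N) \<longlonglongrightarrow> (\<integral>x. U x \<bullet> V x \<partial>N)"
proof -
  let ?i = "\<lambda>U V. \<integral>x. U x \<bullet> V x \<partial>N"
  have "(\<lambda>n. ?i (Us n) (Vs n) - ?i U V) \<longlonglongrightarrow> 0"
  proof (rule Lim_null_comparison)
    show "\<forall>\<^sub>F n in sequentially. norm (?i (Us n) (Vs n) - ?i U V) \<le>
      sqrt (msq N (\<lambda>x. Us n x - U x)) * sqrt (msq N (\<lambda>x. Vs n x - V x))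
      + sqrt (msq N (\<lambda>x. Us n x - U x)) * sqrt (msq N V)
      + sqrt (msq N U) * sqrt (msq N (\<lambda>x. Vs n x - V x))"
    proof (intro always_eventually allI)
      fix n
      let ?a = "\<lambda>x. Us n x - U x" and ?b = "\<lambda>x. Vs n x - V x"
      have a: "sq_int N ?a" and b: "sq_int N ?b" using sq by auto
      have "?i (Us n) (Vs n) = (\<integral>x. ?a x \<bullet> ?b x + ?a x \<bullet> V x + U x \<bullet> ?b x + U x \<bullet> V x \<partial>N)"
        by (intro Bochner_Integration.integral_cong) (auto simp: inner_simps)
      also have "\<dots> = ?i ?a ?b + ?i ?a V + ?i U ?b + ?i U V"
        using a b sq by (simp add: integrable_inner)
      finally have "?i (Us n) (Vs n) - ?i U V = ?i ?a ?b + ?i ?a V + ?i U ?b" by simp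
      then show "norm (?i (Us n) (Vs n) - ?i U V) \<le> sqrt (msq N ?a) * sqrt (msq N ?b)
        + sqrt (msq N ?a) * sqrt (msq N V) + sqrt (msq N U) * sqrt (msq N ?b)"
        using inner_integral_le[OF a b] inner_integral_le[OF a sq(4)] inner_integral_le[OF sq(3) b]
        by (simp del: real_sqrt_mult)
    qed
    show "(\<lambda>n. sqrt (msq N (\<lambda>x. Us n x - U x)) * sqrt (msq N (\<lambda>x. Vs n x - V x))
      + sqrt (msq N (\<lambda>x. Us n x - U x)) * sqrt (msq N V)
      + sqrt (msq N U) * sqrt (msq N (\<lambda>x. Vs n x - V x))) \<longlonglongrightarrow> 0"
      by (rule tendsto_eq_intros lim refl | simp)+
  qed
  then show ?thesis by (rule LIM_zero_cancel)
qed

lemma msq_tendsto: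
  assumes "\<And>n. sq_int N (Us n)" "sq_int N U" "(\<lambda>n. msq N (\<lambda>x. Us n x - U x)) \<longlonglongrightarrow> 0"
  shows "(\<lambda>n. msq N (Us n)) \<longlonglongrightarrow> msq N U"
  using inner_integral_tendsto[OF assms(1,1,2,2,3,3)] by (simp add: msq_def power2_norm_eq_inner)

lemma mean_square_eq_msq:
  assumes "sq_int N U" shows "mean_square N U = ennreal (msq N U)"
  unfolding mean_square_def msq_def using assms
  by (intro nn_integral_eq_integral) (auto simp: sq_int_def)

lemma sq_int_if_mean_square_finite:
  assumes "U \<in> borel_measurable N" "mean_square N U < \<infinity>" shows "sq_int N U"
  unfolding sq_int_def using assms
  by (auto intro!: integrableI_nonneg simp: mean_square_def)

lemma (in prob_space) sq_int_const[simp]: "sq_int M (\<lambda>_. c)"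
  by (simp add: sq_int_def)

lemma (in prob_space) msq_const[simp]: "msq M (\<lambda>_. c) = (norm c)\<^sup>2"
  by (simp add: msq_def prob_space)


section \<open>Gronwall inequalities\<close>

lemma discrete_gronwall:
  fixes m h t :: "nat \<Rightarrow> real"
  assumes "0 \<le> C" "0 \<le> D" "\<And>n. n < N \<Longrightarrow> 0 \<le> h n" "0 \<le> m 0"
    and step: "\<And>n. n < N \<Longrightarrow> m (Suc n) \<le> (1 + C * h n) * m n + D * h n"
    and n: "n \<le> N"
  shows "m n \<le> exp (C * (\<Sum>k<n. h k)) * (m 0 + D * (\<Sum>k<n. h k))"
  using n
proof (induction n)
  case (Suc n)
  let ?s = "\<Sum>k<n. h k"
  have D: "0 \<le> D" by (rule assms(2))
  have h: "0 \<le> h n" and s: "0 \<le> ?s" using assms(3) Suc.prems by (auto intro!: sum_nonneg)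
  have C: "0 \<le> C * h n" using h assms(1) by simp
  have "m (Suc n) \<le> (1 + C * h n) * m n + D * h n"
    using step Suc.prems by simp
  also have "\<dots> \<le> (1 + C * h n) * (exp (C * ?s) * (m 0 + D * ?s)) + D * h n"
    using Suc C by (intro add_right_mono mult_left_mono) auto
  also have "\<dots> \<le> exp (C * h n) * (exp (C * ?s) * (m 0 + D * ?s)) + exp (C * (h n + ?s)) * (D * h n)"
  proof (intro add_mono mult_right_mono)
    have "1 \<le> exp (C * (h n + ?s))" "0 \<le> D * h n" using h s assms(1,2) by auto
    then show "D * h n \<le> exp (C * (h n + ?s)) * (D * h n)"
      using mult_right_mono[of 1 "exp (C * (h n + ?s))" "D * h n"] by simp
    show "0 \<le> exp (C * ?s) * (m 0 + D * ?s)" using D assms(4) s by (intro mult_nonneg_nonneg add_nonneg_nonneg) auto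
  qed (use exp_ge_add_one_self[of "C * h n"] in auto)
  also have "\<dots> = exp (C * (\<Sum>k<Suc n. h k)) * (m 0 + D * (\<Sum>k<Suc n. h k))"
    by (simp add: exp_add[symmetric] algebra_simps flip: mult_exp_exp)
  finally show ?case .
qed simp

text \<open>The shape in which the squared Lipschitz bounds of drift and diffusion are integrated.\<close>

lemma set_integral_affine:
  fixes u v :: "real \<Rightarrow> real"
  assumes "0 \<le> t" "set_integrable lborel {0..t} u" "set_integrable lborel {0..t} v"
  shows "(LBINT s:{0..t}. 4 * (a + b * u s + c + d * v s))
    = 4 * (t * a + b * (LBINT s:{0..t}. u s) + t * c + d * (LBINT s:{0..t}. v s))"
proof -
  have const: "set_integrable lborel {0..t} (\<lambda>_. e)" "(LBINT s:{0..t}. e) = t * e" for e :: real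
    using assms(1) by (simp_all add: set_integrable_def set_lebesgue_integral_def)
  have bu: "set_integrable lborel {0..t} (\<lambda>s. b * u s)" and dv: "set_integrable lborel {0..t} (\<lambda>s. d * v s)"
    using assms(2,3) by simp_all
  note add1 = set_integral_add[OF const(1)[of a] bu] and add2 = set_integral_add[OF add1(1) const(1)[of c]]
  show ?thesis
    unfolding set_integral_mult_right set_integral_add(2)[OF add2(1) dv] add2(2) add1(2) const(2) ..
qed

text \<open>Iterating the inequality bounds \<open>y\<close> by partial sums of the exponential series plus a
  remainder \<open>B (\<kappa>t)\<^sup>n / n!\<close>; integrability of \<open>y\<close> alone supplies the bound \<open>B\<close>.\<close>

lemma integral_gronwall:
  fixes y :: "real \<Rightarrow> real"
  assumes y: "set_integrable lborel {0..T} y" and nonneg: "\<And>t. t \<in> {0..T} \<Longrightarrow> 0 \<le> y t"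
    and \<kappa>: "0 \<le> \<kappa>" and A: "0 \<le> A"
    and le: "\<And>t. t \<in> {0..T} \<Longrightarrow> y t \<le> A + \<kappa> * (LBINT s:{0..t}. y s)"
    and t: "t \<in> {0..T}"
  shows "y t \<le> A * exp (\<kappa> * t)"
proof -
  define B where "B = A + \<kappa> * (LBINT s:{0..T}. y s)"
  have sub: "set_integrable lborel {0..t} y" if "t \<in> {0..T}" for t
    using that by (intro set_integrable_subset[OF y]) auto
  have bound: "y t \<le> (\<Sum>k<n. A * ((\<kappa> * t) ^ k / fact k)) + B * ((\<kappa> * t) ^ n / fact n)"
    if "t \<in> {0..T}" for t n
    using that
  proof (induction n arbitrary: t)
    case 0
    have "(LBINT s:{0..t}. y s) \<le> (LBINT s:{0..T}. y s)"
      unfolding set_lebesgue_integral_def using y sub[OF 0] 0 nonneg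
      by (intro integral_mono) (auto simp: set_integrable_def indicator_def)
    then show ?case using le[OF 0] \<kappa> by (simp add: B_def) (smt (verit) mult_left_mono)
  next
    case (Suc n)
    let ?p = "\<lambda>n s. (\<Sum>k<n. A * ((\<kappa> * s) ^ k / fact k)) + B * ((\<kappa> * s) ^ n / fact n)"
    let ?P = "\<lambda>s. (\<Sum>k<n. A * (\<kappa> ^ k * s ^ Suc k / fact (Suc k))) + B * (\<kappa> ^ n * s ^ Suc n / fact (Suc n))"
    have der1: "((\<lambda>s. c * (\<kappa> ^ k * s ^ Suc k / fact (Suc k))) has_real_derivative c * ((\<kappa> * s) ^ k / fact k)) (at s)"
      for c s :: real and k
    proof -
      have "((\<lambda>s. s ^ Suc k / fact (Suc k)) has_real_derivative s ^ k / fact k) (at s)"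
      proof (rule DERIV_cong)
        show "((\<lambda>s. s ^ Suc k / fact (Suc k)) has_real_derivative (real (Suc k) * s ^ k) / fact (Suc k)) (at s)"
          by (intro DERIV_cdivide DERIV_pow[THEN DERIV_cong]) simp
        show "(real (Suc k) * s ^ k) / fact (Suc k) = s ^ k / fact k"
          unfolding fact_Suc by (simp del: of_nat_Suc)
      qed
      from DERIV_cmult[OF this, of "c * \<kappa> ^ k"] show ?thesis
        by (simp add: power_mult_distrib mult_ac)
    qed
    have "(?P has_real_derivative ?p n s) (at s)" for s
      by (intro DERIV_add DERIV_sum der1)
    then have hbi: "has_bochner_integral lborel (\<lambda>x. indicator {0..t} x *\<^sub>R ?p n x) (?P t - ?P 0)"
      using Suc.prems
      by (intro has_bochner_integral_FTC_Icc)
        (auto simp: has_real_derivative_iff_has_vector_derivative[symmetric]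
          intro: DERIV_subset has_vector_derivative_at_within
          intro!: continuous_intros)
    have "(LBINT s:{0..t}. y s) \<le> (LBINT s:{0..t}. ?p n s)"
      unfolding set_lebesgue_integral_def
    proof (rule integral_mono)
      show "integrable lborel (\<lambda>x. indicator {0..t} x *\<^sub>R y x)"
        using sub[OF Suc.prems] by (simp add: set_integrable_def)
      show "integrable lborel (\<lambda>x. indicator {0..t} x *\<^sub>R ?p n x)"
        using hbi by (rule integrable.intros)
    qed (use Suc in \<open>auto simp: indicator_def\<close>)
    also have "\<dots> = ?P t"
      unfolding set_lebesgue_integral_def using has_bochner_integral_integral_eq[OF hbi] by simp
    finally have "y t \<le> A + \<kappa> * ?P t"
      using le[OF Suc.prems] \<kappa> by (smt (verit) mult_left_mono)
    also have "\<dots> = ?p (Suc n) t"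
      by (subst sum.lessThan_Suc_shift) (simp add: sum_distrib_left distrib_left power_mult_distrib mult_ac)
    finally show ?case .
  qed
  have "(\<lambda>n. (\<Sum>k<n. A * ((\<kappa> * t) ^ k / fact k)) + B * ((\<kappa> * t) ^ n / fact n))
      \<longlonglongrightarrow> A * exp (\<kappa> * t) + B * 0"
  proof (intro tendsto_add tendsto_mult tendsto_const)
    have "(\<lambda>k. A * ((\<kappa> * t) ^ k /\<^sub>R fact k)) sums (A * exp (\<kappa> * t))"
      by (intro sums_mult exp_converges)
    then show "(\<lambda>n. \<Sum>k<n. A * ((\<kappa> * t) ^ k / fact k)) \<longlonglongrightarrow> A * exp (\<kappa> * t)"
      by (simp add: sums_def field_simps)
    show "(\<lambda>n. (\<kappa> * t) ^ n / fact n) \<longlonglongrightarrow> 0"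
      using summable_LIMSEQ_zero[OF summable_exp[of "\<kappa> * t"]] by (simp add: field_simps)
  qed
  then show ?thesis using bound[OF t] by (intro LIMSEQ_le_const) auto
qed

section \<open>Brownian increments and elementary integrals\<close>

lemma borel_measurable_vec_nth[measurable]: "(\<lambda>v::('b::{real_normed_vector,second_countable_topology})^'n. v $ i) \<in> borel_measurable borel"
  by (intro borel_measurable_continuous_onI linear_continuous_on bounded_linear_vec_nth)

lemma sq_int_vec_nth:
  fixes U :: "'a \<Rightarrow> ('b::euclidean_space)^'n"
  assumes "sq_int N U" shows "sq_int N (\<lambda>x. U x $ i)"
proof (rule sq_int_dominated)
  show "integrable N (\<lambda>x. (norm (U x))\<^sup>2)" using assms by (simp add: sq_int_def)
  show "(\<lambda>x. U x $ i) \<in> borel_measurable N"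
    by (rule measurable_compose[OF sq_int_measurable[OF assms] borel_measurable_vec_nth])
qed (auto intro!: power_mono Finite_Cartesian_Product.norm_nth_le)

lemma sq_int_scaleR_left:
  fixes u :: "'a \<Rightarrow> real"
  assumes "sq_int N u" shows "sq_int N (\<lambda>x. u x *\<^sub>R c)"
  using assms by (auto simp: sq_int_def power_mult_distrib)

lemma matrix_vector_mult_axis_sum:
  fixes A :: "real^'d^'k"
  shows "A *v w = (\<Sum>k\<in>UNIV. \<Sum>j\<in>UNIV. (A $ k $ j * w $ j) *\<^sub>R axis k 1)"
proof -
  have "(\<Sum>k\<in>UNIV. \<Sum>j\<in>UNIV. (A $ k $ j * w $ j) *\<^sub>R axis k (1::real)) $ i = (A *v w) $ i" for i
  proof -
    have "(\<Sum>k\<in>UNIV. \<Sum>j\<in>UNIV. (A $ k $ j * w $ j) *\<^sub>R axis k (1::real)) $ i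
      = (\<Sum>k\<in>UNIV. if k = i then \<Sum>j\<in>UNIV. A $ k $ j * w $ j else 0)"
      unfolding sum_component by (intro sum.cong) (auto simp: axis_def)
    then show ?thesis by (simp add: matrix_vector_mult_def)
  qed
  then show ?thesis by (simp add: vec_eq_iff)
qed

lemma borel_measurable_matrix_vector_mult[measurable (raw)]:
  fixes A :: "'a \<Rightarrow> real^'d^'k"
  assumes [measurable]: "A \<in> borel_measurable N" "w \<in> borel_measurable N"
  shows "(\<lambda>x. A x *v w x) \<in> borel_measurable N"
  unfolding matrix_vector_mult_axis_sum by measurable

lemma inner_matrix_vector_mult:
  fixes A :: "real^'d^'k"
  shows "v \<bullet> (A *v w) = (\<Sum>k\<in>UNIV. \<Sum>j\<in>UNIV. v $ k * A $ k $ j * w $ j)"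
  by (simp add: inner_vec_def matrix_vector_mult_def sum_distrib_left mult.assoc)

locale brownian = prob_space M for M :: "'a measure" +
  fixes T :: real and W :: "real \<Rightarrow> 'a \<Rightarrow> real^'d"
  assumes T_pos: "0 < T" and bm: "brownian_motion M T W"
begin

abbreviation F :: "real \<Rightarrow> 'a measure" where "F \<equiv> aug_filtration M W"

lemma W_measurable: "t \<in> {0..T} \<Longrightarrow> W t \<in> borel_measurable M"
  using bm by (simp add: brownian_motion_def)

lemma space_F[simp]: "space (F t) = space M"
  by (simp add: aug_filtration_def space_measure_of_conv)

lemma F_generator_subset:
  "(\<Union>s\<in>{0..t}. {W s -` A \<inter> space M | A. A \<in> sets borel}) \<union> null_sets M \<subseteq> Pow (space M)"
  using sets.sets_into_space by (auto simp: null_sets_def)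

lemma sets_F: "sets (F t) = sigma_sets (space M)
    ((\<Union>s\<in>{0..t}. {W s -` A \<inter> space M | A. A \<in> sets borel}) \<union> null_sets M)"
  unfolding aug_filtration_def using F_generator_subset by (rule sets_measure_of)

lemma sets_F_subset: "t \<le> T \<Longrightarrow> sets (F t) \<subseteq> sets M"
  unfolding sets_F
proof (rule sets.sigma_sets_subset, rule Un_least, rule UN_least)
  fix s assume "t \<le> T" "s \<in> {0..t}"
  then have "W s \<in> borel_measurable M" by (intro W_measurable) simp
  then show "{W s -` A \<inter> space M | A. A \<in> sets borel} \<subseteq> sets M"
    using measurable_sets by blast
qed (auto simp: null_sets_def)

lemma sets_F_mono: "s \<le> t \<Longrightarrow> sets (F s) \<subseteq> sets (F t)"
  unfolding sets_F
proof (rule sigma_sets_mono', rule Un_mono)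
  assume "s \<le> t"
  then show "(\<Union>r\<in>{0..s}. {W r -` A \<inter> space M | A. A \<in> sets borel})
    \<subseteq> (\<Union>r\<in>{0..t}. {W r -` A \<inter> space M | A. A \<in> sets borel})"
    by (intro UN_mono) auto
qed simp

lemma measurable_F_mono: "U \<in> borel_measurable (F s) \<Longrightarrow> s \<le> t \<Longrightarrow> U \<in> borel_measurable (F t)"
  using sets_F_mono[of s t] by (auto simp: measurable_def)

lemma measurable_F_M: "U \<in> borel_measurable (F s) \<Longrightarrow> s \<le> T \<Longrightarrow> U \<in> borel_measurable M"
  using sets_F_subset[of s] by (auto simp: measurable_def)

lemma W_measurable_F: "0 \<le> s \<Longrightarrow> s \<le> t \<Longrightarrow> W s \<in> borel_measurable (F t)"
proof (rule measurableI)
  fix A :: "(real^'d) set" assume s: "0 \<le> s" "s \<le> t" and A: "A \<in> sets borel"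
  then have "W s -` A \<inter> space M \<in> (\<Union>s\<in>{0..t}. {W s -` A \<inter> space M | A. A \<in> sets borel})"
    by (intro UN_I[of s]) auto
  then show "W s -` A \<inter> space (F t) \<in> sets (F t)"
    unfolding sets_F space_F by (intro sigma_sets.Basic UnI1)
qed simp

lemma null_sets_F: "A \<in> null_sets M \<Longrightarrow> A \<in> sets (F t)"
  unfolding sets_F by (intro sigma_sets.Basic UnI2)

lemma increment_component_moments:
  assumes "0 \<le> a" "a \<le> b" "b \<le> T"
  shows "integrable M (\<lambda>\<omega>. (W b \<omega> - W a \<omega>) $ i)"
    and "integrable M (\<lambda>\<omega>. ((W b \<omega> - W a \<omega>) $ i)\<^sup>2)"
    and "expectation (\<lambda>\<omega>. (W b \<omega> - W a \<omega>) $ i) = 0"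
    and "expectation (\<lambda>\<omega>. ((W b \<omega> - W a \<omega>) $ i)\<^sup>2) = b - a"
proof -
  let ?X = "\<lambda>\<omega>. (W b \<omega> - W a \<omega>) $ i"
  have "integrable M ?X \<and> integrable M (\<lambda>\<omega>. (?X \<omega>)\<^sup>2) \<and> expectation ?X = 0 \<and> expectation (\<lambda>\<omega>. (?X \<omega>)\<^sup>2) = b - a"
  proof (cases "a = b")
    case False
    then have ab: "a < b" using assms by simp
    then have s: "0 < sqrt (b - a)" by simp
    have D: "distributed M lborel ?X (normal_density 0 (sqrt (b - a)))"
      using bm assms ab unfolding brownian_motion_def by auto
    have "integrable M ?X"
      using distributed_integrable[OF D, of "\<lambda>x. x"] integrable_normal_moment_nz_1[OF s, of 0] by simp
    moreover have "integrable M (\<lambda>\<omega>. (?X \<omega>)\<^sup>2)"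
      using distributed_integrable[OF D, of "\<lambda>x. x\<^sup>2"] integrable_normal_moment[OF s, of 0 2] by simp
    moreover have "expectation ?X = 0"
      by (rule normal_distributed_expectation[OF s D])
    moreover have "expectation (\<lambda>\<omega>. (?X \<omega>)\<^sup>2) = b - a"
      using normal_distributed_variance[OF s D] normal_distributed_expectation[OF s D] ab by simp
    ultimately show ?thesis by blast
  qed simp
  then show "integrable M ?X" "integrable M (\<lambda>\<omega>. (?X \<omega>)\<^sup>2)" "expectation ?X = 0"
    "expectation (\<lambda>\<omega>. (?X \<omega>)\<^sup>2) = b - a" by blast+
qed

lemma increment_measurable: "0 \<le> a \<Longrightarrow> a \<le> b \<Longrightarrow> b \<le> T \<Longrightarrow> (\<lambda>\<omega>. W b \<omega> - W a \<omega>) \<in> borel_measurable M"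
  using W_measurable[of a] W_measurable[of b] by auto

lemma increment_sq_int:
  assumes "0 \<le> a" "a \<le> b" "b \<le> T"
  shows "sq_int M (\<lambda>\<omega>. (W b \<omega> - W a \<omega>) $ i)"
  using increment_component_moments(2)[OF assms] measurable_compose[OF increment_measurable[OF assms] borel_measurable_vec_nth]
  by (simp add: sq_int_def)

lemma increment_covariance:
  assumes "0 \<le> a" "a \<le> b" "b \<le> T"
  shows "integrable M (\<lambda>\<omega>. (W b \<omega> - W a \<omega>) $ i * (W b \<omega> - W a \<omega>) $ j)"
    and "expectation (\<lambda>\<omega>. (W b \<omega> - W a \<omega>) $ i * (W b \<omega> - W a \<omega>) $ j) = (if i = j then b - a else 0)"
proof -
  let ?X = "\<lambda>i \<omega>. (W b \<omega> - W a \<omega>) $ i"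
  show int: "integrable M (\<lambda>\<omega>. ?X i \<omega> * ?X j \<omega>)"
    using integrable_inner[OF increment_sq_int[OF assms] increment_sq_int[OF assms]] by simp
  show "expectation (\<lambda>\<omega>. ?X i \<omega> * ?X j \<omega>) = (if i = j then b - a else 0)"
  proof (cases "i = j \<or> a = b")
    case True
    then show ?thesis
      using increment_component_moments(4)[OF assms, of i] by (auto simp: power2_eq_square)
  next
    case False
    then have "indep_vars (\<lambda>_. borel) ?X UNIV"
      using bm assms unfolding brownian_motion_def by force
    then have "indep_vars (\<lambda>_. borel) ?X {i, j}"
      by (rule indep_vars_subset) simp
    then have "expectation (\<lambda>\<omega>. \<Prod>k\<in>{i, j}. ?X k \<omega>) = (\<Prod>k\<in>{i, j}. expectation (?X k))"
      by (intro indep_vars_lebesgue_integral) (use increment_component_moments[OF assms] in auto)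
    then have "expectation (\<lambda>\<omega>. ?X i \<omega> * ?X j \<omega>) = expectation (?X i) * expectation (?X j)"
      using False by simp
    then show ?thesis using False increment_component_moments(3)[OF assms] by simp
  qed
qed

text \<open>The independence of an increment from the past enters only through this factorization.\<close>

lemma increment_independent:
  fixes \<xi> :: "'a \<Rightarrow> real" and g :: "real^'d \<Rightarrow> real"
  assumes ab: "0 \<le> a" "a \<le> b" "b \<le> T"
    and \<xi>: "\<xi> \<in> borel_measurable (F a)" "integrable M \<xi>"
    and g: "g \<in> borel_measurable borel" "integrable M (\<lambda>\<omega>. g (W b \<omega> - W a \<omega>))"
  shows "integrable M (\<lambda>\<omega>. \<xi> \<omega> * g (W b \<omega> - W a \<omega>))"
    and "expectation (\<lambda>\<omega>. \<xi> \<omega> * g (W b \<omega> - W a \<omega>)) = expectation \<xi> * expectation (\<lambda>\<omega>. g (W b \<omega> - W a \<omega>))"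
proof -
  let ?D = "\<lambda>\<omega>. W b \<omega> - W a \<omega>"
  have "integrable M (\<lambda>\<omega>. \<xi> \<omega> * g (?D \<omega>)) \<and> expectation (\<lambda>\<omega>. \<xi> \<omega> * g (?D \<omega>)) = expectation \<xi> * expectation (\<lambda>\<omega>. g (?D \<omega>))"
  proof (cases "a = b")
    case True
    then show ?thesis using \<xi> by (simp add: prob_space)
  next
    case False
    let ?G = "{?D -` A \<inter> space M | A. A \<in> sets borel}"
    have ind: "indep_set (sets (F a)) ?G"
      using bm ab False unfolding brownian_motion_def by auto
    have gD: "(\<lambda>\<omega>. g (?D \<omega>)) \<in> borel_measurable M"
      using g(2) by auto
    have \<xi>M: "\<xi> \<in> borel_measurable M" using \<xi>(2) by auto
    have "indep_var borel \<xi> borel (\<lambda>\<omega>. g (?D \<omega>))"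
      unfolding indep_var_eq
    proof (intro conjI gD \<xi>M)
      have 1: "sigma_sets (space M) {\<xi> -` A \<inter> space M | A. A \<in> sets borel} \<subseteq> sets (F a)"
      proof -
        have "{\<xi> -` A \<inter> space M | A. A \<in> sets borel} \<subseteq> sets (F a)"
        proof safe
          fix A :: "real set" assume "A \<in> sets borel"
          from measurable_sets[OF \<xi>(1) this] show "\<xi> -` A \<inter> space M \<in> sets (F a)"
            unfolding space_F .
        qed
        from sets.sigma_sets_subset[OF this] show ?thesis unfolding space_F .
      qed
      have G: "?G = sets (vimage_algebra (space M) ?D borel)"
        by (rule sets_vimage_algebra2[symmetric]) simp
      have s: "sigma_algebra (space M) ?G"
        unfolding G using sets.sigma_algebra_axioms[of "vimage_algebra (space M) ?D borel"]
        unfolding space_vimage_algebra .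
      have mono: "indep_set A' B'" if "indep_set A B" "A' \<subseteq> A" "B' \<subseteq> B" for A B A' B'
        using that unfolding indep_sets2_eq by blast
      have 2: "sigma_sets (space M) {(\<lambda>\<omega>. g (?D \<omega>)) -` A \<inter> space M | A. A \<in> sets borel} \<subseteq> ?G"
      proof (rule sigma_algebra.sigma_sets_subset[OF s], safe)
        fix A :: "real set" assume "A \<in> sets borel"
        then have "g -` A \<in> sets borel" using measurable_sets[OF g(1)] by simp
        then show "\<exists>B. (\<lambda>\<omega>. g (?D \<omega>)) -` A \<inter> space M = ?D -` B \<inter> space M \<and> B \<in> sets borel"
          by (intro exI[of _ "g -` A"]) auto
      qed
      show "indep_set (sigma_sets (space M) {\<xi> -` A \<inter> space M | A. A \<in> sets borel})
        (sigma_sets (space M) {(\<lambda>\<omega>. g (?D \<omega>)) -` A \<inter> space M | A. A \<in> sets borel})"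
        by (rule mono[OF ind 1 2])
    qed
    then show ?thesis
      using indep_var_integrable[OF _ \<xi>(2) g(2)] indep_var_lebesgue_integral[OF _ \<xi>(2) g(2)] by simp
  qed
  then show "integrable M (\<lambda>\<omega>. \<xi> \<omega> * g (?D \<omega>))"
    "expectation (\<lambda>\<omega>. \<xi> \<omega> * g (?D \<omega>)) = expectation \<xi> * expectation (\<lambda>\<omega>. g (?D \<omega>))" by blast+
qed

lemma matrix_increment_sq_int:
  fixes \<xi> :: "'a \<Rightarrow> real^'d^'k"
  assumes ab: "0 \<le> a" "a \<le> b" "b \<le> T" and \<xi>: "\<xi> \<in> borel_measurable (F a)" "sq_int M \<xi>"
  shows "sq_int M (\<lambda>\<omega>. \<xi> \<omega> *v (W b \<omega> - W a \<omega>))"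
  unfolding matrix_vector_mult_axis_sum
proof (intro sq_int_sum sq_int_scaleR_left)
  fix k :: 'k and j :: 'd
  have 1: "sq_int M (\<lambda>\<omega>. \<xi> \<omega> $ k $ j)" by (intro sq_int_vec_nth \<xi>(2))
  have m: "(\<lambda>\<omega>. \<xi> \<omega> $ k $ j) \<in> borel_measurable (F a)" using \<xi>(1) by measurable
  have "integrable M (\<lambda>\<omega>. (\<xi> \<omega> $ k $ j)\<^sup>2 * ((W b \<omega> - W a \<omega>) $ j)\<^sup>2)"
    by (rule increment_independent(1)[OF ab, where g="\<lambda>w. (w $ j)\<^sup>2"])
      (use m 1 increment_component_moments(2)[OF ab] in \<open>auto simp: sq_int_def intro!: borel_measurable_power\<close>)
  then show "sq_int M (\<lambda>\<omega>. \<xi> \<omega> $ k $ j * (W b \<omega> - W a \<omega>) $ j)"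
    using sq_int_measurable[OF 1] sq_int_measurable[OF increment_sq_int[OF ab]]
    by (simp add: sq_int_def power_mult_distrib)
qed

lemma matrix_increment_orthogonal:
  fixes \<eta> :: "'a \<Rightarrow> real^'d^'k"
  assumes ab: "0 \<le> a" "a \<le> b" "b \<le> T" and \<eta>: "\<eta> \<in> borel_measurable (F a)" "sq_int M \<eta>"
    and V: "V \<in> borel_measurable (F a)" "sq_int M V"
  shows "expectation (\<lambda>\<omega>. V \<omega> \<bullet> (\<eta> \<omega> *v (W b \<omega> - W a \<omega>))) = 0"
proof -
  have m: "(\<lambda>\<omega>. V \<omega> $ k * \<eta> \<omega> $ k $ j) \<in> borel_measurable (F a)" for k j
    using \<eta>(1) V(1) by measurable
  have i: "integrable M (\<lambda>\<omega>. V \<omega> $ k * \<eta> \<omega> $ k $ j)" for k j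
    using integrable_inner[OF sq_int_vec_nth[OF V(2)] sq_int_vec_nth[OF sq_int_vec_nth[OF \<eta>(2)]], of k k j] by simp
  have 1: "integrable M (\<lambda>\<omega>. V \<omega> $ k * \<eta> \<omega> $ k $ j * (W b \<omega> - W a \<omega>) $ j)" for k j
    by (rule increment_independent(1)[OF ab m i]) (use increment_component_moments[OF ab] in auto)
  have 2: "expectation (\<lambda>\<omega>. V \<omega> $ k * \<eta> \<omega> $ k $ j * (W b \<omega> - W a \<omega>) $ j) = 0" for k j
    by (subst increment_independent(2)[OF ab m i, where g="\<lambda>w. w $ j"]) (use increment_component_moments[OF ab] in auto)
  show ?thesis
    unfolding inner_matrix_vector_mult using 1 2 by (simp add: Bochner_Integration.integral_sum)
qed

lemma matrix_increment_isometry: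
  fixes \<xi> \<eta> :: "'a \<Rightarrow> real^'d^'k"
  assumes ab: "0 \<le> a" "a \<le> b" "b \<le> T"
    and \<xi>: "\<xi> \<in> borel_measurable (F a)" "sq_int M \<xi>"
    and \<eta>: "\<eta> \<in> borel_measurable (F a)" "sq_int M \<eta>"
  shows "expectation (\<lambda>\<omega>. (\<xi> \<omega> *v (W b \<omega> - W a \<omega>)) \<bullet> (\<eta> \<omega> *v (W b \<omega> - W a \<omega>)))
    = (b - a) * expectation (\<lambda>\<omega>. \<xi> \<omega> \<bullet> \<eta> \<omega>)"
proof -
  let ?w = "\<lambda>\<omega>. W b \<omega> - W a \<omega>"
  have m: "(\<lambda>\<omega>. \<xi> \<omega> $ k $ i * \<eta> \<omega> $ k $ j) \<in> borel_measurable (F a)" for k i j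
    using \<eta>(1) \<xi>(1) by measurable
  have int: "integrable M (\<lambda>\<omega>. \<xi> \<omega> $ k $ i * \<eta> \<omega> $ k $ j)" for k i j
    using integrable_inner[OF sq_int_vec_nth[OF sq_int_vec_nth[OF \<xi>(2)]] sq_int_vec_nth[OF sq_int_vec_nth[OF \<eta>(2)]], of k i k j]
    by simp
  have 1: "integrable M (\<lambda>\<omega>. \<xi> \<omega> $ k $ i * \<eta> \<omega> $ k $ j * (?w \<omega> $ i * ?w \<omega> $ j))" for k i j
    by (rule increment_independent(1)[OF ab m int, where g="\<lambda>w. w $ i * w $ j"])
      (use increment_covariance(1)[OF ab] in auto)
  have 2: "expectation (\<lambda>\<omega>. \<xi> \<omega> $ k $ i * \<eta> \<omega> $ k $ j * (?w \<omega> $ i * ?w \<omega> $ j))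
     = (if i = j then (b - a) * expectation (\<lambda>\<omega>. \<xi> \<omega> $ k $ i * \<eta> \<omega> $ k $ i) else 0)" for k i j
    by (subst increment_independent(2)[OF ab m int, where g="\<lambda>w. w $ i * w $ j"])
      (use increment_covariance[OF ab] in auto)
  have "expectation (\<lambda>\<omega>. (\<xi> \<omega> *v ?w \<omega>) \<bullet> (\<eta> \<omega> *v ?w \<omega>))
    = expectation (\<lambda>\<omega>. \<Sum>k\<in>UNIV. \<Sum>i\<in>UNIV. \<Sum>j\<in>UNIV. \<xi> \<omega> $ k $ i * \<eta> \<omega> $ k $ j * (?w \<omega> $ i * ?w \<omega> $ j))"
    by (intro Bochner_Integration.integral_cong)
      (simp_all only: inner_vec_def matrix_vector_mult_def vec_lambda_beta inner_real_def sum_product, simp add: mult_ac)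
  also have "\<dots> = (\<Sum>k\<in>UNIV. \<Sum>i\<in>UNIV. (b - a) * expectation (\<lambda>\<omega>. \<xi> \<omega> $ k $ i * \<eta> \<omega> $ k $ i))"
    using 1 2 by (simp add: Bochner_Integration.integral_sum)
  also have "\<dots> = (b - a) * expectation (\<lambda>\<omega>. \<Sum>k\<in>UNIV. \<Sum>i\<in>UNIV. \<xi> \<omega> $ k $ i * \<eta> \<omega> $ k $ i)"
    using int by (simp add: Bochner_Integration.integral_sum sum_distrib_left)
  finally show ?thesis by (simp add: inner_vec_def)
qed

lemma matrix_increment_measurable:
  fixes \<xi> :: "'a \<Rightarrow> real^'d^'k"
  assumes "0 \<le> a" "a \<le> b" "b \<le> c" "\<xi> \<in> borel_measurable (F a)"
  shows "(\<lambda>\<omega>. \<xi> \<omega> *v (W b \<omega> - W a \<omega>)) \<in> borel_measurable (F c)"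
proof -
  have [measurable]: "\<xi> \<in> borel_measurable (F c)" "W a \<in> borel_measurable (F c)" "W b \<in> borel_measurable (F c)"
    using assms by (auto intro: measurable_F_mono W_measurable_F)
  show ?thesis by measurable
qed

text \<open>Splitting both increments at the larger left and the smaller right end point leaves one common
  increment; all other pairs are orthogonal because one factor is known when the other one starts.\<close>

lemma matrix_increment_inner:
  fixes \<xi> \<eta> :: "'a \<Rightarrow> real^'d^'k"
  assumes "0 \<le> a" "a \<le> b" "b \<le> T" and \<xi>: "\<xi> \<in> borel_measurable (F a)" "sq_int M \<xi>"
    and "0 \<le> c" "c \<le> d" "d \<le> T" and \<eta>: "\<eta> \<in> borel_measurable (F c)" "sq_int M \<eta>"
  shows "expectation (\<lambda>\<omega>. (\<xi> \<omega> *v (W b \<omega> - W a \<omega>)) \<bullet> (\<eta> \<omega> *v (W d \<omega> - W c \<omega>)))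
    = max 0 (min b d - max a c) * expectation (\<lambda>\<omega>. \<xi> \<omega> \<bullet> \<eta> \<omega>)"
  using assms
proof (induction a c arbitrary: b d \<xi> \<eta> rule: linorder_wlog)
  case (sym a c)
  show ?case
    using sym(1)[OF sym(7-11) sym(2-6)] by (simp add: inner_commute max.commute min.commute)
next
  case (le a c b d \<xi> \<eta>)
  note \<xi> = le(5,6) and \<eta> = le(10,11)
  have sq: "sq_int M (\<lambda>\<omega>. \<xi> \<omega> *v (W q \<omega> - W p \<omega>))" if "a \<le> p" "p \<le> q" "q \<le> T" for p q
    using that le by (intro matrix_increment_sq_int) (auto intro: measurable_F_mono)
  have sq': "sq_int M (\<lambda>\<omega>. \<eta> \<omega> *v (W q \<omega> - W p \<omega>))" if "c \<le> p" "p \<le> q" "q \<le> T" for p q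
    using that le by (intro matrix_increment_sq_int) (auto intro: measurable_F_mono)
  show ?case
  proof (cases "b \<le> c")
    case True
    have "expectation (\<lambda>\<omega>. (\<xi> \<omega> *v (W b \<omega> - W a \<omega>)) \<bullet> (\<eta> \<omega> *v (W d \<omega> - W c \<omega>))) = 0"
      using le True by (intro matrix_increment_orthogonal matrix_increment_measurable sq) auto
    then show ?thesis using True le by simp
  next
    case False
    define e where "e = min b d"
    have e: "c \<le> e" "e \<le> b" "e \<le> d" "e \<le> T" using False le by (auto simp: e_def)
    have \<xi>c: "\<xi> \<in> borel_measurable (F c)" using \<xi> le by (auto intro: measurable_F_mono)
    let ?A = "\<lambda>\<omega>. \<xi> \<omega> *v (W c \<omega> - W a \<omega>)" and ?B = "\<lambda>\<omega>. \<xi> \<omega> *v (W e \<omega> - W c \<omega>)"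
      and ?C = "\<lambda>\<omega>. \<xi> \<omega> *v (W b \<omega> - W e \<omega>)"
      and ?D = "\<lambda>\<omega>. \<eta> \<omega> *v (W e \<omega> - W c \<omega>)" and ?E = "\<lambda>\<omega>. \<eta> \<omega> *v (W d \<omega> - W e \<omega>)"
    have s: "sq_int M ?A" "sq_int M ?B" "sq_int M ?C" "sq_int M ?D" "sq_int M ?E"
      using le e False by (auto intro!: sq sq')
    have AD: "expectation (\<lambda>\<omega>. ?A \<omega> \<bullet> ?D \<omega>) = 0"
      using le e s by (intro matrix_increment_orthogonal matrix_increment_measurable) auto
    have AE: "expectation (\<lambda>\<omega>. ?A \<omega> \<bullet> ?E \<omega>) = 0"
      using le e s by (intro matrix_increment_orthogonal matrix_increment_measurable) (auto intro: measurable_F_mono)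
    have BE: "expectation (\<lambda>\<omega>. ?B \<omega> \<bullet> ?E \<omega>) = 0"
      using le e s \<xi>c by (intro matrix_increment_orthogonal matrix_increment_measurable) (auto intro: measurable_F_mono)
    have DC: "expectation (\<lambda>\<omega>. ?D \<omega> \<bullet> ?C \<omega>) = 0"
      using le e s by (intro matrix_increment_orthogonal matrix_increment_measurable) (auto intro: measurable_F_mono)
    have CE: "expectation (\<lambda>\<omega>. ?C \<omega> \<bullet> ?E \<omega>) = 0"
    proof -
      have "e = b \<or> e = d" by (simp add: e_def min_def)
      then show ?thesis by auto
    qed
    have BD: "expectation (\<lambda>\<omega>. ?B \<omega> \<bullet> ?D \<omega>) = (e - c) * expectation (\<lambda>\<omega>. \<xi> \<omega> \<bullet> \<eta> \<omega>)"
      using le e \<xi>c by (intro matrix_increment_isometry) auto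
    have split: "(\<xi> \<omega> *v (W b \<omega> - W a \<omega>)) \<bullet> (\<eta> \<omega> *v (W d \<omega> - W c \<omega>))
      = ?A \<omega> \<bullet> ?D \<omega> + ?A \<omega> \<bullet> ?E \<omega> + ?B \<omega> \<bullet> ?D \<omega> + ?B \<omega> \<bullet> ?E \<omega> + ?D \<omega> \<bullet> ?C \<omega> + ?C \<omega> \<bullet> ?E \<omega>" for \<omega>
    proof -
      have "\<xi> \<omega> *v (W b \<omega> - W a \<omega>) = ?A \<omega> + ?B \<omega> + ?C \<omega>" "\<eta> \<omega> *v (W d \<omega> - W c \<omega>) = ?D \<omega> + ?E \<omega>"
        by (simp_all add: matrix_vector_mult_diff_distrib)
      then show ?thesis by (simp add: inner_add_left inner_add_right inner_commute[of "?C \<omega>" "?D \<omega>"])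
    qed
    have "expectation (\<lambda>\<omega>. (\<xi> \<omega> *v (W b \<omega> - W a \<omega>)) \<bullet> (\<eta> \<omega> *v (W d \<omega> - W c \<omega>)))
      = (e - c) * expectation (\<lambda>\<omega>. \<xi> \<omega> \<bullet> \<eta> \<omega>)"
      unfolding split using AD AE BE DC CE BD s by (simp add: integrable_inner)
    then show ?thesis using le e by (simp add: e_def max_def)
  qed
qed

end

section \<open>The product of time and probability\<close>

context brownian
begin

text \<open>A process is treated as the function \<open>case_prod H\<close> on \<open>[0, T] \<times> \<Omega>\<close>: there \<open>msq\<close> of the
  control is \<open>\<integral> E|Z\<^sub>t|\<^sup>2 dt\<close>, and exchanging the two integrations is an instance of Fubini's theorem.\<close>

definition TM :: "real measure" where "TM = restrict_space lborel {0..T}"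

definition Q :: "(real \<times> 'a) measure" where "Q = TM \<Otimes>\<^sub>M M"

lemma space_TM[simp]: "space TM = {0..T}"
  by (simp add: TM_def space_restrict_space)

lemma finite_measure_TM: "finite_measure TM"
  by (rule finite_measureI) (simp add: TM_def emeasure_restrict_space emeasure_lborel_Icc_eq)

sublocale TM: finite_measure TM by (rule finite_measure_TM)

sublocale TQ: pair_sigma_finite TM M ..

lemma space_Q: "space Q = {0..T} \<times> space M"
  by (simp add: Q_def space_pair_measure)

lemma sets_TM: "sets TM = sets (restrict_space borel {0..T})"
  by (simp add: TM_def sets_restrict_space)

lemma sets_Q: "sets Q = sets (restrict_space borel {0..T} \<Otimes>\<^sub>M M)"
  unfolding Q_def by (rule sets_pair_measure_cong[OF sets_TM refl])

lemma measurable_TM_borel[measurable]: "(\<lambda>t. t) \<in> measurable TM borel"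
  unfolding TM_def by (rule measurable_restrict_space1) simp

lemma measurable_fst_Q[measurable]: "fst \<in> borel_measurable Q"
  unfolding Q_def by (rule measurable_compose[OF measurable_fst measurable_TM_borel])

lemma measurable_snd_Q[measurable]: "snd \<in> measurable Q M"
  unfolding Q_def by (rule measurable_snd)

lemma integral_TM:
  fixes f :: "real \<Rightarrow> 'b::{banach, second_countable_topology}"
  shows "(\<integral>s. f s \<partial>TM) = (LBINT s:{0..T}. f s)"
  unfolding TM_def set_lebesgue_integral_def by (rule integral_restrict_space) simp

lemma integral_TM_indicator:
  fixes f :: "real \<Rightarrow> 'b::{banach, second_countable_topology}"
  assumes "0 \<le> a" "b \<le> T"
  shows "(\<integral>s. indicator {a..b} s *\<^sub>R f s \<partial>TM) = (LBINT s:{a..b}. f s)"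
proof -
  have "indicator {0..T} s *\<^sub>R indicator {a..b} s *\<^sub>R f s = indicator {a..b} s *\<^sub>R f s" for s
    using assms by (auto simp: indicator_def)
  then show ?thesis unfolding integral_TM set_lebesgue_integral_def by (simp only:)
qed

lemma integrable_TM:
  fixes f :: "real \<Rightarrow> 'b::{banach, second_countable_topology}"
  shows "integrable TM f \<longleftrightarrow> set_integrable lborel {0..T} f"
  unfolding TM_def set_integrable_def by (rule integrable_restrict_space) simp

lemma AE_TM_neq: "AE s in TM. s \<noteq> c"
  unfolding TM_def by (subst AE_restrict_space_iff) (auto intro: AE_mp[OF AE_lborel_singleton[of c]])

lemma integral_TM_half_open:
  fixes f :: "real \<Rightarrow> 'b::{banach, second_countable_topology}"
  assumes "f \<in> borel_measurable TM"
  shows "(\<integral>s. indicator {a<..b} s *\<^sub>R f s \<partial>TM) = (\<integral>s. indicator {a..b} s *\<^sub>R f s \<partial>TM)"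
proof (rule integral_cong_AE)
  have [measurable]: "{a<..b} \<in> sets borel" "{a..b} \<in> sets borel" by auto
  show "(\<lambda>s. indicator {a<..b} s *\<^sub>R f s) \<in> borel_measurable TM"
    "(\<lambda>s. indicator {a..b} s *\<^sub>R f s) \<in> borel_measurable TM"
    using assms by measurable
  show "AE s in TM. indicator {a<..b} s *\<^sub>R f s = indicator {a..b} s *\<^sub>R f s"
    using AE_TM_neq[of a] by eventually_elim (auto simp: indicator_def)
qed

lemma int_mean_square_Q:
  assumes "case_prod H \<in> borel_measurable Q"
  shows "int_mean_square M T H = mean_square Q (case_prod H)"
proof -
  have [measurable]: "case_prod H \<in> borel_measurable (TM \<Otimes>\<^sub>M M)"
    using assms by (simp add: Q_def)
  have "int_mean_square M T H = (\<integral>\<^sup>+\<omega>. \<integral>\<^sup>+t. ennreal ((norm (H t \<omega>))\<^sup>2) \<partial>TM \<partial>M)"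
    unfolding int_mean_square_def TM_def by (intro nn_integral_cong) (simp add: nn_integral_restrict_space)
  also have "\<dots> = (\<integral>\<^sup>+x. ennreal ((norm (case_prod H x))\<^sup>2) \<partial>Q)"
    unfolding Q_def by (subst TQ.nn_integral_snd[symmetric]) (auto simp: split_def)
  finally show ?thesis by (simp add: mean_square_def)
qed

lemma int_mean_square_eq_msq:
  assumes "sq_int Q (case_prod H)"
  shows "int_mean_square M T H = ennreal (msq Q (case_prod H))"
  by (simp only: int_mean_square_Q[OF sq_int_measurable[OF assms]] mean_square_eq_msq[OF assms])

lemma sq_int_Q_if_int_mean_square_finite:
  assumes m: "case_prod H \<in> borel_measurable Q" and fin: "int_mean_square M T H < \<infinity>"
  shows "sq_int Q (case_prod H)"
  using fin unfolding int_mean_square_Q[OF m] by (rule sq_int_if_mean_square_finite[OF m])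

lemma inner_integral_Q:
  assumes "sq_int Q (case_prod H)" "sq_int Q (case_prod G)"
  shows "(\<integral>x. case_prod H x \<bullet> case_prod G x \<partial>Q) = (\<integral>t. (\<integral>\<omega>. H t \<omega> \<bullet> G t \<omega> \<partial>M) \<partial>TM)"
    and "integrable TM (\<lambda>t. \<integral>\<omega>. H t \<omega> \<bullet> G t \<omega> \<partial>M)"
    and "AE \<omega> in M. integrable TM (\<lambda>t. H t \<omega> \<bullet> G t \<omega>)"
    and "(\<integral>x. case_prod H x \<bullet> case_prod G x \<partial>Q) = (\<integral>\<omega>. (\<integral>t. H t \<omega> \<bullet> G t \<omega> \<partial>TM) \<partial>M)"
    and "integrable M (\<lambda>\<omega>. \<integral>t. H t \<omega> \<bullet> G t \<omega> \<partial>TM)"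
proof -
  have i: "integrable (TM \<Otimes>\<^sub>M M) (\<lambda>(t, \<omega>). H t \<omega> \<bullet> G t \<omega>)"
    using integrable_inner[OF assms] by (simp add: Q_def split_def)
  show "(\<integral>x. case_prod H x \<bullet> case_prod G x \<partial>Q) = (\<integral>t. (\<integral>\<omega>. H t \<omega> \<bullet> G t \<omega> \<partial>M) \<partial>TM)"
    using TQ.integral_fst[OF i] by (simp add: Q_def split_def)
  show "integrable TM (\<lambda>t. \<integral>\<omega>. H t \<omega> \<bullet> G t \<omega> \<partial>M)"
    using TQ.integrable_fst[OF i] .
  show "AE \<omega> in M. integrable TM (\<lambda>t. H t \<omega> \<bullet> G t \<omega>)"
    using TQ.AE_integrable_snd[OF i] .
  show "(\<integral>x. case_prod H x \<bullet> case_prod G x \<partial>Q) = (\<integral>\<omega>. (\<integral>t. H t \<omega> \<bullet> G t \<omega> \<partial>TM) \<partial>M)"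
    using TQ.integral_snd[OF i] by (simp add: Q_def split_def)
  show "integrable M (\<lambda>\<omega>. \<integral>t. H t \<omega> \<bullet> G t \<omega> \<partial>TM)"
    using TQ.integrable_snd[OF i] .
qed

lemma msq_Q_eq:
  assumes "sq_int Q (case_prod H)"
  shows "msq Q (case_prod H) = (\<integral>t. msq M (H t) \<partial>TM)" "integrable TM (\<lambda>t. msq M (H t))"
  using inner_integral_Q(1,2)[OF assms assms] by (simp_all add: msq_def power2_norm_eq_inner)

lemma AE_sq_int_section:
  assumes "sq_int Q (case_prod H)"
  shows "AE \<omega> in M. sq_int TM (\<lambda>t. H t \<omega>)"
proof -
  have m: "case_prod H \<in> borel_measurable (TM \<Otimes>\<^sub>M M)"
    using sq_int_measurable[OF assms] by (simp add: Q_def)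
  show ?thesis
    using inner_integral_Q(3)[OF assms assms] AE_space
  proof eventually_elim
    case (elim \<omega>)
    then show ?case using measurable_compose[OF measurable_Pair2'[of \<omega> M TM] m]
      by (simp add: sq_int_def power2_norm_eq_inner)
  qed
qed

lemma sq_int_indicator_Q:
  assumes "sq_int Q (case_prod H)" "A \<in> sets borel"
  shows "sq_int Q (\<lambda>(t, \<omega>). indicator A t *\<^sub>R H t \<omega>)"
proof (rule sq_int_dominated)
  show "integrable Q (\<lambda>x. (norm (case_prod H x))\<^sup>2)" using assms by (simp add: sq_int_def)
  have [measurable]: "case_prod H \<in> borel_measurable Q" "A \<in> sets borel"
    using assms by (auto intro: sq_int_measurable)
  show "(\<lambda>(t, \<omega>). indicator A t *\<^sub>R H t \<omega>) \<in> borel_measurable Q"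
  proof -
    have "(\<lambda>x. indicator A (fst x) *\<^sub>R case_prod H x) \<in> borel_measurable Q" by measurable
    then show ?thesis by (simp add: split_def)
  qed
qed (auto simp: indicator_def split: prod.splits)

lemma msq_Q_window:
  assumes "sq_int Q (case_prod H)" "0 \<le> s" "t \<le> T"
  shows "msq Q (\<lambda>(r, \<omega>). indicator {s<..t} r *\<^sub>R H r \<omega>) = (LBINT r:{s..t}. msq M (H r))"
proof -
  have "msq Q (\<lambda>(r, \<omega>). indicator {s<..t} r *\<^sub>R H r \<omega>)
    = (\<integral>r. msq M (\<lambda>\<omega>. indicator {s<..t} r *\<^sub>R H r \<omega>) \<partial>TM)"
    using msq_Q_eq(1)[OF sq_int_indicator_Q[OF assms(1), of "{s<..t}"]] by simp
  also have "\<dots> = (\<integral>r. indicator {s<..t} r *\<^sub>R msq M (H r) \<partial>TM)"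
    by (intro Bochner_Integration.integral_cong) (auto simp: msq_scaleR indicator_def)
  also have "\<dots> = (LBINT r:{s..t}. msq M (H r))"
    using integral_TM_half_open[of "\<lambda>r. msq M (H r)" s t] msq_Q_eq(2)[OF assms(1)] integral_TM_indicator[OF assms(2,3)]
    by (simp add: borel_measurable_integrable del: real_scaleR_def)
  finally show ?thesis .
qed

lemma integral_Q_product:
  fixes u :: "real \<Rightarrow> real" and v :: "'a \<Rightarrow> real"
  assumes "integrable TM u" "integrable M v"
  shows "(\<integral>x. u (fst x) * v (snd x) \<partial>Q) = (\<integral>t. u t \<partial>TM) * expectation v"
    and "integrable Q (\<lambda>x. u (fst x) * v (snd x))"
proof -
  have [measurable]: "u \<in> borel_measurable TM" "v \<in> borel_measurable M"
    using assms by auto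
  have i: "integrable (TM \<Otimes>\<^sub>M M) (\<lambda>x. u (fst x) * v (snd x))"
    by (rule TQ.Fubini_integrable) (use assms in \<open>auto simp: abs_mult\<close>)
  then show "integrable Q (\<lambda>x. u (fst x) * v (snd x))" by (simp add: Q_def)
  show "(\<integral>x. u (fst x) * v (snd x) \<partial>Q) = (\<integral>t. u t \<partial>TM) * expectation v"
    unfolding Q_def using TQ.integral_fst'[OF i] by simp
qed


section \<open>Finite sums of increments with square-integrable coefficients\<close>

definition valid_elem :: "(real \<times> real \<times> ('a \<Rightarrow> real^'d^'k)) list \<Rightarrow> bool"
  where "valid_elem l \<longleftrightarrow> (\<forall>(a, b, \<xi>)\<in>set l. 0 \<le> a \<and> a \<le> b \<and> b \<le> T \<and> \<xi> \<in> borel_measurable (F a) \<and> sq_int M \<xi>)"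

definition elem_integrand :: "(real \<times> real \<times> ('a \<Rightarrow> real^'d^'k)) list \<Rightarrow> real \<Rightarrow> 'a \<Rightarrow> real^'d^'k"
  where "elem_integrand l t \<omega> = (\<Sum>(a, b, \<xi>)\<leftarrow>l. indicator {a<..b} t *\<^sub>R \<xi> \<omega>)"

definition elem_total :: "(real \<times> real \<times> ('a \<Rightarrow> real^'d^'k)) list \<Rightarrow> 'a \<Rightarrow> real^'k"
  where "elem_total l \<omega> = (\<Sum>(a, b, \<xi>)\<leftarrow>l. \<xi> \<omega> *v (W b \<omega> - W a \<omega>))"

definition elem_integral :: "(real \<times> real \<times> ('a \<Rightarrow> real^'d^'k)) list \<Rightarrow> real \<Rightarrow> 'a \<Rightarrow> real^'k"
  where "elem_integral l t \<omega> = (\<Sum>(a, b, \<xi>)\<leftarrow>l. \<xi> \<omega> *v (W (min t b) \<omega> - W (min t a) \<omega>))"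

text \<open>Clipping restricts the integrand to the window from \<open>s\<close> to \<open>t\<close>. Intervals that miss the window
  are dropped, since \<open>valid_elem\<close> asks for ordered end points.\<close>

definition clip :: "real \<Rightarrow> real \<Rightarrow> (real \<times> real \<times> ('a \<Rightarrow> real^'d^'k)) list \<Rightarrow> (real \<times> real \<times> ('a \<Rightarrow> real^'d^'k)) list"
  where "clip s t l = map (\<lambda>(a, b, \<xi>). (max a s, min b t, \<xi>)) (filter (\<lambda>(a, b, \<xi>). max a s \<le> min b t) l)"

lemma valid_elem_Nil[simp]: "valid_elem []" by (simp add: valid_elem_def)

lemma valid_elem_Cons[simp]: "valid_elem ((a, b, \<xi>) # l) \<longleftrightarrow>
    0 \<le> a \<and> a \<le> b \<and> b \<le> T \<and> \<xi> \<in> borel_measurable (F a) \<and> sq_int M \<xi> \<and> valid_elem l"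
  by (auto simp: valid_elem_def)

lemma valid_elem_append[simp]: "valid_elem (l @ l') \<longleftrightarrow> valid_elem l \<and> valid_elem l'"
  by (simp only: valid_elem_def set_append ball_Un)

lemma elem_integrand_simps[simp]:
  "elem_integrand [] t \<omega> = 0"
  "elem_integrand ((a, b, \<xi>) # l) t \<omega> = indicator {a<..b} t *\<^sub>R \<xi> \<omega> + elem_integrand l t \<omega>"
  "elem_integrand (l @ l') t \<omega> = elem_integrand l t \<omega> + elem_integrand l' t \<omega>"
  by (simp_all add: elem_integrand_def)

lemma elem_total_simps[simp]:
  "elem_total [] \<omega> = 0"
  "elem_total ((a, b, \<xi>) # l) \<omega> = \<xi> \<omega> *v (W b \<omega> - W a \<omega>) + elem_total l \<omega>"
  by (simp_all add: elem_total_def)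

lemma elem_integral_simps[simp]:
  "elem_integral [] t \<omega> = 0"
  "elem_integral ((a, b, \<xi>) # l) t \<omega> = \<xi> \<omega> *v (W (min t b) \<omega> - W (min t a) \<omega>) + elem_integral l t \<omega>"
  "elem_integral (l @ l') t \<omega> = elem_integral l t \<omega> + elem_integral l' t \<omega>"
  by (simp_all add: elem_integral_def)

lemma elem_total_sq_int: "valid_elem l \<Longrightarrow> sq_int M (elem_total l)"
proof (induction l)
  case (Cons x l)
  obtain a b \<xi> where x: "x = (a, b, \<xi>)" by (cases x) auto
  have "sq_int M (\<lambda>\<omega>. \<xi> \<omega> *v (W b \<omega> - W a \<omega>) + elem_total l \<omega>)"
    using Cons by (intro sq_int_add matrix_increment_sq_int) (auto simp: x)
  then show ?case by (simp add: x)
qed (simp add: elem_total_def[abs_def])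

lemma integrable_TM_indicator: "A \<in> sets borel \<Longrightarrow> integrable TM (indicator A :: real \<Rightarrow> real)"
proof (rule TM.integrable_const_bound[of _ 1])
  assume [measurable]: "A \<in> sets borel"
  show "(indicator A :: real \<Rightarrow> real) \<in> borel_measurable TM"
    using measurable_compose[OF measurable_TM_borel borel_measurable_indicator[of A borel]] by simp
qed (auto simp: indicator_def)

lemma elem_integrand_single_sq_int:
  assumes "sq_int M \<xi>" shows "sq_int Q (\<lambda>x. indicator {a<..b} (fst x) *\<^sub>R \<xi> (snd x))"
proof (rule sq_int_dominated)
  have [measurable]: "\<xi> \<in> borel_measurable M" using assms by (rule sq_int_measurable)
  show "(\<lambda>x. indicator {a<..b} (fst x) *\<^sub>R \<xi> (snd x)) \<in> borel_measurable Q" by measurable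
  show "integrable Q (\<lambda>x. indicator {a<..b} (fst x) * (norm (\<xi> (snd x)))\<^sup>2)"
    using assms by (intro integral_Q_product integrable_TM_indicator sq_int_integrable) auto
qed (auto simp: indicator_def)

lemma elem_integrand_sq_int: "valid_elem l \<Longrightarrow> sq_int Q (case_prod (elem_integrand l))"
proof (induction l)
  case (Cons x l)
  obtain a b \<xi> where x: "x = (a, b, \<xi>)" by (cases x) auto
  have "sq_int Q (\<lambda>y. indicator {a<..b} (fst y) *\<^sub>R \<xi> (snd y) + case_prod (elem_integrand l) y)"
    using Cons by (intro sq_int_add elem_integrand_single_sq_int) (auto simp: x)
  then show ?case by (simp add: x split_def)
qed (simp add: split_def)

lemma elem_single_isometry:
  fixes \<xi> \<eta> :: "'a \<Rightarrow> real^'d^'k"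
  assumes "valid_elem [(a, b, \<xi>)]" "valid_elem [(c, d, \<eta>)]"
  shows "(\<integral>\<omega>. (\<xi> \<omega> *v (W b \<omega> - W a \<omega>)) \<bullet> (\<eta> \<omega> *v (W d \<omega> - W c \<omega>)) \<partial>M)
    = (\<integral>x. (indicator {a<..b} (fst x) *\<^sub>R \<xi> (snd x)) \<bullet> (indicator {c<..d} (fst x) *\<^sub>R \<eta> (snd x)) \<partial>Q)"
proof -
  let ?A = "{max a c<..min b d}"
  have "(\<integral>x. (indicator {a<..b} (fst x) *\<^sub>R \<xi> (snd x)) \<bullet> (indicator {c<..d} (fst x) *\<^sub>R \<eta> (snd x)) \<partial>Q)
    = (\<integral>x. indicator ?A (fst x) * (\<xi> (snd x) \<bullet> \<eta> (snd x)) \<partial>Q)"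
    by (intro Bochner_Integration.integral_cong) (auto simp: indicator_def)
  also have "\<dots> = (\<integral>t. indicator ?A t \<partial>TM) * expectation (\<lambda>\<omega>. \<xi> \<omega> \<bullet> \<eta> \<omega>)"
    using assms by (intro integral_Q_product(1)[where v="\<lambda>\<omega>. \<xi> \<omega> \<bullet> \<eta> \<omega>"] integrable_TM_indicator integrable_inner) auto
  also have "(\<integral>t. indicator ?A t \<partial>TM) = max 0 (min b d - max a c)"
  proof -
    have "(\<integral>t. indicator ?A t \<partial>TM) = (\<integral>t. indicator ?A t *\<^sub>R (1::real) \<partial>TM)" by simp
    also have "\<dots> = (LBINT s:{max a c..min b d}. 1)"
      using assms integral_TM_indicator[of "max a c" "min b d" "\<lambda>_. 1::real"]
      by (subst integral_TM_half_open) (auto simp del: real_scaleR_def)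
    also have "\<dots> = max 0 (min b d - max a c)"
      by (auto simp: set_lebesgue_integral_def max_def)
    finally show ?thesis .
  qed
  finally show ?thesis using assms by (simp add: matrix_increment_inner)
qed

lemma elem_isometry:
  fixes l l' :: "(real \<times> real \<times> ('a \<Rightarrow> real^'d^'k)) list"
  assumes "valid_elem l" "valid_elem l'"
  shows "(\<integral>\<omega>. elem_total l \<omega> \<bullet> elem_total l' \<omega> \<partial>M)
    = (\<integral>x. case_prod (elem_integrand l) x \<bullet> case_prod (elem_integrand l') x \<partial>Q)"
  using assms
proof (induction l)
  case (Cons x l)
  obtain a b \<xi> where x: "x = (a, b, \<xi>)" by (cases x) auto
  have v: "valid_elem [(a, b, \<xi>)]" "valid_elem l" using Cons.prems by (auto simp: x)
  let ?\<xi> = "\<lambda>\<omega>. \<xi> \<omega> *v (W b \<omega> - W a \<omega>)"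
  let ?i = "\<lambda>y. indicator {a<..b} (fst y) *\<^sub>R \<xi> (snd y)"
  have s\<xi>: "sq_int M ?\<xi>" using v by (intro matrix_increment_sq_int) auto
  have si: "sq_int Q ?i" using v by (intro elem_integrand_single_sq_int) auto
  have single: "(\<integral>\<omega>. ?\<xi> \<omega> \<bullet> elem_total l' \<omega> \<partial>M) = (\<integral>y. ?i y \<bullet> case_prod (elem_integrand l') y \<partial>Q)"
    using Cons.prems(2)
  proof (induction l')
    case (Cons z l')
    obtain c d \<eta> where z: "z = (c, d, \<eta>)" by (cases z) auto
    have v': "valid_elem [(c, d, \<eta>)]" "valid_elem l'" using Cons.prems by (auto simp: z)
    have s\<eta>: "sq_int M (\<lambda>\<omega>. \<eta> \<omega> *v (W d \<omega> - W c \<omega>))" using v' by (intro matrix_increment_sq_int) auto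
    have sj: "sq_int Q (\<lambda>y. indicator {c<..d} (fst y) *\<^sub>R \<eta> (snd y))" using v' by (intro elem_integrand_single_sq_int) auto
    show ?case
      using integrable_inner[OF s\<xi> s\<eta>] integrable_inner[OF s\<xi> elem_total_sq_int[OF v'(2)]]
        integrable_inner[OF si sj] integrable_inner[OF si elem_integrand_sq_int[OF v'(2)]]
        elem_single_isometry[OF v(1) v'(1)] Cons.IH[OF v'(2)]
      by (simp add: z split_def inner_add_right)
  qed (simp add: split_def)
  show ?case
    using integrable_inner[OF s\<xi> elem_total_sq_int[OF assms(2)]] integrable_inner[OF elem_total_sq_int[OF v(2)] elem_total_sq_int[OF assms(2)]]
      integrable_inner[OF si elem_integrand_sq_int[OF assms(2)]] integrable_inner[OF elem_integrand_sq_int[OF v(2)] elem_integrand_sq_int[OF assms(2)]]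
      single Cons.IH[OF v(2) assms(2)]
    by (simp add: x split_def inner_add_left)
qed (simp add: split_def)

lemma valid_clip: "valid_elem l \<Longrightarrow> 0 \<le> s \<Longrightarrow> t \<le> T \<Longrightarrow> valid_elem (clip s t l)"
  by (auto simp: valid_elem_def clip_def intro: measurable_F_mono)

lemma elem_integrand_clip: "elem_integrand (clip s t l) r \<omega> = indicator {s<..t} r *\<^sub>R elem_integrand l r \<omega>"
  by (induction l) (auto simp: clip_def elem_integrand_def indicator_def scaleR_add_right)

text \<open>The total of the clipped sum is the increment of the integral. Hence both the isometry over a window
  and the orthogonality to the past of \<open>s\<close> are statements about totals.\<close>

lemma elem_total_clip:
  assumes "valid_elem l" "0 \<le> s" "s \<le> t"
  shows "elem_total (clip s t l) \<omega> = elem_integral l t \<omega> - elem_integral l s \<omega>"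
  using assms(1)
proof (induction l)
  case (Cons x l)
  obtain a b \<xi> where x: "x = (a, b, \<xi>)" by (cases x) auto
  then have ab: "0 \<le> a" "a \<le> b" "b \<le> T" and IH: "elem_total (clip s t l) \<omega> = elem_integral l t \<omega> - elem_integral l s \<omega>"
    using Cons by auto
  show ?case
  proof (cases "max a s \<le> min b t")
    case True
    then have "W (min b t) \<omega> - W (max a s) \<omega> = (W (min t b) \<omega> - W (min t a) \<omega>) - (W (min s b) \<omega> - W (min s a) \<omega>)"
    proof -
      consider "t \<le> a" | "b \<le> s" | "a < t" "s < b" by linarith
      then show ?thesis
      proof cases
        case 1
        then have "t = a" using True by simp
        then show ?thesis using ab assms(3) by (simp add: min_def max_def)
      next
        case 2
        then have "b = s" using True by simp
        then show ?thesis using ab assms(3) by simp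
      next
        case 3
        then show ?thesis using ab assms(3) by (simp add: min.commute min_absorb1 max_def)
      qed
    qed
    then have "\<xi> \<omega> *v (W (min b t) \<omega> - W (max a s) \<omega>)
      = \<xi> \<omega> *v (W (min t b) \<omega> - W (min t a) \<omega>) - \<xi> \<omega> *v (W (min s b) \<omega> - W (min s a) \<omega>)"
      by (simp only: matrix_vector_mult_diff_distrib)
    moreover have "clip s t (x # l) = (max a s, min b t, \<xi>) # clip s t l"
      using True by (simp only: x clip_def filter.simps prod.case if_True list.map)
    ultimately show ?thesis using IH by (simp add: x)
  next
    case False
    then have "W (min t b) \<omega> - W (min t a) \<omega> = W (min s b) \<omega> - W (min s a) \<omega>"
      using ab assms(2,3) by (auto simp: min_def max_def split: if_splits)
    moreover have "clip s t (x # l) = clip s t l"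
      using False by (simp only: x clip_def filter.simps prod.case if_False)
    ultimately show ?thesis using IH by (simp add: x)
  qed
qed (simp add: clip_def)

lemma elem_integral_0: "valid_elem l \<Longrightarrow> elem_integral l 0 \<omega> = 0"
  by (induction l) (auto simp: min_def)

lemma elem_total_orthogonal:
  assumes "valid_elem l" "\<And>a b \<xi>. (a, b, \<xi>) \<in> set l \<Longrightarrow> s \<le> a"
    and V: "V \<in> borel_measurable (F s)" "sq_int M V"
  shows "expectation (\<lambda>\<omega>. V \<omega> \<bullet> elem_total l \<omega>) = 0"
  using assms(1,2)
proof (induction l)
  case (Cons x l)
  obtain a b \<xi> where x: "x = (a, b, \<xi>)" by (cases x) auto
  have v: "valid_elem [(a, b, \<xi>)]" "valid_elem l" "s \<le> a" using Cons.prems by (auto simp: x)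
  have s\<xi>: "sq_int M (\<lambda>\<omega>. \<xi> \<omega> *v (W b \<omega> - W a \<omega>))" using v by (intro matrix_increment_sq_int) auto
  have "expectation (\<lambda>\<omega>. V \<omega> \<bullet> (\<xi> \<omega> *v (W b \<omega> - W a \<omega>))) = 0"
    using v V measurable_F_mono[OF V(1) v(3)] by (intro matrix_increment_orthogonal) auto
  moreover have "expectation (\<lambda>\<omega>. V \<omega> \<bullet> elem_total l \<omega>) = 0"
    using Cons.IH v(2) Cons.prems(2) by auto
  ultimately show ?case
    using integrable_inner[OF V(2) s\<xi>] integrable_inner[OF V(2) elem_total_sq_int[OF v(2)]]
    by (simp add: x inner_add_right)
qed simp

end

section \<open>The mean-square closure of the elementary integrals\<close>

context brownian
begin

text \<open>The elementary integrands may have unbounded square-integrable coefficients. Therefore the closure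
  contains the piecewise constant control of the scheme, whose integral is a finite sum.\<close>

definition ito :: "(real \<Rightarrow> 'a \<Rightarrow> real^'d^'k) \<Rightarrow> (real \<Rightarrow> 'a \<Rightarrow> real^'k) \<Rightarrow> bool"
  where "ito H I \<longleftrightarrow> sq_int Q (case_prod H) \<and> (\<forall>t\<in>{0..T}. sq_int M (I t)) \<and>
    (\<exists>l. (\<forall>n. valid_elem (l n)) \<and>
      (\<lambda>n. msq Q (\<lambda>x. case_prod (elem_integrand (l n)) x - case_prod H x)) \<longlonglongrightarrow> 0 \<and>
      (\<forall>t\<in>{0..T}. (\<lambda>n. msq M (\<lambda>\<omega>. elem_integral (l n) t \<omega> - I t \<omega>)) \<longlonglongrightarrow> 0))"

lemma elem_integral_sq_int:
  assumes "valid_elem l" "t \<in> {0..T}" shows "sq_int M (elem_integral l t)"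
proof -
  have "elem_integral l t = elem_total (clip 0 t l)"
    using elem_total_clip[OF assms(1), of 0 t] elem_integral_0[OF assms(1)] assms(2) by (intro ext) simp
  then show ?thesis using elem_total_sq_int[OF valid_clip[OF assms(1), of 0 t]] assms(2) by simp
qed

lemma ito_elem:
  assumes "valid_elem l" shows "ito (elem_integrand l) (elem_integral l)"
  unfolding ito_def
proof (intro conjI ballI elem_integrand_sq_int elem_integral_sq_int assms exI[of _ "\<lambda>_. l"] allI)
  show "(\<lambda>n. msq Q (\<lambda>x. case_prod (elem_integrand l) x - case_prod (elem_integrand l) x)) \<longlonglongrightarrow> 0"
    by (simp add: msq_def)
  show "(\<lambda>n. msq M (\<lambda>\<omega>. elem_integral l t \<omega> - elem_integral l t \<omega>)) \<longlonglongrightarrow> 0" for t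
    by (simp add: msq_def)
qed

lemma ito_elim:
  assumes "ito H I"
  obtains l where "\<And>n. valid_elem (l n)"
    "(\<lambda>n. msq Q (\<lambda>x. case_prod (elem_integrand (l n)) x - case_prod H x)) \<longlonglongrightarrow> 0"
    "\<And>t. t \<in> {0..T} \<Longrightarrow> (\<lambda>n. msq M (\<lambda>\<omega>. elem_integral (l n) t \<omega> - I t \<omega>)) \<longlonglongrightarrow> 0"
  using assms unfolding ito_def by blast

lemma ito_sq_int:
  assumes "ito H I"
  shows "sq_int Q (case_prod H)" "t \<in> {0..T} \<Longrightarrow> sq_int M (I t)"
  using assms by (auto simp: ito_def)

lemma msq_sum_tendsto_0:
  assumes "\<And>n. sq_int N (U n)" "\<And>n. sq_int N (V n)" "(\<lambda>n. msq N (U n)) \<longlonglongrightarrow> 0" "(\<lambda>n. msq N (V n)) \<longlonglongrightarrow> 0"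
  shows "(\<lambda>n. msq N (\<lambda>x. U n x - V n x)) \<longlonglongrightarrow> 0"
proof (rule Lim_null_comparison)
  show "\<forall>\<^sub>F n in sequentially. norm (msq N (\<lambda>x. U n x - V n x)) \<le> 2 * msq N (U n) + 2 * msq N (V n)"
    using assms(1,2) by (intro always_eventually allI) (simp add: msq_diff_le)
  show "(\<lambda>n. 2 * msq N (U n) + 2 * msq N (V n)) \<longlonglongrightarrow> 0"
    using tendsto_add[OF tendsto_mult_right_zero[OF assms(3), of 2] tendsto_mult_right_zero[OF assms(4), of 2]] by simp
qed

definition neg_elem :: "(real \<times> real \<times> ('a \<Rightarrow> real^'d^'k)) list \<Rightarrow> (real \<times> real \<times> ('a \<Rightarrow> real^'d^'k)) list"
  where "neg_elem l = map (\<lambda>(a, b, \<xi>). (a, b, \<lambda>\<omega>. - \<xi> \<omega>)) l"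

lemma valid_neg_elem: "valid_elem l \<Longrightarrow> valid_elem (neg_elem l)"
proof (induction l)
  case (Cons x l)
  obtain a b \<xi> where x: "x = (a, b, \<xi>)" by (cases x) auto
  have n: "neg_elem (x # l) = (a, b, \<lambda>\<omega>. - \<xi> \<omega>) # neg_elem l" by (simp add: neg_elem_def x)
  show ?case unfolding n valid_elem_Cons using Cons by (simp add: x sq_int_uminus)
qed (simp add: neg_elem_def)

lemma matrix_vector_mult_minus: "(- A) *v x = - (A *v (x::real^'n))"
  using scaleR_matrix_vector_assoc[of "-1" A x] by simp

lemma elem_neg:
  "elem_integrand (neg_elem l) t \<omega> = - elem_integrand l t \<omega>"
  "elem_integral (neg_elem l) t \<omega> = - elem_integral l t \<omega>"
  by (induction l) (auto simp: neg_elem_def matrix_vector_mult_minus)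

lemma ito_diff:
  assumes "ito H I" "ito H' I'"
  shows "ito (\<lambda>t \<omega>. H t \<omega> - H' t \<omega>) (\<lambda>t \<omega>. I t \<omega> - I' t \<omega>)"
proof -
  obtain l where l: "\<And>n. valid_elem (l n)"
    "(\<lambda>n. msq Q (\<lambda>x. case_prod (elem_integrand (l n)) x - case_prod H x)) \<longlonglongrightarrow> 0"
    "\<And>t. t \<in> {0..T} \<Longrightarrow> (\<lambda>n. msq M (\<lambda>\<omega>. elem_integral (l n) t \<omega> - I t \<omega>)) \<longlonglongrightarrow> 0"
    using ito_elim[OF assms(1)] by blast
  obtain l' where l': "\<And>n. valid_elem (l' n)"
    "(\<lambda>n. msq Q (\<lambda>x. case_prod (elem_integrand (l' n)) x - case_prod H' x)) \<longlonglongrightarrow> 0"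
    "\<And>t. t \<in> {0..T} \<Longrightarrow> (\<lambda>n. msq M (\<lambda>\<omega>. elem_integral (l' n) t \<omega> - I' t \<omega>)) \<longlonglongrightarrow> 0"
    using ito_elim[OF assms(2)] by blast
  note sq = ito_sq_int[OF assms(1)] ito_sq_int[OF assms(2)]
  let ?l = "\<lambda>n. l n @ neg_elem (l' n)"
  have "(\<lambda>n. msq Q (\<lambda>x. (case_prod (elem_integrand (l n)) x - case_prod H x)
      - (case_prod (elem_integrand (l' n)) x - case_prod H' x))) \<longlonglongrightarrow> 0"
    by (rule msq_sum_tendsto_0[OF _ _ l(2) l'(2)]) (intro sq_int_diff elem_integrand_sq_int l(1) l'(1) sq)+
  then have 1: "(\<lambda>n. msq Q (\<lambda>x. case_prod (elem_integrand (?l n)) x - (case x of (t, \<omega>) \<Rightarrow> H t \<omega> - H' t \<omega>))) \<longlonglongrightarrow> 0"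
    by (simp add: elem_neg split_def algebra_simps)
  have 2: "(\<lambda>n. msq M (\<lambda>\<omega>. elem_integral (?l n) t \<omega> - (I t \<omega> - I' t \<omega>))) \<longlonglongrightarrow> 0" if t: "t \<in> {0..T}" for t
  proof -
    have "(\<lambda>n. msq M (\<lambda>\<omega>. (elem_integral (l n) t \<omega> - I t \<omega>) - (elem_integral (l' n) t \<omega> - I' t \<omega>))) \<longlonglongrightarrow> 0"
      by (rule msq_sum_tendsto_0[OF _ _ l(3)[OF t] l'(3)[OF t]]) (intro sq_int_diff elem_integral_sq_int l(1) l'(1) sq t)+
    then show ?thesis by (simp add: elem_neg algebra_simps)
  qed
  have 3: "sq_int Q (\<lambda>(t, \<omega>). H t \<omega> - H' t \<omega>)"
    using sq_int_diff[OF sq(1,3)] by (simp add: split_def)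
  show ?thesis
    unfolding ito_def
  proof (intro conjI exI[of _ ?l] ballI allI 1 2 3)
    show "valid_elem (?l n)" for n using l(1) valid_neg_elem[OF l'(1)] by simp
    show "sq_int M (\<lambda>\<omega>. I t \<omega> - I' t \<omega>)" if "t \<in> {0..T}" for t
      using sq(2,4)[OF that] by (rule sq_int_diff)
  qed
qed

lemma ito_increments:
  assumes "ito H I" "0 \<le> s" "s \<le> t" "t \<le> T"
  obtains c where "\<And>n. valid_elem (c n)" "\<And>n a b \<xi>. (a, b, \<xi>) \<in> set (c n) \<Longrightarrow> s \<le> a"
    "(\<lambda>n. msq Q (\<lambda>x. case_prod (elem_integrand (c n)) x - (case x of (r, \<omega>) \<Rightarrow> indicator {s<..t} r *\<^sub>R H r \<omega>))) \<longlonglongrightarrow> 0"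
    "(\<lambda>n. msq M (\<lambda>\<omega>. elem_total (c n) \<omega> - (I t \<omega> - I s \<omega>))) \<longlonglongrightarrow> 0"
proof -
  obtain l where l: "\<And>n. valid_elem (l n)"
    "(\<lambda>n. msq Q (\<lambda>x. case_prod (elem_integrand (l n)) x - case_prod H x)) \<longlonglongrightarrow> 0"
    "\<And>t. t \<in> {0..T} \<Longrightarrow> (\<lambda>n. msq M (\<lambda>\<omega>. elem_integral (l n) t \<omega> - I t \<omega>)) \<longlonglongrightarrow> 0"
    using ito_elim[OF assms(1)] by blast
  note sq = ito_sq_int[OF assms(1)]
  have st: "s \<in> {0..T}" "t \<in> {0..T}" using assms by auto
  let ?c = "\<lambda>n. clip s t (l n)"
  let ?H = "\<lambda>(r, \<omega>). indicator {s<..t} r *\<^sub>R H r \<omega>"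
  have tot: "elem_total (?c n) = (\<lambda>\<omega>. elem_integral (l n) t \<omega> - elem_integral (l n) s \<omega>)" for n
    using elem_total_clip[OF l(1) assms(2,3)] by auto
  have "(\<lambda>n. msq M (\<lambda>\<omega>. (elem_integral (l n) t \<omega> - I t \<omega>) - (elem_integral (l n) s \<omega> - I s \<omega>))) \<longlonglongrightarrow> 0"
    by (rule msq_sum_tendsto_0[OF _ _ l(3)[OF st(2)] l(3)[OF st(1)]]) (intro sq_int_diff elem_integral_sq_int l(1) sq st)+
  then have lim: "(\<lambda>n. msq M (\<lambda>\<omega>. elem_total (?c n) \<omega> - (I t \<omega> - I s \<omega>))) \<longlonglongrightarrow> 0"
    by (simp add: tot algebra_simps)
  have limQ: "(\<lambda>n. msq Q (\<lambda>x. case_prod (elem_integrand (?c n)) x - ?H x)) \<longlonglongrightarrow> 0"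
  proof (rule Lim_null_comparison[OF always_eventually l(2)], rule allI)
    fix n
    have d: "sq_int Q (\<lambda>x. case_prod (elem_integrand (l n)) x - case_prod H x)"
      using l(1) sq by (intro sq_int_diff elem_integrand_sq_int)
    have "msq Q (\<lambda>x. case_prod (elem_integrand (?c n)) x - ?H x) \<le> msq Q (\<lambda>x. case_prod (elem_integrand (l n)) x - case_prod H x)"
      by (subst (2) msq_def, rule msq_le_integral[OF sq_int_integrable[OF d]])
        (auto simp: elem_integrand_clip indicator_def)
    then show "norm (msq Q (\<lambda>x. case_prod (elem_integrand (?c n)) x - ?H x)) \<le> msq Q (\<lambda>x. case_prod (elem_integrand (l n)) x - case_prod H x)"
      by (simp only: real_norm_def abs_of_nonneg msq_nonneg)
  qed
  show thesis
    by (rule that[of ?c, OF valid_clip[OF l(1) assms(2,4)] _ limQ lim]) (auto simp: clip_def)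
qed

text \<open>Both sides are continuous for mean-square convergence and agree for elementary integrands.\<close>

lemma ito_isometry:
  assumes "ito H I" "0 \<le> s" "s \<le> t" "t \<le> T"
  shows "msq M (\<lambda>\<omega>. I t \<omega> - I s \<omega>) = (LBINT r:{s..t}. msq M (H r))"
proof -
  let ?H = "\<lambda>(r, \<omega>). indicator {s<..t} r *\<^sub>R H r \<omega>"
  obtain c where c: "\<And>n. valid_elem (c n)" "\<And>n a b \<xi>. (a, b, \<xi>) \<in> set (c n) \<Longrightarrow> s \<le> a"
    "(\<lambda>n. msq Q (\<lambda>x. case_prod (elem_integrand (c n)) x - ?H x)) \<longlonglongrightarrow> 0"
    "(\<lambda>n. msq M (\<lambda>\<omega>. elem_total (c n) \<omega> - (I t \<omega> - I s \<omega>))) \<longlonglongrightarrow> 0"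
    by (rule ito_increments[OF assms]) (rule that; assumption)
  note sq = ito_sq_int[OF assms(1)]
  have st: "s \<in> {0..T}" "t \<in> {0..T}" using assms by auto
  have sqH: "sq_int Q ?H" by (intro sq_int_indicator_Q sq) auto
  have "msq M (elem_total (c n)) = msq Q (case_prod (elem_integrand (c n)))" for n
    using elem_isometry[OF c(1) c(1), of n n] by (simp add: msq_def power2_norm_eq_inner)
  then have "msq M (\<lambda>\<omega>. I t \<omega> - I s \<omega>) = msq Q ?H"
    using msq_tendsto[OF elem_total_sq_int[OF c(1)] sq_int_diff[OF sq(2)[OF st(2)] sq(2)[OF st(1)]] c(4)]
      msq_tendsto[OF elem_integrand_sq_int[OF c(1)] sqH c(3)] by (simp add: LIMSEQ_unique)
  then show ?thesis using msq_Q_window[OF sq(1) assms(2,4)] by simp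
qed

lemma ito_start:
  assumes "ito H I" shows "AE \<omega> in M. I 0 \<omega> = 0"
proof -
  obtain l where l: "\<And>n. valid_elem (l n)"
    "(\<lambda>n. msq Q (\<lambda>x. case_prod (elem_integrand (l n)) x - case_prod H x)) \<longlonglongrightarrow> 0"
    "\<And>t. t \<in> {0..T} \<Longrightarrow> (\<lambda>n. msq M (\<lambda>\<omega>. elem_integral (l n) t \<omega> - I t \<omega>)) \<longlonglongrightarrow> 0"
    using ito_elim[OF assms] by blast
  have "0 \<in> {0..T}" using T_pos by simp
  note sq = ito_sq_int(2)[OF assms this] and lim = l(3)[OF this]
  have "(\<lambda>n. msq M (I 0)) \<longlonglongrightarrow> 0"
    using lim by (simp add: elem_integral_0[OF l(1)] msq_def)
  then have "msq M (I 0) = 0" by (simp add: LIMSEQ_const_iff)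
  then show ?thesis
    using sq by (auto simp: msq_def sq_int_def integral_nonneg_eq_0_iff_AE)
qed

lemma ito_orthogonal:
  assumes "ito H I" "0 \<le> s" "s \<le> t" "t \<le> T" and V: "V \<in> borel_measurable (F s)" "sq_int M V"
  shows "expectation (\<lambda>\<omega>. V \<omega> \<bullet> (I t \<omega> - I s \<omega>)) = 0"
proof -
  obtain c where c: "\<And>n. valid_elem (c n)" "\<And>n a b \<xi>. (a, b, \<xi>) \<in> set (c n) \<Longrightarrow> s \<le> a"
    "(\<lambda>n. msq Q (\<lambda>x. case_prod (elem_integrand (c n)) x - (case x of (r, \<omega>) \<Rightarrow> indicator {s<..t} r *\<^sub>R H r \<omega>))) \<longlonglongrightarrow> 0"
    "(\<lambda>n. msq M (\<lambda>\<omega>. elem_total (c n) \<omega> - (I t \<omega> - I s \<omega>))) \<longlonglongrightarrow> 0"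
    by (rule ito_increments[OF assms(1-4)]) (rule that; assumption)
  have "s \<in> {0..T}" "t \<in> {0..T}" using assms by auto
  then have sq: "sq_int M (\<lambda>\<omega>. I t \<omega> - I s \<omega>)" by (intro sq_int_diff ito_sq_int(2)[OF assms(1)])
  have "(\<lambda>n. expectation (\<lambda>\<omega>. V \<omega> \<bullet> elem_total (c n) \<omega>)) \<longlonglongrightarrow> expectation (\<lambda>\<omega>. V \<omega> \<bullet> (I t \<omega> - I s \<omega>))"
    by (rule inner_integral_tendsto[OF V(2) elem_total_sq_int[OF c(1)] V(2) sq _ c(4)]) (simp add: msq_def)
  moreover have "expectation (\<lambda>\<omega>. V \<omega> \<bullet> elem_total (c n) \<omega>) = 0" for n
    by (rule elem_total_orthogonal[OF c(1) c(2) V])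
  ultimately show ?thesis by (simp add: LIMSEQ_const_iff)
qed

lemma has_ito_integral_imp_ito:
  assumes I: "has_ito_integral M W T H I" and H: "sq_int Q (case_prod H)"
  shows "ito H I"
proof -
  obtain s \<xi> where simple: "\<And>n. simple_integrand F T (s n) (\<xi> n)"
    and limH: "(\<lambda>n. int_mean_square M T (\<lambda>t \<omega>. step_process (s n) (\<xi> n) t \<omega> - H t \<omega>)) \<longlonglongrightarrow> 0"
    and limI: "\<And>t. t \<in> {0..T} \<Longrightarrow> (\<lambda>n. mean_square M (\<lambda>\<omega>. step_integral W (s n) (\<xi> n) t \<omega> - I t \<omega>)) \<longlonglongrightarrow> 0"
    using I unfolding has_ito_integral_def by blast
  define l where "l n = map (\<lambda>j. (s n ! j, s n ! Suc j, \<xi> n j)) [0..<cells (s n)]" for n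
  have valid: "valid_elem (l n)" for n
    unfolding valid_elem_def
  proof safe
    fix a b x assume "(a, b, x) \<in> set (l n)"
    then obtain j where j: "j < cells (s n)" "a = s n ! j" "b = s n ! Suc j" "x = \<xi> n j"
      by (auto simp: l_def)
    have part: "is_partition T (s n)" and m: "\<xi> n j \<in> borel_measurable (F (s n ! j))"
      and bd: "\<exists>C. \<forall>\<omega>. norm (\<xi> n j \<omega>) \<le> C"
      using simple[of n] j by (auto simp: simple_integrand_def)
    have srt: "sorted (s n)" and len: "2 \<le> length (s n)" and hd: "hd (s n) = 0" and last: "last (s n) = T"
      using part by (auto simp: is_partition_def strict_sorted_iff)
    have ne: "s n \<noteq> []" using len by auto
    have "s n ! 0 \<le> s n ! j" using srt j len by (intro sorted_nth_mono) auto
    then show a0: "0 \<le> a" using hd ne by (simp add: j hd_conv_nth)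
    show ab: "a \<le> b" unfolding j using srt j len by (intro sorted_nth_mono) auto
    have "s n ! Suc j \<le> s n ! (length (s n) - 1)" using srt j len by (intro sorted_nth_mono) auto
    then show bT: "b \<le> T" using last ne by (simp add: j last_conv_nth)
    show xm: "x \<in> borel_measurable (F a)" using m by (simp add: j)
    obtain C where C: "\<And>\<omega>. norm (\<xi> n j \<omega>) \<le> C" using bd by blast
    show "sq_int M x"
    proof (rule sq_int_dominated)
      show "x \<in> borel_measurable M" using measurable_F_M[OF xm] ab bT by simp
      show "integrable M (\<lambda>_. C\<^sup>2)" by simp
      show "(norm (x \<omega>))\<^sup>2 \<le> C\<^sup>2" for \<omega> using C[of \<omega>] by (simp add: j power_mono)
    qed
  qed
  have stepH: "elem_integrand (l n) = step_process (s n) (\<xi> n)" for n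
    by (intro ext) (simp add: elem_integrand_def step_process_def l_def o_def interv_sum_list_conv_sum_set_nat atLeast0LessThan)
  have stepI: "elem_integral (l n) = step_integral W (s n) (\<xi> n)" for n
    by (intro ext) (simp add: elem_integral_def step_integral_def l_def o_def interv_sum_list_conv_sum_set_nat atLeast0LessThan)
  have limH': "(\<lambda>n. msq Q (\<lambda>x. case_prod (elem_integrand (l n)) x - case_prod H x)) \<longlonglongrightarrow> 0"
  proof -
    have "int_mean_square M T (\<lambda>t \<omega>. step_process (s n) (\<xi> n) t \<omega> - H t \<omega>)
      = ennreal (msq Q (\<lambda>x. case_prod (elem_integrand (l n)) x - case_prod H x))" for n
      using int_mean_square_eq_msq[of "\<lambda>t \<omega>. elem_integrand (l n) t \<omega> - H t \<omega>"]
        sq_int_diff[OF elem_integrand_sq_int[OF valid[of n]] H] by (simp add: stepH split_def)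
    then show ?thesis using limH by (simp add: ennreal_tendsto_0_iff)
  qed
  \<comment> \<open>The limit is square-integrable because some elementary integral is at distance less than one.\<close>
  have It: "sq_int M (I t)" if t: "t \<in> {0..T}" for t
  proof -
    have m: "I t \<in> borel_measurable M"
      using I t measurable_F_M[of "I t" t] by (auto simp: has_ito_integral_def adapted_def)
    have "\<forall>\<^sub>F n in sequentially. mean_square M (\<lambda>\<omega>. step_integral W (s n) (\<xi> n) t \<omega> - I t \<omega>) < 1"
      using limI[OF t] by (rule order_tendstoD) simp
    then obtain n where "mean_square M (\<lambda>\<omega>. step_integral W (s n) (\<xi> n) t \<omega> - I t \<omega>) < 1"
      by (auto simp: eventually_sequentially)
    then have "mean_square M (\<lambda>\<omega>. elem_integral (l n) t \<omega> - I t \<omega>) < \<infinity>"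
      by (simp add: stepI order.strict_trans[OF _ ennreal_one_less_top])
    then have "sq_int M (\<lambda>\<omega>. elem_integral (l n) t \<omega> - I t \<omega>)"
      using sq_int_measurable[OF elem_integral_sq_int[OF valid[of n] t]] m by (intro sq_int_if_mean_square_finite) auto
    from sq_int_diff[OF elem_integral_sq_int[OF valid[of n] t] this] show ?thesis by simp
  qed
  have lim: "(\<lambda>n. msq M (\<lambda>\<omega>. elem_integral (l n) t \<omega> - I t \<omega>)) \<longlonglongrightarrow> 0" if t: "t \<in> {0..T}" for t
  proof -
    have "mean_square M (\<lambda>\<omega>. step_integral W (s n) (\<xi> n) t \<omega> - I t \<omega>) = ennreal (msq M (\<lambda>\<omega>. elem_integral (l n) t \<omega> - I t \<omega>))" for n
      using mean_square_eq_msq[OF sq_int_diff[OF elem_integral_sq_int[OF valid[of n] t] It[OF t]]] by (simp add: stepI)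
    then show ?thesis using limI[OF t] by (simp add: ennreal_tendsto_0_iff)
  qed
  show ?thesis unfolding ito_def by (intro conjI exI[of _ l] ballI allI valid limH' It H lim)
qed

end

section \<open>Integrals over time\<close>

text \<open>Reversing time turns the bound by the future into a bound by the past.\<close>

lemma backward_gronwall:
  fixes y :: "real \<Rightarrow> real"
  assumes T: "0 \<le> T" and y: "set_integrable lborel {0..T} y" and nonneg: "\<And>t. t \<in> {0..T} \<Longrightarrow> 0 \<le> y t"
    and \<kappa>: "0 \<le> \<kappa>" and A: "0 \<le> A"
    and le: "\<And>t. t \<in> {0..T} \<Longrightarrow> y t \<le> A + \<kappa> * (LBINT s:{t..T}. y s)"
    and t: "t \<in> {0..T}"
  shows "y t \<le> A * exp (\<kappa> * (T - t))"
proof -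
  have ind: "indicator {0..T} (T + - 1 * s) = indicator {0..T} s"
    "indicator {T - t..T} (T + - 1 * s) = (indicator {0..t} s :: real)" for s t :: real
    by (auto simp: indicator_def)
  have "set_integrable lborel {0..T} (\<lambda>s. y (T - s))"
    using lborel_integrable_real_affine[OF y[unfolded set_integrable_def], of "-1" T]
    by (simp add: set_integrable_def ind[simplified])
  moreover have "(LBINT s:{0..t}. y (T - s)) = (LBINT s:{T - t..T}. y s)" for t
    using lborel_integral_real_affine[of "-1" "\<lambda>s. indicator {T - t..T} s *\<^sub>R y s" T] ind(2)[of t]
    by (simp add: set_lebesgue_integral_def)
  ultimately have "y (T - (T - t)) \<le> A * exp (\<kappa> * (T - t))"
    using nonneg le t by (intro integral_gronwall[where T=T and y="\<lambda>s. y (T - s)"] \<kappa> A) auto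
  then show ?thesis by simp
qed

lemma exp_integral:
  fixes \<kappa> :: real assumes "0 \<le> T"
  shows "(LBINT s:{0..T}. \<kappa> * exp (\<kappa> * (T - s))) = exp (\<kappa> * T) - 1"
    and "set_integrable lborel {0..T} (\<lambda>s. \<kappa> * exp (\<kappa> * (T - s)))"
proof -
  have "((\<lambda>s. - exp (\<kappa> * (T - s))) has_real_derivative \<kappa> * exp (\<kappa> * (T - s))) (at s within {0..T})" for s
    by (auto intro!: derivative_eq_intros)
  then have h: "has_bochner_integral lborel (\<lambda>s. indicator {0..T} s *\<^sub>R (\<kappa> * exp (\<kappa> * (T - s)))) (- exp (\<kappa> * (T - T)) - (- exp (\<kappa> * (T - 0))))"
    by (intro has_bochner_integral_FTC_Icc assms)
      (auto simp: has_real_derivative_iff_has_vector_derivative[symmetric] intro!: continuous_intros)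
  show "(LBINT s:{0..T}. \<kappa> * exp (\<kappa> * (T - s))) = exp (\<kappa> * T) - 1"
    unfolding set_lebesgue_integral_def has_bochner_integral_integral_eq[OF h] by simp
  show "set_integrable lborel {0..T} (\<lambda>s. \<kappa> * exp (\<kappa> * (T - s)))"
    using h unfolding set_integrable_def by (rule integrable.intros)
qed

context brownian
begin

lemma measure_TM: "measure TM (space TM) = T"
  using T_pos by (simp add: TM_def measure_restrict_space)

lemma sq_int_TM_const[simp]: "sq_int TM (\<lambda>_. c)"
  by (simp add: sq_int_def)

lemma sq_int_TM_integrable:
  assumes "sq_int TM f" shows "integrable TM f"
proof (rule Bochner_Integration.integrable_bound)
  show "integrable TM (\<lambda>s. 1 + (norm (f s))\<^sup>2)" using assms by (auto simp: sq_int_def)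
  show "AE s in TM. norm (f s) \<le> norm (1 + (norm (f s))\<^sup>2)"
  proof (rule AE_I2)
    fix s
    have "2 * norm (f s) \<le> 1 + (norm (f s))\<^sup>2" using zero_le_power2[of "1 - norm (f s)"] by (simp add: power2_diff)
    moreover have "norm (f s) \<le> 2 * norm (f s)" by simp
    moreover have "norm (1 + (norm (f s))\<^sup>2) = 1 + (norm (f s))\<^sup>2" by simp
    ultimately show "norm (f s) \<le> norm (1 + (norm (f s))\<^sup>2)" by linarith
  qed
qed (use assms in auto)

lemma LBINT_split_L2:
  fixes f :: "real \<Rightarrow> 'b::euclidean_space"
  assumes f: "sq_int TM f" and ab: "0 \<le> a" "s \<in> {a..b}" "b \<le> T"
  shows "(LBINT r:{a..b}. f r) = (LBINT r:{a..s}. f r) + (LBINT r:{s..b}. f r)"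
proof -
  have i: "set_integrable lborel A f" if "A \<subseteq> {0..T}" "A \<in> sets lborel" for A
    using sq_int_TM_integrable[OF f] that unfolding integrable_TM by (auto intro: set_integrable_subset)
  have "(LBINT r:{a..b}. f r) = (LBINT r:{a..s} \<union> {s<..b}. f r)"
    using ab by (intro arg_cong[where f="\<lambda>A. set_lebesgue_integral lborel A f"]) auto
  also have "\<dots> = (LBINT r:{a..s}. f r) + (LBINT r:{s<..b}. f r)"
    using ab by (intro set_integral_Un i) auto
  also have "(LBINT r:{s<..b}. f r) = (LBINT r:{s..b}. f r)"
  proof -
    have "indicator {0..T} r *\<^sub>R indicator {s<..b} r *\<^sub>R f r = indicator {s<..b} r *\<^sub>R f r" for r
      using ab by (auto simp: indicator_def)
    then have "(\<integral>r. indicator {s<..b} r *\<^sub>R f r \<partial>TM) = (LBINT r:{s<..b}. f r)"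
      unfolding integral_TM set_lebesgue_integral_def by (simp only:)
    moreover have "(\<integral>r. indicator {s..b} r *\<^sub>R f r \<partial>TM) = (LBINT r:{s..b}. f r)"
      using ab by (intro integral_TM_indicator) auto
    ultimately show ?thesis
      using integral_TM_half_open[OF sq_int_measurable[OF f], of s b] by simp
  qed
  finally show ?thesis .
qed

lemma norm_integral_TM_sq_le:
  assumes "sq_int TM f" shows "(norm (\<integral>s. f s \<partial>TM))\<^sup>2 \<le> T * msq TM f"
proof -
  let ?c = "\<integral>s. f s \<partial>TM"
  have "(norm ?c)\<^sup>2 = (\<integral>s. ?c \<bullet> f s \<partial>TM)"
    using sq_int_TM_integrable[OF assms] by (simp add: power2_norm_eq_inner)
  also have "\<dots> \<le> sqrt (msq TM (\<lambda>_. ?c)) * sqrt (msq TM f)"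
    using inner_integral_le[OF sq_int_TM_const assms, of ?c] by linarith
  also have "msq TM (\<lambda>_. ?c) = T * (norm ?c)\<^sup>2"
    by (simp add: msq_def measure_TM[simplified])
  finally have le: "(norm ?c)\<^sup>2 \<le> norm ?c * (sqrt T * sqrt (msq TM f))"
    by (simp add: real_sqrt_mult mult_ac)
  show ?thesis
  proof (cases "norm ?c = 0")
    case True
    then show ?thesis using T_pos by simp
  next
    case False
    then have "norm ?c \<le> sqrt T * sqrt (msq TM f)"
      using le by (simp add: power2_eq_square)
    then have "(norm ?c)\<^sup>2 \<le> (sqrt T * sqrt (msq TM f))\<^sup>2" by (intro power_mono) auto
    then show ?thesis using T_pos by (simp add: power_mult_distrib)
  qed
qed

lemma sq_int_Q_const:
  assumes "sq_int M v" shows "sq_int Q (\<lambda>(t, \<omega>). v \<omega>)"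
proof (rule sq_int_dominated)
  have [measurable]: "v \<in> borel_measurable M" using assms by (rule sq_int_measurable)
  show "(\<lambda>(t, \<omega>). v \<omega>) \<in> borel_measurable Q" by measurable
  show "integrable Q (\<lambda>x. 1 * (norm (v (snd x)))\<^sup>2)"
    using assms by (intro integral_Q_product(2)[where u="\<lambda>_. 1"] sq_int_integrable) auto
qed auto

lemma AE_Q_snd:
  assumes "AE \<omega> in M. P \<omega>" shows "AE x in Q. P (snd x)"
proof -
  obtain N where N: "{\<omega>\<in>space M. \<not> P \<omega>} \<subseteq> N" "N \<in> null_sets M"
    using AE_E[OF assms] by (metis null_setsI)
  show ?thesis
  proof (rule AE_I[of _ _ "space TM \<times> N"])
    show "{x \<in> space Q. \<not> P (snd x)} \<subseteq> space TM \<times> N" using N by (auto simp: space_Q)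
    have "N \<in> sets M" using N by auto
    then have "space TM \<times> N \<in> sets (TM \<Otimes>\<^sub>M M)" by (intro pair_measureI sets.top)
    then show "space TM \<times> N \<in> sets Q" by (simp add: Q_def)
    show "emeasure Q (space TM \<times> N) = 0"
      unfolding Q_def using N \<open>N \<in> sets M\<close> emeasure_pair_measure_Times[of "space TM" TM N]
      by (simp add: null_sets_def del: space_TM)
  qed
qed

lemma AE_TM_section:
  assumes "sq_int Q (case_prod H)" shows "AE t in TM. sq_int M (H t)"
proof -
  have m: "case_prod H \<in> borel_measurable (TM \<Otimes>\<^sub>M M)"
    using sq_int_measurable[OF assms] by (simp add: Q_def)
  have "integrable (TM \<Otimes>\<^sub>M M) (\<lambda>(t, \<omega>). (norm (H t \<omega>))\<^sup>2)"
    using sq_int_integrable[OF assms] by (simp add: Q_def split_def)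
  from TQ.AE_integrable_fst[OF this] AE_space show ?thesis
  proof eventually_elim
    case (elim t)
    then show ?case using measurable_compose[OF measurable_Pair1'[of t TM M] m]
      by (simp add: sq_int_def)
  qed
qed

lemma running_integral_sq_int:
  assumes g: "sq_int Q (case_prod g)"
  shows "sq_int Q (\<lambda>(r, \<omega>). \<integral>u. indicator {..r} u *\<^sub>R g u \<omega> \<partial>TM)"
proof -
  have [measurable]: "case_prod g \<in> borel_measurable (TM \<Otimes>\<^sub>M M)"
    using sq_int_measurable[OF g] by (simp add: Q_def)
  let ?G = "\<lambda>(r, \<omega>). \<integral>u. indicator {..r} u *\<^sub>R g u \<omega> \<partial>TM"
  have "(\<lambda>x. \<integral>u. (if u \<le> fst x then case_prod g (u, snd x) else 0) \<partial>TM) \<in> borel_measurable Q"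
    unfolding Q_def
  proof (rule TM.borel_measurable_lebesgue_integral)
    show "(\<lambda>(x, u). if u \<le> fst x then case_prod g (u, snd x) else 0) \<in> borel_measurable ((TM \<Otimes>\<^sub>M M) \<Otimes>\<^sub>M TM)"
      by measurable
  qed
  then have m: "?G \<in> borel_measurable Q"
    by (simp add: split_def indicator_def if_distrib cong: if_cong)
  have "integrable Q (\<lambda>x. 1 * (T * (\<integral>u. g u (snd x) \<bullet> g u (snd x) \<partial>TM)))"
    using inner_integral_Q(5)[OF g g]
    by (intro integral_Q_product(2)[where u="\<lambda>_. 1"]) auto
  then have i: "integrable Q (\<lambda>x. T * (\<integral>u. g u (snd x) \<bullet> g u (snd x) \<partial>TM))" by simp
  have "AE x in Q. (norm (?G x))\<^sup>2 \<le> T * (\<integral>u. g u (snd x) \<bullet> g u (snd x) \<partial>TM)"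
    using AE_Q_snd[OF AE_sq_int_section[OF g]]
  proof eventually_elim
    case (elim x)
    let ?f = "\<lambda>u. indicator {..fst x} u *\<^sub>R g u (snd x)"
    have dom: "(norm (?f u))\<^sup>2 \<le> (norm (g u (snd x)))\<^sup>2" for u by (simp add: indicator_def)
    have meas: "?f \<in> borel_measurable TM"
    proof -
      have [measurable]: "(\<lambda>u. g u (snd x)) \<in> borel_measurable TM" using elim by (rule sq_int_measurable)
      have "(\<lambda>u. if u \<le> fst x then g u (snd x) else 0) \<in> borel_measurable TM" by measurable
      then show ?thesis by (simp add: indicator_def if_distrib cong: if_cong)
    qed
    have "sq_int TM ?f"
      by (rule sq_int_dominated[OF meas sq_int_integrable[OF elim] dom])
    then have "(norm (?G x))\<^sup>2 \<le> T * msq TM ?f"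
      using norm_integral_TM_sq_le by (simp add: split_def)
    also have "\<dots> \<le> T * msq TM (\<lambda>u. g u (snd x))"
      using msq_le_integral[OF sq_int_integrable[OF elim] dom] T_pos by (simp add: msq_def)
    finally show ?case by (simp add: msq_def power2_norm_eq_inner)
  qed
  then show ?thesis
    unfolding sq_int_def using m
    by (intro conjI m Bochner_Integration.integrable_bound[OF i])
      (auto elim!: eventually_mono intro: order_trans[OF _ abs_ge_self])
qed

text \<open>The square \<open>{0..T}\<^sup>2\<close> splits along its diagonal into two triangles on which the symmetric
  kernel has the same integral.\<close>

lemma integral_triangle:
  fixes g :: "real \<Rightarrow> 'b::euclidean_space"
  assumes g: "sq_int TM g"
  shows "2 * (\<integral>r. (\<integral>u. indicator {..r} u *\<^sub>R g u \<partial>TM) \<bullet> g r \<partial>TM) = (norm (\<integral>u. g u \<partial>TM))\<^sup>2"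
proof -
  interpret TT: pair_sigma_finite TM TM ..
  have gi: "integrable TM g" by (rule sq_int_TM_integrable[OF g])
  have [measurable]: "g \<in> borel_measurable TM" using g by (rule sq_int_measurable)
  have full: "integrable (TM \<Otimes>\<^sub>M TM) (\<lambda>(r, u). norm (g r) * norm (g u))"
    by (rule TT.Fubini_integrable) (use gi in auto)
  have meas: "(\<lambda>(r, u). if u \<le> r then g u \<bullet> g r else 0) \<in> borel_measurable (TM \<Otimes>\<^sub>M TM)"
    "(\<lambda>(r, u). g u \<bullet> g r) \<in> borel_measurable (TM \<Otimes>\<^sub>M TM)"
    by measurable
  have b: "\<bar>x \<bullet> y\<bar> \<le> norm y * norm x" for x y :: 'b
    using Cauchy_Schwarz_ineq2[of x y] by (simp add: mult.commute)
  have tri: "integrable (TM \<Otimes>\<^sub>M TM) (\<lambda>(r, u). if u \<le> r then g u \<bullet> g r else 0)"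
    by (rule Bochner_Integration.integrable_bound[OF full meas(1)]) (auto simp: b)
  have all: "integrable (TM \<Otimes>\<^sub>M TM) (\<lambda>(r, u). g u \<bullet> g r)"
    by (rule Bochner_Integration.integrable_bound[OF full meas(2)]) (auto simp: b)
  have inner1: "(\<integral>u. indicator {..r} u *\<^sub>R g u \<partial>TM) \<bullet> g r = (\<integral>u. (if u \<le> r then g u \<bullet> g r else 0) \<partial>TM)" for r
  proof -
    have "integrable TM (\<lambda>u. indicator {..r} u *\<^sub>R g u)"
    proof (rule Bochner_Integration.integrable_bound[OF gi])
      have "(\<lambda>u. if u \<le> r then g u else 0) \<in> borel_measurable TM" by measurable
      then show "(\<lambda>u. indicator {..r} u *\<^sub>R g u) \<in> borel_measurable TM"
        by (simp add: indicator_def if_distrib cong: if_cong)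
    qed (auto simp: indicator_def)
    then have "(\<integral>u. indicator {..r} u *\<^sub>R g u \<partial>TM) \<bullet> g r = (\<integral>u. (indicator {..r} u *\<^sub>R g u) \<bullet> g r \<partial>TM)"
      by (intro integral_inner_left[symmetric])
    also have "\<dots> = (\<integral>u. (if u \<le> r then g u \<bullet> g r else 0) \<partial>TM)"
      by (intro Bochner_Integration.integral_cong) (auto simp: indicator_def)
    finally show ?thesis .
  qed
  let ?K = "\<lambda>r u. if u \<le> r then g u \<bullet> g r else 0"
  have lower: "(\<integral>r. (\<integral>u. indicator {..r} u *\<^sub>R g u \<partial>TM) \<bullet> g r \<partial>TM) = (\<integral>r. (\<integral>u. ?K r u \<partial>TM) \<partial>TM)"
    by (simp add: inner1)
  have swap: "(\<integral>r. (\<integral>u. ?K r u \<partial>TM) \<partial>TM) = (\<integral>r. (\<integral>u. ?K u r \<partial>TM) \<partial>TM)"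
    using TT.Fubini_integral[OF tri] by simp
  have tri': "integrable (TM \<Otimes>\<^sub>M TM) (\<lambda>(r, u). ?K u r)"
    using TT.integrable_product_swap[OF tri] by simp
  have "AE r in TM. (\<integral>u. ?K r u \<partial>TM) + (\<integral>u. ?K u r \<partial>TM) = (\<integral>u. g u \<bullet> g r \<partial>TM)"
    using TT.AE_integrable_fst[OF tri] TT.AE_integrable_fst[OF tri']
  proof eventually_elim
    case (elim r)
    have "(\<integral>u. ?K r u \<partial>TM) + (\<integral>u. ?K u r \<partial>TM) = (\<integral>u. ?K r u + ?K u r \<partial>TM)"
      using elim by (intro Bochner_Integration.integral_add[symmetric])
    also have "\<dots> = (\<integral>u. g u \<bullet> g r \<partial>TM)"
    proof (rule integral_cong_AE)
      show "(\<lambda>u. ?K r u + ?K u r) \<in> borel_measurable TM" using elim by auto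
      show "(\<lambda>u. g u \<bullet> g r) \<in> borel_measurable TM" by measurable
      show "AE u in TM. ?K r u + ?K u r = g u \<bullet> g r"
        using AE_TM_neq[of r] by eventually_elim (auto simp: inner_commute)
    qed
    finally show ?case .
  qed
  then have "(\<integral>r. (\<integral>u. ?K r u \<partial>TM) + (\<integral>u. ?K u r \<partial>TM) \<partial>TM) = (\<integral>r. (\<integral>u. g u \<bullet> g r \<partial>TM) \<partial>TM)"
    using TT.integrable_fst[OF tri] TT.integrable_fst[OF tri'] TT.integrable_fst[OF all]
    by (intro integral_cong_AE) auto
  also have "\<dots> = (\<integral>r. (\<integral>u. g u \<partial>TM) \<bullet> g r \<partial>TM)"
    using gi by simp
  also have "\<dots> = (\<integral>u. g u \<partial>TM) \<bullet> (\<integral>u. g u \<partial>TM)"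
    using gi by (simp add: integral_inner_right)
  finally show ?thesis
    using TT.integrable_fst[OF tri] TT.integrable_fst[OF tri'] swap lower
    by (simp add: power2_norm_eq_inner)
qed

end

section \<open>Energy identity and stability of linear equations\<close>

context brownian
begin

text \<open>The energy identity is Ito's formula for \<open>|D|\<^sup>2\<close> in expectation. With \<open>G\<^sub>s\<close> the integral of \<open>\<phi>\<close> over
  \<open>[t, s]\<close>, the process \<open>V = D + G\<close> is a martingale on \<open>[t, T]\<close>, so \<open>E<V\<^sub>T, \<phi>\<^sub>s> = E<V\<^sub>s, \<phi>\<^sub>s>\<close>; integrating
  over \<open>s\<close> evaluates the mixed term of \<open>E|V\<^sub>T - G\<^sub>T|\<^sup>2\<close>, and the part that comes from \<open>G\<^sub>s\<close> is
  \<open>E|G\<^sub>T|\<^sup>2 / 2\<close>.\<close>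

lemma energy_identity:
  fixes D \<phi> :: "real \<Rightarrow> 'a \<Rightarrow> real^'k" and H :: "real \<Rightarrow> 'a \<Rightarrow> real^'d^'k"
  assumes D: "adapted F T D" "sq_int Q (case_prod D)" "\<And>s. s \<in> {0..T} \<Longrightarrow> sq_int M (D s)"
    and \<phi>: "adapted F T \<phi>" "sq_int Q (case_prod \<phi>)"
    and N: "ito H N"
    and eq: "\<And>s. s \<in> {0..T} \<Longrightarrow>
      AE \<omega> in M. D s \<omega> = D T \<omega> + (LBINT r:{s..T}. \<phi> r \<omega>) - (N T \<omega> - N s \<omega>)"
    and t: "t \<in> {0..T}"
  shows "msq M (D T) = msq M (D t) + (LBINT r:{t..T}. msq M (H r))
    - 2 * (LBINT s:{t..T}. expectation (\<lambda>\<omega>. D s \<omega> \<bullet> \<phi> s \<omega>))"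
proof -
  have tT: "0 \<le> t" "t \<le> T" "T \<in> {0..T}" using t by auto
  define g where "g r \<omega> = indicator {t..T} r *\<^sub>R \<phi> r \<omega>" for r \<omega>
  define G where "G s \<omega> = (\<integral>u. indicator {..s} u *\<^sub>R g u \<omega> \<partial>TM)" for s \<omega>
  define V where "V s \<omega> = D t \<omega> + (N s \<omega> - N t \<omega>)" for s \<omega>
  have g: "sq_int Q (case_prod g)"
    unfolding g_def using sq_int_indicator_Q[OF \<phi>(2), of "{t..T}"] by simp
  have GQ: "sq_int Q (case_prod G)"
    unfolding G_def using running_integral_sq_int[OF g] .
  note Nsq = ito_sq_int[OF N]
  have V: "sq_int M (V s)" if "s \<in> {0..T}" for s
    unfolding V_def by (intro sq_int_add sq_int_diff D(3) Nsq(2) t that)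
  have G_eq: "G s \<omega> = (LBINT r:{t..s}. \<phi> r \<omega>)" if "s \<in> {t..T}" for s \<omega>
  proof -
    have "G s \<omega> = (\<integral>u. indicator {t..s} u *\<^sub>R \<phi> u \<omega> \<partial>TM)"
      unfolding G_def g_def using that by (intro Bochner_Integration.integral_cong) (auto simp: indicator_def)
    also have "\<dots> = (LBINT r:{t..s}. \<phi> r \<omega>)"
      using that tT by (intro integral_TM_indicator) auto
    finally show ?thesis .
  qed
  have VG: "AE \<omega> in M. V s \<omega> = D s \<omega> + G s \<omega>" if s: "s \<in> {t..T}" for s
  proof -
    have "s \<in> {0..T}" using s tT by auto
    from eq[OF this] eq[OF t] AE_sq_int_section[OF \<phi>(2)] show ?thesis
    proof eventually_elim
      case (elim \<omega>)
      have "(LBINT r:{t..T}. \<phi> r \<omega>) = G s \<omega> + (LBINT r:{s..T}. \<phi> r \<omega>)"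
        using LBINT_split_L2[OF elim(3) tT(1) s order_refl] by (simp add: G_eq[OF s])
      then show ?case
        unfolding V_def by (subst elim(1), subst elim(2)) (simp add: algebra_simps)
    qed
  qed
  have G_meas: "G s \<in> borel_measurable M" if "s \<in> {0..T}" for s
    using measurable_compose[OF measurable_Pair1'[of s TM M] sq_int_measurable[OF GQ, unfolded Q_def]] that by simp
  have Gsq: "sq_int M (G s)" if s: "s \<in> {t..T}" for s
  proof (rule sq_int_cong_AE)
    have s': "s \<in> {0..T}" using s tT by auto
    show "sq_int M (\<lambda>\<omega>. V s \<omega> - D s \<omega>)" using V[OF s'] D(3)[OF s'] by (rule sq_int_diff)
    show "G s \<in> borel_measurable M" by (rule G_meas[OF s'])
    show "AE \<omega> in M. V s \<omega> - D s \<omega> = G s \<omega>" using VG[OF s] by eventually_elim simp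
  qed
  have T': "T \<in> {t..T}" using tT by auto
  have "msq M (D T) = msq M (\<lambda>\<omega>. V T \<omega> - G T \<omega>)"
  proof (rule msq_cong_AE)
    show "AE x in M. D T x = V T x - G T x" using VG[OF T'] by eventually_elim simp
  qed (use D(3)[OF tT(3)] sq_int_diff[OF V[OF tT(3)] Gsq[OF T']] in \<open>auto intro: sq_int_measurable\<close>)
  also have "\<dots> = msq M (V T) - 2 * expectation (\<lambda>\<omega>. V T \<omega> \<bullet> G T \<omega>) + msq M (G T)"
    by (rule msq_diff[OF V[OF tT(3)] Gsq[OF T']])
  also have "msq M (V T) = msq M (D t) + (LBINT r:{t..T}. msq M (H r))"
  proof -
    have "msq M (V T) = msq M (D t) + 2 * expectation (\<lambda>\<omega>. D t \<omega> \<bullet> (N T \<omega> - N t \<omega>)) + msq M (\<lambda>\<omega>. N T \<omega> - N t \<omega>)"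
      unfolding V_def by (intro msq_add D(3) sq_int_diff Nsq(2) t tT)
    moreover have "expectation (\<lambda>\<omega>. D t \<omega> \<bullet> (N T \<omega> - N t \<omega>)) = 0"
      using D(1) t tT by (intro ito_orthogonal[OF N] D(3)) (auto simp: adapted_def)
    ultimately show ?thesis using ito_isometry[OF N tT(1,2)] by simp
  qed
  \<comment> \<open>The mixed term: first Fubini, then the martingale property of \<open>V\<close> at each time \<open>s\<close>.\<close>
  also have "expectation (\<lambda>\<omega>. V T \<omega> \<bullet> G T \<omega>)
    = (LBINT s:{t..T}. expectation (\<lambda>\<omega>. D s \<omega> \<bullet> \<phi> s \<omega>)) + msq M (G T) / 2"
  proof -
    have VQ: "sq_int Q (\<lambda>(s, \<omega>). V T \<omega>)" by (rule sq_int_Q_const[OF V[OF tT(3)]])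
    have gi: "AE \<omega> in M. integrable TM (\<lambda>s. g s \<omega>)"
      using AE_sq_int_section[OF g] by eventually_elim (rule sq_int_TM_integrable)
    have GT: "G T \<omega> = (\<integral>s. g s \<omega> \<partial>TM)" for \<omega>
      unfolding G_def g_def by (intro Bochner_Integration.integral_cong) (auto simp: indicator_def)
    have "expectation (\<lambda>\<omega>. V T \<omega> \<bullet> G T \<omega>) = expectation (\<lambda>\<omega>. \<integral>s. V T \<omega> \<bullet> g s \<omega> \<partial>TM)"
    proof (rule integral_cong_AE)
      show "(\<lambda>\<omega>. V T \<omega> \<bullet> G T \<omega>) \<in> borel_measurable M"
        using integrable_inner[OF V[OF tT(3)] Gsq[OF T']] by auto
      show "(\<lambda>\<omega>. \<integral>s. V T \<omega> \<bullet> g s \<omega> \<partial>TM) \<in> borel_measurable M"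
        using inner_integral_Q(5)[OF VQ g] by auto
      show "AE \<omega> in M. V T \<omega> \<bullet> G T \<omega> = (\<integral>s. V T \<omega> \<bullet> g s \<omega> \<partial>TM)"
        using gi by eventually_elim (simp add: GT integral_inner_right)
    qed
    also have "\<dots> = (\<integral>s. expectation (\<lambda>\<omega>. V T \<omega> \<bullet> g s \<omega>) \<partial>TM)"
      using inner_integral_Q(1,4)[OF VQ g] by simp
    also have "\<dots> = (\<integral>s. indicator {t..T} s *\<^sub>R expectation (\<lambda>\<omega>. D s \<omega> \<bullet> \<phi> s \<omega>) + expectation (\<lambda>\<omega>. G s \<omega> \<bullet> g s \<omega>) \<partial>TM)"
    proof (rule integral_cong_AE)
      show "(\<lambda>s. expectation (\<lambda>\<omega>. V T \<omega> \<bullet> g s \<omega>)) \<in> borel_measurable TM"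
        using inner_integral_Q(2)[OF VQ g] by auto
      have "(\<lambda>s. indicator {t..T} s *\<^sub>R expectation (\<lambda>\<omega>. D s \<omega> \<bullet> \<phi> s \<omega>)) \<in> borel_measurable TM"
        using inner_integral_Q(2)[OF D(2) \<phi>(2)] by (intro borel_measurable_scaleR measurable_compose[OF measurable_TM_borel borel_measurable_indicator]) auto
      then show "(\<lambda>s. indicator {t..T} s *\<^sub>R expectation (\<lambda>\<omega>. D s \<omega> \<bullet> \<phi> s \<omega>) + expectation (\<lambda>\<omega>. G s \<omega> \<bullet> g s \<omega>)) \<in> borel_measurable TM"
        using inner_integral_Q(2)[OF GQ g] by (intro borel_measurable_add) auto
      show "AE s in TM. expectation (\<lambda>\<omega>. V T \<omega> \<bullet> g s \<omega>)
        = indicator {t..T} s *\<^sub>R expectation (\<lambda>\<omega>. D s \<omega> \<bullet> \<phi> s \<omega>) + expectation (\<lambda>\<omega>. G s \<omega> \<bullet> g s \<omega>)"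
        using AE_TM_section[OF \<phi>(2)] AE_space
      proof eventually_elim
        case (elim s)
        show ?case
        proof (cases "s \<in> {t..T}")
          case False
          then show ?thesis by (simp add: g_def)
        next
          case True
          then have s': "s \<in> {0..T}" and gs: "g s = \<phi> s" using tT by (auto simp: g_def)
          have VT: "V T \<omega> = V s \<omega> + (N T \<omega> - N s \<omega>)" for \<omega> by (simp add: V_def)
          have NN: "sq_int M (\<lambda>\<omega>. N T \<omega> - N s \<omega>)" by (intro sq_int_diff Nsq(2) s' tT)
          have "expectation (\<lambda>\<omega>. V T \<omega> \<bullet> \<phi> s \<omega>) = expectation (\<lambda>\<omega>. V s \<omega> \<bullet> \<phi> s \<omega> + \<phi> s \<omega> \<bullet> (N T \<omega> - N s \<omega>))"
            unfolding VT inner_add_left inner_commute[of "N T _ - N s _"] by (rule refl)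
          also have "\<dots> = expectation (\<lambda>\<omega>. V s \<omega> \<bullet> \<phi> s \<omega>) + expectation (\<lambda>\<omega>. \<phi> s \<omega> \<bullet> (N T \<omega> - N s \<omega>))"
            using integrable_inner[OF V[OF s'] elim(1)] integrable_inner[OF elim(1) NN]
            by (intro Bochner_Integration.integral_add)
          also have "expectation (\<lambda>\<omega>. \<phi> s \<omega> \<bullet> (N T \<omega> - N s \<omega>)) = 0"
            using \<phi>(1) s' elim(1) by (intro ito_orthogonal[OF N]) (auto simp: adapted_def)
          also have "expectation (\<lambda>\<omega>. V s \<omega> \<bullet> \<phi> s \<omega>) = expectation (\<lambda>\<omega>. D s \<omega> \<bullet> \<phi> s \<omega> + G s \<omega> \<bullet> \<phi> s \<omega>)"
          proof (rule integral_cong_AE)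
            show "AE \<omega> in M. V s \<omega> \<bullet> \<phi> s \<omega> = D s \<omega> \<bullet> \<phi> s \<omega> + G s \<omega> \<bullet> \<phi> s \<omega>"
              using VG[OF True] by eventually_elim (simp add: inner_add_left)
          qed (use integrable_inner[OF V[OF s'] elim(1)] integrable_inner[OF D(3)[OF s'] elim(1)] integrable_inner[OF Gsq[OF True] elim(1)] in auto)
          also have "\<dots> = expectation (\<lambda>\<omega>. D s \<omega> \<bullet> \<phi> s \<omega>) + expectation (\<lambda>\<omega>. G s \<omega> \<bullet> \<phi> s \<omega>)"
            using integrable_inner[OF D(3)[OF s'] elim(1)] integrable_inner[OF Gsq[OF True] elim(1)]
            by (intro Bochner_Integration.integral_add)
          finally show ?thesis using True by (simp add: gs)
        qed
      qed
    qed
    also have "\<dots> = (\<integral>s. indicator {t..T} s *\<^sub>R expectation (\<lambda>\<omega>. D s \<omega> \<bullet> \<phi> s \<omega>) \<partial>TM) + (\<integral>s. expectation (\<lambda>\<omega>. G s \<omega> \<bullet> g s \<omega>) \<partial>TM)"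
    proof (rule Bochner_Integration.integral_add)
      show "integrable TM (\<lambda>s. indicator {t..T} s *\<^sub>R expectation (\<lambda>\<omega>. D s \<omega> \<bullet> \<phi> s \<omega>))"
      proof (rule Bochner_Integration.integrable_bound[OF inner_integral_Q(2)[OF D(2) \<phi>(2)]])
        show "(\<lambda>s. indicator {t..T} s *\<^sub>R expectation (\<lambda>\<omega>. D s \<omega> \<bullet> \<phi> s \<omega>)) \<in> borel_measurable TM"
          using inner_integral_Q(2)[OF D(2) \<phi>(2)] by (intro borel_measurable_scaleR measurable_compose[OF measurable_TM_borel borel_measurable_indicator]) auto
      qed (auto simp: indicator_def)
    qed (rule inner_integral_Q(2)[OF GQ g])
    also have "(\<integral>s. expectation (\<lambda>\<omega>. G s \<omega> \<bullet> g s \<omega>) \<partial>TM) = expectation (\<lambda>\<omega>. \<integral>s. G s \<omega> \<bullet> g s \<omega> \<partial>TM)"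
      using inner_integral_Q(1,4)[OF GQ g] by simp
    also have "\<dots> = expectation (\<lambda>\<omega>. (norm (G T \<omega>))\<^sup>2 / 2)"
    proof (rule integral_cong_AE)
      show "(\<lambda>\<omega>. \<integral>s. G s \<omega> \<bullet> g s \<omega> \<partial>TM) \<in> borel_measurable M"
        using inner_integral_Q(5)[OF GQ g] by auto
      show "(\<lambda>\<omega>. (norm (G T \<omega>))\<^sup>2 / 2) \<in> borel_measurable M"
        using sq_int_integrable[OF Gsq[OF T']] by auto
      show "AE \<omega> in M. (\<integral>s. G s \<omega> \<bullet> g s \<omega> \<partial>TM) = (norm (G T \<omega>))\<^sup>2 / 2"
        using AE_sq_int_section[OF g]
      proof eventually_elim
        case (elim \<omega>)
        show ?case using integral_triangle[OF elim] unfolding GT by (simp add: G_def)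
      qed
    qed
    also have "\<dots> = msq M (G T) / 2" by (simp add: msq_def)
    finally show ?thesis unfolding integral_TM_indicator[OF tT(1) order_refl] .
  qed
  finally show ?thesis by simp
qed

lemma LBINT_mono_TM:
  fixes f g :: "real \<Rightarrow> real"
  assumes "integrable TM f" "integrable TM g" "AE s in TM. f s \<le> g s" "0 \<le> a" "b \<le> T"
  shows "(LBINT s:{a..b}. f s) \<le> (LBINT s:{a..b}. g s)"
proof -
  have i: "integrable TM (\<lambda>s. indicator {a..b} s *\<^sub>R h s)" if "integrable TM h" for h :: "real \<Rightarrow> real"
    using that
    by (intro Bochner_Integration.integrable_bound[OF that]
        borel_measurable_scaleR measurable_compose[OF measurable_TM_borel borel_measurable_indicator]) (auto simp: indicator_def)
  have "(\<integral>s. indicator {a..b} s *\<^sub>R f s \<partial>TM) \<le> (\<integral>s. indicator {a..b} s *\<^sub>R g s \<partial>TM)"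
    using assms(3) by (intro integral_mono_AE i assms) (auto elim!: eventually_mono simp: indicator_def)
  then show ?thesis unfolding integral_TM_indicator[OF assms(4,5)] .
qed

lemma LBINT_mono_set_TM:
  fixes f :: "real \<Rightarrow> real"
  assumes f: "integrable TM f" "\<And>s. s \<in> {0..T} \<Longrightarrow> 0 \<le> f s" and t: "t \<in> {0..T}"
  shows "(LBINT s:{t..T}. f s) \<le> (LBINT s:{0..T}. f s)" "(LBINT s:{0..t}. f s) \<le> (LBINT s:{0..T}. f s)"
proof -
  have i: "set_integrable lborel A f" if "A \<subseteq> {0..T}" "A \<in> sets lborel" for A
    using f(1) that by (simp add: integrable_TM set_integrable_subset)
  show "(LBINT s:{t..T}. f s) \<le> (LBINT s:{0..T}. f s)"
    unfolding set_lebesgue_integral_def using t f(2) i[of "{t..T}"] i[of "{0..T}"]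
    by (intro integral_mono) (auto simp: set_integrable_def indicator_def)
  show "(LBINT s:{0..t}. f s) \<le> (LBINT s:{0..T}. f s)"
    unfolding set_lebesgue_integral_def using t f(2) i[of "{0..t}"] i[of "{0..T}"]
    by (intro integral_mono) (auto simp: set_integrable_def indicator_def)
qed

lemma young_driver:
  fixes d e \<rho> h Lx Ly Lz :: real
  shows "2 * (d * (e + Lx * \<rho> + Ly * d + Lz * h))
    \<le> (2 * Ly + 2 * Lz\<^sup>2 + 2) * d\<^sup>2 + (e\<^sup>2 + Lx\<^sup>2 * \<rho>\<^sup>2) + h\<^sup>2 / 2"
  using zero_le_power2[of "d - e"] zero_le_power2[of "d - Lx * \<rho>"] zero_le_power2[of "2 * Lz * d - h"]
  by (simp add: power2_eq_square algebra_simps)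

text \<open>In the energy identity Young's inequality costs half of the control energy and leaves
  \<open>\<beta> E|D|\<^sup>2\<close> to Gronwall's inequality. Inserting the resulting exponential bound once more at \<open>t = 0\<close> gives
  \<open>A + A (exp (\<beta>T) - 1) = A exp (\<beta>T)\<close>, so the control costs no more than twice the bound for \<open>D\<close>.
  Together the two bounds make up the factor \<open>3 exp (\<beta>T)\<close> of \<^const>\<open>K_B\<close>.\<close>

lemma backward_stability:
  fixes D \<phi> :: "real \<Rightarrow> 'a \<Rightarrow> real^'k" and H :: "real \<Rightarrow> 'a \<Rightarrow> real^'d^'k" and e \<rho> :: "real \<Rightarrow> 'a \<Rightarrow> real"
  assumes D: "adapted F T D" "sq_int Q (case_prod D)" "\<And>s. s \<in> {0..T} \<Longrightarrow> sq_int M (D s)"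
    and \<phi>: "adapted F T \<phi>" "sq_int Q (case_prod \<phi>)"
    and N: "ito H N"
    and eq: "\<And>s. s \<in> {0..T} \<Longrightarrow>
      AE \<omega> in M. D s \<omega> = D T \<omega> + (LBINT r:{s..T}. \<phi> r \<omega>) - (N T \<omega> - N s \<omega>)"
    and e: "\<And>s. s \<in> {0..T} \<Longrightarrow> sq_int M (e s)" "\<And>s. s \<in> {0..T} \<Longrightarrow> msq M (e s) \<le> \<epsilon>"
    and \<rho>: "\<And>s. s \<in> {0..T} \<Longrightarrow> sq_int M (\<rho> s)" "\<And>s. s \<in> {0..T} \<Longrightarrow> msq M (\<rho> s) \<le> r"
    and bound: "\<And>s \<omega>. s \<in> {0..T} \<Longrightarrow> \<omega> \<in> space M \<Longrightarrow>
      norm (\<phi> s \<omega>) \<le> e s \<omega> + Lx * \<rho> s \<omega> + Ly * norm (D s \<omega>) + Lz * norm (H s \<omega>)"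
    and L: "0 \<le> Ly"
  defines "A \<equiv> msq M (D T) + T * (\<epsilon> + Lx\<^sup>2 * r)" and "\<beta> \<equiv> 2 * Ly + 2 * Lz\<^sup>2 + 2"
  shows "t \<in> {0..T} \<Longrightarrow> msq M (D t) \<le> exp (\<beta> * T) * A"
    and "(LBINT s:{0..T}. msq M (H s)) \<le> 2 * (exp (\<beta> * T) * A)"
proof -
  have T0: "0 \<in> {0..T}" "T \<in> {0..T}" "0 \<le> T" using T_pos by auto
  have \<beta>: "0 \<le> \<beta>" using L by (simp add: \<beta>_def)
  have \<epsilon>: "0 \<le> \<epsilon>" "0 \<le> r"
    using e(2)[OF T0(1)] \<rho>(2)[OF T0(1)] msq_nonneg[of M "e 0"] msq_nonneg[of M "\<rho> 0"] by linarith+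
  define c where "c = \<epsilon> + Lx\<^sup>2 * r"
  have c: "0 \<le> c" using \<epsilon> by (simp add: c_def)
  have A: "0 \<le> A" using c T0(3) by (simp add: A_def c_def)
  have H: "sq_int Q (case_prod H)" by (rule ito_sq_int(1)[OF N])
  let ?y = "\<lambda>s. msq M (D s)" and ?h = "\<lambda>s. msq M (H s)"
  have yi: "integrable TM ?y" and hi: "integrable TM ?h"
    using msq_Q_eq(2)[OF D(2)] msq_Q_eq(2)[OF H] by auto
  have si: "set_integrable lborel {a..b} f" if "integrable TM f" "0 \<le> a" "b \<le> T" for a b and f :: "real \<Rightarrow> real"
    using that by (auto simp: integrable_TM intro: set_integrable_subset)
  have young: "AE s in TM. 2 * expectation (\<lambda>\<omega>. D s \<omega> \<bullet> \<phi> s \<omega>) \<le> \<beta> * ?y s + c + ?h s / 2"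
    using AE_TM_section[OF H] AE_TM_section[OF \<phi>(2)] AE_space
  proof eventually_elim
    case (elim s)
    then have s: "s \<in> {0..T}" by simp
    have i: "integrable M (\<lambda>\<omega>. \<beta> * (norm (D s \<omega>))\<^sup>2 + ((norm (e s \<omega>))\<^sup>2 + Lx\<^sup>2 * (norm (\<rho> s \<omega>))\<^sup>2) + (norm (H s \<omega>))\<^sup>2 / 2)"
      using sq_int_integrable[OF D(3)[OF s]] sq_int_integrable[OF e(1)[OF s]] sq_int_integrable[OF \<rho>(1)[OF s]] sq_int_integrable[OF elim(1)]
      by (intro Bochner_Integration.integrable_add integrable_mult_right integrable_divide)
    have "2 * expectation (\<lambda>\<omega>. D s \<omega> \<bullet> \<phi> s \<omega>) = expectation (\<lambda>\<omega>. 2 * (D s \<omega> \<bullet> \<phi> s \<omega>))" by simp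
    also have "\<dots> \<le> expectation (\<lambda>\<omega>. \<beta> * (norm (D s \<omega>))\<^sup>2 + ((norm (e s \<omega>))\<^sup>2 + Lx\<^sup>2 * (norm (\<rho> s \<omega>))\<^sup>2) + (norm (H s \<omega>))\<^sup>2 / 2)"
    proof (rule integral_mono[OF _ i])
      show "integrable M (\<lambda>\<omega>. 2 * (D s \<omega> \<bullet> \<phi> s \<omega>))"
        using integrable_inner[OF D(3)[OF s] elim(2)] by simp
      fix \<omega> assume \<omega>: "\<omega> \<in> space M"
      have "D s \<omega> \<bullet> \<phi> s \<omega> \<le> norm (D s \<omega>) * norm (\<phi> s \<omega>)" by (rule norm_cauchy_schwarz)
      also have "\<dots> \<le> norm (D s \<omega>) * (e s \<omega> + Lx * \<rho> s \<omega> + Ly * norm (D s \<omega>) + Lz * norm (H s \<omega>))"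
        by (intro mult_left_mono bound s \<omega>) auto
      finally show "2 * (D s \<omega> \<bullet> \<phi> s \<omega>) \<le> \<beta> * (norm (D s \<omega>))\<^sup>2 + ((norm (e s \<omega>))\<^sup>2 + Lx\<^sup>2 * (norm (\<rho> s \<omega>))\<^sup>2) + (norm (H s \<omega>))\<^sup>2 / 2"
        using young_driver[of "norm (D s \<omega>)" "e s \<omega>" Lx "\<rho> s \<omega>" Ly Lz "norm (H s \<omega>)"] by (simp add: \<beta>_def)
    qed
    also have "\<dots> = \<beta> * ?y s + (msq M (e s) + Lx\<^sup>2 * msq M (\<rho> s)) + ?h s / 2"
      using sq_int_integrable[OF D(3)[OF s]] sq_int_integrable[OF e(1)[OF s]] sq_int_integrable[OF \<rho>(1)[OF s]] sq_int_integrable[OF elim(1)]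
      by (simp add: msq_def)
    also have "\<dots> \<le> \<beta> * ?y s + c + ?h s / 2"
      unfolding c_def using e(2)[OF s] mult_left_mono[OF \<rho>(2)[OF s], of "Lx\<^sup>2"] by simp
    finally show ?case .
  qed
  have main: "?y t + (LBINT s:{t..T}. ?h s) / 2 \<le> A + \<beta> * (LBINT s:{t..T}. ?y s)" if t: "t \<in> {0..T}" for t
  proof -
    have tT: "0 \<le> t" "t \<le> T" using t by auto
    let ?k = "\<lambda>s. expectation (\<lambda>\<omega>. D s \<omega> \<bullet> \<phi> s \<omega>)"
    have ki: "integrable TM ?k" by (rule inner_integral_Q(2)[OF D(2) \<phi>(2)])
    have "2 * (LBINT s:{t..T}. ?k s) = (LBINT s:{t..T}. 2 * ?k s)" by simp
    also have "\<dots> \<le> (LBINT s:{t..T}. \<beta> * ?y s + c + ?h s / 2)"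
      using yi hi ki by (intro LBINT_mono_TM young tT) auto
    also have "\<dots> = \<beta> * (LBINT s:{t..T}. ?y s) + (LBINT s:{t..T}. c) + (LBINT s:{t..T}. ?h s) / 2"
    proof -
      have yi': "set_integrable lborel {t..T} ?y" and hi': "set_integrable lborel {t..T} ?h"
        using yi hi tT by (auto intro: si)
      have ci': "set_integrable lborel {t..T} (\<lambda>_. c)" by (rule si) (use tT in auto)
      show ?thesis using yi' hi' ci' by (simp add: set_integral_add)
    qed
    also have "(LBINT s:{t..T}. c) = (T - t) * c" using tT by (simp add: set_lebesgue_integral_def)
    also have "\<dots> \<le> T * c" using c tT by (intro mult_right_mono) auto
    finally show ?thesis
      using energy_identity[OF D \<phi> N eq t] by (simp add: A_def c_def)
  qed
  have hpos: "0 \<le> (LBINT s:{t..T}. ?h s)" for t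
    unfolding set_lebesgue_integral_def by (intro integral_nonneg_AE AE_I2) auto
  have y: "?y t \<le> A * exp (\<beta> * (T - t))" if t: "t \<in> {0..T}" for t
  proof (rule backward_gronwall[OF T0(3) _ _ \<beta> A _ t])
    show "set_integrable lborel {0..T} ?y" using yi by (simp add: integrable_TM)
    show "?y t \<le> A + \<beta> * (LBINT s:{t..T}. ?y s)" if "t \<in> {0..T}" for t
      using main[OF that] hpos[of t] by linarith
  qed auto
  show "?y t \<le> exp (\<beta> * T) * A" if t: "t \<in> {0..T}"
  proof -
    have "exp (\<beta> * (T - t)) \<le> exp (\<beta> * T)" using t \<beta> by (simp add: mult_left_mono)
    then have "A * exp (\<beta> * (T - t)) \<le> A * exp (\<beta> * T)" using A by (rule mult_left_mono)
    then show ?thesis using y[OF t] by (simp add: mult.commute)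
  qed
  have "\<beta> * (LBINT s:{0..T}. ?y s) = (LBINT s:{0..T}. \<beta> * ?y s)" by simp
  also have "\<dots> \<le> (LBINT s:{0..T}. A * (\<beta> * exp (\<beta> * (T - s))))"
  proof (rule set_integral_mono)
    show "set_integrable lborel {0..T} (\<lambda>s. \<beta> * ?y s)" using yi by (simp add: integrable_TM)
    show "set_integrable lborel {0..T} (\<lambda>s. A * (\<beta> * exp (\<beta> * (T - s))))"
      using exp_integral(2)[OF T0(3), of \<beta>] by (rule set_integrable_mult_right)
    show "\<beta> * ?y s \<le> A * (\<beta> * exp (\<beta> * (T - s)))" if "s \<in> {0..T}" for s
      using mult_left_mono[OF y[OF that] \<beta>] by (simp add: mult_ac)
  qed
  also have "\<dots> = A * (exp (\<beta> * T) - 1)"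
    using exp_integral(1)[OF T0(3), of \<beta>] by (simp add: set_integral_mult_right del: mult_cancel_left)
  finally have "A + \<beta> * (LBINT s:{0..T}. ?y s) \<le> exp (\<beta> * T) * A" by (simp add: algebra_simps)
  then show "(LBINT s:{0..T}. ?h s) \<le> 2 * (exp (\<beta> * T) * A)"
    using main[OF T0(1)] msq_nonneg[of M "D 0"] by linarith
qed

text \<open>Cauchy-Schwarz in time, integrated over the paths.\<close>

lemma msq_drift_le:
  assumes \<phi>: "sq_int Q (case_prod \<phi>)" and t: "t \<in> {0..T}"
  shows "sq_int M (\<lambda>\<omega>. LBINT s:{0..t}. \<phi> s \<omega>)"
    and "msq M (\<lambda>\<omega>. LBINT s:{0..t}. \<phi> s \<omega>) \<le> T * (LBINT s:{0..t}. msq M (\<phi> s))"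
proof -
  define g where "g r \<omega> = indicator {0..t} r *\<^sub>R \<phi> r \<omega>" for r \<omega>
  have g: "sq_int Q (case_prod g)"
    unfolding g_def using sq_int_indicator_Q[OF \<phi>, of "{0..t}"] by simp
  have eq: "(LBINT s:{0..t}. \<phi> s \<omega>) = (\<integral>s. g s \<omega> \<partial>TM)" for \<omega>
    unfolding g_def using t by (intro integral_TM_indicator[symmetric]) auto
  have meas: "(\<lambda>\<omega>. \<integral>s. g s \<omega> \<partial>TM) \<in> borel_measurable M"
  proof (rule TM.borel_measurable_lebesgue_integral)
    have [measurable]: "case_prod g \<in> borel_measurable (TM \<Otimes>\<^sub>M M)"
      using sq_int_measurable[OF g] by (simp add: Q_def)
    show "(\<lambda>(\<omega>, s). g s \<omega>) \<in> borel_measurable (M \<Otimes>\<^sub>M TM)" by measurable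
  qed
  let ?b = "\<lambda>\<omega>. T * (\<integral>s. g s \<omega> \<bullet> g s \<omega> \<partial>TM)"
  have bi: "integrable M ?b" using inner_integral_Q(5)[OF g g] by simp
  have le: "AE \<omega> in M. (norm (\<integral>s. g s \<omega> \<partial>TM))\<^sup>2 \<le> ?b \<omega>"
    using AE_sq_int_section[OF g]
    by eventually_elim (use norm_integral_TM_sq_le in \<open>auto simp: msq_def power2_norm_eq_inner\<close>)
  show sq: "sq_int M (\<lambda>\<omega>. LBINT s:{0..t}. \<phi> s \<omega>)"
    unfolding eq sq_int_def using meas le
    by (intro conjI meas Bochner_Integration.integrable_bound[OF bi])
      (auto elim!: eventually_mono intro: order_trans[OF _ abs_ge_self])
  have "msq M (\<lambda>\<omega>. LBINT s:{0..t}. \<phi> s \<omega>) \<le> expectation ?b"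
    using sq_int_integrable[OF sq] le unfolding msq_def eq by (intro integral_mono_AE bi)
  also have "\<dots> = T * (\<integral>s. msq M (g s) \<partial>TM)"
    using inner_integral_Q(1,4)[OF g g] by (simp add: msq_def power2_norm_eq_inner)
  also have "(\<integral>s. msq M (g s) \<partial>TM) = (\<integral>s. indicator {0..t} s *\<^sub>R msq M (\<phi> s) \<partial>TM)"
    unfolding g_def[abs_def] by (intro Bochner_Integration.integral_cong) (auto simp: msq_scaleR indicator_def)
  also have "\<dots> = (LBINT s:{0..t}. msq M (\<phi> s))"
    using t by (intro integral_TM_indicator) auto
  finally show "msq M (\<lambda>\<omega>. LBINT s:{0..t}. \<phi> s \<omega>) \<le> T * (LBINT s:{0..t}. msq M (\<phi> s))" .
qed

lemma sum_sq_4: "(a + b + c + d)\<^sup>2 \<le> 4 * (a\<^sup>2 + b\<^sup>2 + c\<^sup>2 + (d::real)\<^sup>2)"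
  using zero_le_power2[of "a - b"] zero_le_power2[of "a - c"] zero_le_power2[of "a - d"]
    zero_le_power2[of "b - c"] zero_le_power2[of "b - d"] zero_le_power2[of "c - d"]
  by (simp add: power2_eq_square algebra_simps)

lemma msq_le_of_norm_le:
  assumes U: "sq_int M e" "sq_int M x" "sq_int M y" "sq_int M z"
    and le: "\<And>\<omega>. \<omega> \<in> space M \<Longrightarrow> norm (V \<omega>) \<le> e \<omega> + a * norm (x \<omega>) + b * norm (y \<omega>) + c * norm (z \<omega>)"
  shows "msq M V \<le> 4 * (msq M e + a\<^sup>2 * msq M x + b\<^sup>2 * msq M y + c\<^sup>2 * msq M z)"
proof -
  let ?g = "\<lambda>\<omega>. 4 * ((norm (e \<omega>))\<^sup>2 + a\<^sup>2 * (norm (x \<omega>))\<^sup>2 + b\<^sup>2 * (norm (y \<omega>))\<^sup>2 + c\<^sup>2 * (norm (z \<omega>))\<^sup>2)"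
  have "msq M V \<le> expectation ?g"
  proof (rule msq_le_integral)
    show "integrable M ?g"
      using U[THEN sq_int_integrable] by (intro Bochner_Integration.integrable_add integrable_mult_right)
    fix \<omega> assume "\<omega> \<in> space M"
    then have "(norm (V \<omega>))\<^sup>2 \<le> (e \<omega> + a * norm (x \<omega>) + b * norm (y \<omega>) + c * norm (z \<omega>))\<^sup>2"
      by (intro power_mono le) auto
    also have "\<dots> \<le> ?g \<omega>"
      using sum_sq_4[of "e \<omega>" "a * norm (x \<omega>)" "b * norm (y \<omega>)" "c * norm (z \<omega>)"] by (simp add: power_mult_distrib)
    finally show "(norm (V \<omega>))\<^sup>2 \<le> ?g \<omega>" .
  qed
  also have "\<dots> = 4 * (msq M e + a\<^sup>2 * msq M x + b\<^sup>2 * msq M y + c\<^sup>2 * msq M z)"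
    using U[THEN sq_int_integrable] by (simp add: msq_def)
  finally show ?thesis .
qed

text \<open>The drift is bounded by Cauchy-Schwarz in time and the noise by the isometry. Splitting drift plus
  noise costs a factor \<open>2\<close> and each sum of four terms a factor \<open>4\<close>, so that the constants \<open>8\<close> do not
  exceed those of \<^const>\<open>K_F\<close>.\<close>

lemma forward_stability:
  fixes D \<phi> :: "real \<Rightarrow> 'a \<Rightarrow> real^'k" and \<Psi> :: "real \<Rightarrow> 'a \<Rightarrow> real^'d^'k"
    and y :: "real \<Rightarrow> 'a \<Rightarrow> 'y::euclidean_space" and h :: "real \<Rightarrow> 'a \<Rightarrow> 'h::euclidean_space"
    and e e' :: "real \<Rightarrow> 'a \<Rightarrow> real"
  assumes D: "sq_int Q (case_prod D)" "\<And>s. s \<in> {0..T} \<Longrightarrow> sq_int M (D s)"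
    and \<phi>: "sq_int Q (case_prod \<phi>)" and N: "ito \<Psi> N"
    and eq: "\<And>s. s \<in> {0..T} \<Longrightarrow> AE \<omega> in M. D s \<omega> = (LBINT r:{0..s}. \<phi> r \<omega>) + N s \<omega>"
    and e: "\<And>s. s \<in> {0..T} \<Longrightarrow> sq_int M (e s)" "\<And>s. s \<in> {0..T} \<Longrightarrow> msq M (e s) \<le> \<epsilon>"
    and e': "\<And>s. s \<in> {0..T} \<Longrightarrow> sq_int M (e' s)" "\<And>s. s \<in> {0..T} \<Longrightarrow> msq M (e' s) \<le> \<epsilon>"
    and y: "\<And>s. s \<in> {0..T} \<Longrightarrow> sq_int M (y s)" "\<And>s. s \<in> {0..T} \<Longrightarrow> msq M (y s) \<le> Yb"
    and h: "sq_int Q (case_prod h)" "(LBINT s:{0..T}. msq M (h s)) \<le> Zb"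
    and bound: "\<And>s \<omega>. s \<in> {0..T} \<Longrightarrow> \<omega> \<in> space M \<Longrightarrow>
      norm (\<phi> s \<omega>) \<le> e s \<omega> + bx * norm (D s \<omega>) + by * norm (y s \<omega>) + bz * norm (h s \<omega>)"
    and bound': "\<And>s \<omega>. s \<in> {0..T} \<Longrightarrow> \<omega> \<in> space M \<Longrightarrow>
      norm (\<Psi> s \<omega>) \<le> e' s \<omega> + sx * norm (D s \<omega>) + sy * norm (y s \<omega>)"
    and t: "t \<in> {0..T}"
  shows "msq M (D t) \<le> exp ((8 * T * bx\<^sup>2 + 8 * sx\<^sup>2) * T)
    * ((8 * T * by\<^sup>2 + 8 * sy\<^sup>2) * T * Yb + 8 * T * bz\<^sup>2 * Zb + (8 * T\<^sup>2 + 8 * T) * \<epsilon>)"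
proof -
  have T0: "0 \<in> {0..T}" "T \<in> {0..T}" "0 \<le> T" using T_pos by auto
  have pos: "0 \<le> \<epsilon>" "0 \<le> Yb"
    using e(2)[OF T0(1)] y(2)[OF T0(1)] msq_nonneg[of M "e 0"] msq_nonneg[of M "y 0"] by linarith+
  have hpos: "0 \<le> (LBINT s:{0..t}. msq M (h s))" for t
    unfolding set_lebesgue_integral_def by (intro integral_nonneg_AE AE_I2) auto
  have Zb: "0 \<le> Zb" using hpos[of T] h(2) by linarith
  define \<kappa> where "\<kappa> = 8 * T * bx\<^sup>2 + 8 * sx\<^sup>2"
  define A where "A = (8 * T * by\<^sup>2 + 8 * sy\<^sup>2) * T * Yb + 8 * T * bz\<^sup>2 * Zb + (8 * T\<^sup>2 + 8 * T) * \<epsilon>"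
  have \<kappa>: "0 \<le> \<kappa>" using T0 by (simp add: \<kappa>_def)
  have A: "0 \<le> A" using T0 pos Zb by (simp add: A_def)
  have \<Psi>: "sq_int Q (case_prod \<Psi>)" by (rule ito_sq_int(1)[OF N])
  have Di: "integrable TM (\<lambda>s. msq M (D s))" and hi: "integrable TM (\<lambda>s. msq M (h s))"
    and \<phi>i: "integrable TM (\<lambda>s. msq M (\<phi> s))" and \<Psi>i: "integrable TM (\<lambda>s. msq M (\<Psi> s))"
    using msq_Q_eq(2) D(1) h(1) \<phi> \<Psi> by auto
  have si: "set_integrable lborel {0..t} f" if "integrable TM f" "t \<le> T" for t and f :: "real \<Rightarrow> real"
    using that by (auto simp: integrable_TM intro: set_integrable_subset)
  have le\<phi>: "AE s in TM. msq M (\<phi> s) \<le> 4 * (\<epsilon> + bx\<^sup>2 * msq M (D s) + by\<^sup>2 * Yb + bz\<^sup>2 * msq M (h s))"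
    using AE_TM_section[OF h(1)] AE_space
  proof eventually_elim
    case (elim s)
    then have s: "s \<in> {0..T}" by simp
    have "msq M (\<phi> s) \<le> 4 * (msq M (e s) + bx\<^sup>2 * msq M (D s) + by\<^sup>2 * msq M (y s) + bz\<^sup>2 * msq M (h s))"
      by (intro msq_le_of_norm_le e D y elim bound s)
    also have "\<dots> \<le> 4 * (\<epsilon> + bx\<^sup>2 * msq M (D s) + by\<^sup>2 * Yb + bz\<^sup>2 * msq M (h s))"
      using e(2)[OF s] y(2)[OF s] by (intro mult_left_mono add_mono) auto
    finally show ?case .
  qed
  have le\<Psi>: "AE s in TM. msq M (\<Psi> s) \<le> 4 * (\<epsilon> + sx\<^sup>2 * msq M (D s) + sy\<^sup>2 * Yb)"
    using AE_space
  proof eventually_elim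
    case (elim s)
    then have s: "s \<in> {0..T}" by simp
    have "msq M (\<Psi> s) \<le> 4 * (msq M (e' s) + sx\<^sup>2 * msq M (D s) + sy\<^sup>2 * msq M (y s) + 0\<^sup>2 * msq M (\<lambda>_. 0::real))"
      using bound'[OF s] by (intro msq_le_of_norm_le e' D y s) auto
    also have "\<dots> \<le> 4 * (\<epsilon> + sx\<^sup>2 * msq M (D s) + sy\<^sup>2 * Yb)"
      using mult_left_mono[OF y(2)[OF s], of "sy\<^sup>2"] e'(2)[OF s] by simp
    finally show ?case .
  qed
  have main: "msq M (D t) \<le> A + \<kappa> * (LBINT s:{0..t}. msq M (D s))" if t: "t \<in> {0..T}" for t
  proof -
    have tT: "0 \<le> t" "t \<le> T" using t by auto
    let ?J = "LBINT s:{0..t}. msq M (D s)"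
    have Nt: "msq M (N t) = (LBINT s:{0..t}. msq M (\<Psi> s))"
    proof -
      have "msq M (N t) = msq M (\<lambda>\<omega>. N t \<omega> - N 0 \<omega>)"
        using ito_sq_int(2)[OF N t] ito_sq_int(2)[OF N T0(1)] ito_start[OF N]
        by (intro msq_cong_AE) (auto elim!: eventually_mono)
      then show ?thesis using ito_isometry[OF N order_refl tT] by simp
    qed
    have "msq M (D t) = msq M (\<lambda>\<omega>. (LBINT r:{0..t}. \<phi> r \<omega>) + N t \<omega>)"
      using D(2)[OF t] sq_int_add[OF msq_drift_le(1)[OF \<phi> t] ito_sq_int(2)[OF N t]] eq[OF t]
      by (intro msq_cong_AE sq_int_measurable)
    also have "\<dots> \<le> 2 * msq M (\<lambda>\<omega>. LBINT r:{0..t}. \<phi> r \<omega>) + 2 * msq M (N t)"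
      by (intro msq_add_le msq_drift_le(1) \<phi> ito_sq_int(2)[OF N] t)
    also have "\<dots> \<le> 2 * (T * (LBINT s:{0..t}. msq M (\<phi> s))) + 2 * (LBINT s:{0..t}. msq M (\<Psi> s))"
      using msq_drift_le(2)[OF \<phi> t] Nt by simp
    also have "(LBINT s:{0..t}. msq M (\<phi> s)) \<le> 4 * (T * \<epsilon> + bx\<^sup>2 * ?J + T * (by\<^sup>2 * Yb) + bz\<^sup>2 * Zb)"
    proof -
      have "(LBINT s:{0..t}. msq M (\<phi> s)) \<le> (LBINT s:{0..t}. 4 * (\<epsilon> + bx\<^sup>2 * msq M (D s) + by\<^sup>2 * Yb + bz\<^sup>2 * msq M (h s)))"
        using \<phi>i Di hi by (intro LBINT_mono_TM le\<phi> tT) auto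
      also have "\<dots> = 4 * (t * \<epsilon> + bx\<^sup>2 * ?J + t * (by\<^sup>2 * Yb) + bz\<^sup>2 * (LBINT s:{0..t}. msq M (h s)))"
        by (rule set_integral_affine[OF tT(1) si[OF Di tT(2)] si[OF hi tT(2)]])
      also have "4 * (t * \<epsilon> + bx\<^sup>2 * ?J + t * (by\<^sup>2 * Yb) + bz\<^sup>2 * (LBINT s:{0..t}. msq M (h s)))
        \<le> 4 * (T * \<epsilon> + bx\<^sup>2 * ?J + T * (by\<^sup>2 * Yb) + bz\<^sup>2 * Zb)"
        using LBINT_mono_set_TM(2)[OF hi _ t] h(2) tT pos
        by (intro mult_left_mono add_mono mult_right_mono) auto
      finally show ?thesis .
    qed
    also have "(LBINT s:{0..t}. msq M (\<Psi> s)) \<le> 4 * (T * \<epsilon> + sx\<^sup>2 * ?J + T * (sy\<^sup>2 * Yb))"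
    proof -
      have "(LBINT s:{0..t}. msq M (\<Psi> s)) \<le> (LBINT s:{0..t}. 4 * (\<epsilon> + sx\<^sup>2 * msq M (D s) + sy\<^sup>2 * Yb))"
        using \<Psi>i Di by (intro LBINT_mono_TM le\<Psi> tT) auto
      also have "\<dots> = 4 * (t * \<epsilon> + sx\<^sup>2 * ?J + t * (sy\<^sup>2 * Yb))"
        using set_integral_affine[OF tT(1) si[OF Di tT(2)] si[OF Di tT(2)], of \<epsilon> "sx\<^sup>2" "sy\<^sup>2 * Yb" 0] by simp
      also have "4 * (t * \<epsilon> + sx\<^sup>2 * ?J + t * (sy\<^sup>2 * Yb)) \<le> 4 * (T * \<epsilon> + sx\<^sup>2 * ?J + T * (sy\<^sup>2 * Yb))"
        using tT pos by (intro mult_left_mono add_mono mult_right_mono) auto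
      finally show ?thesis .
    qed
    finally have "msq M (D t) \<le> 2 * (T * (4 * (T * \<epsilon> + bx\<^sup>2 * ?J + T * (by\<^sup>2 * Yb) + bz\<^sup>2 * Zb)))
      + 2 * (4 * (T * \<epsilon> + sx\<^sup>2 * ?J + T * (sy\<^sup>2 * Yb)))" using T0 by (simp add: mult_left_mono)
    also have "\<dots> = A + \<kappa> * ?J" by (simp add: A_def \<kappa>_def power2_eq_square algebra_simps)
    finally show ?thesis .
  qed
  have "msq M (D t) \<le> A * exp (\<kappa> * t)"
    using Di main t by (intro integral_gronwall[OF _ _ \<kappa> A]) (auto simp: integrable_TM)
  also have "\<dots> \<le> A * exp (\<kappa> * T)"
    using t \<kappa> A by (intro mult_left_mono) (auto simp: mult_left_mono)
  finally show ?thesis unfolding A_def \<kappa>_def by (simp add: mult.commute)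
qed

end

section \<open>Continuous processes and coefficients\<close>

context brownian
begin

text \<open>\<open>cont_L2\<close> is the common class of the components \<open>X\<close> and \<open>Y\<close> of exact solutions, the running averages, and
  the interpolating paths of the scheme. \<open>proc_L2\<close> adds the joint measurability that Fubini's theorem
  needs; a process in \<open>cont_L2\<close> has it after changing its values on a null set.\<close>

definition cont_L2 :: "(real \<Rightarrow> 'a \<Rightarrow> 'b::euclidean_space) \<Rightarrow> bool"
  where "cont_L2 X \<longleftrightarrow> adapted F T X \<and> (AE \<omega> in M. continuous_on {0..T} (\<lambda>t. X t \<omega>)) \<and>
    (\<exists>C. \<forall>t\<in>{0..T}. sq_int M (X t) \<and> msq M (X t) \<le> C)"

definition proc_L2 :: "(real \<Rightarrow> 'a \<Rightarrow> 'b::euclidean_space) \<Rightarrow> bool"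
  where "proc_L2 X \<longleftrightarrow> adapted F T X \<and> sq_int Q (case_prod X)"

lemma space_S2_cont_L2:
  assumes "X \<in> space_S2 M F T" shows "cont_L2 X"
proof -
  let ?S = "\<integral>\<^sup>+ \<omega>. (SUP t\<in>{0..T}. ennreal ((norm (X t \<omega>))\<^sup>2)) \<partial>M"
  have X: "adapted F T X" "AE \<omega> in M. continuous_on {0..T} (\<lambda>t. X t \<omega>)" and S: "?S < \<infinity>"
    using assms by (auto simp: space_S2_def)
  have "sq_int M (X t) \<and> msq M (X t) \<le> enn2real ?S" if t: "t \<in> {0..T}" for t
  proof
    have m: "X t \<in> borel_measurable M"
      using X(1) t measurable_F_M[of "X t" t] by (auto simp: adapted_def)
    have le: "mean_square M (X t) \<le> ?S"
      unfolding mean_square_def using t by (intro nn_integral_mono SUP_upper)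
    then show sq: "sq_int M (X t)"
      using S m by (intro sq_int_if_mean_square_finite) auto
    show "msq M (X t) \<le> enn2real ?S"
      using le S unfolding mean_square_eq_msq[OF sq]
      by (metis enn2real_ennreal enn2real_mono msq_nonneg infinity_ennreal_def)
  qed
  then show ?thesis using X unfolding cont_L2_def by blast
qed

lemma cont_L2_D:
  assumes "cont_L2 X"
  shows "adapted F T X" "AE \<omega> in M. continuous_on {0..T} (\<lambda>t. X t \<omega>)" "t \<in> {0..T} \<Longrightarrow> sq_int M (X t)"
  using assms by (auto simp: cont_L2_def)

lemma cont_L2_scaleR_add:
  assumes "cont_L2 X" "cont_L2 Y" shows "cont_L2 (\<lambda>t \<omega>. a *\<^sub>R X t \<omega> + b *\<^sub>R Y t \<omega>)"
proof -
  obtain C where C: "\<And>t. t \<in> {0..T} \<Longrightarrow> sq_int M (X t)" "\<And>t. t \<in> {0..T} \<Longrightarrow> msq M (X t) \<le> C"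
    using assms(1) unfolding cont_L2_def by blast
  obtain C' where C': "\<And>t. t \<in> {0..T} \<Longrightarrow> sq_int M (Y t)" "\<And>t. t \<in> {0..T} \<Longrightarrow> msq M (Y t) \<le> C'"
    using assms(2) unfolding cont_L2_def by blast
  have 1: "adapted F T (\<lambda>t \<omega>. a *\<^sub>R X t \<omega> + b *\<^sub>R Y t \<omega>)"
    using cont_L2_D(1)[OF assms(1)] cont_L2_D(1)[OF assms(2)] unfolding adapted_def
    by (intro ballI borel_measurable_add borel_measurable_scaleR measurable_const) auto
  have 2: "AE \<omega> in M. continuous_on {0..T} (\<lambda>t. a *\<^sub>R X t \<omega> + b *\<^sub>R Y t \<omega>)"
    using cont_L2_D(2)[OF assms(1)] cont_L2_D(2)[OF assms(2)] by eventually_elim (intro continuous_intros)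
  have 3: "sq_int M (\<lambda>\<omega>. a *\<^sub>R X t \<omega> + b *\<^sub>R Y t \<omega>) \<and>
    msq M (\<lambda>\<omega>. a *\<^sub>R X t \<omega> + b *\<^sub>R Y t \<omega>) \<le> 2 * (a\<^sup>2 * C) + 2 * (b\<^sup>2 * C')" if t: "t \<in> {0..T}" for t
  proof
    show "sq_int M (\<lambda>\<omega>. a *\<^sub>R X t \<omega> + b *\<^sub>R Y t \<omega>)" by (intro sq_int_add sq_int_scaleR C C' t)
    have "msq M (\<lambda>\<omega>. a *\<^sub>R X t \<omega> + b *\<^sub>R Y t \<omega>) \<le> 2 * (a\<^sup>2 * msq M (X t)) + 2 * (b\<^sup>2 * msq M (Y t))"
      unfolding msq_scaleR[symmetric] by (intro msq_add_le sq_int_scaleR C C' t)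
    also have "\<dots> \<le> 2 * (a\<^sup>2 * C) + 2 * (b\<^sup>2 * C')"
      using mult_left_mono[OF C(2)[OF t], of "a\<^sup>2"] mult_left_mono[OF C'(2)[OF t], of "b\<^sup>2"] by simp
    finally show "msq M (\<lambda>\<omega>. a *\<^sub>R X t \<omega> + b *\<^sub>R Y t \<omega>) \<le> 2 * (a\<^sup>2 * C) + 2 * (b\<^sup>2 * C')" .
  qed
  show ?thesis unfolding cont_L2_def using 1 2 3 by blast
qed

text \<open>A continuous adapted process is a pointwise limit of processes that are constant between the
  points of a grid, once its discontinuous paths, which form a null set known at time \<open>0\<close>, are
  replaced by zero.\<close>

lemma cont_L2_modification:
  fixes X :: "real \<Rightarrow> 'a \<Rightarrow> 'b::euclidean_space"
  assumes "cont_L2 X"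
  obtains X' where "proc_L2 X'" "\<And>t. t \<in> {0..T} \<Longrightarrow> sq_int M (X' t)"
    "AE \<omega> in M. \<forall>t\<in>{0..T}. X' t \<omega> = X t \<omega>"
proof -
  obtain C where C: "\<And>t. t \<in> {0..T} \<Longrightarrow> sq_int M (X t)" "\<And>t. t \<in> {0..T} \<Longrightarrow> msq M (X t) \<le> C"
    using assms(1) unfolding cont_L2_def by blast
  obtain N where N: "{\<omega>\<in>space M. \<not> continuous_on {0..T} (\<lambda>t. X t \<omega>)} \<subseteq> N" "N \<in> null_sets M"
    using AE_E[OF cont_L2_D(2)[OF assms]] by (metis null_setsI)
  define X' where "X' t \<omega> = (if \<omega> \<in> N then 0 else X t \<omega>)" for t \<omega>
  have AEN: "AE \<omega> in M. \<omega> \<notin> N" using AE_not_in[OF N(2)] .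
  have ad: "adapted F T X'"
    unfolding adapted_def
  proof
    fix t assume t: "t \<in> {0..T}"
    have [measurable]: "X t \<in> borel_measurable (F t)" "N \<in> sets (F t)"
      using cont_L2_D(1)[OF assms] t null_sets_F[OF N(2)] by (auto simp: adapted_def)
    show "X' t \<in> borel_measurable (F t)" unfolding X'_def[abs_def] by measurable
  qed
  have m: "X' t \<in> borel_measurable M" if "t \<in> {0..T}" for t
    using ad that measurable_F_M[of "X' t" t] by (auto simp: adapted_def)
  have sq: "sq_int M (X' t)" if t: "t \<in> {0..T}" for t
    by (rule sq_int_cong_AE[OF C(1)[OF t] m[OF t]]) (use AEN in \<open>auto elim!: eventually_mono simp: X'_def\<close>)
  have msq: "msq M (X' t) \<le> C" if t: "t \<in> {0..T}" for t
  proof -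
    have "msq M (X' t) = msq M (X t)"
      by (rule msq_cong_AE[OF m[OF t] sq_int_measurable[OF C(1)[OF t]]])
        (use AEN in \<open>auto elim!: eventually_mono simp: X'_def\<close>)
    then show ?thesis using C(2)[OF t] by simp
  qed
  have cont: "continuous_on {0..T} (\<lambda>t. X' t \<omega>)" if "\<omega> \<in> space M" for \<omega>
    using N(1) that by (cases "\<omega> \<in> N") (auto simp: X'_def)
  define d where "d n t = T * of_int \<lfloor>real n * t / T\<rfloor> / real n" for n :: nat and t
  have d_in: "d n t \<in> {0..T}" if t: "t \<in> {0..T}" and n: "0 < n" for n t
  proof -
    define k where "k = \<lfloor>real n * t / T\<rfloor>"
    have k0: "0 \<le> k" using t T_pos by (simp add: k_def)
    have "of_int k \<le> real n * t / T" by (simp add: k_def)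
    also have "\<dots> \<le> real n" using t n T_pos by (simp add: field_simps)
    finally have "T * of_int k \<le> T * real n" using T_pos by simp
    then show ?thesis using T_pos n k0 unfolding d_def k_def[symmetric] by (simp add: pos_divide_le_eq)
  qed
  have d_lim: "(\<lambda>n. d n t) \<longlonglongrightarrow> t" for t
  proof (rule Lim_transform2[OF tendsto_const[of t]], rule Lim_null_comparison)
    show "\<forall>\<^sub>F n in sequentially. norm (t - d n t) \<le> T * (1 / real n)"
    proof (rule eventually_mono[OF eventually_gt_at_top[of 0]])
      fix n :: nat assume n: "0 < n"
      have "\<bar>real n * t / T - of_int \<lfloor>real n * t / T\<rfloor>\<bar> \<le> 1" by linarith
      then have "\<bar>T / real n * (real n * t / T - of_int \<lfloor>real n * t / T\<rfloor>)\<bar> \<le> T / real n * 1"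
        using n T_pos unfolding abs_mult by (intro mult_mono) auto
      moreover have "T / real n * (real n * t / T - of_int \<lfloor>real n * t / T\<rfloor>) = t - d n t"
        using n T_pos by (simp add: d_def field_simps)
      ultimately have "\<bar>t - d n t\<bar> \<le> T / real n * 1" by (simp only:)
      then show "norm (t - d n t) \<le> T * (1 / real n)" by simp
    qed
    show "(\<lambda>n. T * (1 / real n)) \<longlonglongrightarrow> 0" using tendsto_mult_right_zero[OF lim_1_over_n] by simp
  qed
  have approx: "(\<lambda>x. X' (d n (fst x)) (snd x)) \<in> borel_measurable Q" if n: "0 < n" for n
  proof -
    let ?k = "\<lambda>x. nat \<lfloor>real n * fst x / T\<rfloor>"
    have eq: "X' (d n (fst x)) (snd x)
      = (\<Sum>k\<le>n. indicator {x \<in> space Q. ?k x = k} x *\<^sub>R X' (T * real k / real n) (snd x))" if x: "x \<in> space Q" for x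
    proof -
      have t: "fst x \<in> {0..T}" using x by (auto simp: space_Q)
      have f: "real n * fst x / T \<le> real n" "0 \<le> real n * fst x / T"
        using t n T_pos by (auto simp: field_simps)
      then have k: "?k x \<le> n" by linarith
      have "(\<Sum>k\<le>n. indicator {x \<in> space Q. ?k x = k} x *\<^sub>R X' (T * real k / real n) (snd x))
        = (\<Sum>k\<le>n. if ?k x = k then X' (T * real k / real n) (snd x) else 0)"
        using x by (intro sum.cong) (auto simp: indicator_def)
      also have "\<dots> = X' (T * real (?k x) / real n) (snd x)" using k by simp
      also have "T * real (?k x) / real n = d n (fst x)" using f by (simp add: d_def)
      finally show ?thesis by simp
    qed
    have meas: "(\<lambda>x. indicator {x \<in> space Q. ?k x = k} x *\<^sub>R X' (T * real k / real n) (snd x)) \<in> borel_measurable Q"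
      if k: "k \<le> n" for k
    proof -
      have "T * real k / real n \<in> {0..T}" using k n T_pos by (auto simp: field_simps)
      from m[OF this] have [measurable]: "X' (T * real k / real n) \<in> borel_measurable M" .
      have [measurable]: "{x \<in> space Q. ?k x = k} \<in> sets Q" by measurable
      show ?thesis by measurable
    qed
    have "(\<lambda>x. \<Sum>k\<le>n. indicator {x \<in> space Q. ?k x = k} x *\<^sub>R X' (T * real k / real n) (snd x)) \<in> borel_measurable Q"
      using meas by (intro borel_measurable_sum) simp
    then show ?thesis using eq by (simp cong: measurable_cong)
  qed
  have jm: "case_prod X' \<in> borel_measurable Q"
  proof (rule borel_measurable_LIMSEQ_metric)
    show "(\<lambda>x. X' (d (Suc n) (fst x)) (snd x)) \<in> borel_measurable Q" for n by (rule approx) simp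
    fix x assume x: "x \<in> space Q"
    then have t: "fst x \<in> {0..T}" "snd x \<in> space M" by (auto simp: space_Q)
    have "(\<lambda>n. X' (d (Suc n) (fst x)) (snd x)) \<longlonglongrightarrow> X' (fst x) (snd x)"
      by (rule continuous_on_tendsto_compose[OF cont[OF t(2)] LIMSEQ_Suc[OF d_lim] t(1)])
        (use d_in[OF t(1)] in auto)
    then show "(\<lambda>n. X' (d (Suc n) (fst x)) (snd x)) \<longlonglongrightarrow> case_prod X' x" by (simp add: split_def)
  qed
  have "sq_int Q (case_prod X')"
  proof -
    have jm': "case_prod X' \<in> borel_measurable (TM \<Otimes>\<^sub>M M)" using jm by (simp add: Q_def)
    have "integrable (TM \<Otimes>\<^sub>M M) (\<lambda>x. (norm (case_prod X' x))\<^sup>2)"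
    proof (rule TQ.Fubini_integrable)
      show m2: "(\<lambda>x. (norm (case_prod X' x))\<^sup>2) \<in> borel_measurable (TM \<Otimes>\<^sub>M M)" using jm' by measurable
      have i: "integrable TM (\<lambda>t. msq M (X' t))"
      proof (rule TM.integrable_const_bound[of _ C])
        show "AE t in TM. norm (msq M (X' t)) \<le> C" using msq by (intro AE_I2) simp
        have "(\<lambda>t. \<integral>\<omega>. (norm (case_prod X' (t, \<omega>)))\<^sup>2 \<partial>M) \<in> borel_measurable TM"
          using m2 by (intro borel_measurable_lebesgue_integral) (simp add: split_def)
        then show "(\<lambda>t. msq M (X' t)) \<in> borel_measurable TM" by (simp add: msq_def)
      qed
      then show "integrable TM (\<lambda>t. \<integral>\<omega>. norm ((norm (case_prod X' (t, \<omega>)))\<^sup>2) \<partial>M)" by (simp add: msq_def)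
      show "AE t in TM. integrable M (\<lambda>\<omega>. (norm (case_prod X' (t, \<omega>)))\<^sup>2)"
        using sq_int_integrable[OF sq] by (intro AE_I2) simp
    qed
    then show ?thesis using jm by (simp add: sq_int_def Q_def)
  qed
  then have "proc_L2 X'" using ad by (simp add: proc_L2_def)
  moreover have "AE \<omega> in M. \<forall>t\<in>{0..T}. X' t \<omega> = X t \<omega>"
    using AEN by eventually_elim (simp add: X'_def)
  ultimately show thesis using that sq by blast
qed

lemma proc_L2_D:
  assumes "proc_L2 X"
  shows "adapted F T X" "sq_int Q (case_prod X)" "t \<in> {0..T} \<Longrightarrow> X t \<in> borel_measurable (F t)" "t \<in> {0..T} \<Longrightarrow> X t \<in> borel_measurable M"
  using assms measurable_F_M[of "X t" t] by (auto simp: proc_L2_def adapted_def)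

lemma proc_L2_diff:
  assumes "proc_L2 X" "proc_L2 Y" shows "proc_L2 (\<lambda>t \<omega>. X t \<omega> - Y t \<omega>)"
  unfolding proc_L2_def
proof
  show "adapted F T (\<lambda>t \<omega>. X t \<omega> - Y t \<omega>)"
    using assms unfolding adapted_def proc_L2_def by (intro ballI borel_measurable_diff) auto
  show "sq_int Q (\<lambda>(t, \<omega>). X t \<omega> - Y t \<omega>)"
    using assms sq_int_diff[of Q "case_prod X" "case_prod Y"] by (simp add: proc_L2_def split_def)
qed

lemma space_L2_proc_L2:
  assumes "H \<in> space_L2 M F T" shows "proc_L2 H"
proof -
  have m: "case_prod H \<in> borel_measurable Q"
    using assms measurable_cong_sets[OF sets_Q refl] by (auto simp: space_L2_def)
  then show ?thesis
    using assms sq_int_Q_if_int_mean_square_finite[OF m] by (auto simp: space_L2_def proc_L2_def)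
qed

text \<open>One predicate covers the drift, the driver, and, with \<open>Lz = 0\<close>, the diffusion.\<close>

definition coeff_regular ::
    "(real \<Rightarrow> real^'n \<Rightarrow> real^'m \<Rightarrow> real^'d^'m \<Rightarrow> 'c::euclidean_space) \<Rightarrow> real \<Rightarrow> real \<Rightarrow> real \<Rightarrow> real \<Rightarrow> real \<Rightarrow> bool"
  where "coeff_regular c Lx Ly Lz Lt Lo \<longleftrightarrow>
    (\<lambda>(t, x, y, z). c t x y z) \<in> borel_measurable (restrict_space borel ({0..T} \<times> UNIV)) \<and>
    0 \<le> Lx \<and> 0 \<le> Ly \<and> 0 \<le> Lz \<and> 0 \<le> Lt \<and>
    (\<forall>t\<in>{0..T}. \<forall>x x' y y' z z'. norm (c t x y z - c t x' y' z') \<le> Lx * norm (x - x') + Ly * norm (y - y') + Lz * norm (z - z')) \<and>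
    (\<forall>t\<in>{0..T}. norm (c t 0 0 0) \<le> Lo) \<and>
    (\<forall>t\<in>{0..T}. \<forall>s\<in>{0..T}. \<forall>x y z. norm (c t x y z - c s x y z) \<le> Lt * (1 + norm x + norm y + norm z) * sqrt \<bar>t - s\<bar>)"

lemma coeff_regular_D:
  assumes "coeff_regular c Lx Ly Lz Lt Lo"
  shows "(\<lambda>(t, x, y, z). c t x y z) \<in> borel_measurable (restrict_space borel ({0..T} \<times> UNIV))"
    and "0 \<le> Lx" "0 \<le> Ly" "0 \<le> Lz" "0 \<le> Lt"
    and "t \<in> {0..T} \<Longrightarrow> norm (c t x y z - c t x' y' z') \<le> Lx * norm (x - x') + Ly * norm (y - y') + Lz * norm (z - z')"
    and "t \<in> {0..T} \<Longrightarrow> norm (c t 0 0 0) \<le> Lo"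
    and "t \<in> {0..T} \<Longrightarrow> s \<in> {0..T} \<Longrightarrow> norm (c t x y z - c s x y z) \<le> Lt * (1 + norm x + norm y + norm z) * sqrt \<bar>t - s\<bar>"
  using assms unfolding coeff_regular_def by blast+

lemma coeff_growth:
  assumes "coeff_regular c Lx Ly Lz Lt Lo" "t \<in> {0..T}"
  shows "norm (c t x y z) \<le> Lo + Lx * norm x + Ly * norm y + Lz * norm z"
proof -
  have "norm (c t x y z) \<le> norm (c t 0 0 0) + norm (c t x y z - c t 0 0 0)"
    by (metis add.commute diff_add_cancel norm_triangle_ineq)
  then show ?thesis using coeff_regular_D(6)[OF assms, of x y z 0 0 0] coeff_regular_D(7)[OF assms] by simp
qed

lemma coeff_measurable:
  assumes c: "coeff_regular c Lx Ly Lz Lt Lo"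
    and m: "\<tau> \<in> borel_measurable K" "x \<in> borel_measurable K" "y \<in> borel_measurable K" "z \<in> borel_measurable K"
    and \<tau>: "\<And>k. k \<in> space K \<Longrightarrow> \<tau> k \<in> {0..T}"
  shows "(\<lambda>k. c (\<tau> k) (x k) (y k) (z k)) \<in> borel_measurable K"
proof -
  have "(\<lambda>k. (\<tau> k, x k, y k, z k)) \<in> measurable K (restrict_space borel ({0..T} \<times> UNIV))"
    using m \<tau> by (intro measurable_restrict_space2 borel_measurable_Pair) auto
  from measurable_compose[OF this coeff_regular_D(1)[OF c]] show ?thesis by simp
qed

lemma coeff_sq_int:
  assumes c: "coeff_regular c Lx Ly Lz Lt Lo" and \<tau>: "\<tau> \<in> {0..T}"
    and sq: "sq_int M x" "sq_int M y" "sq_int M z"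
  shows "sq_int M (\<lambda>\<omega>. c \<tau> (x \<omega>) (y \<omega>) (z \<omega>))"
    and "msq M (\<lambda>\<omega>. c \<tau> (x \<omega>) (y \<omega>) (z \<omega>)) \<le> 4 * (Lo\<^sup>2 + Lx\<^sup>2 * msq M x + Ly\<^sup>2 * msq M y + Lz\<^sup>2 * msq M z)"
proof -
  let ?g = "\<lambda>\<omega>. 4 * (Lo\<^sup>2 + Lx\<^sup>2 * (norm (x \<omega>))\<^sup>2 + Ly\<^sup>2 * (norm (y \<omega>))\<^sup>2 + Lz\<^sup>2 * (norm (z \<omega>))\<^sup>2)"
  have b: "(norm (c \<tau> (x \<omega>) (y \<omega>) (z \<omega>)))\<^sup>2 \<le> ?g \<omega>" for \<omega>
  proof -
    have "(norm (c \<tau> (x \<omega>) (y \<omega>) (z \<omega>)))\<^sup>2 \<le> (Lo + Lx * norm (x \<omega>) + Ly * norm (y \<omega>) + Lz * norm (z \<omega>))\<^sup>2"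
      by (intro power_mono coeff_growth[OF c \<tau>]) auto
    also have "\<dots> \<le> ?g \<omega>"
      using sum_sq_4[of Lo "Lx * norm (x \<omega>)" "Ly * norm (y \<omega>)" "Lz * norm (z \<omega>)"] by (simp add: power_mult_distrib)
    finally show ?thesis .
  qed
  have i: "integrable M ?g"
    using sq[THEN sq_int_integrable] by (intro Bochner_Integration.integrable_add integrable_mult_right) auto
  show "sq_int M (\<lambda>\<omega>. c \<tau> (x \<omega>) (y \<omega>) (z \<omega>))"
    using sq \<tau> by (intro sq_int_dominated[OF _ i b] coeff_measurable[OF c]) (auto intro: sq_int_measurable)
  have "msq M (\<lambda>\<omega>. c \<tau> (x \<omega>) (y \<omega>) (z \<omega>)) \<le> expectation ?g"
    by (rule msq_le_integral[OF i b])
  also have "\<dots> = 4 * (Lo\<^sup>2 + Lx\<^sup>2 * msq M x + Ly\<^sup>2 * msq M y + Lz\<^sup>2 * msq M z)"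
    using sq[THEN sq_int_integrable] by (simp add: msq_def prob_space)
  finally show "msq M (\<lambda>\<omega>. c \<tau> (x \<omega>) (y \<omega>) (z \<omega>)) \<le> 4 * (Lo\<^sup>2 + Lx\<^sup>2 * msq M x + Ly\<^sup>2 * msq M y + Lz\<^sup>2 * msq M z)" .
qed

lemma coeff_proc_L2:
  assumes c: "coeff_regular c Lx Ly Lz Lt Lo" and X: "proc_L2 X" and Y: "proc_L2 Y" and Z: "proc_L2 Z"
  shows "proc_L2 (\<lambda>t \<omega>. c t (X t \<omega>) (Y t \<omega>) (Z t \<omega>))"
  unfolding proc_L2_def
proof
  show "adapted F T (\<lambda>t \<omega>. c t (X t \<omega>) (Y t \<omega>) (Z t \<omega>))"
    unfolding adapted_def
  proof
    fix t assume t: "t \<in> {0..T}"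
    then show "(\<lambda>\<omega>. c t (X t \<omega>) (Y t \<omega>) (Z t \<omega>)) \<in> borel_measurable (F t)"
      by (intro coeff_measurable[OF c measurable_const proc_L2_D(3)[OF X] proc_L2_D(3)[OF Y] proc_L2_D(3)[OF Z]]) auto
  qed
  note sq = proc_L2_D(2)[OF X] proc_L2_D(2)[OF Y] proc_L2_D(2)[OF Z]
  have m: "(\<lambda>x. c (fst x) (case_prod X x) (case_prod Y x) (case_prod Z x)) \<in> borel_measurable Q"
    by (intro coeff_measurable[OF c] sq_int_measurable sq measurable_fst_Q) (auto simp: space_Q)
  have i1: "integrable Q (\<lambda>x. Lo\<^sup>2 :: real)"
    using integral_Q_product(2)[of "\<lambda>_. 1" "\<lambda>_. Lo\<^sup>2"] by simp
  have "sq_int Q (\<lambda>x. c (fst x) (case_prod X x) (case_prod Y x) (case_prod Z x))"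
  proof (rule sq_int_dominated[OF m])
    show "integrable Q (\<lambda>x. 4 * (Lo\<^sup>2 + Lx\<^sup>2 * (norm (case_prod X x))\<^sup>2 + Ly\<^sup>2 * (norm (case_prod Y x))\<^sup>2 + Lz\<^sup>2 * (norm (case_prod Z x))\<^sup>2))"
      using sq[THEN sq_int_integrable] i1 by (intro Bochner_Integration.integrable_add integrable_mult_right)
    fix x assume "x \<in> space Q"
    then have t: "fst x \<in> {0..T}" by (auto simp: space_Q)
    have "(norm (c (fst x) (case_prod X x) (case_prod Y x) (case_prod Z x)))\<^sup>2
      \<le> (Lo + Lx * norm (case_prod X x) + Ly * norm (case_prod Y x) + Lz * norm (case_prod Z x))\<^sup>2"
      by (intro power_mono coeff_growth[OF c t]) auto
    also have "\<dots> \<le> 4 * (Lo\<^sup>2 + Lx\<^sup>2 * (norm (case_prod X x))\<^sup>2 + Ly\<^sup>2 * (norm (case_prod Y x))\<^sup>2 + Lz\<^sup>2 * (norm (case_prod Z x))\<^sup>2)"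
      using sum_sq_4[of Lo "Lx * norm (case_prod X x)" "Ly * norm (case_prod Y x)" "Lz * norm (case_prod Z x)"]
      by (simp add: power_mult_distrib del: split_beta)
    finally show "(norm (c (fst x) (case_prod X x) (case_prod Y x) (case_prod Z x)))\<^sup>2 \<le> \<dots>" .
  qed
  then show "sq_int Q (\<lambda>(t, \<omega>). c t (X t \<omega>) (Y t \<omega>) (Z t \<omega>))" by (simp add: split_def)
qed

end

section \<open>Partitions and interpolation\<close>

context
  fixes T :: real and \<pi> :: "real list"
  assumes part: "is_partition T \<pi>"
begin

lemma partition_length: "0 < cells \<pi>" "cells \<pi> < length \<pi>" "\<pi> \<noteq> []"
  using part by (auto simp: is_partition_def)

lemma partition_ends: "\<pi> ! 0 = 0" "\<pi> ! cells \<pi> = T"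
  using part partition_length by (auto simp: is_partition_def hd_conv_nth last_conv_nth)

lemma partition_less: "i < j \<Longrightarrow> j \<le> cells \<pi> \<Longrightarrow> \<pi> ! i < \<pi> ! j"
  using part partition_length(2)
  by (intro sorted_wrt_nth_less[where P="(<)"]) (auto simp: is_partition_def)

lemma partition_le: "i \<le> j \<Longrightarrow> j \<le> cells \<pi> \<Longrightarrow> \<pi> ! i \<le> \<pi> ! j"
  using partition_less[of i j] by (cases "i = j") auto

lemma partition_in: "n \<le> cells \<pi> \<Longrightarrow> \<pi> ! n \<in> {0..T}"
  using partition_le[of 0 n] partition_le[of n "cells \<pi>"] partition_ends by auto

lemma mesh_ge: "n < cells \<pi> \<Longrightarrow> \<pi> ! Suc n - \<pi> ! n \<le> mesh \<pi>"
  unfolding mesh_def by (intro Max_ge) auto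

lemma mesh_bounds: "0 \<le> mesh \<pi>" "mesh \<pi> \<le> T"
proof -
  show "0 \<le> mesh \<pi>"
    using mesh_ge[OF partition_length(1)] partition_less[of 0 1] partition_length(1) by (simp add: Suc_le_eq)
  have ne: "(\<lambda>n. \<pi> ! Suc n - \<pi> ! n) ` {..<cells \<pi>} \<noteq> {}"
    using partition_length(1) by blast
  show "mesh \<pi> \<le> T"
    unfolding mesh_def
  proof (rule Max.boundedI[OF _ ne])
    fix a assume "a \<in> (\<lambda>n. \<pi> ! Suc n - \<pi> ! n) ` {..<cells \<pi>}"
    then obtain n where "n < cells \<pi>" "a = \<pi> ! Suc n - \<pi> ! n" by auto
    then show "a \<le> T" using partition_in[of n] partition_in[of "Suc n"] by auto
  qed simp
qed

lemma partition_locate: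
  assumes "t \<in> {0..T}"
  obtains "t = T" | n where "n < cells \<pi>" "\<pi> ! n \<le> t" "t < \<pi> ! Suc n"
proof (cases "t = T")
  case False
  then have t: "0 \<le> t" "t < T" using assms by auto
  define m where "m = (LEAST m. t < \<pi> ! m)"
  have m: "t < \<pi> ! m" "m \<le> cells \<pi>"
    using LeastI[of "\<lambda>m. t < \<pi> ! m" "cells \<pi>"] Least_le[of "\<lambda>m. t < \<pi> ! m" "cells \<pi>"] t partition_ends
    by (auto simp: m_def)
  have "m \<noteq> 0" using m(1) t partition_ends by (metis not_less)
  then obtain n where n: "m = Suc n" by (cases m) auto
  have "\<not> t < \<pi> ! n" using not_less_Least[of n "\<lambda>m. t < \<pi> ! m"] n by (simp add: m_def)
  then show ?thesis using that(2)[of n] m n by auto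
qed

definition grid_index :: "real \<Rightarrow> nat"
  where "grid_index t = (GREATEST n. n < length \<pi> \<and> \<pi> ! n \<le> t)"

lemma interpolate_grid_index: "interpolate \<pi> U t = U (grid_index t)"
  by (simp add: interpolate_def grid_index_def)

lemma grid_index_eq: "n < cells \<pi> \<Longrightarrow> \<pi> ! n \<le> t \<Longrightarrow> t < \<pi> ! Suc n \<Longrightarrow> grid_index t = n"
  using interpolate_eq[OF part, of n t "\<lambda>n (_::unit). n"] by (simp add: interpolate_grid_index fun_eq_iff)

lemma grid_index_end: "grid_index T = cells \<pi>"
  using interpolate_end[OF part, of "\<lambda>n (_::unit). n"] by (simp add: interpolate_grid_index fun_eq_iff)

lemma grid_index_bounds:
  assumes "t \<in> {0..T}"
  shows "grid_index t \<le> cells \<pi>" "\<pi> ! grid_index t \<le> t" "t - \<pi> ! grid_index t \<le> mesh \<pi>"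
    "grid_index t = cells \<pi> \<longleftrightarrow> t = T" "grid_index t < cells \<pi> \<Longrightarrow> t < \<pi> ! Suc (grid_index t)"
proof -
  have "grid_index t \<le> cells \<pi> \<and> \<pi> ! grid_index t \<le> t \<and> t - \<pi> ! grid_index t \<le> mesh \<pi>
    \<and> (grid_index t = cells \<pi> \<longleftrightarrow> t = T) \<and> (grid_index t < cells \<pi> \<longrightarrow> t < \<pi> ! Suc (grid_index t))"
  proof (rule partition_locate[OF assms])
    assume "t = T"
    then show ?thesis using mesh_bounds partition_ends(2) by (simp add: grid_index_end)
  next
    fix n assume n: "n < cells \<pi>" "\<pi> ! n \<le> t" "t < \<pi> ! Suc n"
    have "\<pi> ! Suc n \<le> \<pi> ! cells \<pi>" using n by (intro partition_le) auto
    then have "t < T" using n partition_ends by linarith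
    then show ?thesis using n mesh_ge[OF n(1)] by (auto simp: grid_index_eq)
  qed
  then show "grid_index t \<le> cells \<pi>" "\<pi> ! grid_index t \<le> t" "t - \<pi> ! grid_index t \<le> mesh \<pi>"
    "grid_index t = cells \<pi> \<longleftrightarrow> t = T" "grid_index t < cells \<pi> \<Longrightarrow> t < \<pi> ! Suc (grid_index t)"
    by blast+
qed

end

section \<open>Interpolating paths of a recursion\<close>

context brownian
begin

lemma AE_Q_fst:
  assumes "AE t in TM. P t" shows "AE x in Q. P (fst x)"
proof -
  obtain N where N: "{t\<in>space TM. \<not> P t} \<subseteq> N" "N \<in> null_sets TM"
    using AE_E[OF assms] by (metis null_setsI)
  show ?thesis
  proof (rule AE_I[of _ _ "N \<times> space M"])
    show "{x \<in> space Q. \<not> P (fst x)} \<subseteq> N \<times> space M" using N by (auto simp: space_Q)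
    have "N \<in> sets TM" using N by auto
    then have "N \<times> space M \<in> sets (TM \<Otimes>\<^sub>M M)" by (intro pair_measureI sets.top)
    then show "N \<times> space M \<in> sets Q" by (simp add: Q_def)
    show "emeasure Q (N \<times> space M) = 0"
      unfolding Q_def using N \<open>N \<in> sets TM\<close> emeasure_pair_measure_Times[of N TM "space M"]
      by (simp add: null_sets_def)
  qed
qed

lemma ito_cong_AE:
  assumes I: "ito H I" and H': "sq_int Q (case_prod H')" "AE x in Q. case_prod H x = case_prod H' x"
  shows "ito H' I"
proof -
  obtain l where l: "\<And>n. valid_elem (l n)"
    "(\<lambda>n. msq Q (\<lambda>x. case_prod (elem_integrand (l n)) x - case_prod H x)) \<longlonglongrightarrow> 0"
    "\<And>t. t \<in> {0..T} \<Longrightarrow> (\<lambda>n. msq M (\<lambda>\<omega>. elem_integral (l n) t \<omega> - I t \<omega>)) \<longlonglongrightarrow> 0"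
    using ito_elim[OF I] by blast
  have "msq Q (\<lambda>x. case_prod (elem_integrand (l n)) x - case_prod H x)
    = msq Q (\<lambda>x. case_prod (elem_integrand (l n)) x - case_prod H' x)" for n
  proof (rule msq_cong_AE)
    show "AE x in Q. case_prod (elem_integrand (l n)) x - case_prod H x = case_prod (elem_integrand (l n)) x - case_prod H' x"
      using H'(2) by eventually_elim simp
    show "(\<lambda>x. case_prod (elem_integrand (l n)) x - case_prod H x) \<in> borel_measurable Q"
      by (intro sq_int_measurable sq_int_diff elem_integrand_sq_int l(1) ito_sq_int(1)[OF I])
    show "(\<lambda>x. case_prod (elem_integrand (l n)) x - case_prod H' x) \<in> borel_measurable Q"
      by (intro sq_int_measurable sq_int_diff elem_integrand_sq_int l(1) H'(1))
  qed
  then have "(\<lambda>n. msq Q (\<lambda>x. case_prod (elem_integrand (l n)) x - case_prod H' x)) \<longlonglongrightarrow> 0"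
    using l(2) by simp
  then show ?thesis
    unfolding ito_def by (intro conjI exI[of _ l] allI ballI l H'(1) ito_sq_int(2)[OF I])
qed

lemma interpolate_proc_L2:
  fixes U :: "nat \<Rightarrow> 'a \<Rightarrow> 'b::euclidean_space"
  assumes \<pi>: "is_partition T \<pi>"
    and U: "\<And>n. n \<le> cells \<pi> \<Longrightarrow> U n \<in> borel_measurable (F (\<pi> ! n))" "\<And>n. n \<le> cells \<pi> \<Longrightarrow> sq_int M (U n)"
  shows "proc_L2 (interpolate \<pi> U)"
  unfolding proc_L2_def
proof
  show "adapted F T (interpolate \<pi> U)"
    unfolding adapted_def
  proof
    fix t assume t: "t \<in> {0..T}"
    show "interpolate \<pi> U t \<in> borel_measurable (F t)"
      unfolding interpolate_grid_index[OF \<pi>]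
      using U(1) grid_index_bounds(1,2)[OF \<pi> t] by (blast intro: measurable_F_mono)
  qed
  define A where "A n = (if n < cells \<pi> then {\<pi> ! n..<\<pi> ! Suc n} else {T})" for n
  have A: "t \<in> A k \<longleftrightarrow> k = grid_index \<pi> t" if t: "t \<in> {0..T}" and k: "k \<le> cells \<pi>" for t k
  proof -
    note b = grid_index_bounds[OF \<pi> t]
    show ?thesis
    proof (cases "k < cells \<pi>")
      case True
      have "t \<in> A k \<Longrightarrow> k = grid_index \<pi> t" using True grid_index_eq[OF \<pi> True] by (auto simp: A_def)
      then show ?thesis using True b by (auto simp: A_def)
    next
      case False
      then show ?thesis using b k by (auto simp: A_def)
    qed
  qed
  have "sq_int Q (\<lambda>x. \<Sum>n\<le>cells \<pi>. indicator (A n) (fst x) *\<^sub>R U n (snd x))"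
  proof (rule sq_int_sum)
    fix n assume "n \<in> {..cells \<pi>}"
    then have "sq_int Q (\<lambda>(t, \<omega>). indicator (A n) t *\<^sub>R U n \<omega>)"
      by (intro sq_int_indicator_Q sq_int_Q_const U) (auto simp: A_def)
    then show "sq_int Q (\<lambda>x. indicator (A n) (fst x) *\<^sub>R U n (snd x))" by (simp add: split_def)
  qed
  moreover have "(\<Sum>n\<le>cells \<pi>. indicator (A n) (fst x) *\<^sub>R U n (snd x)) = case_prod (interpolate \<pi> U) x" if x: "x \<in> space Q" for x
  proof -
    have t: "fst x \<in> {0..T}" using x by (auto simp: space_Q)
    have "(\<Sum>n\<le>cells \<pi>. indicator (A n) (fst x) *\<^sub>R U n (snd x)) = (\<Sum>n\<le>cells \<pi>. if n = grid_index \<pi> (fst x) then U n (snd x) else 0)"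
      using A[OF t] by (intro sum.cong) (auto simp: indicator_def)
    then show ?thesis using grid_index_bounds(1)[OF \<pi> t] by (simp add: interpolate_grid_index[OF \<pi>] split_def)
  qed
  ultimately show "sq_int Q (case_prod (interpolate \<pi> U))"
    unfolding sq_int_def by (simp cong: measurable_cong Bochner_Integration.integrable_cong)
qed

definition grid_elem :: "real list \<Rightarrow> (nat \<Rightarrow> 'a \<Rightarrow> real^'d^'k) \<Rightarrow> (real \<times> real \<times> ('a \<Rightarrow> real^'d^'k)) list"
  where "grid_elem \<pi> s = map (\<lambda>j. (\<pi> ! j, \<pi> ! Suc j, s j)) [0..<cells \<pi>]"

lemma grid_elem_integral:
  "elem_integral (grid_elem \<pi> s) t \<omega> = (\<Sum>j<cells \<pi>. s j \<omega> *v (W (min t (\<pi> ! Suc j)) \<omega> - W (min t (\<pi> ! j)) \<omega>))"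
  by (simp add: elem_integral_def grid_elem_def o_def interv_sum_list_conv_sum_set_nat atLeast0LessThan)

lemma grid_elem_integrand:
  "elem_integrand (grid_elem \<pi> s) t \<omega> = (\<Sum>j<cells \<pi>. indicator {\<pi> ! j<..\<pi> ! Suc j} t *\<^sub>R s j \<omega>)"
  by (simp add: elem_integrand_def grid_elem_def o_def interv_sum_list_conv_sum_set_nat atLeast0LessThan)

lemma grid_elem_valid:
  assumes \<pi>: "is_partition T \<pi>"
    and s: "\<And>n. n < cells \<pi> \<Longrightarrow> s n \<in> borel_measurable (F (\<pi> ! n))" "\<And>n. n < cells \<pi> \<Longrightarrow> sq_int M (s n)"
  shows "valid_elem (grid_elem \<pi> s)"
  unfolding valid_elem_def
proof safe
  fix a b \<xi> assume "(a, b, \<xi>) \<in> set (grid_elem \<pi> s)"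
  then obtain j where j: "j < cells \<pi>" "a = \<pi> ! j" "b = \<pi> ! Suc j" "\<xi> = s j" by (auto simp: grid_elem_def)
  show "0 \<le> a" "b \<le> T" using partition_in[OF \<pi>, of j] partition_in[OF \<pi>, of "Suc j"] j by auto
  show "a \<le> b" using partition_le[OF \<pi>, of j "Suc j"] j by auto
  show "\<xi> \<in> borel_measurable (F a)" "sq_int M \<xi>" using s j by auto
qed

text \<open>The interpolation is constant on intervals closed on the left, the elementary integrand on
  intervals closed on the right; they differ at grid points only, which form a null set.\<close>

lemma grid_elem_ito:
  assumes \<pi>: "is_partition T \<pi>"
    and s: "\<And>n. n \<le> cells \<pi> \<Longrightarrow> s n \<in> borel_measurable (F (\<pi> ! n))" "\<And>n. n \<le> cells \<pi> \<Longrightarrow> sq_int M (s n)"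
  shows "ito (interpolate \<pi> s) (elem_integral (grid_elem \<pi> s))"
proof (rule ito_cong_AE)
  show "ito (elem_integrand (grid_elem \<pi> s)) (elem_integral (grid_elem \<pi> s))"
    by (intro ito_elem grid_elem_valid \<pi> s) auto
  show "sq_int Q (case_prod (interpolate \<pi> s))"
    using interpolate_proc_L2[OF \<pi> s] by (simp add: proc_L2_def)
  have "AE t in TM. \<forall>j\<in>{..cells \<pi>}. t \<noteq> \<pi> ! j"
    by (intro AE_finite_allI AE_TM_neq) simp
  from AE_Q_fst[OF this] AE_space show "AE x in Q. case_prod (elem_integrand (grid_elem \<pi> s)) x = case_prod (interpolate \<pi> s) x"
  proof eventually_elim
    case (elim x)
    then have t: "fst x \<in> {0..T}" by (auto simp: space_Q)
    note b = grid_index_bounds[OF \<pi> t]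
    let ?n = "grid_index \<pi> (fst x)"
    have n: "?n < cells \<pi>" using b elim(1) partition_ends(2)[OF \<pi>] by (metis atMost_iff le_refl le_neq_implies_less)
    have iff: "fst x \<in> {\<pi> ! j<..\<pi> ! Suc j} \<longleftrightarrow> j = ?n" if j: "j < cells \<pi>" for j
    proof
      assume "fst x \<in> {\<pi> ! j<..\<pi> ! Suc j}"
      moreover have "fst x \<noteq> \<pi> ! Suc j" using elim(1) j by auto
      ultimately show "j = ?n" using grid_index_eq[OF \<pi> j, of "fst x"] by auto
    next
      assume "j = ?n"
      moreover have "fst x \<noteq> \<pi> ! ?n" using elim(1) n by auto
      ultimately show "fst x \<in> {\<pi> ! j<..\<pi> ! Suc j}" using b(2) b(5)[OF n] by auto
    qed
    have "elem_integrand (grid_elem \<pi> s) (fst x) (snd x) = (\<Sum>j<cells \<pi>. if j = ?n then s j (snd x) else 0)"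
      unfolding grid_elem_integrand using iff by (intro sum.cong) (auto simp: indicator_def)
    then show ?case using n by (simp add: split_def interpolate_grid_index[OF \<pi>])
  qed
qed

text \<open>The continuous interpolation of a recursion \<open>u\<^sub>n\<^sub>+\<^sub>1 = u\<^sub>n + a\<^sub>n \<Delta>t\<^sub>n + s\<^sub>n \<Delta>W\<^sub>n\<close>.\<close>

definition euler_path :: "real list \<Rightarrow> real^'k \<Rightarrow> (nat \<Rightarrow> 'a \<Rightarrow> real^'k) \<Rightarrow> (nat \<Rightarrow> 'a \<Rightarrow> real^'d^'k) \<Rightarrow> real \<Rightarrow> 'a \<Rightarrow> real^'k"
  where "euler_path \<pi> v a s t \<omega> = v + (\<Sum>j<cells \<pi>. (min t (\<pi> ! Suc j) - min t (\<pi> ! j)) *\<^sub>R a j \<omega>)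
    + (\<Sum>j<cells \<pi>. s j \<omega> *v (W (min t (\<pi> ! Suc j)) \<omega> - W (min t (\<pi> ! j)) \<omega>))"

lemma euler_path_cell:
  assumes \<pi>: "is_partition T \<pi>" and n: "n < cells \<pi>" and t: "\<pi> ! n \<le> t" "t \<le> \<pi> ! Suc n"
  shows "euler_path \<pi> v a s t \<omega> = euler_path \<pi> v a s (\<pi> ! n) \<omega> + (t - \<pi> ! n) *\<^sub>R a n \<omega> + s n \<omega> *v (W t \<omega> - W (\<pi> ! n) \<omega>)"
proof -
  have cases: "(min t (\<pi> ! Suc j) = min (\<pi> ! n) (\<pi> ! Suc j) \<and> min t (\<pi> ! j) = min (\<pi> ! n) (\<pi> ! j)) \<or>
    (min t (\<pi> ! Suc j) = t \<and> min t (\<pi> ! j) = t \<and> min (\<pi> ! n) (\<pi> ! Suc j) = \<pi> ! n \<and> min (\<pi> ! n) (\<pi> ! j) = \<pi> ! n)"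
    if j: "j < cells \<pi>" "j \<noteq> n" for j
  proof (cases "j < n")
    case True
    then have "\<pi> ! Suc j \<le> \<pi> ! n" "\<pi> ! j \<le> \<pi> ! n" using n by (auto intro!: partition_le[OF \<pi>])
    then show ?thesis using t by (simp add: min_def)
  next
    case False
    then have "\<pi> ! Suc n \<le> \<pi> ! j" "\<pi> ! Suc n \<le> \<pi> ! Suc j" using j by (auto intro!: partition_le[OF \<pi>])
    then show ?thesis using t by (auto simp: min_def)
  qed
  have atn: "min t (\<pi> ! Suc n) = t" "min t (\<pi> ! n) = \<pi> ! n" "min (\<pi> ! n) (\<pi> ! Suc n) = \<pi> ! n"
    using t by auto
  have drift: "(\<Sum>j<cells \<pi>. (min t (\<pi> ! Suc j) - min t (\<pi> ! j)) *\<^sub>R a j \<omega>)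
      - (\<Sum>j<cells \<pi>. (min (\<pi> ! n) (\<pi> ! Suc j) - min (\<pi> ! n) (\<pi> ! j)) *\<^sub>R a j \<omega>)
    = (\<Sum>j<cells \<pi>. if j = n then (t - \<pi> ! n) *\<^sub>R a n \<omega> else 0)"
    unfolding sum_subtractf[symmetric]
  proof (rule sum.cong[OF refl])
    fix j assume j: "j \<in> {..<cells \<pi>}"
    show "(min t (\<pi> ! Suc j) - min t (\<pi> ! j)) *\<^sub>R a j \<omega> - (min (\<pi> ! n) (\<pi> ! Suc j) - min (\<pi> ! n) (\<pi> ! j)) *\<^sub>R a j \<omega>
      = (if j = n then (t - \<pi> ! n) *\<^sub>R a n \<omega> else 0)"
      using cases[of j] atn j by (cases "j = n") auto
  qed
  have "(\<Sum>j<cells \<pi>. s j \<omega> *v (W (min t (\<pi> ! Suc j)) \<omega> - W (min t (\<pi> ! j)) \<omega>))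
      - (\<Sum>j<cells \<pi>. s j \<omega> *v (W (min (\<pi> ! n) (\<pi> ! Suc j)) \<omega> - W (min (\<pi> ! n) (\<pi> ! j)) \<omega>))
    = (\<Sum>j<cells \<pi>. if j = n then s n \<omega> *v (W t \<omega> - W (\<pi> ! n) \<omega>) else 0)"
    unfolding sum_subtractf[symmetric]
  proof (rule sum.cong[OF refl])
    fix j assume j: "j \<in> {..<cells \<pi>}"
    show "s j \<omega> *v (W (min t (\<pi> ! Suc j)) \<omega> - W (min t (\<pi> ! j)) \<omega>) - s j \<omega> *v (W (min (\<pi> ! n) (\<pi> ! Suc j)) \<omega> - W (min (\<pi> ! n) (\<pi> ! j)) \<omega>)
      = (if j = n then s n \<omega> *v (W t \<omega> - W (\<pi> ! n) \<omega>) else 0)"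
      using cases[of j] atn j by (cases "j = n") auto
  qed
  note noise = this
  have aux: "v + A + B = (v + A' + B') + x + y" if "A - A' = x" "B - B' = y" for A A' B B' x y
    using that by (auto simp: algebra_simps)
  have "n \<in> {..<cells \<pi>}" using n by simp
  then show ?thesis
    unfolding euler_path_def using drift noise by (intro aux) (simp_all only: sum.delta[OF finite_lessThan] if_True)
qed

lemma euler_path_grid:
  assumes \<pi>: "is_partition T \<pi>" and u0: "u 0 \<omega> = v"
    and u: "\<And>n. n < cells \<pi> \<Longrightarrow> u (Suc n) \<omega> = u n \<omega> + (\<pi> ! Suc n - \<pi> ! n) *\<^sub>R a n \<omega> + s n \<omega> *v (W (\<pi> ! Suc n) \<omega> - W (\<pi> ! n) \<omega>)"
    and n: "n \<le> cells \<pi>"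
  shows "euler_path \<pi> v a s (\<pi> ! n) \<omega> = u n \<omega>"
  using n
proof (induction n)
  case 0
  have "\<And>j. j < cells \<pi> \<Longrightarrow> 0 \<le> \<pi> ! j \<and> 0 \<le> \<pi> ! Suc j"
    using partition_in[OF \<pi>] by (metis Suc_leI atLeastAtMost_iff less_imp_le)
  then have "min 0 (\<pi> ! Suc j) = 0 \<and> min 0 (\<pi> ! j) = 0" if "j < cells \<pi>" for j using that by (simp add: min_def)
  then show ?case using u0 by (simp add: euler_path_def partition_ends[OF \<pi>])
next
  case (Suc n)
  then have n: "n < cells \<pi>" by simp
  show ?case
    using euler_path_cell[OF \<pi> n partition_le[OF \<pi>] order_refl, of v a s \<omega>] n Suc u[OF n] by simp
qed

lemma euler_path_integral:
  assumes \<pi>: "is_partition T \<pi>" and t: "t \<in> {0..T}"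
  shows "euler_path \<pi> v a s t \<omega> = v + (LBINT r:{0..t}. interpolate \<pi> a r \<omega>) + elem_integral (grid_elem \<pi> s) t \<omega>"
proof -
  have len: "(LBINT r:{0..t}. indicator {\<pi> ! j..<\<pi> ! Suc j} r *\<^sub>R a j \<omega>) = (min t (\<pi> ! Suc j) - min t (\<pi> ! j)) *\<^sub>R a j \<omega>
    \<and> set_integrable lborel {0..t} (\<lambda>r. indicator {\<pi> ! j..<\<pi> ! Suc j} r *\<^sub>R a j \<omega>)" if j: "j < cells \<pi>" for j
  proof -
    have p: "0 \<le> \<pi> ! j" "\<pi> ! j \<le> \<pi> ! Suc j"
      using partition_in[OF \<pi>, of j] partition_le[OF \<pi>, of j "Suc j"] j by auto
    let ?A = "{0..t} \<inter> {\<pi> ! j..<\<pi> ! Suc j}"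
    have ind: "indicator {0..t} r *\<^sub>R indicator {\<pi> ! j..<\<pi> ! Suc j} r *\<^sub>R a j \<omega> = indicator ?A r *\<^sub>R a j \<omega>" for r
      by (simp add: indicator_def)
    have "emeasure lborel ?A \<le> emeasure lborel {0..t}" by (intro emeasure_mono) auto
    then have fin: "emeasure lborel ?A < \<infinity>" by (simp add: emeasure_lborel_Icc_eq order.strict_trans1)
    have m: "measure lborel ?A = min t (\<pi> ! Suc j) - min t (\<pi> ! j)"
    proof (cases "\<pi> ! Suc j \<le> t")
      case True
      then have "?A = {\<pi> ! j..<\<pi> ! Suc j}" using p by auto
      then show ?thesis using True p by (simp add: min_def)
    next
      case False
      then have "?A = {\<pi> ! j..t}" using p by auto
      then show ?thesis using False by (cases "\<pi> ! j \<le> t") (simp_all add: min_def)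
    qed
    show ?thesis
      unfolding set_lebesgue_integral_def set_integrable_def ind using fin m by (simp add: integrable_scaleR_left)
  qed
  have "(LBINT r:{0..t}. interpolate \<pi> a r \<omega>) = (LBINT r:{0..t}. \<Sum>j<cells \<pi>. indicator {\<pi> ! j..<\<pi> ! Suc j} r *\<^sub>R a j \<omega>)"
    unfolding set_lebesgue_integral_def
  proof (rule integral_cong_AE)
    have eq: "AE r in lborel. indicator {0..t} r *\<^sub>R interpolate \<pi> a r \<omega> = indicator {0..t} r *\<^sub>R (\<Sum>j<cells \<pi>. indicator {\<pi> ! j..<\<pi> ! Suc j} r *\<^sub>R a j \<omega>)"
      using AE_lborel_singleton[of T]
    proof eventually_elim
      case (elim r)
      show ?case
      proof (cases "r \<in> {0..t}")
        case True
        then have r: "r \<in> {0..T}" using t by auto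
        note b = grid_index_bounds[OF \<pi> r]
        have n: "grid_index \<pi> r < cells \<pi>" using b(1,4) elim by auto
        have iff: "r \<in> {\<pi> ! j..<\<pi> ! Suc j} \<longleftrightarrow> j = grid_index \<pi> r" if "j < cells \<pi>" for j
          using grid_index_eq[OF \<pi> that, of r] b(2) b(5)[OF n] by auto
        have "(\<Sum>j<cells \<pi>. indicator {\<pi> ! j..<\<pi> ! Suc j} r *\<^sub>R a j \<omega>) = (\<Sum>j<cells \<pi>. if j = grid_index \<pi> r then a j \<omega> else 0)"
          using iff by (intro sum.cong) (auto simp: indicator_def)
        then show ?thesis using n by (simp add: interpolate_grid_index[OF \<pi>])
      qed simp
    qed
    show "AE r in lborel. indicator {0..t} r *\<^sub>R interpolate \<pi> a r \<omega> = indicator {0..t} r *\<^sub>R (\<Sum>j<cells \<pi>. indicator {\<pi> ! j..<\<pi> ! Suc j} r *\<^sub>R a j \<omega>)"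
      by (rule eq)
    show m2: "(\<lambda>r. indicator {0..t} r *\<^sub>R (\<Sum>j<cells \<pi>. indicator {\<pi> ! j..<\<pi> ! Suc j} r *\<^sub>R a j \<omega>)) \<in> borel_measurable lborel"
      by measurable
    have "(\<lambda>r. indicator {0..t} r *\<^sub>R interpolate \<pi> a r \<omega>) \<in> borel_measurable lborel"
    proof -
      have e: "indicator {0..t} r *\<^sub>R interpolate \<pi> a r \<omega>
        = (\<Sum>j\<le>cells \<pi>. indicator ({0..t} \<inter> (if j < cells \<pi> then {\<pi> ! j..<\<pi> ! Suc j} else {T})) r *\<^sub>R a j \<omega>)" for r
      proof (cases "r \<in> {0..t}")
        case True
        then have r: "r \<in> {0..T}" using t by auto
        note b = grid_index_bounds[OF \<pi> r]
        have iff: "r \<in> {0..t} \<inter> (if j < cells \<pi> then {\<pi> ! j..<\<pi> ! Suc j} else {T}) \<longleftrightarrow> j = grid_index \<pi> r" if j: "j \<le> cells \<pi>" for j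
        proof (cases "j < cells \<pi>")
          case j': True
          have "r \<in> {\<pi> ! j..<\<pi> ! Suc j} \<Longrightarrow> j = grid_index \<pi> r" using grid_index_eq[OF \<pi> j', of r] by auto
          then show ?thesis using j' b True by auto
        next
          case False
          then show ?thesis using b j True by auto
        qed
        have "(\<Sum>j\<le>cells \<pi>. indicator ({0..t} \<inter> (if j < cells \<pi> then {\<pi> ! j..<\<pi> ! Suc j} else {T})) r *\<^sub>R a j \<omega>)
          = (\<Sum>j\<le>cells \<pi>. if j = grid_index \<pi> r then a j \<omega> else 0)"
          using iff by (intro sum.cong) (auto simp: indicator_def)
        then show ?thesis using b(1) True by (simp add: interpolate_grid_index[OF \<pi>])
      next
        case False
        then show ?thesis
          by (simp only: indicator_inter_arith indicator_simps(2)[OF False] mult_zero_left scaleR_zero_left sum.neutral_const)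
      qed
      show ?thesis unfolding e by measurable
    qed
    then show "(\<lambda>r. indicator {0..t} r *\<^sub>R interpolate \<pi> a r \<omega>) \<in> borel_measurable lborel" .
  qed
  also have "\<dots> = (\<Sum>j<cells \<pi>. LBINT r:{0..t}. indicator {\<pi> ! j..<\<pi> ! Suc j} r *\<^sub>R a j \<omega>)"
    unfolding set_lebesgue_integral_def scaleR_sum_right using len
    by (intro Bochner_Integration.integral_sum) (simp add: set_integrable_def)
  also have "\<dots> = (\<Sum>j<cells \<pi>. (min t (\<pi> ! Suc j) - min t (\<pi> ! j)) *\<^sub>R a j \<omega>)"
    using len by simp
  finally show ?thesis by (simp add: euler_path_def grid_elem_integral)
qed

text \<open>Within a cell the drift moves the path by \<open>h\<close> times a bounded coefficient, so its square is at most
  \<open>T h\<close> times a bound, and the squared noise is of order \<open>h\<close> by the isometry.\<close>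

lemma euler_path_one_step:
  fixes u a :: "nat \<Rightarrow> 'a \<Rightarrow> real^'k" and s :: "nat \<Rightarrow> 'a \<Rightarrow> real^'d^'k"
  assumes \<pi>: "is_partition T \<pi>" and u0: "\<And>\<omega>. u 0 \<omega> = v"
    and u: "\<And>n \<omega>. n < cells \<pi> \<Longrightarrow> u (Suc n) \<omega> = u n \<omega> + (\<pi> ! Suc n - \<pi> ! n) *\<^sub>R a n \<omega> + s n \<omega> *v (W (\<pi> ! Suc n) \<omega> - W (\<pi> ! n) \<omega>)"
    and um: "\<And>n. n \<le> cells \<pi> \<Longrightarrow> u n \<in> borel_measurable (F (\<pi> ! n))"
    and usq: "\<And>n. n \<le> cells \<pi> \<Longrightarrow> sq_int M (u n)" and ub: "\<And>n. n \<le> cells \<pi> \<Longrightarrow> msq M (u n) \<le> C"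
    and am: "\<And>n. n < cells \<pi> \<Longrightarrow> a n \<in> borel_measurable (F (\<pi> ! n))"
    and asq: "\<And>n. n < cells \<pi> \<Longrightarrow> sq_int M (a n)" "\<And>n. n < cells \<pi> \<Longrightarrow> msq M (a n) \<le> B"
    and sm: "\<And>n. n < cells \<pi> \<Longrightarrow> s n \<in> borel_measurable (F (\<pi> ! n))"
    and ssq: "\<And>n. n < cells \<pi> \<Longrightarrow> sq_int M (s n)" "\<And>n. n < cells \<pi> \<Longrightarrow> msq M (s n) \<le> B"
    and B: "0 \<le> B"
  shows "t \<in> {0..T} \<Longrightarrow> sq_int M (\<lambda>\<omega>. euler_path \<pi> v a s t \<omega> - interpolate \<pi> u t \<omega>)"
    and "t \<in> {0..T} \<Longrightarrow> msq M (\<lambda>\<omega>. euler_path \<pi> v a s t \<omega> - interpolate \<pi> u t \<omega>) \<le> (2 * T + 2) * B * mesh \<pi>"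
    and "cont_L2 (euler_path \<pi> v a s)"
proof -
  have grid: "euler_path \<pi> v a s (\<pi> ! n) \<omega> = u n \<omega>" if "n \<le> cells \<pi>" for n \<omega>
    using euler_path_grid[where u=u, OF \<pi> u0 u that] .
  have end_eq: "euler_path \<pi> v a s T \<omega> = u (cells \<pi>) \<omega>" for \<omega>
    using grid[of "cells \<pi>" \<omega>] unfolding partition_ends(2)[OF \<pi>] by simp
  have cell_eq: "euler_path \<pi> v a s t \<omega> = u n \<omega> + (t - \<pi> ! n) *\<^sub>R a n \<omega> + s n \<omega> *v (W t \<omega> - W (\<pi> ! n) \<omega>)"
    if "n < cells \<pi>" "\<pi> ! n \<le> t" "t \<le> \<pi> ! Suc n" for n t \<omega>
    using euler_path_cell[OF \<pi> that, of v a s \<omega>] grid[of n \<omega>] that by simp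
  have step: "sq_int M (\<lambda>\<omega>. euler_path \<pi> v a s t \<omega> - interpolate \<pi> u t \<omega>) \<and>
    msq M (\<lambda>\<omega>. euler_path \<pi> v a s t \<omega> - interpolate \<pi> u t \<omega>) \<le> (2 * T + 2) * B * mesh \<pi> \<and>
    euler_path \<pi> v a s t \<in> borel_measurable (F t)" if t: "t \<in> {0..T}" for t
  proof (rule partition_locate[OF \<pi> t])
    assume T: "t = T"
    have "euler_path \<pi> v a s T = u (cells \<pi>)" "interpolate \<pi> u T = u (cells \<pi>)"
      using end_eq interpolate_end[OF \<pi>] by auto
    then show ?thesis using B T_pos mesh_bounds[OF \<pi>] um[of "cells \<pi>"] partition_ends[OF \<pi>]
      by (simp add: T msq_def)
  next
    fix n assume n: "n < cells \<pi>" "\<pi> ! n \<le> t" "t < \<pi> ! Suc n"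
    let ?h = "t - \<pi> ! n"
    have h: "0 \<le> ?h" "?h \<le> mesh \<pi>" "?h \<le> T" using n mesh_ge[OF \<pi> n(1)] mesh_bounds[OF \<pi>] by auto
    have p: "0 \<le> \<pi> ! n" "t \<le> T" using partition_in[OF \<pi>, of n] n t by auto
    have eq: "euler_path \<pi> v a s t \<omega> = u n \<omega> + ?h *\<^sub>R a n \<omega> + s n \<omega> *v (W t \<omega> - W (\<pi> ! n) \<omega>)" for \<omega>
      using cell_eq n by auto
    have diff: "(\<lambda>\<omega>. euler_path \<pi> v a s t \<omega> - interpolate \<pi> u t \<omega>) = (\<lambda>\<omega>. ?h *\<^sub>R a n \<omega> + s n \<omega> *v (W t \<omega> - W (\<pi> ! n) \<omega>))"
      using interpolate_eq[OF \<pi> n(1), of t u] n by (intro ext) (simp add: eq)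
    have sn: "sq_int M (\<lambda>\<omega>. s n \<omega> *v (W t \<omega> - W (\<pi> ! n) \<omega>))"
      by (intro matrix_increment_sq_int p n sm ssq)
    have an: "sq_int M (\<lambda>\<omega>. ?h *\<^sub>R a n \<omega>)" by (intro sq_int_scaleR asq n)
    have "msq M (\<lambda>\<omega>. ?h *\<^sub>R a n \<omega> + s n \<omega> *v (W t \<omega> - W (\<pi> ! n) \<omega>))
      \<le> 2 * (?h\<^sup>2 * msq M (a n)) + 2 * msq M (\<lambda>\<omega>. s n \<omega> *v (W t \<omega> - W (\<pi> ! n) \<omega>))"
      using msq_add_le[OF an sn] by (simp add: msq_scaleR)
    also have "msq M (\<lambda>\<omega>. s n \<omega> *v (W t \<omega> - W (\<pi> ! n) \<omega>)) = ?h * msq M (s n)"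
      using matrix_increment_isometry[OF p(1) n(2) p(2) sm[OF n(1)] ssq(1)[OF n(1)] sm[OF n(1)] ssq(1)[OF n(1)]]
      by (simp add: msq_def power2_norm_eq_inner)
    also have "2 * (?h\<^sup>2 * msq M (a n)) + 2 * (?h * msq M (s n)) \<le> 2 * (T * ?h * B) + 2 * (?h * B)"
    proof -
      have "?h\<^sup>2 \<le> T * ?h" unfolding power2_eq_square using h by (intro mult_right_mono) auto
      then have "?h\<^sup>2 * msq M (a n) \<le> T * ?h * B" using asq(2)[OF n(1)] h T_pos by (intro mult_mono) auto
      moreover have "?h * msq M (s n) \<le> ?h * B" using ssq(2)[OF n(1)] h by (intro mult_left_mono) auto
      ultimately show ?thesis by linarith
    qed
    also have "\<dots> = (2 * T + 2) * B * ?h" by (simp add: algebra_simps)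
    also have "\<dots> \<le> (2 * T + 2) * B * mesh \<pi>" using h B T_pos by (intro mult_left_mono) auto
    finally have b: "msq M (\<lambda>\<omega>. ?h *\<^sub>R a n \<omega> + s n \<omega> *v (W t \<omega> - W (\<pi> ! n) \<omega>)) \<le> (2 * T + 2) * B * mesh \<pi>" .
    have "(\<lambda>\<omega>. s n \<omega> *v (W t \<omega> - W (\<pi> ! n) \<omega>)) \<in> borel_measurable (F t)"
      by (intro matrix_increment_measurable p n sm order_refl)
    moreover have "u n \<in> borel_measurable (F t)" "a n \<in> borel_measurable (F t)"
      using um[of n] am[OF n(1)] n by (auto intro: measurable_F_mono)
    ultimately have "euler_path \<pi> v a s t \<in> borel_measurable (F t)"
      unfolding eq[abs_def] by (intro borel_measurable_add borel_measurable_scaleR measurable_const) auto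
    then show ?thesis using b an sn unfolding diff by (auto intro: sq_int_add)
  qed
  show "t \<in> {0..T} \<Longrightarrow> sq_int M (\<lambda>\<omega>. euler_path \<pi> v a s t \<omega> - interpolate \<pi> u t \<omega>)"
    and "t \<in> {0..T} \<Longrightarrow> msq M (\<lambda>\<omega>. euler_path \<pi> v a s t \<omega> - interpolate \<pi> u t \<omega>) \<le> (2 * T + 2) * B * mesh \<pi>"
    using step by blast+
  have "sq_int M (euler_path \<pi> v a s t) \<and> msq M (euler_path \<pi> v a s t) \<le> 2 * ((2 * T + 2) * B * mesh \<pi>) + 2 * C" if t: "t \<in> {0..T}" for t
  proof -
    have ut: "sq_int M (interpolate \<pi> u t)" "msq M (interpolate \<pi> u t) \<le> C"
      using usq ub grid_index_bounds(1)[OF \<pi> t] by (auto simp: interpolate_grid_index[OF \<pi>])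
    have d: "sq_int M (\<lambda>\<omega>. euler_path \<pi> v a s t \<omega> - interpolate \<pi> u t \<omega>)"
      "msq M (\<lambda>\<omega>. euler_path \<pi> v a s t \<omega> - interpolate \<pi> u t \<omega>) \<le> (2 * T + 2) * B * mesh \<pi>"
      using step[OF t] by auto
    show ?thesis
      using sq_int_add[OF d(1) ut(1)] msq_add_le[OF d(1) ut(1)] d(2) ut(2) by simp
  qed
  moreover have "adapted F T (euler_path \<pi> v a s)" using step by (simp add: adapted_def)
  moreover have "AE \<omega> in M. continuous_on {0..T} (\<lambda>t. euler_path \<pi> v a s t \<omega>)"
  proof -
    have "AE \<omega> in M. continuous_on {0..T} (\<lambda>t. W t \<omega>)" using bm by (simp add: brownian_motion_def)
    then show ?thesis
    proof eventually_elim
      case (elim \<omega>)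
      have c: "continuous_on {0..T} (\<lambda>t. W (min t (\<pi> ! j)) \<omega>)" if "j \<le> cells \<pi>" for j
        using partition_in[OF \<pi> that] by (intro continuous_on_compose2[OF elim]) (auto intro!: continuous_intros)
      have "continuous_on {0..T} (\<lambda>t. s j \<omega> *v (W (min t (\<pi> ! Suc j)) \<omega> - W (min t (\<pi> ! j)) \<omega>))" if j: "j < cells \<pi>" for j
        using j by (intro bounded_linear.continuous_on[OF matrix_vector_mul_bounded_linear] continuous_on_diff c) auto
      then show ?case unfolding euler_path_def by (auto intro!: continuous_intros)
    qed
  qed
  ultimately show "cont_L2 (euler_path \<pi> v a s)" unfolding cont_L2_def by blast
qed

end

section \<open>Second moments of the scheme\<close>

lemma borel_measurable_matrixI:
  fixes A :: "'a \<Rightarrow> real^'n^'m"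
  assumes "\<And>i j. (\<lambda>x. A x $ i $ j) \<in> borel_measurable N"
  shows "A \<in> borel_measurable N"
proof (subst borel_measurable_euclidean_space, rule ballI)
  fix b :: "real^'n^'m" assume "b \<in> Basis"
  then obtain i j where "b = axis i (axis j 1)" by (auto simp: Basis_vec_def)
  then have "(\<lambda>x. A x \<bullet> b) = (\<lambda>x. A x $ i $ j)" by (simp add: inner_axis)
  then show "(\<lambda>x. A x \<bullet> b) \<in> borel_measurable N" using assms by simp
qed

lemma borel_measurable_matrix_matrix_mult:
  fixes A :: "'a \<Rightarrow> real^'n^'m" and B :: "'a \<Rightarrow> real^'k^'n"
  assumes [measurable]: "A \<in> borel_measurable N" "B \<in> borel_measurable N"
  shows "(\<lambda>x. A x ** B x) \<in> borel_measurable N"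
  by (rule borel_measurable_matrixI) (simp add: matrix_matrix_mult_def)

text \<open>The entries of the Jacobian are limits of difference quotients along the axes.\<close>

lemma jacobian_measurable:
  fixes f :: "real^'n \<Rightarrow> real^'m"
  assumes f: "\<And>x. f differentiable (at x)"
  shows "(\<lambda>x. jacobian f (at x)) \<in> borel_measurable borel"
proof (rule borel_measurable_matrixI)
  fix i :: 'm and j :: 'n
  have [measurable]: "f \<in> borel_measurable borel"
    using f by (intro borel_measurable_continuous_onI continuous_at_imp_continuous_on ballI differentiable_imp_continuous_within)
  let ?q = "\<lambda>k x. (f (x + (1 / real (Suc k)) *\<^sub>R axis j 1) $ i - f x $ i) / (1 / real (Suc k))"
  show "(\<lambda>x. jacobian f (at x) $ i $ j) \<in> borel_measurable borel"
  proof (rule borel_measurable_LIMSEQ_real)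
    show "?q k \<in> borel_measurable borel" for k by measurable
    fix x :: "real^'n"
    have D: "(f has_derivative (\<lambda>h. jacobian f (at x) *v h)) (at x)"
      using f jacobian_works by blast
    have "((\<lambda>t. f (x + t *\<^sub>R axis j 1)) has_derivative (\<lambda>t. jacobian f (at x) *v (t *\<^sub>R axis j 1))) (at 0)"
      by (rule has_derivative_compose[where g=f and f="\<lambda>t. x + t *\<^sub>R axis j 1"])
        (auto intro!: derivative_eq_intros D)
    then have "((\<lambda>t. f (x + t *\<^sub>R axis j 1) $ i) has_derivative (\<lambda>t. (jacobian f (at x) *v (t *\<^sub>R axis j 1)) $ i)) (at 0)"
      by (rule bounded_linear.has_derivative[OF bounded_linear_vec_nth])
    moreover have "(jacobian f (at x) *v (t *\<^sub>R axis j 1)) $ i = jacobian f (at x) $ i $ j * t" for t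
      by (simp add: matrix_vector_mult_scaleR matrix_vector_mul_component inner_axis)
    ultimately have "((\<lambda>t. f (x + t *\<^sub>R axis j 1) $ i) has_derivative (\<lambda>t. jacobian f (at x) $ i $ j * t)) (at 0)"
      by (simp only:)
    then have "((\<lambda>t. f (x + t *\<^sub>R axis j 1) $ i) has_real_derivative jacobian f (at x) $ i $ j) (at 0)"
      unfolding has_field_derivative_def .
    then have "(\<lambda>h. (f (x + h *\<^sub>R axis j 1) $ i - f x $ i) / h) \<midarrow>0\<rightarrow> jacobian f (at x) $ i $ j"
      by (simp add: DERIV_def)
    then show "(\<lambda>k. ?q k x) \<longlonglongrightarrow> jacobian f (at x) $ i $ j"
      by (rule filterlim_compose) (use LIMSEQ_Suc[OF lim_1_over_n] in \<open>auto intro!: filterlim_atI\<close>)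
  qed
qed

lemma norm_matrix_columns:
  fixes A :: "real^'n^'m"
  shows "(norm A)\<^sup>2 = (\<Sum>j\<in>UNIV. (norm (column j A))\<^sup>2)"
  unfolding power2_norm_eq_inner
  by (simp add: inner_vec_def column_def) (rule sum.swap)

lemma norm_matrix_mult_le:
  fixes A :: "real^'n^'m" and B :: "real^'k^'n"
  shows "norm (A ** B) \<le> onorm ((*v) A) * norm B"
proof (rule power2_le_imp_le)
  have bl: "bounded_linear ((*v) A)" by (rule matrix_vector_mul_bounded_linear)
  have col: "column j (A ** B) = A *v column j B" for j
    by (simp add: vec_eq_iff column_def matrix_matrix_mult_def matrix_vector_mult_def)
  have "(norm (A ** B))\<^sup>2 = (\<Sum>j\<in>UNIV. (norm (A *v column j B))\<^sup>2)"
    by (simp add: norm_matrix_columns col)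
  also have "\<dots> \<le> (\<Sum>j\<in>UNIV. (onorm ((*v) A) * norm (column j B))\<^sup>2)"
    by (intro sum_mono power_mono onorm[OF bl]) auto
  also have "\<dots> = (onorm ((*v) A) * norm B)\<^sup>2"
    by (simp add: power_mult_distrib norm_matrix_columns sum_distrib_left)
  finally show "(norm (A ** B))\<^sup>2 \<le> (onorm ((*v) A) * norm B)\<^sup>2" .
  show "0 \<le> onorm ((*v) A) * norm B" using onorm_pos_le[OF bl] by simp
qed

locale fbsde_setting = brownian M "horizon P" W
  for M :: "'a measure" and W :: "real \<Rightarrow> 'a \<Rightarrow> real^'d" and P :: "('d::finite, 'm::finite) fbsde" +
  fixes L :: reg_consts
  assumes mc: "measurable_coefficients P" and cr: "coefficient_regularity P L"
begin

abbreviation T :: real where "T \<equiv> horizon P"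

lemma Lip_nonneg:
  "0 \<le> Lbx L" "0 \<le> Lby L" "0 \<le> Lbz L" "0 \<le> Lsx L" "0 \<le> Lsy L" "0 \<le> Lfx L" "0 \<le> Lfy L" "0 \<le> Lfz L"
  "0 \<le> Lg L" "0 \<le> Lbt L" "0 \<le> Lst L" "0 \<le> Lft L" "0 \<le> L0 L"
  using cr by (auto simp: coefficient_regularity_def)

lemma coeff_0:
  assumes "t \<in> {0..T}"
  shows "norm (drift P t 0 0 0) \<le> L0 L" "norm (diffusion P t 0 0) \<le> L0 L" "norm (driver P t 0 0 0) \<le> L0 L" "norm (terminal P 0) \<le> L0 L"
proof -
  have "norm (drift P t 0 0 0) + norm (diffusion P t 0 0) + norm (driver P t 0 0 0) + norm (terminal P 0) \<le> L0 L"
    using cr assms by (simp add: coefficient_regularity_def)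
  moreover have "0 \<le> norm (drift P t 0 0 0)" "0 \<le> norm (diffusion P t 0 0)" "0 \<le> norm (driver P t 0 0 0)" "0 \<le> norm (terminal P 0)"
    by auto
  ultimately show "norm (drift P t 0 0 0) \<le> L0 L" "norm (diffusion P t 0 0) \<le> L0 L" "norm (driver P t 0 0 0) \<le> L0 L" "norm (terminal P 0) \<le> L0 L"
    by linarith+
qed

lemma coeff_Lipschitz:
  "t \<in> {0..T} \<Longrightarrow> norm (drift P t x y z - drift P t x' y' z') \<le> Lbx L * norm (x - x') + Lby L * norm (y - y') + Lbz L * norm (z - z')"
  "t \<in> {0..T} \<Longrightarrow> norm (diffusion P t x y - diffusion P t x' y') \<le> Lsx L * norm (x - x') + Lsy L * norm (y - y')"
  "t \<in> {0..T} \<Longrightarrow> norm (driver P t x y z - driver P t x' y' z') \<le> Lfx L * norm (x - x') + Lfy L * norm (y - y') + Lfz L * norm (z - z')"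
  "norm (terminal P x - terminal P x') \<le> Lg L * norm (x - x')"
  subgoal using cr[unfolded coefficient_regularity_def, THEN conjunct2, THEN conjunct2, THEN conjunct1] by blast
  subgoal using cr[unfolded coefficient_regularity_def, THEN conjunct2, THEN conjunct2, THEN conjunct2, THEN conjunct1] by blast
  subgoal using cr[unfolded coefficient_regularity_def, THEN conjunct2, THEN conjunct2, THEN conjunct2, THEN conjunct2, THEN conjunct1] by blast
  subgoal using cr[unfolded coefficient_regularity_def, THEN conjunct2, THEN conjunct2, THEN conjunct2, THEN conjunct2, THEN conjunct2, THEN conjunct1] by blast
  done

lemma coeff_Hoelder:
  "t \<in> {0..T} \<Longrightarrow> s \<in> {0..T} \<Longrightarrow> norm (drift P t x y z - drift P s x y z) \<le> Lbt L * (1 + norm x + norm y + norm z) * sqrt \<bar>t - s\<bar>"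
  "t \<in> {0..T} \<Longrightarrow> s \<in> {0..T} \<Longrightarrow> norm (diffusion P t x y - diffusion P s x y) \<le> Lst L * (1 + norm x + norm y) * sqrt \<bar>t - s\<bar>"
  "t \<in> {0..T} \<Longrightarrow> s \<in> {0..T} \<Longrightarrow> norm (driver P t x y z - driver P s x y z) \<le> Lft L * (1 + norm x + norm y + norm z) * sqrt \<bar>t - s\<bar>"
  subgoal using cr[unfolded coefficient_regularity_def, THEN conjunct2, THEN conjunct2, THEN conjunct2, THEN conjunct2, THEN conjunct2, THEN conjunct2, THEN conjunct2, THEN conjunct1] by blast
  subgoal using cr[unfolded coefficient_regularity_def, THEN conjunct2, THEN conjunct2, THEN conjunct2, THEN conjunct2, THEN conjunct2, THEN conjunct2, THEN conjunct2, THEN conjunct2, THEN conjunct1] by blast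
  subgoal using cr[unfolded coefficient_regularity_def, THEN conjunct2, THEN conjunct2, THEN conjunct2, THEN conjunct2, THEN conjunct2, THEN conjunct2, THEN conjunct2, THEN conjunct2, THEN conjunct2] by blast
  done

lemma drift_regular: "coeff_regular (drift P) (Lbx L) (Lby L) (Lbz L) (Lbt L) (L0 L)"
  unfolding coeff_regular_def
proof (intro conjI ballI allI Lip_nonneg)
  show "(\<lambda>(t, x, y, z). drift P t x y z) \<in> borel_measurable (restrict_space borel ({0..T} \<times> UNIV))"
    using mc by (simp add: measurable_coefficients_def)
qed (intro coeff_Lipschitz coeff_Hoelder coeff_0; assumption)+

lemma driver_regular: "coeff_regular (driver P) (Lfx L) (Lfy L) (Lfz L) (Lft L) (L0 L)"
  unfolding coeff_regular_def
proof (intro conjI ballI allI Lip_nonneg)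
  show "(\<lambda>(t, x, y, z). driver P t x y z) \<in> borel_measurable (restrict_space borel ({0..T} \<times> UNIV))"
    using mc by (simp add: measurable_coefficients_def)
qed (intro coeff_Lipschitz coeff_Hoelder coeff_0; assumption)+

lemma diffusion_regular: "coeff_regular (\<lambda>t x y z. diffusion P t x y) (Lsx L) (Lsy L) 0 (Lst L) (L0 L)"
  unfolding coeff_regular_def
proof (intro conjI ballI allI Lip_nonneg order_refl)
  have p: "(\<lambda>p. (fst p, fst (snd p), fst (snd (snd p)))) \<in> measurable (restrict_space borel ({0..T} \<times> UNIV) :: (real \<times> (real^'d) \<times> (real^'m) \<times> (real^'d^'m)) measure)
      (restrict_space borel ({0..T} \<times> UNIV))"
    by (intro measurable_restrict_space2 measurable_restrict_space1 borel_measurable_continuous_onI continuous_intros)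
      (auto simp: space_restrict_space)
  have "(\<lambda>(t, x, y). diffusion P t x y) \<in> borel_measurable (restrict_space borel ({0..T} \<times> UNIV))"
    using mc by (simp add: measurable_coefficients_def)
  from measurable_compose[OF p this]
  show "(\<lambda>(t, x, y, z :: real^'d^'m). diffusion P t x y) \<in> borel_measurable (restrict_space borel ({0..T} \<times> UNIV))"
    by (simp add: split_def)
  fix t s :: real and x :: "real^'d" and y :: "real^'m" and z :: "real^'d^'m"
  assume ts: "t \<in> {0..T}" "s \<in> {0..T}"
  have "norm (diffusion P t x y - diffusion P s x y) \<le> Lst L * (1 + norm x + norm y) * sqrt \<bar>t - s\<bar>"
    by (rule coeff_Hoelder(2)[OF ts])
  also have "\<dots> \<le> Lst L * (1 + norm x + norm y + norm z) * sqrt \<bar>t - s\<bar>"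
    using Lip_nonneg by (intro mult_right_mono mult_left_mono) auto
  finally show "norm (diffusion P t x y - diffusion P s x y) \<le> Lst L * (1 + norm x + norm y + norm z) * sqrt \<bar>t - s\<bar>" .
next
  fix t :: real and x x' :: "real^'d" and y y' :: "real^'m" and z z' :: "real^'d^'m"
  assume t: "t \<in> {0..T}"
  show "norm (diffusion P t x y - diffusion P t x' y') \<le> Lsx L * norm (x - x') + Lsy L * norm (y - y') + 0 * norm (z - z')"
    using coeff_Lipschitz(2)[OF t] by simp
  show "norm (diffusion P t 0 0) \<le> L0 L" by (rule coeff_0(2)[OF t])
qed

definition network_bounds :: "real list \<Rightarrow> (nat \<Rightarrow> real^'d \<Rightarrow> real^'m) \<Rightarrow> real \<Rightarrow> real \<Rightarrow> bool"
  where "network_bounds \<pi> \<phi> K K' \<longleftrightarrow> (\<forall>n<cells \<pi>. norm (\<phi> n 0) \<le> K \<and>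
    (\<forall>x. \<phi> n differentiable (at x) \<and> onorm ((*v) (jacobian (\<phi> n) (at x))) \<le> K'))"

text \<open>The bound on the Jacobian is a Lipschitz bound by the mean value inequality.\<close>

lemma network_growth:
  assumes "network_bounds \<pi> \<phi> K K'" "n < cells \<pi>"
  shows "norm (\<phi> n x) \<le> K + K' * norm x"
proof -
  have d: "(\<phi> n has_derivative (\<lambda>h. jacobian (\<phi> n) (at y) *v h)) (at y)" for y
    using assms jacobian_works by (auto simp: network_bounds_def)
  have "norm (\<phi> n x - \<phi> n 0) \<le> K' * norm (x - 0)"
    using assms by (intro differentiable_bound[of UNIV "\<phi> n" "\<lambda>y. (*v) (jacobian (\<phi> n) (at y))"])
      (auto simp: network_bounds_def d)
  moreover have "norm (\<phi> n 0) \<le> K" using assms by (simp add: network_bounds_def)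
  moreover have "norm (\<phi> n x) \<le> norm (\<phi> n 0) + norm (\<phi> n x - \<phi> n 0)"
    by (metis add.commute diff_add_cancel norm_triangle_ineq)
  ultimately show ?thesis by simp
qed

text \<open>A constant of linear growth for \<^const>\<open>z_approx\<close>.\<close>

definition Kz :: "real \<Rightarrow> real \<Rightarrow> real"
  where "Kz K K' = K' * (L0 L + Lsx L + Lsy L * (K + K'))"

lemma z_approx_growth:
  assumes \<phi>: "network_bounds \<pi> \<phi> K K'" and n: "n < cells \<pi>" and \<pi>: "is_partition T \<pi>" and K: "0 \<le> K" "0 \<le> K'"
  shows "norm (z_approx P \<pi> \<phi> n r) \<le> Kz K K' * (1 + norm r)"
proof -
  have t: "\<pi> ! n \<in> {0..T}" using partition_in[OF \<pi>] n by simp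
  have "norm (z_approx P \<pi> \<phi> n r) \<le> onorm ((*v) (jacobian (\<phi> n) (at r))) * norm (diffusion P (\<pi> ! n) r (\<phi> n r))"
    unfolding z_approx_def by (rule norm_matrix_mult_le)
  also have "\<dots> \<le> K' * ((L0 L + Lsx L + Lsy L * (K + K')) * (1 + norm r))"
  proof (rule mult_mono)
    have "norm (diffusion P (\<pi> ! n) r (\<phi> n r)) \<le> L0 L + Lsx L * norm r + Lsy L * norm (\<phi> n r)"
      using coeff_growth[OF diffusion_regular t, of r "\<phi> n r"] by simp
    also have "\<dots> \<le> L0 L + Lsx L * norm r + Lsy L * (K + K' * norm r)"
      using network_growth[OF \<phi> n] Lip_nonneg by (intro add_left_mono mult_left_mono) auto
    also have "\<dots> \<le> (L0 L + Lsx L + Lsy L * (K + K')) * (1 + norm r)"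
      using Lip_nonneg K by (simp add: algebra_simps)
    finally show "norm (diffusion P (\<pi> ! n) r (\<phi> n r)) \<le> (L0 L + Lsx L + Lsy L * (K + K')) * (1 + norm r)" .
    show "onorm ((*v) (jacobian (\<phi> n) (at r))) \<le> K'" using \<phi> n by (simp add: network_bounds_def)
  qed (use K in auto)
  finally show ?thesis by (simp add: Kz_def mult.assoc)
qed

lemma z_approx_measurable:
  assumes \<phi>: "network_bounds \<pi> \<phi> K K'" and n: "n < cells \<pi>" and \<pi>: "is_partition T \<pi>"
  shows "z_approx P \<pi> \<phi> n \<in> borel_measurable borel"
proof -
  have t: "\<pi> ! n \<in> {0..T}" using partition_in[OF \<pi>] n by simp
  have d: "\<phi> n differentiable (at x)" for x using \<phi> n by (simp add: network_bounds_def)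
  have m: "\<phi> n \<in> borel_measurable borel"
    using d by (intro borel_measurable_continuous_onI continuous_at_imp_continuous_on ballI differentiable_imp_continuous_within)
  have "(\<lambda>r. diffusion P (\<pi> ! n) r (\<phi> n r)) \<in> borel_measurable borel"
    using coeff_measurable[OF diffusion_regular, of "\<lambda>_. \<pi> ! n" borel "\<lambda>r. r" "\<phi> n" "\<lambda>_. 0"] m t by simp
  then show ?thesis
    unfolding z_approx_def[abs_def] by (intro borel_measurable_matrix_matrix_mult jacobian_measurable d)
qed

lemma z_approx_sq_int:
  assumes \<phi>: "network_bounds \<pi> \<phi> K K'" and n: "n < cells \<pi>" and \<pi>: "is_partition T \<pi>" and K: "0 \<le> K" "0 \<le> K'"
    and r: "sq_int M r"
  shows "sq_int M (\<lambda>\<omega>. z_approx P \<pi> \<phi> n (r \<omega>))"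
    and "msq M (\<lambda>\<omega>. z_approx P \<pi> \<phi> n (r \<omega>)) \<le> 2 * (Kz K K')\<^sup>2 * (1 + msq M r)"
proof -
  let ?g = "\<lambda>\<omega>. 2 * (Kz K K')\<^sup>2 * (1 + (norm (r \<omega>))\<^sup>2)"
  have b: "(norm (z_approx P \<pi> \<phi> n (r \<omega>)))\<^sup>2 \<le> ?g \<omega>" for \<omega>
  proof -
    have "(norm (z_approx P \<pi> \<phi> n (r \<omega>)))\<^sup>2 \<le> (Kz K K' * (1 + norm (r \<omega>)))\<^sup>2"
      by (intro power_mono z_approx_growth[OF \<phi> n \<pi> K]) auto
    also have "\<dots> = (Kz K K')\<^sup>2 * (1 + norm (r \<omega>))\<^sup>2" by (simp add: power_mult_distrib)
    also have "\<dots> \<le> (Kz K K')\<^sup>2 * (2 * (1 + (norm (r \<omega>))\<^sup>2))"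
      using zero_le_power2[of "1 - norm (r \<omega>)"] by (intro mult_left_mono) (simp_all add: power2_sum power2_diff)
    finally show ?thesis by (simp add: algebra_simps)
  qed
  have i: "integrable M ?g" using sq_int_integrable[OF r] by simp
  have m: "(\<lambda>\<omega>. z_approx P \<pi> \<phi> n (r \<omega>)) \<in> borel_measurable M"
    using measurable_compose[OF sq_int_measurable[OF r] z_approx_measurable[OF \<phi> n \<pi>]] .
  show "sq_int M (\<lambda>\<omega>. z_approx P \<pi> \<phi> n (r \<omega>))" by (rule sq_int_dominated[OF m i b])
  have "msq M (\<lambda>\<omega>. z_approx P \<pi> \<phi> n (r \<omega>)) \<le> expectation ?g" by (rule msq_le_integral[OF i b])
  also have "\<dots> = 2 * (Kz K K')\<^sup>2 * (1 + msq M r)"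
    using sq_int_integrable[OF r] by (simp add: msq_def prob_space)
  finally show "msq M (\<lambda>\<omega>. z_approx P \<pi> \<phi> n (r \<omega>)) \<le> 2 * (Kz K K')\<^sup>2 * (1 + msq M r)" .
qed

lemma msq_euler_increment:
  fixes u a :: "'a \<Rightarrow> real^'k" and s :: "'a \<Rightarrow> real^'d^'k"
  assumes t: "0 \<le> t" "t \<le> t'" "t' \<le> T" and h: "h = t' - t"
    and m: "u \<in> borel_measurable (F t)" "a \<in> borel_measurable (F t)" "s \<in> borel_measurable (F t)"
    and sq: "sq_int M u" "sq_int M a" "sq_int M s"
  shows "sq_int M (\<lambda>\<omega>. u \<omega> + h *\<^sub>R a \<omega> + s \<omega> *v (W t' \<omega> - W t \<omega>))"
    and "msq M (\<lambda>\<omega>. u \<omega> + h *\<^sub>R a \<omega> + s \<omega> *v (W t' \<omega> - W t \<omega>)) \<le> (1 + h) * msq M u + h * ((T + 1) * msq M a + msq M s)"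
    and "(\<lambda>\<omega>. u \<omega> + h *\<^sub>R a \<omega> + s \<omega> *v (W t' \<omega> - W t \<omega>)) \<in> borel_measurable (F t')"
proof -
  let ?n = "\<lambda>\<omega>. s \<omega> *v (W t' \<omega> - W t \<omega>)" and ?v = "\<lambda>\<omega>. u \<omega> + h *\<^sub>R a \<omega>"
  have h0: "0 \<le> h" "h \<le> T" using t h by auto
  have n: "sq_int M ?n" by (rule matrix_increment_sq_int[OF t m(3) sq(3)])
  have v: "sq_int M ?v" by (intro sq_int_add sq_int_scaleR sq)
  have vm: "?v \<in> borel_measurable (F t)" by (intro borel_measurable_add borel_measurable_scaleR measurable_const m) auto
  show "sq_int M (\<lambda>\<omega>. ?v \<omega> + ?n \<omega>)" by (rule sq_int_add[OF v n])
  show "(\<lambda>\<omega>. ?v \<omega> + ?n \<omega>) \<in> borel_measurable (F t')"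
    by (intro borel_measurable_add matrix_increment_measurable measurable_F_mono[OF vm] t m order_refl)
  have "msq M (\<lambda>\<omega>. ?v \<omega> + ?n \<omega>) = msq M ?v + msq M ?n"
    using msq_add[OF v n] matrix_increment_orthogonal[OF t m(3) sq(3) vm v] by simp
  also have "msq M ?n = h * msq M s"
    using matrix_increment_isometry[OF t m(3) sq(3) m(3) sq(3)] by (simp add: msq_def power2_norm_eq_inner h)
  also have "msq M ?v \<le> (1 + h) * msq M u + (h + h\<^sup>2) * msq M a"
  proof (cases "h = 0")
    case False
    then have "0 < h" using h0 by simp
    have "(1 + 1 / h) * (h\<^sup>2 * msq M a) = (h + h\<^sup>2) * msq M a"
      using False by (simp add: power2_eq_square field_simps)
    with msq_add_weighted[OF sq(1) sq_int_scaleR[OF sq(2), of h] \<open>0 < h\<close>]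
    show ?thesis by (simp only: msq_scaleR)
  qed simp
  also have "(h + h\<^sup>2) * msq M a \<le> h * ((T + 1) * msq M a)"
  proof -
    have "h + h\<^sup>2 \<le> h * (T + 1)" using mult_left_mono[OF h0(2) h0(1)] by (simp add: power2_eq_square algebra_simps)
    then have "(h + h\<^sup>2) * msq M a \<le> h * (T + 1) * msq M a" by (rule mult_right_mono) simp
    then show ?thesis by (simp add: mult.assoc)
  qed
  finally show "msq M (\<lambda>\<omega>. ?v \<omega> + ?n \<omega>) \<le> (1 + h) * msq M u + h * ((T + 1) * msq M a + msq M s)"
    by (simp add: algebra_simps)
qed

text \<open>Both kinds of iteration at once: the reference is either the forward component itself, so
  \<open>\<rho> = 0\<close>, or a given process with second moments at most \<open>\<rho>\<close>.\<close>

definition scheme_run ::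
    "real list \<Rightarrow> (nat \<Rightarrow> real^'d \<Rightarrow> real^'m) \<Rightarrow> real^'m \<Rightarrow> (nat \<Rightarrow> 'a \<Rightarrow> real^'d) \<Rightarrow> (nat \<Rightarrow> 'a \<Rightarrow> (real^'d) \<times> (real^'m)) \<Rightarrow>
     real \<Rightarrow> real \<Rightarrow> real \<Rightarrow> bool"
  where "scheme_run \<pi> \<phi> \<theta> R U \<rho> K K' \<longleftrightarrow> is_partition T \<pi> \<and> network_bounds \<pi> \<phi> K K' \<and> norm \<theta> \<le> K \<and>
    (\<forall>\<omega>. U 0 \<omega> = (start P, \<theta>)) \<and> (\<forall>n<cells \<pi>. \<forall>\<omega>. U (Suc n) \<omega> = euler_step P W \<pi> \<phi> n \<omega> (R n \<omega>) (U n \<omega>)) \<and>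
    (\<forall>n\<le>cells \<pi>. (\<lambda>\<omega>. fst (U n \<omega>)) \<in> borel_measurable (F (\<pi> ! n)) \<longrightarrow> sq_int M (\<lambda>\<omega>. fst (U n \<omega>)) \<longrightarrow>
      R n \<in> borel_measurable (F (\<pi> ! n)) \<and> sq_int M (R n) \<and> msq M (R n) \<le> \<rho> + msq M (\<lambda>\<omega>. fst (U n \<omega>)))"

text \<open>One step multiplies the sum of the second moments by \<open>1 + (1 + B) h\<close> and adds a multiple of \<open>h\<close>, so
  the discrete Gronwall inequality applies. The bound does not depend on the partition.\<close>

lemma scheme_run_moments:
  assumes K: "0 \<le> K" "0 \<le> K'" and \<rho>: "0 \<le> \<rho>"
  obtains C where "0 \<le> C" "\<And>\<pi> \<phi> \<theta> R U n. scheme_run \<pi> \<phi> \<theta> R U \<rho> K K' \<Longrightarrow> n \<le> cells \<pi> \<Longrightarrow>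
    (\<lambda>\<omega>. fst (U n \<omega>)) \<in> borel_measurable (F (\<pi> ! n)) \<and> (\<lambda>\<omega>. snd (U n \<omega>)) \<in> borel_measurable (F (\<pi> ! n)) \<and>
    sq_int M (\<lambda>\<omega>. fst (U n \<omega>)) \<and> sq_int M (\<lambda>\<omega>. snd (U n \<omega>)) \<and>
    msq M (\<lambda>\<omega>. fst (U n \<omega>)) + msq M (\<lambda>\<omega>. snd (U n \<omega>)) \<le> C"
proof -
  define z2 where "z2 = 4 * (Kz K K')\<^sup>2"
  define Bb where "Bb = 4 * ((L0 L)\<^sup>2 + (Lbx L)\<^sup>2 + (Lby L)\<^sup>2 + (Lbz L)\<^sup>2 * z2)"
  define Bs where "Bs = 4 * ((L0 L)\<^sup>2 + (Lsx L)\<^sup>2 + (Lsy L)\<^sup>2)"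
  define Bf where "Bf = 4 * ((L0 L)\<^sup>2 + (Lfx L)\<^sup>2 + (Lfy L)\<^sup>2 + (Lfz L)\<^sup>2 * z2)"
  define B where "B = (T + 1) * Bb + Bs + (T + 1) * Bf + z2"
  define C where "C = exp ((1 + B) * T) * ((norm (start P))\<^sup>2 + K\<^sup>2 + B * (1 + \<rho>) * T)"
  have T0: "0 \<le> T" using T_pos by simp
  have z2: "0 \<le> z2" by (simp add: z2_def)
  have B: "0 \<le> B" using T0 z2 by (simp add: B_def Bb_def Bs_def Bf_def)
  have C: "0 \<le> C" using T0 B \<rho> by (simp add: C_def)
  have "(\<lambda>\<omega>. fst (U n \<omega>)) \<in> borel_measurable (F (\<pi> ! n)) \<and> (\<lambda>\<omega>. snd (U n \<omega>)) \<in> borel_measurable (F (\<pi> ! n)) \<and>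
    sq_int M (\<lambda>\<omega>. fst (U n \<omega>)) \<and> sq_int M (\<lambda>\<omega>. snd (U n \<omega>)) \<and>
    msq M (\<lambda>\<omega>. fst (U n \<omega>)) + msq M (\<lambda>\<omega>. snd (U n \<omega>)) \<le> C"
    if run: "scheme_run \<pi> \<phi> \<theta> R U \<rho> K K'" and n: "n \<le> cells \<pi>" for \<pi> \<phi> \<theta> R U n
  proof -
    have \<pi>: "is_partition T \<pi>" and \<phi>: "network_bounds \<pi> \<phi> K K'" and \<theta>: "norm \<theta> \<le> K"
      and U0: "\<And>\<omega>. U 0 \<omega> = (start P, \<theta>)"
      and US: "\<And>n \<omega>. n < cells \<pi> \<Longrightarrow> U (Suc n) \<omega> = euler_step P W \<pi> \<phi> n \<omega> (R n \<omega>) (U n \<omega>)"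
      and R: "\<And>n. n \<le> cells \<pi> \<Longrightarrow> (\<lambda>\<omega>. fst (U n \<omega>)) \<in> borel_measurable (F (\<pi> ! n)) \<Longrightarrow> sq_int M (\<lambda>\<omega>. fst (U n \<omega>)) \<Longrightarrow>
        R n \<in> borel_measurable (F (\<pi> ! n)) \<and> sq_int M (R n) \<and> msq M (R n) \<le> \<rho> + msq M (\<lambda>\<omega>. fst (U n \<omega>))"
      using run unfolding scheme_run_def by blast+
    let ?x = "\<lambda>n \<omega>. fst (U n \<omega>)" and ?y = "\<lambda>n \<omega>. snd (U n \<omega>)"
    let ?m = "\<lambda>n. msq M (?x n) + msq M (?y n)"
    let ?h = "\<lambda>n. \<pi> ! Suc n - \<pi> ! n"
    have step: "?x (Suc n) \<in> borel_measurable (F (\<pi> ! Suc n)) \<and> ?y (Suc n) \<in> borel_measurable (F (\<pi> ! Suc n)) \<and>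
      sq_int M (?x (Suc n)) \<and> sq_int M (?y (Suc n)) \<and> ?m (Suc n) \<le> (1 + (1 + B) * ?h n) * ?m n + B * (1 + \<rho>) * ?h n"
      if n: "n < cells \<pi>" and xm: "?x n \<in> borel_measurable (F (\<pi> ! n))" and ym: "?y n \<in> borel_measurable (F (\<pi> ! n))"
        and xs: "sq_int M (?x n)" and ys: "sq_int M (?y n)" for n
    proof -
      have t: "0 \<le> \<pi> ! n" "\<pi> ! n \<le> \<pi> ! Suc n" "\<pi> ! Suc n \<le> T" and tT: "\<pi> ! n \<in> {0..T}"
        using partition_in[OF \<pi>, of n] partition_in[OF \<pi>, of "Suc n"] partition_le[OF \<pi>, of n "Suc n"] n by auto
      have Rn: "R n \<in> borel_measurable (F (\<pi> ! n))" "sq_int M (R n)" "msq M (R n) \<le> \<rho> + msq M (?x n)"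
        using R[of n] n xm xs by auto
      define z where "z \<omega> = z_approx P \<pi> \<phi> n (R n \<omega>)" for \<omega>
      have zm: "z \<in> borel_measurable (F (\<pi> ! n))"
        unfolding z_def[abs_def] by (rule measurable_compose[OF Rn(1) z_approx_measurable[OF \<phi> n \<pi>]])
      have zs: "sq_int M z" unfolding z_def[abs_def] by (rule z_approx_sq_int(1)[OF \<phi> n \<pi> K Rn(2)])
      let ?S = "1 + \<rho> + ?m n"
      have le: "1 \<le> ?S" "msq M (?x n) \<le> ?S" "msq M (?y n) \<le> ?S" "msq M (R n) \<le> ?S"
        using Rn(3) \<rho> msq_nonneg[of M "?x n"] msq_nonneg[of M "?y n"] by linarith+
      have zle: "msq M z \<le> z2 * ?S"
      proof -
        have "msq M z \<le> 2 * (Kz K K')\<^sup>2 * (1 + msq M (R n))"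
          unfolding z_def[abs_def] by (rule z_approx_sq_int(2)[OF \<phi> n \<pi> K Rn(2)])
        also have "\<dots> \<le> 2 * (Kz K K')\<^sup>2 * (2 * ?S)" using le by (intro mult_left_mono) auto
        finally show ?thesis by (simp add: z2_def algebra_simps)
      qed
      define b where "b \<omega> = drift P (\<pi> ! n) (?x n \<omega>) (?y n \<omega>) (z \<omega>)" for \<omega>
      define s where "s \<omega> = diffusion P (\<pi> ! n) (?x n \<omega>) (?y n \<omega>)" for \<omega>
      define f where "f \<omega> = - driver P (\<pi> ! n) (R n \<omega>) (?y n \<omega>) (z \<omega>)" for \<omega>
      have meas: "b \<in> borel_measurable (F (\<pi> ! n))" "s \<in> borel_measurable (F (\<pi> ! n))" "f \<in> borel_measurable (F (\<pi> ! n))"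
        unfolding b_def[abs_def] s_def[abs_def] f_def[abs_def]
        using coeff_measurable[OF drift_regular measurable_const xm ym zm] tT
          coeff_measurable[OF diffusion_regular measurable_const xm ym zm]
          borel_measurable_uminus[OF coeff_measurable[OF driver_regular measurable_const Rn(1) ym zm]] by auto
      have sq: "sq_int M b" "sq_int M s" "sq_int M f"
        unfolding b_def[abs_def] s_def[abs_def] f_def[abs_def]
        using coeff_sq_int(1)[OF drift_regular tT xs ys zs] coeff_sq_int(1)[OF diffusion_regular tT xs ys zs]
          sq_int_uminus[OF coeff_sq_int(1)[OF driver_regular tT Rn(2) ys zs]] by auto
      have bb: "msq M b \<le> Bb * ?S"
      proof -
        have "msq M b \<le> 4 * ((L0 L)\<^sup>2 + (Lbx L)\<^sup>2 * msq M (?x n) + (Lby L)\<^sup>2 * msq M (?y n) + (Lbz L)\<^sup>2 * msq M z)"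
          unfolding b_def[abs_def] by (rule coeff_sq_int(2)[OF drift_regular tT xs ys zs])
        also have "\<dots> \<le> 4 * ((L0 L)\<^sup>2 * ?S + (Lbx L)\<^sup>2 * ?S + (Lby L)\<^sup>2 * ?S + (Lbz L)\<^sup>2 * (z2 * ?S))"
          using le zle mult_left_mono[OF le(1), of "(L0 L)\<^sup>2"] by (intro mult_left_mono add_mono) auto
        finally show ?thesis by (simp add: Bb_def algebra_simps)
      qed
      have sb: "msq M s \<le> Bs * ?S"
      proof -
        have "msq M s \<le> 4 * ((L0 L)\<^sup>2 + (Lsx L)\<^sup>2 * msq M (?x n) + (Lsy L)\<^sup>2 * msq M (?y n) + 0\<^sup>2 * msq M z)"
          unfolding s_def[abs_def] by (rule coeff_sq_int(2)[OF diffusion_regular tT xs ys zs])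
        also have "\<dots> \<le> 4 * ((L0 L)\<^sup>2 * ?S + (Lsx L)\<^sup>2 * ?S + (Lsy L)\<^sup>2 * ?S + 0)"
          using le mult_left_mono[OF le(1), of "(L0 L)\<^sup>2"] by (intro mult_left_mono add_mono) auto
        finally show ?thesis by (simp add: Bs_def algebra_simps)
      qed
      have fb: "msq M f \<le> Bf * ?S"
      proof -
        have "msq M f \<le> 4 * ((L0 L)\<^sup>2 + (Lfx L)\<^sup>2 * msq M (R n) + (Lfy L)\<^sup>2 * msq M (?y n) + (Lfz L)\<^sup>2 * msq M z)"
          using coeff_sq_int(2)[OF driver_regular tT Rn(2) ys zs] by (simp add: f_def[abs_def] msq_def)
        also have "\<dots> \<le> 4 * ((L0 L)\<^sup>2 * ?S + (Lfx L)\<^sup>2 * ?S + (Lfy L)\<^sup>2 * ?S + (Lfz L)\<^sup>2 * (z2 * ?S))"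
          using le zle mult_left_mono[OF le(1), of "(L0 L)\<^sup>2"] by (intro mult_left_mono add_mono) auto
        finally show ?thesis by (simp add: Bf_def algebra_simps)
      qed
      have x': "?x (Suc n) = (\<lambda>\<omega>. ?x n \<omega> + ?h n *\<^sub>R b \<omega> + s \<omega> *v (W (\<pi> ! Suc n) \<omega> - W (\<pi> ! n) \<omega>))"
        using US[OF n] by (simp add: euler_step_def Let_def split_def b_def s_def z_def)
      have y': "?y (Suc n) = (\<lambda>\<omega>. ?y n \<omega> + ?h n *\<^sub>R f \<omega> + z \<omega> *v (W (\<pi> ! Suc n) \<omega> - W (\<pi> ! n) \<omega>))"
        using US[OF n] by (simp add: euler_step_def Let_def split_def f_def z_def)
      note ix = msq_euler_increment[OF t refl xm meas(1,2) xs sq(1,2)]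
      note iy = msq_euler_increment[OF t refl ym meas(3) zm ys sq(3) zs]
      have h: "0 \<le> ?h n" using t by simp
      have "?m (Suc n) \<le> (1 + ?h n) * ?m n + ?h n * ((T + 1) * msq M b + msq M s + ((T + 1) * msq M f + msq M z))"
        using ix(2) iy(2) unfolding x' y' by (simp add: algebra_simps)
      also have "\<dots> \<le> (1 + ?h n) * ?m n + ?h n * ((T + 1) * (Bb * ?S) + Bs * ?S + ((T + 1) * (Bf * ?S) + z2 * ?S))"
        using bb sb fb zle h T0 by (intro add_left_mono mult_left_mono add_mono) auto
      also have "\<dots> = (1 + (1 + B) * ?h n) * ?m n + B * (1 + \<rho>) * ?h n"
        by (simp add: B_def algebra_simps)
      finally show ?thesis using ix(1,3) iy(1,3) unfolding x' y' by blast
    qed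
    have all: "?x n \<in> borel_measurable (F (\<pi> ! n)) \<and> ?y n \<in> borel_measurable (F (\<pi> ! n)) \<and> sq_int M (?x n) \<and> sq_int M (?y n)"
      if "n \<le> cells \<pi>" for n
      using that
    proof (induction n)
      case 0
      show ?case by (simp add: U0)
    next
      case (Suc n)
      then show ?case using step[of n] by auto
    qed
    have sum_h: "(\<Sum>k<n. ?h k) = \<pi> ! n" if "n \<le> cells \<pi>" for n
      using partition_ends[OF \<pi>] by (simp add: sum_lessThan_telescope)
    have "?m n \<le> exp ((1 + B) * (\<Sum>k<n. ?h k)) * (?m 0 + B * (1 + \<rho>) * (\<Sum>k<n. ?h k))"
    proof (rule discrete_gronwall[of _ _ "cells \<pi>"])
      show "0 \<le> 1 + B" "0 \<le> B * (1 + \<rho>)" using B \<rho> by auto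
      show "0 \<le> ?h k" if "k < cells \<pi>" for k using partition_le[OF \<pi>, of k "Suc k"] that by simp
      show "?m (Suc k) \<le> (1 + (1 + B) * ?h k) * ?m k + B * (1 + \<rho>) * ?h k" if "k < cells \<pi>" for k
        using step[OF that] all[of k] that by auto
    qed (use n in auto)
    also have "\<dots> \<le> C"
    proof -
      have p: "0 \<le> \<pi> ! n" "\<pi> ! n \<le> T" using partition_in[OF \<pi> n] by auto
      have m0: "?m 0 \<le> (norm (start P))\<^sup>2 + K\<^sup>2" using \<theta> by (simp add: U0 power_mono)
      show ?thesis
        unfolding C_def sum_h[OF n]
        by (rule mult_mono) (use p m0 B \<rho> in \<open>auto intro!: mult_left_mono add_mono add_nonneg_nonneg mult_nonneg_nonneg\<close>)
    qed
    finally show ?thesis using all[OF n] by blast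
  qed
  with C show thesis by (rule that)
qed

end

section \<open>Error of one iteration\<close>

context fbsde_setting
begin

lemma has_ito_integral_cong:
  assumes I: "has_ito_integral M W T H I" and eq: "AE \<omega> in M. \<forall>t\<in>{0..T}. H' t \<omega> = H t \<omega>"
  shows "has_ito_integral M W T H' I"
proof -
  have "int_mean_square M T (\<lambda>t \<omega>. G t \<omega> - H t \<omega>) = int_mean_square M T (\<lambda>t \<omega>. G t \<omega> - H' t \<omega>)" for G
    unfolding int_mean_square_def
  proof (rule nn_integral_cong_AE, use eq in eventually_elim)
    case (elim \<omega>)
    show ?case by (intro nn_integral_cong) (auto simp: elim indicator_def)
  qed
  then show ?thesis using I unfolding has_ito_integral_def by simp
qed

lemma LBINT_diff_L2:
  fixes f g :: "real \<Rightarrow> 'b::euclidean_space"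
  assumes "sq_int TM f" "sq_int TM g" "0 \<le> a" "b \<le> T"
  shows "(LBINT s:{a..b}. f s - g s) = (LBINT s:{a..b}. f s) - (LBINT s:{a..b}. g s)"
proof -
  have i: "set_integrable lborel {a..b} h" if "sq_int TM h" for h :: "real \<Rightarrow> 'b"
    using sq_int_TM_integrable[OF that] assms(3,4)
    by (intro set_integrable_subset[of lborel "{0..T}" h "{a..b}"]) (auto simp: integrable_TM)
  show ?thesis by (rule set_integral_diff(2)[OF i[OF assms(1)] i[OF assms(2)]])
qed

lemma AE_LBINT_diff:
  assumes "sq_int Q (case_prod f)" "sq_int Q (case_prod g)"
  shows "AE \<omega> in M. \<forall>a\<ge>0. \<forall>b\<le>T. (LBINT s:{a..b}. f s \<omega> - g s \<omega>) = (LBINT s:{a..b}. f s \<omega>) - (LBINT s:{a..b}. g s \<omega>)"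
  using AE_sq_int_section[OF assms(1)] AE_sq_int_section[OF assms(2)]
proof eventually_elim
  case (elim \<omega>)
  show ?case by (intro allI impI LBINT_diff_L2[OF elim])
qed

text \<open>A bound for the cost of evaluating a coefficient at \<open>(u, y, z)\<close> and a time off by \<open>h\<close>, instead of at
  \<open>(u', y', z)\<close> and the right time.\<close>

definition local_error :: "real \<Rightarrow> real \<Rightarrow> real \<Rightarrow> real \<Rightarrow> 'x::real_normed_vector \<Rightarrow> 'x \<Rightarrow> 'y::real_normed_vector \<Rightarrow> 'y \<Rightarrow> 'z::real_normed_vector \<Rightarrow> real"
  where "local_error Lx Ly Lt h u u' y y' z =
    Lt * sqrt h * (1 + norm u + norm y + norm z) + Lx * norm (u - u') + Ly * norm (y - y')"

lemma coeff_local_error: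
  assumes c: "coeff_regular c Lx Ly Lz Lt Lo" and t: "\<tau> \<in> {0..T}" "s \<in> {0..T}"
  shows "norm (c \<tau> u y z - c s x' y'' z'')
    \<le> local_error Lx Ly Lt \<bar>\<tau> - s\<bar> u u' y y' z + Lx * norm (u' - x') + Ly * norm (y' - y'') + Lz * norm (z - z'')"
proof -
  have "norm (c \<tau> u y z - c s u y z) \<le> Lt * sqrt \<bar>\<tau> - s\<bar> * (1 + norm u + norm y + norm z)"
    using coeff_regular_D(8)[OF c t, of u y z] by (simp add: mult_ac)
  moreover have "norm (c s u y z - c s u' y' z) \<le> Lx * norm (u - u') + Ly * norm (y - y')"
    using coeff_regular_D(6)[OF c t(2), of u y z u' y' z] by simp
  moreover have "norm (c s u' y' z - c s x' y'' z'') \<le> Lx * norm (u' - x') + Ly * norm (y' - y'') + Lz * norm (z - z'')"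
    using coeff_regular_D(6)[OF c t(2)] .
  moreover have "norm (c \<tau> u y z - c s x' y'' z'')
    \<le> norm (c \<tau> u y z - c s u y z) + norm (c s u y z - c s u' y' z) + norm (c s u' y' z - c s x' y'' z'')"
    using norm_triangle_ineq[of "c \<tau> u y z - c s u y z" "c s u y z - c s x' y'' z''"]
      norm_triangle_ineq[of "c s u y z - c s u' y' z" "c s u' y' z - c s x' y'' z''"] by simp
  ultimately show ?thesis unfolding local_error_def by linarith
qed

lemma local_error_msq:
  fixes u u' :: "'a \<Rightarrow> 'x::euclidean_space" and y y' :: "'a \<Rightarrow> 'y::euclidean_space" and z :: "'a \<Rightarrow> 'z::euclidean_space"
  assumes sq: "sq_int M u" "sq_int M y" "sq_int M z" "sq_int M (\<lambda>\<omega>. u \<omega> - u' \<omega>)" "sq_int M (\<lambda>\<omega>. y \<omega> - y' \<omega>)"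
    and b: "msq M u \<le> Cm" "msq M y \<le> Cm" "msq M z \<le> Cm" "msq M (\<lambda>\<omega>. u \<omega> - u' \<omega>) \<le> C1 * m" "msq M (\<lambda>\<omega>. y \<omega> - y' \<omega>) \<le> C1 * m"
    and h: "0 \<le> h" "h \<le> m"
  shows "sq_int M (\<lambda>\<omega>. local_error Lx Ly Lt h (u \<omega>) (u' \<omega>) (y \<omega>) (y' \<omega>) (z \<omega>))"
    and "msq M (\<lambda>\<omega>. local_error Lx Ly Lt h (u \<omega>) (u' \<omega>) (y \<omega>) (y' \<omega>) (z \<omega>))
      \<le> 4 * (Lt\<^sup>2 * (4 * (1 + 3 * Cm)) + Lx\<^sup>2 * C1 + Ly\<^sup>2 * C1) * m"
proof -
  let ?k = "\<lambda>\<omega>. 1 + norm (u \<omega>) + norm (y \<omega>) + norm (z \<omega>)"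
  have k: "sq_int M ?k" by (intro sq_int_add sq_int_norm sq sq_int_const)
  have "msq M ?k \<le> 4 * (msq M (\<lambda>_. 1::real) + 1\<^sup>2 * msq M u + 1\<^sup>2 * msq M y + 1\<^sup>2 * msq M z)"
    by (rule msq_le_of_norm_le) (use sq in auto)
  then have kb: "msq M ?k \<le> 4 * (1 + 3 * Cm)" using b by simp
  have eq: "local_error Lx Ly Lt h (u \<omega>) (u' \<omega>) (y \<omega>) (y' \<omega>) (z \<omega>)
    = (Lt * sqrt h) *\<^sub>R ?k \<omega> + Lx *\<^sub>R norm (u \<omega> - u' \<omega>) + Ly *\<^sub>R norm (y \<omega> - y' \<omega>)" for \<omega>
    by (simp add: local_error_def)
  show "sq_int M (\<lambda>\<omega>. local_error Lx Ly Lt h (u \<omega>) (u' \<omega>) (y \<omega>) (y' \<omega>) (z \<omega>))"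
    unfolding eq by (intro sq_int_add sq_int_scaleR sq_int_norm sq k sq_int_const)
  have "msq M (\<lambda>\<omega>. local_error Lx Ly Lt h (u \<omega>) (u' \<omega>) (y \<omega>) (y' \<omega>) (z \<omega>))
    \<le> 4 * (msq M (\<lambda>_. 0::real) + (\<bar>Lt\<bar> * sqrt h)\<^sup>2 * msq M ?k + \<bar>Lx\<bar>\<^sup>2 * msq M (\<lambda>\<omega>. u \<omega> - u' \<omega>) + \<bar>Ly\<bar>\<^sup>2 * msq M (\<lambda>\<omega>. y \<omega> - y' \<omega>))"
  proof (rule msq_le_of_norm_le[OF _ k sq(4,5)])
    fix \<omega>
    have "norm (local_error Lx Ly Lt h (u \<omega>) (u' \<omega>) (y \<omega>) (y' \<omega>) (z \<omega>))
      \<le> \<bar>Lt * sqrt h * ?k \<omega>\<bar> + \<bar>Lx * norm (u \<omega> - u' \<omega>)\<bar> + \<bar>Ly * norm (y \<omega> - y' \<omega>)\<bar>"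
      unfolding local_error_def real_norm_def by linarith
    then show "norm (local_error Lx Ly Lt h (u \<omega>) (u' \<omega>) (y \<omega>) (y' \<omega>) (z \<omega>))
      \<le> 0 + \<bar>Lt\<bar> * sqrt h * norm (?k \<omega>) + \<bar>Lx\<bar> * norm (u \<omega> - u' \<omega>) + \<bar>Ly\<bar> * norm (y \<omega> - y' \<omega>)"
      using h(1) by (simp add: abs_mult)
  qed simp
  also have "\<dots> \<le> 4 * (0 + Lt\<^sup>2 * m * (4 * (1 + 3 * Cm)) + Lx\<^sup>2 * (C1 * m) + Ly\<^sup>2 * (C1 * m))"
  proof (intro mult_left_mono add_mono)
    show "(\<bar>Lt\<bar> * sqrt h)\<^sup>2 * msq M ?k \<le> Lt\<^sup>2 * m * (4 * (1 + 3 * Cm))"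
      using h kb by (intro mult_mono) (auto simp: power_mult_distrib intro: mult_left_mono)
  qed (use b in \<open>auto intro: mult_left_mono\<close>)
  finally show "msq M (\<lambda>\<omega>. local_error Lx Ly Lt h (u \<omega>) (u' \<omega>) (y \<omega>) (y' \<omega>) (z \<omega>))
      \<le> 4 * (Lt\<^sup>2 * (4 * (1 + 3 * Cm)) + Lx\<^sup>2 * C1 + Ly\<^sup>2 * C1) * m"
    by (simp add: algebra_simps)
qed

text \<open>Given a bound \<open>Cm\<close> for the second moments of the scheme, the three constants bound the second
  moments of the frozen coefficients, the squared distance of step process and path per unit of mesh
  size, and the squared local errors per unit of mesh size.\<close>

definition step_const :: "real \<Rightarrow> real"
  where "step_const Cm = 4 * ((L0 L)\<^sup>2 + ((Lbx L)\<^sup>2 + (Lby L)\<^sup>2 + (Lbz L)\<^sup>2 + (Lsx L)\<^sup>2 + (Lsy L)\<^sup>2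
    + (Lfx L)\<^sup>2 + (Lfy L)\<^sup>2 + (Lfz L)\<^sup>2) * Cm) + Cm"

definition path_const :: "real \<Rightarrow> real"
  where "path_const Cm = (2 * T + 2) * step_const Cm"

definition eps_const :: "real \<Rightarrow> real"
  where "eps_const Cm = 4 * (((Lbt L)\<^sup>2 + (Lst L)\<^sup>2 + (Lft L)\<^sup>2) * (4 * (1 + 3 * Cm))
    + ((Lbx L)\<^sup>2 + (Lsx L)\<^sup>2) * path_const Cm + ((Lby L)\<^sup>2 + (Lsy L)\<^sup>2 + (Lfy L)\<^sup>2) * path_const Cm)"

end

text \<open>One sweep of the scheme with control \<open>z\<close> and reference \<open>r\<close>, abstracted from the networks that
  produce the control.\<close>

locale euler_scheme = fbsde_setting M W P L
  for M :: "'a measure" and W :: "real \<Rightarrow> 'a \<Rightarrow> real^'d" and P :: "('d::finite, 'm::finite) fbsde" and L :: reg_consts +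
  fixes \<pi> :: "real list" and \<theta> :: "real^'m" and x r :: "nat \<Rightarrow> 'a \<Rightarrow> real^'d" and y :: "nat \<Rightarrow> 'a \<Rightarrow> real^'m"
    and z :: "nat \<Rightarrow> 'a \<Rightarrow> real^'d^'m" and Cm :: real
  assumes \<pi>: "is_partition T \<pi>"
    and x0: "\<And>\<omega>. x 0 \<omega> = start P" and y0: "\<And>\<omega>. y 0 \<omega> = \<theta>"
    and x_Suc: "\<And>n \<omega>. n < cells \<pi> \<Longrightarrow> x (Suc n) \<omega> = x n \<omega> + (\<pi> ! Suc n - \<pi> ! n) *\<^sub>R drift P (\<pi> ! n) (x n \<omega>) (y n \<omega>) (z n \<omega>)
      + diffusion P (\<pi> ! n) (x n \<omega>) (y n \<omega>) *v (W (\<pi> ! Suc n) \<omega> - W (\<pi> ! n) \<omega>)"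
    and y_Suc: "\<And>n \<omega>. n < cells \<pi> \<Longrightarrow> y (Suc n) \<omega> = y n \<omega> + (\<pi> ! Suc n - \<pi> ! n) *\<^sub>R (- driver P (\<pi> ! n) (r n \<omega>) (y n \<omega>) (z n \<omega>))
      + z n \<omega> *v (W (\<pi> ! Suc n) \<omega> - W (\<pi> ! n) \<omega>)"
    and meas: "\<And>n. n \<le> cells \<pi> \<Longrightarrow> x n \<in> borel_measurable (F (\<pi> ! n))" "\<And>n. n \<le> cells \<pi> \<Longrightarrow> y n \<in> borel_measurable (F (\<pi> ! n))"
      "\<And>n. n \<le> cells \<pi> \<Longrightarrow> z n \<in> borel_measurable (F (\<pi> ! n))" "\<And>n. n \<le> cells \<pi> \<Longrightarrow> r n \<in> borel_measurable (F (\<pi> ! n))"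
    and sq: "\<And>n. n \<le> cells \<pi> \<Longrightarrow> sq_int M (x n)" "\<And>n. n \<le> cells \<pi> \<Longrightarrow> sq_int M (y n)"
      "\<And>n. n \<le> cells \<pi> \<Longrightarrow> sq_int M (z n)" "\<And>n. n \<le> cells \<pi> \<Longrightarrow> sq_int M (r n)"
    and bd: "\<And>n. n \<le> cells \<pi> \<Longrightarrow> msq M (x n) \<le> Cm" "\<And>n. n \<le> cells \<pi> \<Longrightarrow> msq M (y n) \<le> Cm"
      "\<And>n. n \<le> cells \<pi> \<Longrightarrow> msq M (z n) \<le> Cm" "\<And>n. n \<le> cells \<pi> \<Longrightarrow> msq M (r n) \<le> Cm"
begin

lemma Cm_nonneg: "0 \<le> Cm"
  using bd(1)[of 0] msq_nonneg[of M "x 0"] by linarith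

lemma step_const_bounds:
  "4 * ((L0 L)\<^sup>2 + (Lbx L)\<^sup>2 * Cm + (Lby L)\<^sup>2 * Cm + (Lbz L)\<^sup>2 * Cm) \<le> step_const Cm"
  "4 * ((L0 L)\<^sup>2 + (Lsx L)\<^sup>2 * Cm + (Lsy L)\<^sup>2 * Cm) \<le> step_const Cm"
  "4 * ((L0 L)\<^sup>2 + (Lfx L)\<^sup>2 * Cm + (Lfy L)\<^sup>2 * Cm + (Lfz L)\<^sup>2 * Cm) \<le> step_const Cm"
  "Cm \<le> step_const Cm" "0 \<le> step_const Cm"
  using Cm_nonneg unfolding step_const_def distrib_left distrib_right
  by (auto intro!: add_nonneg_nonneg simp: add_increasing)

definition b_step :: "nat \<Rightarrow> 'a \<Rightarrow> real^'d"
  where "b_step n \<omega> = drift P (\<pi> ! n) (x n \<omega>) (y n \<omega>) (z n \<omega>)"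

definition s_step :: "nat \<Rightarrow> 'a \<Rightarrow> real^'d^'d"
  where "s_step n \<omega> = diffusion P (\<pi> ! n) (x n \<omega>) (y n \<omega>)"

definition f_step :: "nat \<Rightarrow> 'a \<Rightarrow> real^'m"
  where "f_step n \<omega> = driver P (\<pi> ! n) (r n \<omega>) (y n \<omega>) (z n \<omega>)"

lemma step_coeffs:
  assumes n: "n \<le> cells \<pi>"
  shows "b_step n \<in> borel_measurable (F (\<pi> ! n))" "s_step n \<in> borel_measurable (F (\<pi> ! n))" "f_step n \<in> borel_measurable (F (\<pi> ! n))"
    and "sq_int M (b_step n)" "sq_int M (s_step n)" "sq_int M (f_step n)"
    and "msq M (b_step n) \<le> step_const Cm" "msq M (s_step n) \<le> step_const Cm" "msq M (f_step n) \<le> step_const Cm"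
proof -
  have t: "\<pi> ! n \<in> {0..T}" by (rule partition_in[OF \<pi> n])
  note m = meas[OF n] and s = sq[OF n] and b = bd[OF n]
  show "b_step n \<in> borel_measurable (F (\<pi> ! n))"
    unfolding b_step_def[abs_def] by (rule coeff_measurable[OF drift_regular measurable_const m(1-3)]) (use t in auto)
  show "s_step n \<in> borel_measurable (F (\<pi> ! n))"
    unfolding s_step_def[abs_def] by (rule coeff_measurable[OF diffusion_regular measurable_const m(1-3)]) (use t in auto)
  show "f_step n \<in> borel_measurable (F (\<pi> ! n))"
    unfolding f_step_def[abs_def] by (rule coeff_measurable[OF driver_regular measurable_const m(4,2,3)]) (use t in auto)
  show "sq_int M (b_step n)" "sq_int M (s_step n)" "sq_int M (f_step n)"
    unfolding b_step_def[abs_def] s_step_def[abs_def] f_step_def[abs_def]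
    by (rule coeff_sq_int(1)[OF drift_regular t s(1-3)] coeff_sq_int(1)[OF diffusion_regular t s(1-3)] coeff_sq_int(1)[OF driver_regular t s(4,2,3)])+
  have le: "4 * ((L0 L)\<^sup>2 + a\<^sup>2 * msq M u + a'\<^sup>2 * msq M v + a''\<^sup>2 * msq M w) \<le> 4 * ((L0 L)\<^sup>2 + a\<^sup>2 * Cm + a'\<^sup>2 * Cm + a''\<^sup>2 * Cm)"
    if "msq M u \<le> Cm" "msq M v \<le> Cm" "msq M w \<le> Cm"
    for a a' a'' :: real and u :: "'a \<Rightarrow> real^'d" and v :: "'a \<Rightarrow> real^'m" and w :: "'a \<Rightarrow> real^'d^'m"
    using that by (intro mult_left_mono add_mono order_refl) auto
  show "msq M (b_step n) \<le> step_const Cm"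
    unfolding b_step_def[abs_def] using coeff_sq_int(2)[OF drift_regular t s(1-3)] le[OF b(1-3), of "Lbx L" "Lby L" "Lbz L"] step_const_bounds(1)
    by linarith
  show "msq M (s_step n) \<le> step_const Cm"
    unfolding s_step_def[abs_def] using coeff_sq_int(2)[OF diffusion_regular t s(1-3)] le[OF b(1-3), of "Lsx L" "Lsy L" 0] step_const_bounds(2)
    by simp
  show "msq M (f_step n) \<le> step_const Cm"
    unfolding f_step_def[abs_def] using coeff_sq_int(2)[OF driver_regular t s(4,2,3)] le[OF b(4,2,3), of "Lfx L" "Lfy L" "Lfz L"] step_const_bounds(3)
    by linarith
qed

definition X_path :: "real \<Rightarrow> 'a \<Rightarrow> real^'d"
  where "X_path = euler_path \<pi> (start P) b_step s_step"

definition Y_path :: "real \<Rightarrow> 'a \<Rightarrow> real^'m"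
  where "Y_path = euler_path \<pi> \<theta> (\<lambda>n \<omega>. - f_step n \<omega>) z"

lemma x_step: "n < cells \<pi> \<Longrightarrow> x (Suc n) \<omega> = x n \<omega> + (\<pi> ! Suc n - \<pi> ! n) *\<^sub>R b_step n \<omega> + s_step n \<omega> *v (W (\<pi> ! Suc n) \<omega> - W (\<pi> ! n) \<omega>)"
  using x_Suc by (simp add: b_step_def s_step_def)

lemma y_step: "n < cells \<pi> \<Longrightarrow> y (Suc n) \<omega> = y n \<omega> + (\<pi> ! Suc n - \<pi> ! n) *\<^sub>R (- f_step n \<omega>) + z n \<omega> *v (W (\<pi> ! Suc n) \<omega> - W (\<pi> ! n) \<omega>)"
  using y_Suc by (simp add: f_step_def)

lemma X_path:
  shows "t \<in> {0..T} \<Longrightarrow> sq_int M (\<lambda>\<omega>. X_path t \<omega> - interpolate \<pi> x t \<omega>)"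
    and "t \<in> {0..T} \<Longrightarrow> msq M (\<lambda>\<omega>. X_path t \<omega> - interpolate \<pi> x t \<omega>) \<le> path_const Cm * mesh \<pi>"
    and "cont_L2 X_path"
proof -
  note r = euler_path_one_step[OF \<pi> x0 x_step meas(1) sq(1) bd(1) step_coeffs(1) step_coeffs(4) step_coeffs(7)
      step_coeffs(2) step_coeffs(5) step_coeffs(8) step_const_bounds(5)]
  show "t \<in> {0..T} \<Longrightarrow> sq_int M (\<lambda>\<omega>. X_path t \<omega> - interpolate \<pi> x t \<omega>)"
    unfolding X_path_def by (rule r(1)) auto
  show "t \<in> {0..T} \<Longrightarrow> msq M (\<lambda>\<omega>. X_path t \<omega> - interpolate \<pi> x t \<omega>) \<le> path_const Cm * mesh \<pi>"
    unfolding X_path_def path_const_def by (rule r(2)) auto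
  show "cont_L2 X_path" unfolding X_path_def by (rule r(3)) auto
qed

lemma Y_path:
  shows "t \<in> {0..T} \<Longrightarrow> sq_int M (\<lambda>\<omega>. Y_path t \<omega> - interpolate \<pi> y t \<omega>)"
    and "t \<in> {0..T} \<Longrightarrow> msq M (\<lambda>\<omega>. Y_path t \<omega> - interpolate \<pi> y t \<omega>) \<le> path_const Cm * mesh \<pi>"
    and "cont_L2 Y_path"
proof -
  have f: "(\<lambda>\<omega>. - f_step n \<omega>) \<in> borel_measurable (F (\<pi> ! n))" "sq_int M (\<lambda>\<omega>. - f_step n \<omega>)"
    "msq M (\<lambda>\<omega>. - f_step n \<omega>) \<le> step_const Cm" if "n \<le> cells \<pi>" for n
    using step_coeffs(3,6,9)[OF that] by (auto simp: msq_def)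
  have zb: "msq M (z n) \<le> step_const Cm" if "n \<le> cells \<pi>" for n
    using bd(3)[OF that] step_const_bounds(4) by linarith
  note r = euler_path_one_step[OF \<pi> y0 y_step meas(2) sq(2) bd(2) f meas(3) sq(3) zb step_const_bounds(5)]
  show "t \<in> {0..T} \<Longrightarrow> sq_int M (\<lambda>\<omega>. Y_path t \<omega> - interpolate \<pi> y t \<omega>)"
    unfolding Y_path_def by (rule r(1)) auto
  show "t \<in> {0..T} \<Longrightarrow> msq M (\<lambda>\<omega>. Y_path t \<omega> - interpolate \<pi> y t \<omega>) \<le> path_const Cm * mesh \<pi>"
    unfolding Y_path_def path_const_def by (rule r(2)) auto
  show "cont_L2 Y_path" unfolding Y_path_def by (rule r(3)) auto
qed

lemma path_end: "X_path T \<omega> = x (cells \<pi>) \<omega>" "Y_path T \<omega> = y (cells \<pi>) \<omega>"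
  using euler_path_grid[where u=x and \<omega>=\<omega> and a=b_step and s=s_step, OF \<pi> x0 x_step order_refl]
    euler_path_grid[where u=y and \<omega>=\<omega> and a="\<lambda>n \<omega>. - f_step n \<omega>" and s=z, OF \<pi> y0 y_step order_refl]
  unfolding X_path_def Y_path_def partition_ends(2)[OF \<pi>] by simp_all

end

context fbsde_setting
begin

definition error_const :: "real \<Rightarrow> real \<Rightarrow> real"
  where "error_const \<delta> Cm =
    (1 + \<delta>) * (1 + K_F T L) * (3 * exp (beta_f L * T)) * (2 * (1 + 1 / \<delta>) + T * eps_const Cm)
    + (1 + \<delta>) * (exp (kappa_x T L * T) * (8 * T\<^sup>2 + 8 * T)) * eps_const Cm
    + 2 * (1 + 1 / \<delta>) * path_const Cm"

lemma terminal_sq_int: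
  assumes "sq_int M u" shows "sq_int M (\<lambda>\<omega>. terminal P (u \<omega>))"
proof (rule sq_int_dominated)
  show "(\<lambda>\<omega>. terminal P (u \<omega>)) \<in> borel_measurable M"
    using mc measurable_compose[OF sq_int_measurable[OF assms], of "terminal P" borel] by (simp add: measurable_coefficients_def)
  show "integrable M (\<lambda>\<omega>. 2 * (Lg L)\<^sup>2 * (norm (u \<omega>))\<^sup>2 + 2 * (norm (terminal P 0))\<^sup>2)"
    using sq_int_integrable[OF assms] by simp
  fix \<omega>
  have "(norm (terminal P (u \<omega>)))\<^sup>2 \<le> 2 * (norm (terminal P (u \<omega>) - terminal P 0))\<^sup>2 + 2 * (norm (terminal P 0))\<^sup>2"
    using norm_add_sq_le[of "terminal P (u \<omega>) - terminal P 0" "terminal P 0"] by simp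
  also have "(norm (terminal P (u \<omega>) - terminal P 0))\<^sup>2 \<le> (Lg L * norm (u \<omega> - 0))\<^sup>2"
    by (intro power_mono coeff_Lipschitz(4)) auto
  finally show "(norm (terminal P (u \<omega>)))\<^sup>2 \<le> 2 * (Lg L)\<^sup>2 * (norm (u \<omega>))\<^sup>2 + 2 * (norm (terminal P 0))\<^sup>2"
    by (simp add: power_mult_distrib)
qed

lemma LBINT_singleton: "(LBINT s:{a}. f s) = (0::'b::{banach, second_countable_topology})"
  unfolding set_lebesgue_integral_def
proof (rule integral_eq_zero_AE)
  show "AE s in lborel. indicator {a} s *\<^sub>R f s = 0"
    using AE_lborel_singleton[of a] by eventually_elim simp
qed

end

context euler_scheme
begin

lemma interpolate_at:
  assumes "t \<in> {0..T}"
  shows "sq_int M (interpolate \<pi> x t)" "sq_int M (interpolate \<pi> y t)" "sq_int M (interpolate \<pi> z t)" "sq_int M (interpolate \<pi> r t)"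
    and "msq M (interpolate \<pi> x t) \<le> Cm" "msq M (interpolate \<pi> y t) \<le> Cm" "msq M (interpolate \<pi> z t) \<le> Cm" "msq M (interpolate \<pi> r t) \<le> Cm"
  unfolding interpolate_grid_index[OF \<pi>]
  using sq[OF grid_index_bounds(1)[OF \<pi> assms]] bd[OF grid_index_bounds(1)[OF \<pi> assms]] by auto

lemma eps_const_bounds:
  "4 * ((Lbt L)\<^sup>2 * (4 * (1 + 3 * Cm)) + (Lbx L)\<^sup>2 * path_const Cm + (Lby L)\<^sup>2 * path_const Cm) \<le> eps_const Cm"
  "4 * ((Lst L)\<^sup>2 * (4 * (1 + 3 * Cm)) + (Lsx L)\<^sup>2 * path_const Cm + (Lsy L)\<^sup>2 * path_const Cm) \<le> eps_const Cm"
  "4 * ((Lft L)\<^sup>2 * (4 * (1 + 3 * Cm)) + 0\<^sup>2 * path_const Cm + (Lfy L)\<^sup>2 * path_const Cm) \<le> eps_const Cm"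
  "0 \<le> eps_const Cm" "0 \<le> path_const Cm"
proof -
  have p: "0 \<le> path_const Cm" using step_const_bounds(5) T_pos by (simp add: path_const_def)
  have c: "0 \<le> 4 * (1 + 3 * Cm)" using Cm_nonneg by simp
  define p1 where "p1 = (Lbt L)\<^sup>2 * (4 * (1 + 3 * Cm))"
  define p2 where "p2 = (Lst L)\<^sup>2 * (4 * (1 + 3 * Cm))"
  define p3 where "p3 = (Lft L)\<^sup>2 * (4 * (1 + 3 * Cm))"
  define q1 where "q1 = (Lbx L)\<^sup>2 * path_const Cm"
  define q2 where "q2 = (Lsx L)\<^sup>2 * path_const Cm"
  define r1 where "r1 = (Lby L)\<^sup>2 * path_const Cm"
  define r2 where "r2 = (Lsy L)\<^sup>2 * path_const Cm"
  define r3 where "r3 = (Lfy L)\<^sup>2 * path_const Cm"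
  have n: "0 \<le> p1" "0 \<le> p2" "0 \<le> p3" "0 \<le> q1" "0 \<le> q2" "0 \<le> r1" "0 \<le> r2" "0 \<le> r3"
    using p c by (simp_all add: p1_def p2_def p3_def q1_def q2_def r1_def r2_def r3_def)
  have eps: "eps_const Cm = 4 * (p1 + p2 + p3 + (q1 + q2) + (r1 + r2 + r3))"
    unfolding eps_const_def p1_def p2_def p3_def q1_def q2_def r1_def r2_def r3_def by (simp only: distrib_right)
  show "4 * ((Lbt L)\<^sup>2 * (4 * (1 + 3 * Cm)) + (Lbx L)\<^sup>2 * path_const Cm + (Lby L)\<^sup>2 * path_const Cm) \<le> eps_const Cm"
    "4 * ((Lst L)\<^sup>2 * (4 * (1 + 3 * Cm)) + (Lsx L)\<^sup>2 * path_const Cm + (Lsy L)\<^sup>2 * path_const Cm) \<le> eps_const Cm"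
    "4 * ((Lft L)\<^sup>2 * (4 * (1 + 3 * Cm)) + 0\<^sup>2 * path_const Cm + (Lfy L)\<^sup>2 * path_const Cm) \<le> eps_const Cm"
    "0 \<le> eps_const Cm" "0 \<le> path_const Cm"
    unfolding eps p1_def[symmetric] p2_def[symmetric] p3_def[symmetric] q1_def[symmetric] q2_def[symmetric]
      r1_def[symmetric] r2_def[symmetric] r3_def[symmetric] power_zero_numeral mult_zero_left
    subgoal using n by simp
    subgoal using n by simp
    subgoal using n by simp
    subgoal using n by simp
    subgoal by (rule p)
    done
qed

text \<open>The comparison of a sweep of the scheme with an exact decoupled system. The parameter \<open>\<delta>\<close> weighs the
  distance \<open>\<rho>\<close> of the references against everything that vanishes with the mesh size or with the terminal
  errors: it enters once when the terminal value is split, and once when the continuous paths are replaced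
  by the step processes.\<close>

lemma scheme_stability:
  fixes X R :: "real \<Rightarrow> 'a \<Rightarrow> real^'d" and Y :: "real \<Rightarrow> 'a \<Rightarrow> real^'m" and Z :: "real \<Rightarrow> 'a \<Rightarrow> real^'d^'m"
  assumes X: "proc_L2 X" "\<And>t. t \<in> {0..T} \<Longrightarrow> sq_int M (X t)"
    and Y: "proc_L2 Y" "\<And>t. t \<in> {0..T} \<Longrightarrow> sq_int M (Y t)"
    and R: "proc_L2 R" "\<And>t. t \<in> {0..T} \<Longrightarrow> sq_int M (R t)"
    and Z: "proc_L2 Z"
    and Is: "ito (\<lambda>s \<omega>. diffusion P s (X s \<omega>) (Y s \<omega>)) Is" and Iz: "ito Z Iz"
    and fwd: "AE \<omega> in M. \<forall>t\<in>{0..T}. X t \<omega> = start P + (LBINT s:{0..t}. drift P s (X s \<omega>) (Y s \<omega>) (Z s \<omega>)) + Is t \<omega>"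
    and bwd: "AE \<omega> in M. \<forall>t\<in>{0..T}. Y t \<omega> = terminal P (R T \<omega>)
      + (LBINT s:{t..T}. driver P s (R s \<omega>) (Y s \<omega>) (Z s \<omega>)) - (Iz T \<omega> - Iz t \<omega>)"
    and \<rho>: "\<And>t. t \<in> {0..T} \<Longrightarrow> msq M (\<lambda>\<omega>. interpolate \<pi> r t \<omega> - R t \<omega>) \<le> \<rho>"
    and \<delta>: "0 < \<delta>" and t: "t \<in> {0..T}"
  shows "msq M (\<lambda>\<omega>. interpolate \<pi> x t \<omega> - X t \<omega>) + msq M (\<lambda>\<omega>. interpolate \<pi> y t \<omega> - Y t \<omega>)
      + msq Q (\<lambda>(s, \<omega>). interpolate \<pi> z s \<omega> - Z s \<omega>)
    \<le> error_const \<delta> Cm * (mesh \<pi> + msq M (\<lambda>\<omega>. terminal P (x (cells \<pi>) \<omega>) - y (cells \<pi>) \<omega>)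
        + msq M (\<lambda>\<omega>. terminal P (x (cells \<pi>) \<omega>) - terminal P (r (cells \<pi>) \<omega>)))
      + (1 + \<delta>)\<^sup>2 * ((1 + K_F T L) * K_B T L) * \<rho>"
proof -
  let ?N = "cells \<pi>"
  define m where "m = mesh \<pi>"
  define lo where "lo = msq M (\<lambda>\<omega>. terminal P (x ?N \<omega>) - y ?N \<omega>)"
  define \<tau> where "\<tau> = msq M (\<lambda>\<omega>. terminal P (x ?N \<omega>) - terminal P (r ?N \<omega>))"
  define \<epsilon> where "\<epsilon> = eps_const Cm * m"
  have T0: "0 \<in> {0..T}" "T \<in> {0..T}" "0 \<le> T" using T_pos by auto
  have m: "0 \<le> m" using mesh_bounds[OF \<pi>] by (simp add: m_def)
  have lo\<tau>: "0 \<le> lo" "0 \<le> \<tau>" by (simp_all add: lo_def \<tau>_def)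
  have \<rho>0: "0 \<le> \<rho>" using \<rho>[OF T0(1)] msq_nonneg order_trans by blast
  obtain X' where X': "proc_L2 X'" "\<And>t. t \<in> {0..T} \<Longrightarrow> sq_int M (X' t)" "AE \<omega> in M. \<forall>t\<in>{0..T}. X' t \<omega> = X_path t \<omega>"
    using cont_L2_modification[OF X_path(3)] by blast
  obtain Y' where Y': "proc_L2 Y'" "\<And>t. t \<in> {0..T} \<Longrightarrow> sq_int M (Y' t)" "AE \<omega> in M. \<forall>t\<in>{0..T}. Y' t \<omega> = Y_path t \<omega>"
    using cont_L2_modification[OF Y_path(3)] by blast
  note at = interpolate_at
  have close: "sq_int M (\<lambda>\<omega>. interpolate \<pi> u s \<omega> - V' s \<omega>) \<and> msq M (\<lambda>\<omega>. interpolate \<pi> u s \<omega> - V' s \<omega>) \<le> path_const Cm * m"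
    if s: "s \<in> {0..T}" and u: "sq_int M (interpolate \<pi> u s)" and V': "sq_int M (V' s)" "AE \<omega> in M. \<forall>t\<in>{0..T}. V' t \<omega> = V t \<omega>"
      and V: "sq_int M (\<lambda>\<omega>. V s \<omega> - interpolate \<pi> u s \<omega>)" "msq M (\<lambda>\<omega>. V s \<omega> - interpolate \<pi> u s \<omega>) \<le> path_const Cm * mesh \<pi>"
    for s u and V V' :: "real \<Rightarrow> 'a \<Rightarrow> 'e::euclidean_space"
  proof
    show "sq_int M (\<lambda>\<omega>. interpolate \<pi> u s \<omega> - V' s \<omega>)" by (intro sq_int_diff u V')
    have "msq M (\<lambda>\<omega>. V' s \<omega> - interpolate \<pi> u s \<omega>) = msq M (\<lambda>\<omega>. V s \<omega> - interpolate \<pi> u s \<omega>)"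
    proof (rule msq_cong_AE)
      show "AE \<omega> in M. V' s \<omega> - interpolate \<pi> u s \<omega> = V s \<omega> - interpolate \<pi> u s \<omega>"
        using V'(2) by eventually_elim (use s in simp)
    qed (intro sq_int_measurable sq_int_diff u V', rule sq_int_measurable[OF V(1)])
    then show "msq M (\<lambda>\<omega>. interpolate \<pi> u s \<omega> - V' s \<omega>) \<le> path_const Cm * m"
      using V(2) msq_minus_commute[of M "interpolate \<pi> u s" "V' s"] by (simp add: m_def)
  qed
  have dx: "sq_int M (\<lambda>\<omega>. interpolate \<pi> x s \<omega> - X' s \<omega>)" "msq M (\<lambda>\<omega>. interpolate \<pi> x s \<omega> - X' s \<omega>) \<le> path_const Cm * m"
    if s: "s \<in> {0..T}" for s
    using close[OF s at(1)[OF s] X'(2)[OF s] X'(3) X_path(1,2)[OF s]] by auto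
  have dy: "sq_int M (\<lambda>\<omega>. interpolate \<pi> y s \<omega> - Y' s \<omega>)" "msq M (\<lambda>\<omega>. interpolate \<pi> y s \<omega> - Y' s \<omega>) \<le> path_const Cm * m"
    if s: "s \<in> {0..T}" for s
    using close[OF s at(2)[OF s] Y'(2)[OF s] Y'(3) Y_path(1,2)[OF s]] by auto
  define DX where "DX s \<omega> = X' s \<omega> - X s \<omega>" for s \<omega>
  define DY where "DY s \<omega> = Y' s \<omega> - Y s \<omega>" for s \<omega>
  define H where "H s \<omega> = interpolate \<pi> z s \<omega> - Z s \<omega>" for s \<omega>
  have DX: "proc_L2 DX" "\<And>s. s \<in> {0..T} \<Longrightarrow> sq_int M (DX s)"
    unfolding DX_def[abs_def] by (intro proc_L2_diff X' X) (intro sq_int_diff X' X)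
  have DY: "proc_L2 DY" "\<And>s. s \<in> {0..T} \<Longrightarrow> sq_int M (DY s)"
    unfolding DY_def[abs_def] by (intro proc_L2_diff Y' Y) (intro sq_int_diff Y' Y)
  have zp: "proc_L2 (interpolate \<pi> z)" by (rule interpolate_proc_L2[OF \<pi> meas(3) sq(3)])
  have H: "proc_L2 H" unfolding H_def[abs_def] by (intro proc_L2_diff zp Z)
  define B where "B = interpolate \<pi> b_step"
  define S where "S = interpolate \<pi> s_step"
  define G where "G = interpolate \<pi> f_step"
  have step_p: "proc_L2 B" "proc_L2 S" "proc_L2 G"
    unfolding B_def S_def G_def by (intro interpolate_proc_L2[OF \<pi>] step_coeffs; assumption)+
  define bX where "bX s \<omega> = drift P s (X s \<omega>) (Y s \<omega>) (Z s \<omega>)" for s \<omega>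
  define fX where "fX s \<omega> = driver P s (R s \<omega>) (Y s \<omega>) (Z s \<omega>)" for s \<omega>
  have bX: "proc_L2 bX" unfolding bX_def[abs_def] by (rule coeff_proc_L2[OF drift_regular X(1) Y(1) Z])
  have fX: "proc_L2 fX" unfolding fX_def[abs_def] by (rule coeff_proc_L2[OF driver_regular R(1) Y(1) Z])
  define NX where "NX s \<omega> = elem_integral (grid_elem \<pi> s_step) s \<omega> - Is s \<omega>" for s \<omega>
  define NY where "NY s \<omega> = elem_integral (grid_elem \<pi> z) s \<omega> - Iz s \<omega>" for s \<omega>
  have NX: "ito (\<lambda>s \<omega>. S s \<omega> - diffusion P s (X s \<omega>) (Y s \<omega>)) NX"
    unfolding NX_def[abs_def] S_def by (rule ito_diff[OF grid_elem_ito[OF \<pi> step_coeffs(2) step_coeffs(5)] Is])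
  have NY: "ito H NY"
    unfolding NY_def[abs_def] H_def[abs_def] by (rule ito_diff[OF grid_elem_ito[OF \<pi> meas(3) sq(3)] Iz])
  let ?gi = "grid_index \<pi>"
  have gi: "\<pi> ! ?gi s \<in> {0..T}" "0 \<le> \<bar>\<pi> ! ?gi s - s\<bar>" "\<bar>\<pi> ! ?gi s - s\<bar> \<le> m" if s: "s \<in> {0..T}" for s
    using partition_in[OF \<pi> grid_index_bounds(1)[OF \<pi> s]] grid_index_bounds(2,3)[OF \<pi> s] by (auto simp: m_def)

  \<comment> \<open>The backward difference solves a linear equation whose terminal value and driver only see the reference.\<close>
  define eY where "eY s \<omega> = local_error 0 (Lfy L) (Lft L) \<bar>\<pi> ! ?gi s - s\<bar> (interpolate \<pi> r s \<omega>) (interpolate \<pi> r s \<omega>)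
    (interpolate \<pi> y s \<omega>) (Y' s \<omega>) (interpolate \<pi> z s \<omega>)" for s \<omega>
  have eY: "sq_int M (eY s)" "msq M (eY s) \<le> \<epsilon>" if s: "s \<in> {0..T}" for s
  proof -
    have z0: "sq_int M (\<lambda>\<omega>. interpolate \<pi> r s \<omega> - interpolate \<pi> r s \<omega>)"
      "msq M (\<lambda>\<omega>. interpolate \<pi> r s \<omega> - interpolate \<pi> r s \<omega>) \<le> path_const Cm * m"
      using eps_const_bounds(5) m by (simp_all add: msq_def)
    note le = local_error_msq[OF at(4)[OF s] at(2)[OF s] at(3)[OF s] z0(1) dy(1)[OF s] at(8)[OF s] at(6)[OF s] at(7)[OF s]
        z0(2) dy(2)[OF s] gi(2,3)[OF s], of 0 "Lfy L" "Lft L"]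
    show "sq_int M (eY s)" unfolding eY_def[abs_def] by (rule le(1))
    have "msq M (eY s) \<le> 4 * ((Lft L)\<^sup>2 * (4 * (1 + 3 * Cm)) + 0\<^sup>2 * path_const Cm + (Lfy L)\<^sup>2 * path_const Cm) * m"
      unfolding eY_def[abs_def] by (rule le(2))
    also have "\<dots> \<le> \<epsilon>" unfolding \<epsilon>_def by (intro mult_right_mono eps_const_bounds m)
    finally show "msq M (eY s) \<le> \<epsilon>" .
  qed
  have R\<rho>: "sq_int M (\<lambda>\<omega>. norm (interpolate \<pi> r s \<omega> - R s \<omega>))" "msq M (\<lambda>\<omega>. norm (interpolate \<pi> r s \<omega> - R s \<omega>)) \<le> \<rho>"
    if s: "s \<in> {0..T}" for s
    using \<rho>[OF s] by (auto intro!: sq_int_norm sq_int_diff at R s)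
  have boundY: "norm (G s \<omega> - fX s \<omega>) \<le> eY s \<omega> + Lfx L * norm (interpolate \<pi> r s \<omega> - R s \<omega>)
      + Lfy L * norm (DY s \<omega>) + Lfz L * norm (H s \<omega>)" if s: "s \<in> {0..T}" for s \<omega>
    using coeff_local_error[OF driver_regular gi(1)[OF s] s, of "interpolate \<pi> r s \<omega>" "interpolate \<pi> y s \<omega>" "interpolate \<pi> z s \<omega>"
        "R s \<omega>" "Y s \<omega>" "Z s \<omega>" "interpolate \<pi> r s \<omega>" "Y' s \<omega>"]
    unfolding G_def fX_def eY_def DY_def H_def f_step_def interpolate_grid_index[OF \<pi>] by (simp add: local_error_def)
  have AEfX: "AE \<omega> in M. \<forall>a\<ge>0. \<forall>b\<le>T. (LBINT s:{a..b}. G s \<omega> - fX s \<omega>) = (LBINT s:{a..b}. G s \<omega>) - (LBINT s:{a..b}. fX s \<omega>)"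
    by (rule AE_LBINT_diff[OF proc_L2_D(2)[OF step_p(3)] proc_L2_D(2)[OF fX]])
  have neg: "(LBINT u:{0..s}. interpolate \<pi> (\<lambda>n \<omega>. - f_step n \<omega>) u \<omega>) = - (LBINT u:{0..s}. G u \<omega>)" for s \<omega>
    unfolding G_def interpolate_grid_index[OF \<pi>] by (simp add: set_lebesgue_integral_def)
  have eqY: "AE \<omega> in M. DY s \<omega> = DY T \<omega> + (LBINT u:{s..T}. G u \<omega> - fX u \<omega>) - (NY T \<omega> - NY s \<omega>)" if s: "s \<in> {0..T}" for s
    using Y'(3) bwd AEfX AE_sq_int_section[OF proc_L2_D(2)[OF step_p(3)]]
  proof eventually_elim
    case (elim \<omega>)
    have p: "Y' v \<omega> = \<theta> - (LBINT u:{0..v}. G u \<omega>) + elem_integral (grid_elem \<pi> z) v \<omega>" if "v \<in> {0..T}" for v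
      using elim(1) that euler_path_integral[OF \<pi> that, of \<theta> "\<lambda>n \<omega>. - f_step n \<omega>" z \<omega>] by (simp add: Y_path_def neg)
    have q: "Y s \<omega> = terminal P (R T \<omega>) + (LBINT u:{s..T}. fX u \<omega>) - (Iz T \<omega> - Iz s \<omega>)"
      using elim(2) s by (simp add: fX_def)
    have qT: "Y T \<omega> = terminal P (R T \<omega>)" using elim(2) T0 by (simp add: LBINT_singleton)
    have spl: "(LBINT u:{0..T}. G u \<omega>) = (LBINT u:{0..s}. G u \<omega>) + (LBINT u:{s..T}. G u \<omega>)"
      by (rule LBINT_split_L2[OF elim(4) order_refl s order_refl])
    have dif: "(LBINT u:{s..T}. G u \<omega> - fX u \<omega>) = (LBINT u:{s..T}. G u \<omega>) - (LBINT u:{s..T}. fX u \<omega>)"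
      using elim(3) s by simp
    show ?case unfolding DY_def NY_def dif p[OF s] p[OF T0(2)] spl qT q by (simp add: algebra_simps)
  qed
  define A where "A = msq M (DY T) + T * (\<epsilon> + (Lfx L)\<^sup>2 * \<rho>)"
  define E where "E = exp (beta_f L * T)"
  have GfX: "proc_L2 (\<lambda>s \<omega>. G s \<omega> - fX s \<omega>)" by (rule proc_L2_diff[OF step_p(3) fX])
  note stab = backward_stability[OF proc_L2_D(1)[OF DY(1)] proc_L2_D(2)[OF DY(1)] DY(2) proc_L2_D(1)[OF GfX] proc_L2_D(2)[OF GfX]
      NY eqY eY(1) eY(2) R\<rho>(1) R\<rho>(2) boundY Lip_nonneg(7)]
  have Yb: "msq M (DY s) \<le> E * A" if "s \<in> {0..T}" for s
    unfolding A_def E_def beta_f_def by (rule stab(1)) (assumption | rule that)+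
  have Zb: "(LBINT s:{0..T}. msq M (H s)) \<le> 2 * (E * A)"
    unfolding A_def E_def beta_f_def by (rule stab(2)) assumption+
  have rN: "interpolate \<pi> r T = r ?N" by (rule interpolate_end[OF \<pi>])
  have DYT: "msq M (DY T) \<le> (1 + \<delta>) * ((Lg L)\<^sup>2 * \<rho>) + (1 + 1 / \<delta>) * (2 * (lo + \<tau>))"
  proof -
    let ?g = "terminal P"
    let ?U = "\<lambda>\<omega>. ?g (r ?N \<omega>) - ?g (R T \<omega>)" and ?V = "\<lambda>\<omega>. (?g (x ?N \<omega>) - ?g (r ?N \<omega>)) - (?g (x ?N \<omega>) - y ?N \<omega>)"
    note s = sq[OF order_refl]
    have U: "sq_int M ?U" by (intro sq_int_diff terminal_sq_int s R T0)
    have V1: "sq_int M (\<lambda>\<omega>. ?g (x ?N \<omega>) - ?g (r ?N \<omega>))" "sq_int M (\<lambda>\<omega>. ?g (x ?N \<omega>) - y ?N \<omega>)"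
      by (intro sq_int_diff terminal_sq_int s)+
    have V: "sq_int M ?V" by (rule sq_int_diff[OF V1])
    have "msq M (DY T) = msq M (\<lambda>\<omega>. ?U \<omega> + ?V \<omega>)"
    proof (rule msq_cong_AE[OF sq_int_measurable[OF DY(2)[OF T0(2)]] sq_int_measurable[OF sq_int_add[OF U V]]])
      show "AE \<omega> in M. DY T \<omega> = ?U \<omega> + ?V \<omega>"
        using Y'(3) bwd
      proof eventually_elim
        case (elim \<omega>)
        have "Y T \<omega> = ?g (R T \<omega>)" using elim(2) T0 by (simp add: LBINT_singleton)
        moreover have "Y' T \<omega> = y ?N \<omega>" using elim(1) T0 path_end(2)[of \<omega>] by simp
        ultimately show ?case by (simp add: DY_def)
      qed
    qed
    also have "\<dots> \<le> (1 + \<delta>) * msq M ?U + (1 + 1 / \<delta>) * msq M ?V" by (rule msq_add_weighted[OF U V \<delta>])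
    also have "\<dots> \<le> (1 + \<delta>) * ((Lg L)\<^sup>2 * \<rho>) + (1 + 1 / \<delta>) * (2 * (lo + \<tau>))"
    proof (intro add_mono mult_left_mono)
      have d: "sq_int M (\<lambda>\<omega>. r ?N \<omega> - R T \<omega>)" by (intro sq_int_diff s R T0)
      have "msq M ?U \<le> (\<integral>\<omega>. (Lg L)\<^sup>2 * (norm (r ?N \<omega> - R T \<omega>))\<^sup>2 \<partial>M)"
      proof (rule msq_le_integral)
        show "integrable M (\<lambda>\<omega>. (Lg L)\<^sup>2 * (norm (r ?N \<omega> - R T \<omega>))\<^sup>2)" using sq_int_integrable[OF d] by simp
        show "(norm (?U \<omega>))\<^sup>2 \<le> (Lg L)\<^sup>2 * (norm (r ?N \<omega> - R T \<omega>))\<^sup>2" for \<omega>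
          unfolding power_mult_distrib[symmetric] by (intro power_mono coeff_Lipschitz(4)) auto
      qed
      also have "\<dots> = (Lg L)\<^sup>2 * msq M (\<lambda>\<omega>. r ?N \<omega> - R T \<omega>)" by (simp add: msq_def)
      also have "\<dots> \<le> (Lg L)\<^sup>2 * \<rho>" using \<rho>[OF T0(2)] by (intro mult_left_mono) (simp_all add: rN)
      finally show "msq M ?U \<le> (Lg L)\<^sup>2 * \<rho>" .
      show "msq M ?V \<le> 2 * (lo + \<tau>)" using msq_diff_le[OF V1] by (simp add: lo_def \<tau>_def)
    qed (use \<delta> in auto)
    finally show ?thesis .
  qed

  \<comment> \<open>The forward difference is driven by the errors of \<open>Y\<close> and of the control, both bounded by now.\<close>
  define eX where "eX s \<omega> = local_error (Lbx L) (Lby L) (Lbt L) \<bar>\<pi> ! ?gi s - s\<bar> (interpolate \<pi> x s \<omega>) (X' s \<omega>)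
    (interpolate \<pi> y s \<omega>) (Y' s \<omega>) (interpolate \<pi> z s \<omega>)" for s \<omega>
  define eS where "eS s \<omega> = local_error (Lsx L) (Lsy L) (Lst L) \<bar>\<pi> ! ?gi s - s\<bar> (interpolate \<pi> x s \<omega>) (X' s \<omega>)
    (interpolate \<pi> y s \<omega>) (Y' s \<omega>) (interpolate \<pi> z s \<omega>)" for s \<omega>
  have eX: "sq_int M (eX s)" "msq M (eX s) \<le> \<epsilon>" and eS: "sq_int M (eS s)" "msq M (eS s) \<le> \<epsilon>" if s: "s \<in> {0..T}" for s
  proof -
    note le = local_error_msq[OF at(1)[OF s] at(2)[OF s] at(3)[OF s] dx(1)[OF s] dy(1)[OF s] at(5)[OF s] at(6)[OF s] at(7)[OF s]
        dx(2)[OF s] dy(2)[OF s] gi(2,3)[OF s]]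
    show "sq_int M (eX s)" "sq_int M (eS s)" unfolding eX_def[abs_def] eS_def[abs_def] by (rule le(1))+
    have "msq M (eX s) \<le> 4 * ((Lbt L)\<^sup>2 * (4 * (1 + 3 * Cm)) + (Lbx L)\<^sup>2 * path_const Cm + (Lby L)\<^sup>2 * path_const Cm) * m"
      unfolding eX_def[abs_def] by (rule le(2))
    also have "\<dots> \<le> \<epsilon>" unfolding \<epsilon>_def by (intro mult_right_mono eps_const_bounds m)
    finally show "msq M (eX s) \<le> \<epsilon>" .
    have "msq M (eS s) \<le> 4 * ((Lst L)\<^sup>2 * (4 * (1 + 3 * Cm)) + (Lsx L)\<^sup>2 * path_const Cm + (Lsy L)\<^sup>2 * path_const Cm) * m"
      unfolding eS_def[abs_def] by (rule le(2))
    also have "\<dots> \<le> \<epsilon>" unfolding \<epsilon>_def by (intro mult_right_mono eps_const_bounds m)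
    finally show "msq M (eS s) \<le> \<epsilon>" .
  qed
  have boundX: "norm (B s \<omega> - bX s \<omega>) \<le> eX s \<omega> + Lbx L * norm (DX s \<omega>) + Lby L * norm (DY s \<omega>) + Lbz L * norm (H s \<omega>)"
    if s: "s \<in> {0..T}" for s \<omega>
    using coeff_local_error[OF drift_regular gi(1)[OF s] s, of "interpolate \<pi> x s \<omega>" "interpolate \<pi> y s \<omega>" "interpolate \<pi> z s \<omega>"
        "X s \<omega>" "Y s \<omega>" "Z s \<omega>" "X' s \<omega>" "Y' s \<omega>"]
    unfolding B_def bX_def eX_def DX_def DY_def H_def b_step_def interpolate_grid_index[OF \<pi>] .
  have boundS: "norm (S s \<omega> - diffusion P s (X s \<omega>) (Y s \<omega>)) \<le> eS s \<omega> + Lsx L * norm (DX s \<omega>) + Lsy L * norm (DY s \<omega>)"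
    if s: "s \<in> {0..T}" for s \<omega>
    using coeff_local_error[OF diffusion_regular gi(1)[OF s] s, where u="interpolate \<pi> x s \<omega>" and y="interpolate \<pi> y s \<omega>"
        and z="interpolate \<pi> z s \<omega>" and x'="X s \<omega>" and y''="Y s \<omega>" and z''="Z s \<omega>" and u'="X' s \<omega>" and y'="Y' s \<omega>"]
    unfolding S_def eS_def DX_def DY_def s_step_def interpolate_grid_index[OF \<pi>] by simp
  have AEbX: "AE \<omega> in M. \<forall>a\<ge>0. \<forall>b\<le>T. (LBINT s:{a..b}. B s \<omega> - bX s \<omega>) = (LBINT s:{a..b}. B s \<omega>) - (LBINT s:{a..b}. bX s \<omega>)"
    by (rule AE_LBINT_diff[OF proc_L2_D(2)[OF step_p(1)] proc_L2_D(2)[OF bX]])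
  have eqX: "AE \<omega> in M. DX s \<omega> = (LBINT u:{0..s}. B u \<omega> - bX u \<omega>) + NX s \<omega>" if s: "s \<in> {0..T}" for s
    using X'(3) fwd AEbX
  proof eventually_elim
    case (elim \<omega>)
    have p: "X' s \<omega> = start P + (LBINT u:{0..s}. B u \<omega>) + elem_integral (grid_elem \<pi> s_step) s \<omega>"
      using elim(1) s euler_path_integral[OF \<pi> s, of "start P" b_step s_step \<omega>] by (simp add: X_path_def B_def)
    have q: "X s \<omega> = start P + (LBINT u:{0..s}. bX u \<omega>) + Is s \<omega>"
      using elim(2) s by (simp add: bX_def)
    have dif: "(LBINT u:{0..s}. B u \<omega> - bX u \<omega>) = (LBINT u:{0..s}. B u \<omega>) - (LBINT u:{0..s}. bX u \<omega>)"
      using elim(3) s by simp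
    show ?case unfolding DX_def NX_def dif p q by (simp add: algebra_simps)
  qed
  have Xb: "msq M (DX t) \<le> exp ((8 * T * (Lbx L)\<^sup>2 + 8 * (Lsx L)\<^sup>2) * T)
    * ((8 * T * (Lby L)\<^sup>2 + 8 * (Lsy L)\<^sup>2) * T * (E * A) + 8 * T * (Lbz L)\<^sup>2 * (2 * (E * A)) + (8 * T\<^sup>2 + 8 * T) * \<epsilon>)"
    by (rule forward_stability[OF proc_L2_D(2)[OF DX(1)] DX(2) proc_L2_D(2)[OF proc_L2_diff[OF step_p(1) bX]] NX eqX eX(1) eX(2) eS(1) eS(2)
          DY(2) Yb proc_L2_D(2)[OF H] Zb boundX boundS t])

  \<comment> \<open>With \<open>Y\<close> bounded by \<open>E * A\<close> and the control by \<open>2 * (E * A)\<close>, the larger of the two weights of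
    \<open>K_F\<close> turns the forward bound into \<open>K_F * (3 * (E * A))\<close>; the three errors add up to
    \<open>(1 + K_F) * (3 * (E * A))\<close>, and \<open>3 * E\<close> is the first factor of \<open>K_B\<close>.\<close>
  have \<epsilon>0: "0 \<le> \<epsilon>" using eps_const_bounds(4) m by (simp add: \<epsilon>_def)
  have A0: "0 \<le> A" using \<epsilon>0 \<rho>0 T0 by (simp add: A_def)
  have E0: "0 \<le> E * A" using A0 by (simp add: E_def)
  have \<kappa>0: "0 \<le> kappa_y T L" "0 \<le> kappa_z T L" "0 \<le> K_F T L"
    using T0 by (auto simp: kappa_y_def kappa_z_def K_F_def max_def)
  define e\<kappa> where "e\<kappa> = exp (kappa_x T L * T)"
  have Xb': "msq M (DX t) \<le> K_F T L * (3 * (E * A)) + e\<kappa> * (8 * T\<^sup>2 + 8 * T) * \<epsilon>"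
  proof -
    have kx: "(8 * T * (Lbx L)\<^sup>2 + 8 * (Lsx L)\<^sup>2) * T \<le> kappa_x T L * T"
      unfolding kappa_x_def by (intro mult_right_mono add_mono) (use T0 in auto)
    have "msq M (DX t) \<le> e\<kappa> * (kappa_y T L * T * (E * A) + kappa_z T L * (2 * (E * A)) + (8 * T\<^sup>2 + 8 * T) * \<epsilon>)"
      unfolding e\<kappa>_def
    proof (rule order_trans[OF Xb], intro mult_mono add_mono order_refl)
      show "exp ((8 * T * (Lbx L)\<^sup>2 + 8 * (Lsx L)\<^sup>2) * T) \<le> exp (kappa_x T L * T)" using kx by simp
      show "8 * T * (Lby L)\<^sup>2 + 8 * (Lsy L)\<^sup>2 \<le> kappa_y T L"
        unfolding kappa_y_def by (intro mult_right_mono add_mono) (use T0 in auto)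
      show "8 * T * (Lbz L)\<^sup>2 \<le> kappa_z T L"
        unfolding kappa_z_def by (intro mult_right_mono) (use T0 in auto)
    qed (use T0 E0 A0 \<epsilon>0 \<kappa>0 in \<open>auto simp: E_def\<close>)
    also have "\<dots> \<le> e\<kappa> * (max (kappa_y T L * T) (kappa_z T L) * (E * A) + max (kappa_y T L * T) (kappa_z T L) * (2 * (E * A)) + (8 * T\<^sup>2 + 8 * T) * \<epsilon>)"
      using E0 T0 by (intro mult_left_mono add_mono mult_right_mono) (auto simp: e\<kappa>_def)
    also have "\<dots> = K_F T L * (3 * (E * A)) + e\<kappa> * (8 * T\<^sup>2 + 8 * T) * \<epsilon>"
      by (simp add: K_F_def e\<kappa>_def algebra_simps)
    finally show ?thesis .
  qed
  have shift: "msq M (\<lambda>\<omega>. u \<omega> - v \<omega>) \<le> (1 + \<delta>) * msq M (\<lambda>\<omega>. v' \<omega> - v \<omega>) + (1 + 1 / \<delta>) * (path_const Cm * m)"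
    if "sq_int M (\<lambda>\<omega>. v' \<omega> - v \<omega>)" "sq_int M (\<lambda>\<omega>. u \<omega> - v' \<omega>)" "msq M (\<lambda>\<omega>. u \<omega> - v' \<omega>) \<le> path_const Cm * m"
    for u v v' :: "'a \<Rightarrow> 'e::euclidean_space"
  proof -
    have "msq M (\<lambda>\<omega>. u \<omega> - v \<omega>) \<le> (1 + \<delta>) * msq M (\<lambda>\<omega>. v' \<omega> - v \<omega>) + (1 + 1 / \<delta>) * msq M (\<lambda>\<omega>. u \<omega> - v' \<omega>)"
      using msq_add_weighted[OF that(1,2) \<delta>] by simp
    also have "\<dots> \<le> (1 + \<delta>) * msq M (\<lambda>\<omega>. v' \<omega> - v \<omega>) + (1 + 1 / \<delta>) * (path_const Cm * m)"
      using that(3) \<delta> by (intro add_left_mono mult_left_mono) auto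
    finally show ?thesis .
  qed
  have x_err: "msq M (\<lambda>\<omega>. interpolate \<pi> x t \<omega> - X t \<omega>) \<le> (1 + \<delta>) * msq M (DX t) + (1 + 1 / \<delta>) * (path_const Cm * m)"
    unfolding DX_def[abs_def] by (rule shift[OF DX(2)[OF t, unfolded DX_def[abs_def]] dx[OF t]])
  have y_err: "msq M (\<lambda>\<omega>. interpolate \<pi> y t \<omega> - Y t \<omega>) \<le> (1 + \<delta>) * msq M (DY t) + (1 + 1 / \<delta>) * (path_const Cm * m)"
    unfolding DY_def[abs_def] by (rule shift[OF DY(2)[OF t, unfolded DY_def[abs_def]] dy[OF t]])
  have z_err: "msq Q (\<lambda>(s, \<omega>). interpolate \<pi> z s \<omega> - Z s \<omega>) \<le> 2 * (E * A)"
  proof -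
    have "msq Q (case_prod H) = (LBINT s:{0..T}. msq M (H s))"
      using msq_Q_eq(1)[OF proc_L2_D(2)[OF H]] integral_TM[of "\<lambda>s. msq M (H s)"] by simp
    then show ?thesis using Zb by (simp add: H_def split_def)
  qed
  define k where "k = (1 + \<delta>) * (1 + K_F T L)"
  have k0: "0 \<le> k" using \<delta> \<kappa>0 by (simp add: k_def)
  have "msq M (\<lambda>\<omega>. interpolate \<pi> x t \<omega> - X t \<omega>) + msq M (\<lambda>\<omega>. interpolate \<pi> y t \<omega> - Y t \<omega>)
      + msq Q (\<lambda>(s, \<omega>). interpolate \<pi> z s \<omega> - Z s \<omega>)
    \<le> (1 + \<delta>) * (K_F T L * (3 * (E * A)) + e\<kappa> * (8 * T\<^sup>2 + 8 * T) * \<epsilon>) + (1 + 1 / \<delta>) * (path_const Cm * m)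
      + ((1 + \<delta>) * (E * A) + (1 + 1 / \<delta>) * (path_const Cm * m)) + (1 + \<delta>) * (2 * (E * A))"
  proof (intro add_mono)
    show "msq M (\<lambda>\<omega>. interpolate \<pi> x t \<omega> - X t \<omega>)
      \<le> (1 + \<delta>) * (K_F T L * (3 * (E * A)) + e\<kappa> * (8 * T\<^sup>2 + 8 * T) * \<epsilon>) + (1 + 1 / \<delta>) * (path_const Cm * m)"
      by (rule order_trans[OF x_err], intro add_right_mono mult_left_mono Xb') (use \<delta> in auto)
    show "msq M (\<lambda>\<omega>. interpolate \<pi> y t \<omega> - Y t \<omega>) \<le> (1 + \<delta>) * (E * A) + (1 + 1 / \<delta>) * (path_const Cm * m)"
      by (rule order_trans[OF y_err], intro add_right_mono mult_left_mono Yb[OF t]) (use \<delta> in auto)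
    have "1 * (2 * (E * A)) \<le> (1 + \<delta>) * (2 * (E * A))" using \<delta> E0 by (intro mult_right_mono) auto
    then show "msq Q (\<lambda>(s, \<omega>). interpolate \<pi> z s \<omega> - Z s \<omega>) \<le> (1 + \<delta>) * (2 * (E * A))" using z_err by simp
  qed
  also have "\<dots> = k * (3 * E) * A + (1 + \<delta>) * (e\<kappa> * (8 * T\<^sup>2 + 8 * T)) * \<epsilon> + 2 * (1 + 1 / \<delta>) * path_const Cm * m"
    by (simp add: k_def algebra_simps)
  also have "\<dots> \<le> k * (3 * E) * ((1 + \<delta>) * ((Lg L)\<^sup>2 + T * (Lfx L)\<^sup>2) * \<rho> + 2 * (1 + 1 / \<delta>) * (lo + \<tau>) + T * \<epsilon>)
      + (1 + \<delta>) * (e\<kappa> * (8 * T\<^sup>2 + 8 * T)) * \<epsilon> + 2 * (1 + 1 / \<delta>) * path_const Cm * m"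
  proof (intro add_right_mono mult_left_mono)
    have "T * ((Lfx L)\<^sup>2 * \<rho>) \<le> (1 + \<delta>) * (T * ((Lfx L)\<^sup>2 * \<rho>))"
      using mult_right_mono[of 1 "1 + \<delta>" "T * ((Lfx L)\<^sup>2 * \<rho>)"] \<delta> \<rho>0 T0 by simp
    then have "A \<le> (1 + \<delta>) * ((Lg L)\<^sup>2 * \<rho>) + (1 + 1 / \<delta>) * (2 * (lo + \<tau>)) + (T * \<epsilon> + (1 + \<delta>) * (T * ((Lfx L)\<^sup>2 * \<rho>)))"
      unfolding A_def using DYT by (simp add: distrib_left)
    also have "\<dots> = (1 + \<delta>) * ((Lg L)\<^sup>2 + T * (Lfx L)\<^sup>2) * \<rho> + 2 * (1 + 1 / \<delta>) * (lo + \<tau>) + T * \<epsilon>"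
      by (simp add: algebra_simps add_divide_distrib)
    finally show "A \<le> \<dots>" .
  qed (use k0 in \<open>auto simp: E_def\<close>)
  also have "\<dots> = (k * (3 * E) * (2 * (1 + 1 / \<delta>)) * (lo + \<tau>)
      + (k * (3 * E) * (T * eps_const Cm) + (1 + \<delta>) * (e\<kappa> * (8 * T\<^sup>2 + 8 * T)) * eps_const Cm + 2 * (1 + 1 / \<delta>) * path_const Cm) * m)
      + (1 + \<delta>)\<^sup>2 * ((1 + K_F T L) * K_B T L) * \<rho>"
  proof -
    define w where "w = 1 + 1 / \<delta>"
    show ?thesis
      unfolding w_def[symmetric] by (simp add: \<epsilon>_def k_def K_B_def E_def power2_eq_square algebra_simps)
  qed
  also have "\<dots> \<le> error_const \<delta> Cm * (m + lo + \<tau>) + (1 + \<delta>)\<^sup>2 * ((1 + K_F T L) * K_B T L) * \<rho>"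
  proof (rule add_right_mono)
    define a where "a = k * (3 * E) * (2 * (1 + 1 / \<delta>))"
    define b where "b = k * (3 * E) * (T * eps_const Cm)"
    define c where "c = (1 + \<delta>) * (e\<kappa> * (8 * T\<^sup>2 + 8 * T)) * eps_const Cm"
    define d where "d = 2 * (1 + 1 / \<delta>) * path_const Cm"
    have pos: "0 \<le> a" "0 \<le> b" "0 \<le> c" "0 \<le> d"
      using k0 \<delta> T0 eps_const_bounds(4,5) by (auto simp: a_def b_def c_def d_def E_def e\<kappa>_def)
    have ec: "error_const \<delta> Cm = a + b + c + d"
      by (simp add: error_const_def a_def b_def c_def d_def k_def E_def e\<kappa>_def distrib_left)
    have "a * (lo + \<tau>) + (b + c + d) * m \<le> (a + b + c + d) * (lo + \<tau>) + (a + b + c + d) * m"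
      using pos lo\<tau> m by (intro add_mono mult_right_mono) auto
    then show "k * (3 * E) * (2 * (1 + 1 / \<delta>)) * (lo + \<tau>)
      + (k * (3 * E) * (T * eps_const Cm) + (1 + \<delta>) * (e\<kappa> * (8 * T\<^sup>2 + 8 * T)) * eps_const Cm + 2 * (1 + 1 / \<delta>) * path_const Cm) * m
      \<le> error_const \<delta> Cm * (m + lo + \<tau>)"
      unfolding ec a_def[symmetric] b_def[symmetric] c_def[symmetric] d_def[symmetric]
      by (simp add: algebra_simps)
  qed
  finally show ?thesis unfolding m_def lo_def \<tau>_def .
qed

end

section \<open>The averaged iteration\<close>

lemma msq_convex:
  assumes "sq_int N U" "sq_int N V" "0 \<le> a" "0 \<le> b" "a + b = 1"
  shows "msq N (\<lambda>x. a *\<^sub>R U x + b *\<^sub>R V x) \<le> a * msq N U + b * msq N V"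
proof -
  let ?i = "\<integral>x. U x \<bullet> V x \<partial>N"
  have "msq N (\<lambda>x. a *\<^sub>R U x + b *\<^sub>R V x) = a\<^sup>2 * msq N U + 2 * (a * b * ?i) + b\<^sup>2 * msq N V"
    by (subst msq_add) (use assms in \<open>auto simp: msq_scaleR\<close>)
  moreover have "0 \<le> a * b * msq N (\<lambda>x. U x - V x)" using assms by simp
  then have "2 * (a * b * ?i) \<le> a * b * msq N U + a * b * msq N V"
    unfolding msq_diff[OF assms(1,2)] by (simp add: algebra_simps)
  moreover have "a\<^sup>2 * msq N U + a * b * msq N U = a * msq N U" "b\<^sup>2 * msq N V + a * b * msq N V = b * msq N V"
    using assms(5) by (simp_all add: power2_eq_square flip: distrib_left distrib_right)
  ultimately show ?thesis by linarith
qed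

locale fbsde_approximation = fbsde_setting M W P L
  for M :: "'a measure" and W :: "real \<Rightarrow> 'a \<Rightarrow> real^'d" and P :: "('d::finite, 'm::finite) fbsde" and L :: reg_consts +
  fixes X :: "real \<Rightarrow> 'a \<Rightarrow> real^'d" and Y :: "real \<Rightarrow> 'a \<Rightarrow> real^'m" and Z :: "real \<Rightarrow> 'a \<Rightarrow> real^'d^'m"
    and R\<^sub>0 :: "real \<Rightarrow> 'a \<Rightarrow> real^'d"
    and Xs :: "nat \<Rightarrow> real \<Rightarrow> 'a \<Rightarrow> real^'d" and Ys :: "nat \<Rightarrow> real \<Rightarrow> 'a \<Rightarrow> real^'m" and Zs :: "nat \<Rightarrow> real \<Rightarrow> 'a \<Rightarrow> real^'d^'m"
    and \<phi> :: "real list \<Rightarrow> nat \<Rightarrow> nat \<Rightarrow> real^'d \<Rightarrow> real^'m" and \<theta> :: "real list \<Rightarrow> nat \<Rightarrow> real^'m"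
  assumes wp: "well_posedness M W P X Y Z R\<^sub>0 Xs Ys Zs"
    and nn: "uniform_neural_bounds T \<phi> \<theta>"
begin

abbreviation ref :: "nat \<Rightarrow> real \<Rightarrow> 'a \<Rightarrow> real^'d" where "ref \<equiv> reference_process R\<^sub>0 Xs"
abbreviation sref :: "real list \<Rightarrow> nat \<Rightarrow> nat \<Rightarrow> 'a \<Rightarrow> real^'d" where "sref \<pi> \<equiv> scheme_reference P W \<pi> (\<phi> \<pi>) (\<theta> \<pi>)"
abbreviation sXY :: "real list \<Rightarrow> nat \<Rightarrow> nat \<Rightarrow> 'a \<Rightarrow> (real^'d) \<times> (real^'m)"
  where "sXY \<pi> q \<equiv> next_iterate P W \<pi> (\<phi> \<pi> q) (\<theta> \<pi> q) (sref \<pi> q)"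
abbreviation Xpi where "Xpi \<equiv> X_pi P W \<phi> \<theta>"
abbreviation Ypi where "Ypi \<equiv> Y_pi P W \<phi> \<theta>"
abbreviation Zpi where "Zpi \<equiv> Z_pi P W \<phi> \<theta>"
abbreviation Rpi where "Rpi \<equiv> reference_pi P W \<phi> \<theta>"
abbreviation tloss where "tloss \<equiv> terminal_loss M P W \<phi> \<theta>"
abbreviation tres where "tres \<equiv> terminal_residual M P W \<phi> \<theta>"
abbreviation pres where "pres \<equiv> path_residual M P W \<phi> \<theta> R\<^sub>0 Xs"
abbreviation ferr where "ferr \<equiv> forward_error M P W \<phi> \<theta> R\<^sub>0 Xs"

lemma coupled: "cont_L2 X" "cont_L2 Y" "proc_L2 Z"
  using wp space_S2_cont_L2 space_L2_proc_L2
  by (auto simp: well_posedness_def unique_solution_def coupled_solution_def in_solution_space_def)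

lemma auxiliary: "auxiliary_solution M W P (ref q) (Xs (Suc q)) (Ys (Suc q)) (Zs (Suc q))"
proof -
  have "unique_solution M T (auxiliary_solution M W P (ref (Suc q - 1))) (Xs (Suc q)) (Ys (Suc q)) (Zs (Suc q))"
    using wp unfolding well_posedness_def by (metis One_nat_def Suc_le_mono zero_le)
  then show ?thesis by (simp add: unique_solution_def)
qed

lemma auxiliary_cont: "cont_L2 (Xs (Suc q))" "cont_L2 (Ys (Suc q))" "proc_L2 (Zs (Suc q))"
  using auxiliary[of q] space_S2_cont_L2 space_L2_proc_L2
  by (auto simp: auxiliary_solution_def in_solution_space_def)

lemma ref_cont: "cont_L2 (ref q)"
proof (induction q)
  case 0
  have "R\<^sub>0 \<in> space_S2 M F T" using wp unfolding well_posedness_def by blast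
  then show ?case using space_S2_cont_L2 by simp
next
  case (Suc q)
  then show ?case using cont_L2_scaleR_add[OF Suc auxiliary_cont(1)] by simp
qed

lemma network_constants:
  obtains K K' where "0 \<le> K" "0 \<le> K'"
    "\<And>\<pi> p. is_partition T \<pi> \<Longrightarrow> network_bounds \<pi> (\<phi> \<pi> p) K K'" "\<And>\<pi> p. is_partition T \<pi> \<Longrightarrow> norm (\<theta> \<pi> p) \<le> K"
proof -
  obtain K K' where K: "0 < K" "0 < K'" and b: "\<And>\<pi> p n. is_partition T \<pi> \<Longrightarrow> n < cells \<pi> \<Longrightarrow>
      norm (\<theta> \<pi> p) + norm (\<phi> \<pi> p n 0) \<le> K \<and>
      (\<forall>x. \<phi> \<pi> p n differentiable (at x) \<and> onorm ((*v) (jacobian (\<phi> \<pi> p n) (at x))) \<le> K')"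
    using nn unfolding uniform_neural_bounds_def by blast
  have \<theta>: "norm (\<theta> \<pi> p) \<le> K" if "is_partition T \<pi>" for \<pi> p
    using b[OF that partition_length(1)[OF that], of p] norm_ge_zero[of "\<phi> \<pi> p 0 0"] by linarith
  have \<phi>: "network_bounds \<pi> (\<phi> \<pi> p) K K'" if "is_partition T \<pi>" for \<pi> p
    unfolding network_bounds_def
  proof (intro allI impI conjI)
    fix n x assume n: "n < cells \<pi>"
    show "norm (\<phi> \<pi> p n 0) \<le> K" using b[OF that n, of p] norm_ge_zero[of "\<theta> \<pi> p"] by linarith
    show "\<phi> \<pi> p n differentiable (at x)" "onorm ((*v) (jacobian (\<phi> \<pi> p n) (at x))) \<le> K'"
      using b[OF that n, of p] by blast+
  qed
  show thesis using that[of K K'] K \<phi> \<theta> by simp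
qed

definition moments_le :: "real \<Rightarrow> real list \<Rightarrow> (nat \<Rightarrow> 'a \<Rightarrow> 'b::euclidean_space) \<Rightarrow> bool"
  where "moments_le C \<pi> U \<longleftrightarrow> (\<forall>n\<le>cells \<pi>. U n \<in> borel_measurable (F (\<pi> ! n)) \<and> sq_int M (U n) \<and> msq M (U n) \<le> C)"

lemma next_iterate_moments:
  assumes C: "0 \<le> C" and R: "\<And>\<pi>. is_partition T \<pi> \<Longrightarrow> moments_le C \<pi> (sref \<pi> q)"
  obtains C' where "0 \<le> C'" "\<And>\<pi>. is_partition T \<pi> \<Longrightarrow> moments_le C' \<pi> (\<lambda>n \<omega>. fst (sXY \<pi> q n \<omega>))"
    "\<And>\<pi>. is_partition T \<pi> \<Longrightarrow> moments_le C' \<pi> (\<lambda>n \<omega>. snd (sXY \<pi> q n \<omega>))"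
proof -
  obtain K K' where K: "0 \<le> K" "0 \<le> K'" and \<phi>: "\<And>\<pi> p. is_partition T \<pi> \<Longrightarrow> network_bounds \<pi> (\<phi> \<pi> p) K K'"
    and \<theta>: "\<And>\<pi> p. is_partition T \<pi> \<Longrightarrow> norm (\<theta> \<pi> p) \<le> K"
    by (rule network_constants) (rule that; assumption)
  obtain C' where C': "0 \<le> C'" "\<And>\<pi> \<phi> \<theta> R U n. scheme_run \<pi> \<phi> \<theta> R U C K K' \<Longrightarrow> n \<le> cells \<pi> \<Longrightarrow>
    (\<lambda>\<omega>. fst (U n \<omega>)) \<in> borel_measurable (F (\<pi> ! n)) \<and> (\<lambda>\<omega>. snd (U n \<omega>)) \<in> borel_measurable (F (\<pi> ! n)) \<and>
    sq_int M (\<lambda>\<omega>. fst (U n \<omega>)) \<and> sq_int M (\<lambda>\<omega>. snd (U n \<omega>)) \<and>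
    msq M (\<lambda>\<omega>. fst (U n \<omega>)) + msq M (\<lambda>\<omega>. snd (U n \<omega>)) \<le> C'"
    by (rule scheme_run_moments[OF K C]) (rule that; assumption)
  have run: "scheme_run \<pi> (\<phi> \<pi> q) (\<theta> \<pi> q) (sref \<pi> q) (sXY \<pi> q) C K K'" if \<pi>: "is_partition T \<pi>" for \<pi>
    unfolding scheme_run_def
  proof (intro conjI \<pi> \<phi> \<theta> allI impI)
    fix n assume n: "n \<le> cells \<pi>"
    note r = R[OF \<pi>, unfolded moments_le_def, rule_format, OF n]
    show "sref \<pi> q n \<in> borel_measurable (F (\<pi> ! n))" "sq_int M (sref \<pi> q n)" using r by auto
    show "msq M (sref \<pi> q n) \<le> C + msq M (\<lambda>\<omega>. fst (sXY \<pi> q n \<omega>))"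
      using r by (simp add: add_increasing2)
  qed auto
  have "moments_le C' \<pi> (\<lambda>n \<omega>. fst (sXY \<pi> q n \<omega>)) \<and> moments_le C' \<pi> (\<lambda>n \<omega>. snd (sXY \<pi> q n \<omega>))" if \<pi>: "is_partition T \<pi>" for \<pi>
    unfolding moments_le_def
  proof (intro conjI allI impI)
    fix n assume n: "n \<le> cells \<pi>"
    note r = C'(2)[OF run[OF \<pi>] n]
    show "(\<lambda>\<omega>. fst (sXY \<pi> q n \<omega>)) \<in> borel_measurable (F (\<pi> ! n))" "sq_int M (\<lambda>\<omega>. fst (sXY \<pi> q n \<omega>))"
      "(\<lambda>\<omega>. snd (sXY \<pi> q n \<omega>)) \<in> borel_measurable (F (\<pi> ! n))" "sq_int M (\<lambda>\<omega>. snd (sXY \<pi> q n \<omega>))"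
      using r by blast+
    show "msq M (\<lambda>\<omega>. fst (sXY \<pi> q n \<omega>)) \<le> C'" "msq M (\<lambda>\<omega>. snd (sXY \<pi> q n \<omega>)) \<le> C'"
      using r msq_nonneg[of M "\<lambda>\<omega>. fst (sXY \<pi> q n \<omega>)"] msq_nonneg[of M "\<lambda>\<omega>. snd (sXY \<pi> q n \<omega>)"] by linarith+
  qed
  then show thesis using that[OF C'(1)] by blast
qed

text \<open>Averaging keeps bounds on second moments, so the bounds propagate from one iteration to the next;
  they may grow with the iteration but not with the partition.\<close>

lemma scheme_reference_moments: "\<exists>C\<ge>0. \<forall>\<pi>. is_partition T \<pi> \<longrightarrow> moments_le C \<pi> (sref \<pi> q)"
proof (induction q)
  case 0
  obtain K K' where K: "0 \<le> K" "0 \<le> K'" and \<phi>: "\<And>\<pi> p. is_partition T \<pi> \<Longrightarrow> network_bounds \<pi> (\<phi> \<pi> p) K K'"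
    and \<theta>: "\<And>\<pi> p. is_partition T \<pi> \<Longrightarrow> norm (\<theta> \<pi> p) \<le> K"
    by (rule network_constants) (rule that; assumption)
  obtain C where C: "0 \<le> C" "\<And>\<pi> \<phi> \<theta> R U n. scheme_run \<pi> \<phi> \<theta> R U 0 K K' \<Longrightarrow> n \<le> cells \<pi> \<Longrightarrow>
    (\<lambda>\<omega>. fst (U n \<omega>)) \<in> borel_measurable (F (\<pi> ! n)) \<and> (\<lambda>\<omega>. snd (U n \<omega>)) \<in> borel_measurable (F (\<pi> ! n)) \<and>
    sq_int M (\<lambda>\<omega>. fst (U n \<omega>)) \<and> sq_int M (\<lambda>\<omega>. snd (U n \<omega>)) \<and>
    msq M (\<lambda>\<omega>. fst (U n \<omega>)) + msq M (\<lambda>\<omega>. snd (U n \<omega>)) \<le> C"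
    by (rule scheme_run_moments[OF K order_refl]) (rule that; assumption)
  have "moments_le C \<pi> (sref \<pi> 0)" if \<pi>: "is_partition T \<pi>" for \<pi>
    unfolding moments_le_def
  proof (intro allI impI)
    fix n assume n: "n \<le> cells \<pi>"
    let ?U = "initial_iterate P W \<pi> (\<phi> \<pi> 0) (\<theta> \<pi> 0)"
    have "scheme_run \<pi> (\<phi> \<pi> 0) (\<theta> \<pi> 0) (\<lambda>n \<omega>. fst (?U n \<omega>)) ?U 0 K K'"
      unfolding scheme_run_def by (intro conjI \<pi> \<phi> \<theta>) auto
    note r = C(2)[OF this n]
    note sum = r[THEN conjunct2, THEN conjunct2, THEN conjunct2, THEN conjunct2]
    have eq: "sref \<pi> 0 n = (\<lambda>\<omega>. fst (?U n \<omega>))" by (simp only: scheme_reference.simps)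
    show "sref \<pi> 0 n \<in> borel_measurable (F (\<pi> ! n)) \<and> sq_int M (sref \<pi> 0 n) \<and> msq M (sref \<pi> 0 n) \<le> C"
      unfolding eq
    proof (intro conjI)
      show "msq M (\<lambda>\<omega>. fst (?U n \<omega>)) \<le> C" using sum msq_nonneg[of M "\<lambda>\<omega>. snd (?U n \<omega>)"] by linarith
    qed (rule r[THEN conjunct1] r[THEN conjunct2, THEN conjunct2, THEN conjunct1])+
  qed
  then show ?case using C(1) by blast
next
  case (Suc q)
  then obtain C where C: "0 \<le> C" "\<And>\<pi>. is_partition T \<pi> \<Longrightarrow> moments_le C \<pi> (sref \<pi> q)" by blast
  obtain C' where C': "0 \<le> C'" "\<And>\<pi>. is_partition T \<pi> \<Longrightarrow> moments_le C' \<pi> (\<lambda>n \<omega>. fst (sXY \<pi> q n \<omega>))"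
    "\<And>\<pi>. is_partition T \<pi> \<Longrightarrow> moments_le C' \<pi> (\<lambda>n \<omega>. snd (sXY \<pi> q n \<omega>))"
    by (rule next_iterate_moments[OF C]) (assumption, (rule that; assumption))
  let ?a = "real (Suc q) / (real (Suc q) + 1)" and ?b = "1 / (real (Suc q) + 1)"
  have ab: "0 \<le> ?a" "0 \<le> ?b" "?a \<le> 1" "?b \<le> 1" "?a + ?b = 1" by (auto simp: field_simps)
  have "moments_le (C + C') \<pi> (sref \<pi> (Suc q))" if \<pi>: "is_partition T \<pi>" for \<pi>
    unfolding moments_le_def
  proof (intro allI impI conjI)
    fix n assume n: "n \<le> cells \<pi>"
    note r = C(2)[OF \<pi>, unfolded moments_le_def, rule_format, OF n]
    note x = C'(2)[OF \<pi>, unfolded moments_le_def, rule_format, OF n]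
    have eq: "sref \<pi> (Suc q) n = (\<lambda>\<omega>. ?a *\<^sub>R sref \<pi> q n \<omega> + ?b *\<^sub>R fst (sXY \<pi> q n \<omega>))" by (rule ext) simp
    show "sref \<pi> (Suc q) n \<in> borel_measurable (F (\<pi> ! n))"
      unfolding eq using r x by (intro borel_measurable_add borel_measurable_scaleR measurable_const) auto
    show "sq_int M (sref \<pi> (Suc q) n)" unfolding eq using r x by (intro sq_int_add sq_int_scaleR) auto
    have "msq M (sref \<pi> (Suc q) n) \<le> ?a * msq M (sref \<pi> q n) + ?b * msq M (\<lambda>\<omega>. fst (sXY \<pi> q n \<omega>))"
      unfolding eq using r x ab by (intro msq_convex) auto
    also have "\<dots> \<le> 1 * C + 1 * C'"
      using r x ab C(1) C'(1) by (intro add_mono mult_mono) auto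
    finally show "msq M (sref \<pi> (Suc q) n) \<le> C + C'" by simp
  qed
  then show ?case using C(1) C'(1) by (intro exI[of _ "C + C'"]) auto
qed

lemma interpolate_moments:
  assumes "moments_le C \<pi> U" "is_partition T \<pi>" "t \<in> {0..T}"
  shows "sq_int M (interpolate \<pi> U t)" "msq M (interpolate \<pi> U t) \<le> C"
  using assms(1)[unfolded moments_le_def, rule_format, OF grid_index_bounds(1)[OF assms(2,3)]]
  unfolding interpolate_grid_index[OF assms(2)] by blast+

lemma pi_processes:
  "Xpi \<pi> (Suc q) = interpolate \<pi> (\<lambda>n \<omega>. fst (sXY \<pi> q n \<omega>))"
  "Ypi \<pi> (Suc q) = interpolate \<pi> (\<lambda>n \<omega>. snd (sXY \<pi> q n \<omega>))"
  "Zpi \<pi> (Suc q) = interpolate \<pi> (\<lambda>n \<omega>. z_approx P \<pi> (\<phi> \<pi> q) n (sref \<pi> q n \<omega>))"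
  "Rpi \<pi> q = interpolate \<pi> (sref \<pi> q)"
proof -
  have z: "scheme_Z P W \<pi> (\<phi> \<pi>) (\<theta> \<pi>) (Suc q) = (\<lambda>n \<omega>. z_approx P \<pi> (\<phi> \<pi> q) n (sref \<pi> q n \<omega>))"
    by (intro ext) (simp add: scheme_Z_def)
  show "Zpi \<pi> (Suc q) = interpolate \<pi> (\<lambda>n \<omega>. z_approx P \<pi> (\<phi> \<pi> q) n (sref \<pi> q n \<omega>))"
    unfolding Z_pi_def z ..
qed (simp_all add: X_pi_def Y_pi_def reference_pi_def scheme_XY_def)

text \<open>The control at the last grid point is only a value at the single time \<open>T\<close>, where the network
  is not constrained; it is set to zero.\<close>

definition cut_z :: "real list \<Rightarrow> nat \<Rightarrow> nat \<Rightarrow> 'a \<Rightarrow> real^'d^'m"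
  where "cut_z \<pi> q n \<omega> = (if n < cells \<pi> then z_approx P \<pi> (\<phi> \<pi> q) n (sref \<pi> q n \<omega>) else 0)"

lemma cut_z_moments:
  assumes C: "0 \<le> C" and R: "\<And>\<pi>. is_partition T \<pi> \<Longrightarrow> moments_le C \<pi> (sref \<pi> q)"
  obtains C' where "0 \<le> C'" "\<And>\<pi>. is_partition T \<pi> \<Longrightarrow> moments_le C' \<pi> (cut_z \<pi> q)"
proof -
  obtain K K' where K: "0 \<le> K" "0 \<le> K'" and \<phi>: "\<And>\<pi> p. is_partition T \<pi> \<Longrightarrow> network_bounds \<pi> (\<phi> \<pi> p) K K'"
    and \<theta>: "\<And>\<pi> p. is_partition T \<pi> \<Longrightarrow> norm (\<theta> \<pi> p) \<le> K"
    by (rule network_constants) (rule that; assumption)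
  have "moments_le (2 * (Kz K K')\<^sup>2 * (1 + C)) \<pi> (cut_z \<pi> q)" if \<pi>: "is_partition T \<pi>" for \<pi>
    unfolding moments_le_def
  proof (intro allI impI)
    fix n assume n: "n \<le> cells \<pi>"
    note r = R[OF \<pi>, unfolded moments_le_def, rule_format, OF n]
    show "cut_z \<pi> q n \<in> borel_measurable (F (\<pi> ! n)) \<and> sq_int M (cut_z \<pi> q n) \<and> msq M (cut_z \<pi> q n) \<le> 2 * (Kz K K')\<^sup>2 * (1 + C)"
    proof (cases "n < cells \<pi>")
      case True
      have eq: "cut_z \<pi> q n = (\<lambda>\<omega>. z_approx P \<pi> (\<phi> \<pi> q) n (sref \<pi> q n \<omega>))" using True by (simp add: cut_z_def[abs_def])
      have rs: "sq_int M (sref \<pi> q n)" using r by blast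
      note z = z_approx_sq_int[OF \<phi>[OF \<pi>] True \<pi> K rs]
      have "msq M (cut_z \<pi> q n) \<le> 2 * (Kz K K')\<^sup>2 * (1 + msq M (sref \<pi> q n))" unfolding eq by (rule z(2))
      also have "\<dots> \<le> 2 * (Kz K K')\<^sup>2 * (1 + C)" using r by (intro mult_left_mono) auto
      finally show ?thesis
        using z(1) measurable_compose[OF _ z_approx_measurable[OF \<phi>[OF \<pi>] True \<pi>]] r unfolding eq by blast
    next
      case False
      then show ?thesis using C by (simp add: cut_z_def[abs_def])
    qed
  qed
  then show thesis using that[of "2 * (Kz K K')\<^sup>2 * (1 + C)"] C by simp
qed

lemma int_mean_square_cut_z:
  assumes \<pi>: "is_partition T \<pi>"
  shows "int_mean_square M T (\<lambda>t \<omega>. Zpi \<pi> (Suc q) t \<omega> - V t \<omega>)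
    = int_mean_square M T (\<lambda>t \<omega>. interpolate \<pi> (cut_z \<pi> q) t \<omega> - V t \<omega>)"
  unfolding int_mean_square_def
proof (rule nn_integral_cong, rule nn_integral_cong_AE)
  fix \<omega>
  show "AE t in lborel. ennreal ((norm (Zpi \<pi> (Suc q) t \<omega> - V t \<omega>))\<^sup>2) * indicator {0..T} t
    = ennreal ((norm (interpolate \<pi> (cut_z \<pi> q) t \<omega> - V t \<omega>))\<^sup>2) * indicator {0..T} t"
    using AE_lborel_singleton[of T]
  proof eventually_elim
    case (elim t)
    show ?case
    proof (cases "t \<in> {0..T}")
      case True
      then have "grid_index \<pi> t < cells \<pi>"
        using grid_index_bounds(1,4)[OF \<pi> True] elim by (metis le_neq_implies_less)
      then show ?thesis by (simp add: pi_processes interpolate_grid_index[OF \<pi>] cut_z_def)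
    qed simp
  qed
qed

lemma path_residual_finite:
  assumes "is_partition T \<pi>"
  shows "pres \<pi> (Suc q) < \<infinity>"
proof -
  obtain C where C: "0 \<le> C" "\<And>\<pi>. is_partition T \<pi> \<Longrightarrow> moments_le C \<pi> (sref \<pi> q)"
    using scheme_reference_moments by blast
  obtain C' where C': "\<And>t. t \<in> {0..T} \<Longrightarrow> sq_int M (ref q t)" "\<And>t. t \<in> {0..T} \<Longrightarrow> msq M (ref q t) \<le> C'"
    using ref_cont[of q] unfolding cont_L2_def by blast
  have "pres \<pi> (Suc q) \<le> ennreal (2 * C + 2 * C')"
    unfolding path_residual_def sup_mean_square_def
  proof (rule SUP_least)
    fix t assume t: "t \<in> {0..T}"
    note i = interpolate_moments[OF C(2)[OF assms] assms t]
    have "msq M (\<lambda>\<omega>. interpolate \<pi> (sref \<pi> q) t \<omega> - ref q t \<omega>) \<le> 2 * C + 2 * C'"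
      using msq_diff_le[OF i(1) C'(1)[OF t]] i(2) C'(2)[OF t] by linarith
    then show "mean_square M (\<lambda>\<omega>. Rpi \<pi> (Suc q - 1) t \<omega> - ref (Suc q - 1) t \<omega>) \<le> ennreal (2 * C + 2 * C')"
      by (simp add: pi_processes mean_square_eq_msq[OF sq_int_diff[OF i(1) C'(1)[OF t]]] ennreal_leI)
  qed
  then show ?thesis by (simp add: order.strict_trans1)
qed

lemma err_sq_pointwise:
  assumes "\<And>t. t \<in> {0..T} \<Longrightarrow> sq_int M (\<lambda>\<omega>. U t \<omega> - U' t \<omega>)" "\<And>t. t \<in> {0..T} \<Longrightarrow> sq_int M (\<lambda>\<omega>. V t \<omega> - V' t \<omega>)" "t \<in> {0..T}"
  shows "(\<integral>\<^sup>+ \<omega>. ennreal ((norm (U t \<omega> - U' t \<omega>))\<^sup>2 + (norm (V t \<omega> - V' t \<omega>))\<^sup>2) \<partial>M)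
    = ennreal (msq M (\<lambda>\<omega>. U t \<omega> - U' t \<omega>) + msq M (\<lambda>\<omega>. V t \<omega> - V' t \<omega>))"
proof -
  have "(\<integral>\<^sup>+ \<omega>. ennreal ((norm (U t \<omega> - U' t \<omega>))\<^sup>2 + (norm (V t \<omega> - V' t \<omega>))\<^sup>2) \<partial>M)
    = ennreal (expectation (\<lambda>\<omega>. (norm (U t \<omega> - U' t \<omega>))\<^sup>2 + (norm (V t \<omega> - V' t \<omega>))\<^sup>2))"
    using sq_int_integrable[OF assms(1)[OF assms(3)]] sq_int_integrable[OF assms(2)[OF assms(3)]]
    by (intro nn_integral_eq_integral) auto
  then show ?thesis
    using sq_int_integrable[OF assms(1)[OF assms(3)]] sq_int_integrable[OF assms(2)[OF assms(3)]]
    by (simp add: msq_def)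
qed

lemma iterate_error:
  assumes \<delta>: "0 < \<delta>"
  obtains A where "0 \<le> A" "\<And>\<pi>. is_partition T \<pi> \<Longrightarrow>
    err_sq M T (Xpi \<pi> (Suc q)) (Ypi \<pi> (Suc q)) (Zpi \<pi> (Suc q)) (Xs (Suc q)) (Ys (Suc q)) (Zs (Suc q))
    \<le> ennreal A * (ennreal (mesh \<pi>) + tloss \<pi> (Suc q) + tres \<pi> (Suc q))
      + ennreal ((1 + \<delta>)\<^sup>2 * ((1 + K_F T L) * K_B T L)) * pres \<pi> (Suc q)"
proof -
  obtain C where C: "0 \<le> C" "\<And>\<pi>. is_partition T \<pi> \<Longrightarrow> moments_le C \<pi> (sref \<pi> q)"
    using scheme_reference_moments by blast
  obtain C1 where C1: "0 \<le> C1" "\<And>\<pi>. is_partition T \<pi> \<Longrightarrow> moments_le C1 \<pi> (\<lambda>n \<omega>. fst (sXY \<pi> q n \<omega>))"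
    "\<And>\<pi>. is_partition T \<pi> \<Longrightarrow> moments_le C1 \<pi> (\<lambda>n \<omega>. snd (sXY \<pi> q n \<omega>))"
    by (rule next_iterate_moments[OF C]) (assumption, (rule that; assumption))
  obtain C2 where C2: "0 \<le> C2" "\<And>\<pi>. is_partition T \<pi> \<Longrightarrow> moments_le C2 \<pi> (cut_z \<pi> q)"
    by (rule cut_z_moments[OF C]) (assumption, (rule that; assumption))
  define Cm where "Cm = C + C1 + C2"
  define A where "A = max 0 (error_const \<delta> Cm)"
  \<comment> \<open>Jointly measurable versions of the exact processes; almost every path is unchanged, so they solve
    the same equations.\<close>
  obtain X' where X': "proc_L2 X'" "\<And>t. t \<in> {0..T} \<Longrightarrow> sq_int M (X' t)" "AE \<omega> in M. \<forall>t\<in>{0..T}. X' t \<omega> = Xs (Suc q) t \<omega>"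
    using cont_L2_modification[OF auxiliary_cont(1)] by blast
  obtain Y' where Y': "proc_L2 Y'" "\<And>t. t \<in> {0..T} \<Longrightarrow> sq_int M (Y' t)" "AE \<omega> in M. \<forall>t\<in>{0..T}. Y' t \<omega> = Ys (Suc q) t \<omega>"
    using cont_L2_modification[OF auxiliary_cont(2)] by blast
  obtain R' where R': "proc_L2 R'" "\<And>t. t \<in> {0..T} \<Longrightarrow> sq_int M (R' t)" "AE \<omega> in M. \<forall>t\<in>{0..T}. R' t \<omega> = ref q t \<omega>"
    using cont_L2_modification[OF ref_cont] by blast
  let ?Z = "Zs (Suc q)"
  have Z: "proc_L2 ?Z" by (rule auxiliary_cont(3))
  have T0: "0 \<le> T" "T \<in> {0..T}" using T_pos by auto
  have LBINT_cong: "(LBINT s:{a..b}. f s) = (LBINT s:{a..b}. g s)" if "\<And>s. s \<in> {0..T} \<Longrightarrow> f s = g s" "0 \<le> a" "b \<le> T"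
    for a b and f g :: "real \<Rightarrow> 'z::{banach, second_countable_topology}"
    using that by (intro set_lebesgue_integral_cong) auto

  from auxiliary[of q] obtain Is where
    Is: "has_ito_integral M W T (\<lambda>s \<omega>. diffusion P s (Xs (Suc q) s \<omega>) (Ys (Suc q) s \<omega>)) Is" and
    fwd: "AE \<omega> in M. \<forall>t\<in>{0..T}. Xs (Suc q) t \<omega> = start P + (LBINT s:{0..t}. drift P s (Xs (Suc q) s \<omega>) (Ys (Suc q) s \<omega>) (?Z s \<omega>)) + Is t \<omega>"
    unfolding auxiliary_solution_def forward_sde_def by blast
  from auxiliary[of q] obtain Iz where
    Iz: "has_ito_integral M W T ?Z Iz" and
    bwd: "AE \<omega> in M. \<forall>t\<in>{0..T}. Ys (Suc q) t \<omega> = terminal P (ref q T \<omega>)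
      + (LBINT s:{t..T}. driver P s (ref q s \<omega>) (Ys (Suc q) s \<omega>) (?Z s \<omega>)) - (Iz T \<omega> - Iz t \<omega>)"
    unfolding auxiliary_solution_def backward_sde_def by blast
  have Is': "ito (\<lambda>s \<omega>. diffusion P s (X' s \<omega>) (Y' s \<omega>)) Is"
  proof (rule has_ito_integral_imp_ito[OF has_ito_integral_cong[OF Is]])
    show "AE \<omega> in M. \<forall>t\<in>{0..T}. diffusion P t (X' t \<omega>) (Y' t \<omega>) = diffusion P t (Xs (Suc q) t \<omega>) (Ys (Suc q) t \<omega>)"
      using X'(3) Y'(3) by eventually_elim simp
    show "sq_int Q (\<lambda>(s, \<omega>). diffusion P s (X' s \<omega>) (Y' s \<omega>))"
      using proc_L2_D(2)[OF coeff_proc_L2[OF diffusion_regular X'(1) Y'(1) Z]] by simp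
  qed
  have Iz': "ito ?Z Iz" by (rule has_ito_integral_imp_ito[OF Iz proc_L2_D(2)[OF Z]])
  have fwd': "AE \<omega> in M. \<forall>t\<in>{0..T}. X' t \<omega> = start P + (LBINT s:{0..t}. drift P s (X' s \<omega>) (Y' s \<omega>) (?Z s \<omega>)) + Is t \<omega>"
    using fwd X'(3) Y'(3)
  proof eventually_elim
    case (elim \<omega>)
    show ?case
    proof
      fix t assume t: "t \<in> {0..T}"
      have "(LBINT s:{0..t}. drift P s (X' s \<omega>) (Y' s \<omega>) (?Z s \<omega>)) = (LBINT s:{0..t}. drift P s (Xs (Suc q) s \<omega>) (Ys (Suc q) s \<omega>) (?Z s \<omega>))"
        using elim t by (intro LBINT_cong) auto
      then show "X' t \<omega> = start P + (LBINT s:{0..t}. drift P s (X' s \<omega>) (Y' s \<omega>) (?Z s \<omega>)) + Is t \<omega>"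
        using elim t by simp
    qed
  qed
  have bwd': "AE \<omega> in M. \<forall>t\<in>{0..T}. Y' t \<omega> = terminal P (R' T \<omega>)
      + (LBINT s:{t..T}. driver P s (R' s \<omega>) (Y' s \<omega>) (?Z s \<omega>)) - (Iz T \<omega> - Iz t \<omega>)"
    using bwd Y'(3) R'(3)
  proof eventually_elim
    case (elim \<omega>)
    show ?case
    proof
      fix t assume t: "t \<in> {0..T}"
      have "(LBINT s:{t..T}. driver P s (R' s \<omega>) (Y' s \<omega>) (?Z s \<omega>)) = (LBINT s:{t..T}. driver P s (ref q s \<omega>) (Ys (Suc q) s \<omega>) (?Z s \<omega>))"
        using elim t by (intro LBINT_cong) auto
      then show "Y' t \<omega> = terminal P (R' T \<omega>) + (LBINT s:{t..T}. driver P s (R' s \<omega>) (Y' s \<omega>) (?Z s \<omega>)) - (Iz T \<omega> - Iz t \<omega>)"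
        using elim t T0 by simp
    qed
  qed
  have AEt: "AE \<omega> in M. V t \<omega> = V' t \<omega>" if "AE \<omega> in M. \<forall>t\<in>{0..T}. V t \<omega> = V' t \<omega>" "t \<in> {0..T}" for t and V V' :: "real \<Rightarrow> 'a \<Rightarrow> 'z"
    using that(1) by eventually_elim (use that(2) in blast)

  have "err_sq M T (Xpi \<pi> (Suc q)) (Ypi \<pi> (Suc q)) (Zpi \<pi> (Suc q)) (Xs (Suc q)) (Ys (Suc q)) (Zs (Suc q))
    \<le> ennreal A * (ennreal (mesh \<pi>) + tloss \<pi> (Suc q) + tres \<pi> (Suc q))
      + ennreal ((1 + \<delta>)\<^sup>2 * ((1 + K_F T L) * K_B T L)) * pres \<pi> (Suc q)"
    if \<pi>: "is_partition T \<pi>" for \<pi>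
  proof -
    let ?x = "\<lambda>n \<omega>. fst (sXY \<pi> q n \<omega>)" and ?y = "\<lambda>n \<omega>. snd (sXY \<pi> q n \<omega>)" and ?N = "cells \<pi>"
    note r = C(2)[OF \<pi>, unfolded moments_le_def, rule_format]
    note x = C1(2)[OF \<pi>, unfolded moments_le_def, rule_format]
    note y = C1(3)[OF \<pi>, unfolded moments_le_def, rule_format]
    note z = C2(2)[OF \<pi>, unfolded moments_le_def, rule_format]
    have Cle: "C \<le> Cm" "C1 \<le> Cm" "C2 \<le> Cm" using C(1) C1(1) C2(1) by (auto simp: Cm_def)
    interpret S: euler_scheme M W P L \<pi> "\<theta> \<pi> q" ?x "sref \<pi> q" ?y "cut_z \<pi> q" Cm
    proof (rule euler_scheme.intro[OF fbsde_setting_axioms euler_scheme_axioms.intro])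
      show "is_partition T \<pi>" by (rule \<pi>)
      show "?x 0 \<omega> = start P" "?y 0 \<omega> = \<theta> \<pi> q" for \<omega> by simp_all
      show "?x (Suc n) \<omega> = ?x n \<omega> + (\<pi> ! Suc n - \<pi> ! n) *\<^sub>R drift P (\<pi> ! n) (?x n \<omega>) (?y n \<omega>) (cut_z \<pi> q n \<omega>)
          + diffusion P (\<pi> ! n) (?x n \<omega>) (?y n \<omega>) *v (W (\<pi> ! Suc n) \<omega> - W (\<pi> ! n) \<omega>)"
        "?y (Suc n) \<omega> = ?y n \<omega> + (\<pi> ! Suc n - \<pi> ! n) *\<^sub>R (- driver P (\<pi> ! n) (sref \<pi> q n \<omega>) (?y n \<omega>) (cut_z \<pi> q n \<omega>))
          + cut_z \<pi> q n \<omega> *v (W (\<pi> ! Suc n) \<omega> - W (\<pi> ! n) \<omega>)" if "n < ?N" for n \<omega>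
        using that by (simp_all add: euler_step_def Let_def split_def cut_z_def)
      fix n assume n: "n \<le> ?N"
      note r = r[OF n] and x = x[OF n] and y = y[OF n] and z = z[OF n]
      show "?x n \<in> borel_measurable (F (\<pi> ! n))" "?y n \<in> borel_measurable (F (\<pi> ! n))"
        "cut_z \<pi> q n \<in> borel_measurable (F (\<pi> ! n))" "sref \<pi> q n \<in> borel_measurable (F (\<pi> ! n))"
        by (rule x[THEN conjunct1] y[THEN conjunct1] z[THEN conjunct1] r[THEN conjunct1])+
      show "sq_int M (?x n)" "sq_int M (?y n)" "sq_int M (cut_z \<pi> q n)" "sq_int M (sref \<pi> q n)"
        by (rule x[THEN conjunct2, THEN conjunct1] y[THEN conjunct2, THEN conjunct1]
          z[THEN conjunct2, THEN conjunct1] r[THEN conjunct2, THEN conjunct1])+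
      show "msq M (?x n) \<le> Cm" "msq M (?y n) \<le> Cm"
        by (rule order_trans[OF x[THEN conjunct2, THEN conjunct2] Cle(2)]
          order_trans[OF y[THEN conjunct2, THEN conjunct2] Cle(2)])+
      show "msq M (cut_z \<pi> q n) \<le> Cm" by (rule order_trans[OF z[THEN conjunct2, THEN conjunct2] Cle(3)])
      show "msq M (sref \<pi> q n) \<le> Cm" by (rule order_trans[OF r[THEN conjunct2, THEN conjunct2] Cle(1)])
    qed
    \<comment> \<open>The residual is finite and thus a real number.\<close>
    define \<rho> where "\<rho> = enn2real (pres \<pi> (Suc q))"
    have \<rho>: "pres \<pi> (Suc q) = ennreal \<rho>" "0 \<le> \<rho>"
      using path_residual_finite[OF \<pi>, of q] by (auto simp: \<rho>_def)
    have ref_le: "msq M (\<lambda>\<omega>. interpolate \<pi> (sref \<pi> q) t \<omega> - R' t \<omega>) \<le> \<rho>" if t: "t \<in> {0..T}" for t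
    proof -
      have s: "sq_int M (\<lambda>\<omega>. interpolate \<pi> (sref \<pi> q) t \<omega> - ref q t \<omega>)"
        by (intro sq_int_diff S.interpolate_at cont_L2_D(3)[OF ref_cont] t)
      have "ennreal (msq M (\<lambda>\<omega>. interpolate \<pi> (sref \<pi> q) t \<omega> - ref q t \<omega>)) \<le> pres \<pi> (Suc q)"
        unfolding path_residual_def sup_mean_square_def mean_square_eq_msq[OF s, symmetric]
        using t by (intro SUP_upper2[of t]) (simp_all add: pi_processes)
      then have "msq M (\<lambda>\<omega>. interpolate \<pi> (sref \<pi> q) t \<omega> - ref q t \<omega>) \<le> \<rho>" using \<rho> by simp
      moreover have "msq M (\<lambda>\<omega>. interpolate \<pi> (sref \<pi> q) t \<omega> - R' t \<omega>) = msq M (\<lambda>\<omega>. interpolate \<pi> (sref \<pi> q) t \<omega> - ref q t \<omega>)"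
        using AEt[OF R'(3) t] sq_int_measurable[OF sq_int_diff[OF S.interpolate_at(4)[OF t] R'(2)[OF t]]] sq_int_measurable[OF s]
        by (intro msq_cong_AE) (auto elim!: eventually_mono)
      ultimately show ?thesis by simp
    qed
    define lo where "lo = msq M (\<lambda>\<omega>. terminal P (?x ?N \<omega>) - ?y ?N \<omega>)"
    define \<tau> where "\<tau> = msq M (\<lambda>\<omega>. terminal P (?x ?N \<omega>) - terminal P (sref \<pi> q ?N \<omega>))"
    define G where "G = (1 + \<delta>)\<^sup>2 * ((1 + K_F T L) * K_B T L)"
    have G: "0 \<le> G"
      using T0 by (auto simp: G_def K_F_def K_B_def kappa_y_def kappa_z_def max_def intro!: mult_nonneg_nonneg add_nonneg_nonneg)
    have pos: "0 \<le> lo" "0 \<le> \<tau>" "0 \<le> mesh \<pi>" "0 \<le> A" using mesh_bounds[OF \<pi>] by (auto simp: lo_def \<tau>_def A_def)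
    define Bd where "Bd = A * (mesh \<pi> + lo + \<tau>) + G * \<rho>"
    define zz where "zz = msq Q (\<lambda>(s, \<omega>). interpolate \<pi> (cut_z \<pi> q) s \<omega> - ?Z s \<omega>)"
    have zQ: "sq_int Q (\<lambda>(s, \<omega>). interpolate \<pi> (cut_z \<pi> q) s \<omega> - ?Z s \<omega>)"
      using proc_L2_D(2)[OF proc_L2_diff[OF interpolate_proc_L2[OF \<pi> S.meas(3) S.sq(3)] Z]] by simp
    have bound: "msq M (\<lambda>\<omega>. interpolate \<pi> ?x t \<omega> - Xs (Suc q) t \<omega>) + msq M (\<lambda>\<omega>. interpolate \<pi> ?y t \<omega> - Ys (Suc q) t \<omega>) + zz \<le> Bd"
      if t: "t \<in> {0..T}" for t
    proof -
      have "msq M (\<lambda>\<omega>. interpolate \<pi> ?x t \<omega> - Xs (Suc q) t \<omega>) = msq M (\<lambda>\<omega>. interpolate \<pi> ?x t \<omega> - X' t \<omega>)"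
        using AEt[OF X'(3) t] sq_int_measurable[OF sq_int_diff[OF S.interpolate_at(1)[OF t] X'(2)[OF t]]]
          sq_int_measurable[OF sq_int_diff[OF S.interpolate_at(1)[OF t] cont_L2_D(3)[OF auxiliary_cont(1) t]]]
        by (intro msq_cong_AE) (auto elim!: eventually_mono)
      moreover have "msq M (\<lambda>\<omega>. interpolate \<pi> ?y t \<omega> - Ys (Suc q) t \<omega>) = msq M (\<lambda>\<omega>. interpolate \<pi> ?y t \<omega> - Y' t \<omega>)"
        using AEt[OF Y'(3) t] sq_int_measurable[OF sq_int_diff[OF S.interpolate_at(2)[OF t] Y'(2)[OF t]]]
          sq_int_measurable[OF sq_int_diff[OF S.interpolate_at(2)[OF t] cont_L2_D(3)[OF auxiliary_cont(2) t]]]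
        by (intro msq_cong_AE) (auto elim!: eventually_mono)
      moreover have "msq M (\<lambda>\<omega>. interpolate \<pi> ?x t \<omega> - X' t \<omega>) + msq M (\<lambda>\<omega>. interpolate \<pi> ?y t \<omega> - Y' t \<omega>) + zz
        \<le> error_const \<delta> Cm * (mesh \<pi> + lo + \<tau>) + G * \<rho>"
        unfolding zz_def lo_def \<tau>_def G_def
        by (rule S.scheme_stability[OF X'(1,2) Y'(1,2) R'(1,2) Z Is' Iz' fwd' bwd' ref_le \<delta> t])
      moreover have "error_const \<delta> Cm * (mesh \<pi> + lo + \<tau>) \<le> A * (mesh \<pi> + lo + \<tau>)"
        using pos by (intro mult_right_mono) (auto simp: A_def)
      ultimately show ?thesis unfolding Bd_def by linarith
    qed
    \<comment> \<open>The control error \<open>zz\<close> does not depend on \<open>t\<close>, so the supremum only concerns the other two.\<close>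
    have zB: "zz \<le> Bd"
      using bound[OF T0(2)] msq_nonneg[of M "\<lambda>\<omega>. interpolate \<pi> ?x T \<omega> - Xs (Suc q) T \<omega>"]
        msq_nonneg[of M "\<lambda>\<omega>. interpolate \<pi> ?y T \<omega> - Ys (Suc q) T \<omega>"] by linarith
    have "(SUP t\<in>{0..T}. \<integral>\<^sup>+ \<omega>. ennreal ((norm (interpolate \<pi> ?x t \<omega> - Xs (Suc q) t \<omega>))\<^sup>2 + (norm (interpolate \<pi> ?y t \<omega> - Ys (Suc q) t \<omega>))\<^sup>2) \<partial>M)
      \<le> ennreal (Bd - zz)"
    proof (rule SUP_least)
      fix t assume t: "t \<in> {0..T}"
      show "(\<integral>\<^sup>+ \<omega>. ennreal ((norm (interpolate \<pi> ?x t \<omega> - Xs (Suc q) t \<omega>))\<^sup>2 + (norm (interpolate \<pi> ?y t \<omega> - Ys (Suc q) t \<omega>))\<^sup>2) \<partial>M)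
        \<le> ennreal (Bd - zz)"
      proof (subst err_sq_pointwise[of "interpolate \<pi> ?x" "Xs (Suc q)" "interpolate \<pi> ?y" "Ys (Suc q)" t])
        show "sq_int M (\<lambda>\<omega>. interpolate \<pi> ?x s \<omega> - Xs (Suc q) s \<omega>)" if s: "s \<in> {0..T}" for s
          by (rule sq_int_diff[OF S.interpolate_at(1)[OF s] cont_L2_D(3)[OF auxiliary_cont(1) s]])
        show "sq_int M (\<lambda>\<omega>. interpolate \<pi> ?y s \<omega> - Ys (Suc q) s \<omega>)" if s: "s \<in> {0..T}" for s
          by (rule sq_int_diff[OF S.interpolate_at(2)[OF s] cont_L2_D(3)[OF auxiliary_cont(2) s]])
        show "ennreal (msq M (\<lambda>\<omega>. interpolate \<pi> ?x t \<omega> - Xs (Suc q) t \<omega>) + msq M (\<lambda>\<omega>. interpolate \<pi> ?y t \<omega> - Ys (Suc q) t \<omega>))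
          \<le> ennreal (Bd - zz)"
          by (rule ennreal_leI) (use bound[OF t] in linarith)
      qed (rule t)
    qed
    moreover have "int_mean_square M T (\<lambda>t \<omega>. Zpi \<pi> (Suc q) t \<omega> - ?Z t \<omega>) = ennreal zz"
      unfolding int_mean_square_cut_z[OF \<pi>] zz_def by (rule int_mean_square_eq_msq[OF zQ])
    ultimately have "err_sq M T (Xpi \<pi> (Suc q)) (Ypi \<pi> (Suc q)) (Zpi \<pi> (Suc q)) (Xs (Suc q)) (Ys (Suc q)) (Zs (Suc q))
      \<le> ennreal (Bd - zz) + ennreal zz"
      unfolding err_sq_def pi_processes(1,2) by (intro add_mono) auto
    also have "\<dots> = ennreal Bd"
      using zB by (subst ennreal_plus[symmetric]) (auto simp: zz_def)
    also have "\<dots> = ennreal A * (ennreal (mesh \<pi>) + ennreal lo + ennreal \<tau>) + ennreal G * ennreal \<rho>"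
      using pos G \<rho>(2) by (simp add: Bd_def ennreal_mult[symmetric] flip: ennreal_plus)
    also have "ennreal lo = tloss \<pi> (Suc q)"
      unfolding terminal_loss_def pi_processes interpolate_end[OF \<pi>] lo_def
      by (intro mean_square_eq_msq[symmetric] sq_int_diff terminal_sq_int S.sq order_refl)
    also have "ennreal \<tau> = tres \<pi> (Suc q)"
      unfolding terminal_residual_def diff_Suc_1 pi_processes interpolate_end[OF \<pi>] \<tau>_def
      by (intro mean_square_eq_msq[symmetric] sq_int_diff terminal_sq_int S.sq order_refl)
    finally show ?thesis unfolding G_def \<rho>(1) .
  qed
  moreover have "0 \<le> A" by (simp add: A_def)
  ultimately show thesis using that by blast
qed

lemma err_sq_triangle:
  assumes \<pi>: "is_partition T \<pi>"
  shows "err_sq M T (Xpi \<pi> (Suc q)) (Ypi \<pi> (Suc q)) (Zpi \<pi> (Suc q)) X Y Z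
    \<le> 2 * err_sq M T (Xpi \<pi> (Suc q)) (Ypi \<pi> (Suc q)) (Zpi \<pi> (Suc q)) (Xs (Suc q)) (Ys (Suc q)) (Zs (Suc q))
      + 2 * err_sq M T (Xs (Suc q)) (Ys (Suc q)) (Zs (Suc q)) X Y Z"
proof -
  obtain C where C: "0 \<le> C" "\<And>\<pi>. is_partition T \<pi> \<Longrightarrow> moments_le C \<pi> (sref \<pi> q)"
    using scheme_reference_moments by blast
  obtain C1 where C1: "0 \<le> C1" "\<And>\<pi>. is_partition T \<pi> \<Longrightarrow> moments_le C1 \<pi> (\<lambda>n \<omega>. fst (sXY \<pi> q n \<omega>))"
    "\<And>\<pi>. is_partition T \<pi> \<Longrightarrow> moments_le C1 \<pi> (\<lambda>n \<omega>. snd (sXY \<pi> q n \<omega>))"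
    by (rule next_iterate_moments[OF C]) (assumption, (rule that; assumption))
  obtain C2 where C2: "0 \<le> C2" "\<And>\<pi>. is_partition T \<pi> \<Longrightarrow> moments_le C2 \<pi> (cut_z \<pi> q)"
    by (rule cut_z_moments[OF C]) (assumption, (rule that; assumption))
  let ?x = "Xpi \<pi> (Suc q)" and ?y = "Ypi \<pi> (Suc q)" and ?z = "interpolate \<pi> (cut_z \<pi> q)"
  let ?X = "Xs (Suc q)" and ?Y = "Ys (Suc q)" and ?Z = "Zs (Suc q)"
  have x: "sq_int M (?x t)" and y: "sq_int M (?y t)" and xs: "sq_int M (?X t)" "sq_int M (?Y t)" "sq_int M (X t)" "sq_int M (Y t)"
    if t: "t \<in> {0..T}" for t
    using interpolate_moments(1)[OF C1(2)[OF \<pi>] \<pi> t] interpolate_moments(1)[OF C1(3)[OF \<pi>] \<pi> t]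
      cont_L2_D(3)[OF auxiliary_cont(1) t] cont_L2_D(3)[OF auxiliary_cont(2) t] cont_L2_D(3)[OF coupled(1) t] cont_L2_D(3)[OF coupled(2) t]
    by (simp_all add: pi_processes)
  have zp: "proc_L2 ?z"
    by (rule interpolate_proc_L2[OF \<pi>]) (use C2(2)[OF \<pi>] in \<open>auto simp: moments_le_def\<close>)
  have tri: "msq N (\<lambda>a. U a - U'' a) \<le> 2 * msq N (\<lambda>a. U a - U' a) + 2 * msq N (\<lambda>a. U' a - U'' a)"
    if "sq_int N (\<lambda>a. U a - U' a)" "sq_int N (\<lambda>a. U' a - U'' a)" for N :: "'n measure" and U U' U'' :: "'n \<Rightarrow> 'u::euclidean_space"
    using msq_add_le[OF that] by simp
  have double: "ennreal (2 * a + 2 * b) = 2 * ennreal a + 2 * ennreal b" if "0 \<le> a" "0 \<le> b" for a b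
    using that by (simp add: ennreal_mult)
  have "(SUP t\<in>{0..T}. \<integral>\<^sup>+ \<omega>. ennreal ((norm (?x t \<omega> - X t \<omega>))\<^sup>2 + (norm (?y t \<omega> - Y t \<omega>))\<^sup>2) \<partial>M)
    \<le> 2 * (SUP t\<in>{0..T}. \<integral>\<^sup>+ \<omega>. ennreal ((norm (?x t \<omega> - ?X t \<omega>))\<^sup>2 + (norm (?y t \<omega> - ?Y t \<omega>))\<^sup>2) \<partial>M)
    + 2 * (SUP t\<in>{0..T}. \<integral>\<^sup>+ \<omega>. ennreal ((norm (?X t \<omega> - X t \<omega>))\<^sup>2 + (norm (?Y t \<omega> - Y t \<omega>))\<^sup>2) \<partial>M)"
    (is "_ \<le> 2 * ?S1 + 2 * ?S2")
  proof (rule SUP_least)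
    fix t assume t: "t \<in> {0..T}"
    let ?a = "msq M (\<lambda>\<omega>. ?x t \<omega> - ?X t \<omega>) + msq M (\<lambda>\<omega>. ?y t \<omega> - ?Y t \<omega>)"
    let ?b = "msq M (\<lambda>\<omega>. ?X t \<omega> - X t \<omega>) + msq M (\<lambda>\<omega>. ?Y t \<omega> - Y t \<omega>)"
    have "(\<integral>\<^sup>+ \<omega>. ennreal ((norm (?x t \<omega> - X t \<omega>))\<^sup>2 + (norm (?y t \<omega> - Y t \<omega>))\<^sup>2) \<partial>M)
      = ennreal (msq M (\<lambda>\<omega>. ?x t \<omega> - X t \<omega>) + msq M (\<lambda>\<omega>. ?y t \<omega> - Y t \<omega>))"
      by (rule err_sq_pointwise[of ?x X ?y Y t, OF sq_int_diff[OF x xs(3)] sq_int_diff[OF y xs(4)] t])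
    also have "\<dots> \<le> ennreal (2 * ?a + 2 * ?b)"
      using tri[OF sq_int_diff[OF x[OF t] xs(1)[OF t]] sq_int_diff[OF xs(1)[OF t] xs(3)[OF t]]]
        tri[OF sq_int_diff[OF y[OF t] xs(2)[OF t]] sq_int_diff[OF xs(2)[OF t] xs(4)[OF t]]]
      by (intro ennreal_leI) simp
    also have "\<dots> = 2 * ennreal ?a + 2 * ennreal ?b"
      by (rule double) (rule add_nonneg_nonneg msq_nonneg)+
    also have "\<dots> \<le> 2 * ?S1 + 2 * ?S2"
    proof (intro add_mono mult_left_mono)
      have "ennreal ?a = (\<integral>\<^sup>+ \<omega>. ennreal ((norm (?x t \<omega> - ?X t \<omega>))\<^sup>2 + (norm (?y t \<omega> - ?Y t \<omega>))\<^sup>2) \<partial>M)"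
        by (rule err_sq_pointwise[of ?x ?X ?y ?Y t, OF sq_int_diff[OF x xs(1)] sq_int_diff[OF y xs(2)] t, symmetric])
      then show "ennreal ?a \<le> ?S1" using t by (intro SUP_upper2[of t]) auto
      have "ennreal ?b = (\<integral>\<^sup>+ \<omega>. ennreal ((norm (?X t \<omega> - X t \<omega>))\<^sup>2 + (norm (?Y t \<omega> - Y t \<omega>))\<^sup>2) \<partial>M)"
        by (rule err_sq_pointwise[of ?X X ?Y Y t, OF sq_int_diff[OF xs(1) xs(3)] sq_int_diff[OF xs(2) xs(4)] t, symmetric])
      then show "ennreal ?b \<le> ?S2" using t by (intro SUP_upper2[of t]) auto
    qed auto
    finally show "(\<integral>\<^sup>+ \<omega>. ennreal ((norm (?x t \<omega> - X t \<omega>))\<^sup>2 + (norm (?y t \<omega> - Y t \<omega>))\<^sup>2) \<partial>M) \<le> 2 * ?S1 + 2 * ?S2" .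
  qed
  moreover have "int_mean_square M T (\<lambda>t \<omega>. ?z t \<omega> - Z t \<omega>)
    \<le> 2 * int_mean_square M T (\<lambda>t \<omega>. ?z t \<omega> - ?Z t \<omega>) + 2 * int_mean_square M T (\<lambda>t \<omega>. ?Z t \<omega> - Z t \<omega>)"
  proof -
    note d = proc_L2_D(2)[OF proc_L2_diff[OF zp auxiliary_cont(3)]] proc_L2_D(2)[OF proc_L2_diff[OF auxiliary_cont(3) coupled(3)]]
      proc_L2_D(2)[OF proc_L2_diff[OF zp coupled(3)]]
    have "msq Q (\<lambda>(t, \<omega>). ?z t \<omega> - Z t \<omega>) \<le> 2 * msq Q (\<lambda>(t, \<omega>). ?z t \<omega> - ?Z t \<omega>) + 2 * msq Q (\<lambda>(t, \<omega>). ?Z t \<omega> - Z t \<omega>)"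
      using tri[of Q "case_prod ?z" "case_prod ?Z" "case_prod Z"] d by (simp add: split_def)
    then have "ennreal (msq Q (\<lambda>(t, \<omega>). ?z t \<omega> - Z t \<omega>)) \<le> ennreal (2 * msq Q (\<lambda>(t, \<omega>). ?z t \<omega> - ?Z t \<omega>) + 2 * msq Q (\<lambda>(t, \<omega>). ?Z t \<omega> - Z t \<omega>))"
      by (rule ennreal_leI)
    also have "\<dots> = 2 * ennreal (msq Q (\<lambda>(t, \<omega>). ?z t \<omega> - ?Z t \<omega>)) + 2 * ennreal (msq Q (\<lambda>(t, \<omega>). ?Z t \<omega> - Z t \<omega>))"
      by (rule double) (rule msq_nonneg)+
    finally show ?thesis
      using int_mean_square_eq_msq[OF d(1)] int_mean_square_eq_msq[OF d(2)] int_mean_square_eq_msq[OF d(3)] by simp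
  qed
  ultimately show ?thesis
    unfolding err_sq_def int_mean_square_cut_z[OF \<pi>] distrib_left
    by (rule order_trans[OF add_mono]) (simp only: ac_simps order_refl)
qed

text \<open>The reference of the scheme and the reference process are the same running averages, so their
  distance is at most the average of the distances of the averaged iterates.\<close>

lemma path_residual_le_average:
  assumes \<pi>: "is_partition T \<pi>"
  shows "pres \<pi> (Suc q)
    \<le> ennreal (1 / real (Suc q)) * (\<Sum>j<Suc q. ferr \<pi> j)"
proof -
  let ?f = "ferr \<pi>"
  let ?D = "\<lambda>q t \<omega>. interpolate \<pi> (sref \<pi> q) t \<omega> - ref q t \<omega>"
  have D: "sq_int M (?D q t)" if t: "t \<in> {0..T}" for q t
  proof -
    obtain C where C: "0 \<le> C" "\<And>\<pi>. is_partition T \<pi> \<Longrightarrow> moments_le C \<pi> (sref \<pi> q)"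
      using scheme_reference_moments by blast
    show ?thesis by (intro sq_int_diff interpolate_moments(1)[OF C(2)[OF \<pi>] \<pi> t] cont_L2_D(3)[OF ref_cont t])
  qed
  have le: "ennreal (real (Suc q) * msq M (?D q t)) \<le> (\<Sum>j<Suc q. ?f j)" if t: "t \<in> {0..T}" for q t
  proof (induction q)
    case 0
    have "ennreal (msq M (?D 0 t)) = mean_square M (?D 0 t)" by (rule mean_square_eq_msq[symmetric, OF D[OF t]])
    also have "\<dots> \<le> ?f 0"
      unfolding forward_error_def sup_mean_square_def using t by (intro SUP_upper2[of t]) (simp_all add: pi_processes)
    finally show ?case by simp
  next
    case (Suc q)
    obtain C where C: "0 \<le> C" "\<And>\<pi>. is_partition T \<pi> \<Longrightarrow> moments_le C \<pi> (sref \<pi> q)"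
      using scheme_reference_moments by blast
    obtain C1 where C1: "0 \<le> C1" "\<And>\<pi>. is_partition T \<pi> \<Longrightarrow> moments_le C1 \<pi> (\<lambda>n \<omega>. fst (sXY \<pi> q n \<omega>))"
      "\<And>\<pi>. is_partition T \<pi> \<Longrightarrow> moments_le C1 \<pi> (\<lambda>n \<omega>. snd (sXY \<pi> q n \<omega>))"
      by (rule next_iterate_moments[OF C]) (assumption, (rule that; assumption))
    let ?E = "\<lambda>\<omega>. Xpi \<pi> (Suc q) t \<omega> - Xs (Suc q) t \<omega>"
    have E: "sq_int M ?E"
      unfolding pi_processes by (intro sq_int_diff interpolate_moments(1)[OF C1(2)[OF \<pi>] \<pi> t] cont_L2_D(3)[OF auxiliary_cont(1) t])
    let ?a = "real (Suc q) / (real (Suc q) + 1)" and ?b = "1 / (real (Suc q) + 1)"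
    have ab: "0 \<le> ?a" "0 \<le> ?b" "?a + ?b = 1" by (auto simp: field_simps)
    have eq: "?D (Suc q) t = (\<lambda>\<omega>. ?a *\<^sub>R ?D q t \<omega> + ?b *\<^sub>R ?E \<omega>)"
      by (intro ext) (simp add: pi_processes interpolate_grid_index[OF \<pi>] scaleR_diff_right)
    have "msq M (?D (Suc q) t) \<le> ?a * msq M (?D q t) + ?b * msq M ?E"
      unfolding eq by (rule msq_convex[OF D[OF t] E ab])
    also have "\<dots> = (real (Suc q) * msq M (?D q t) + msq M ?E) / (real (Suc q) + 1)"
      by (simp only: add_divide_distrib times_divide_eq_left mult_1)
    finally have "real (Suc (Suc q)) * msq M (?D (Suc q) t) \<le> real (Suc q) * msq M (?D q t) + msq M ?E"
      by (simp add: pos_le_divide_eq mult.commute add.commute)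
    then have "ennreal (real (Suc (Suc q)) * msq M (?D (Suc q) t)) \<le> ennreal (real (Suc q) * msq M (?D q t) + msq M ?E)"
      by (rule ennreal_leI)
    also have "\<dots> = ennreal (real (Suc q) * msq M (?D q t)) + ennreal (msq M ?E)" by simp
    also have "\<dots> \<le> (\<Sum>j<Suc q. ?f j) + ?f (Suc q)"
    proof (intro add_mono Suc)
      have "ennreal (msq M ?E) = mean_square M ?E" by (rule mean_square_eq_msq[symmetric, OF E])
      also have "\<dots> \<le> ?f (Suc q)"
        unfolding forward_error_def sup_mean_square_def using t by (intro SUP_upper2[of t]) simp_all
      finally show "ennreal (msq M ?E) \<le> ?f (Suc q)" .
    qed
    finally show ?case by simp
  qed
  show ?thesis
    unfolding path_residual_def sup_mean_square_def
  proof (rule SUP_least)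
    fix t assume t: "t \<in> {0..T}"
    have "mean_square M (\<lambda>\<omega>. Rpi \<pi> (Suc q - 1) t \<omega> - ref (Suc q - 1) t \<omega>) = ennreal (msq M (?D q t))"
      unfolding diff_Suc_1 pi_processes by (rule mean_square_eq_msq[OF D[OF t]])
    also have "\<dots> = ennreal (1 / real (Suc q)) * ennreal (real (Suc q) * msq M (?D q t))"
      by (subst ennreal_mult[symmetric]) auto
    also have "\<dots> \<le> ennreal (1 / real (Suc q)) * (\<Sum>j<Suc q. ?f j)"
      by (intro mult_left_mono le t) simp
    finally show "mean_square M (\<lambda>\<omega>. Rpi \<pi> (Suc q - 1) t \<omega> - ref (Suc q - 1) t \<omega>)
      \<le> ennreal (1 / real (Suc q)) * (\<Sum>j<Suc q. ?f j)" .
  qed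
qed

text \<open>The weight \<open>\<delta>\<close> solves \<open>(1 + \<delta>)\<^sup>2 = 1 + \<zeta>\<close>; the factor \<open>2\<close> of \<^const>\<open>Gamma_const\<close> comes from
  inserting the auxiliary solution. Adding \<open>1\<close> makes the constant positive.\<close>

lemma total_error:
  assumes "0 < \<zeta>" "1 \<le> p"
  obtains A where "0 < A" "\<And>\<pi>. is_partition T \<pi> \<Longrightarrow>
    err_sq M T (Xpi \<pi> p) (Ypi \<pi> p) (Zpi \<pi> p) X Y Z
    \<le> ennreal A * (ennreal (mesh \<pi>) + tloss \<pi> p + tres \<pi> p)
      + ennreal (Gamma_const T L \<zeta>) * pres \<pi> p
      + 2 * err_sq M T (Xs p) (Ys p) (Zs p) X Y Z"
proof -
  obtain q where p: "p = Suc q" using assms(2) by (cases p) auto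
  define \<delta> where "\<delta> = sqrt (1 + \<zeta>) - 1"
  have \<delta>: "0 < \<delta>" "(1 + \<delta>)\<^sup>2 = 1 + \<zeta>" using assms(1) by (auto simp: \<delta>_def)
  obtain A where A: "0 \<le> A" "\<And>\<pi>. is_partition T \<pi> \<Longrightarrow>
    err_sq M T (Xpi \<pi> p) (Ypi \<pi> p) (Zpi \<pi> p) (Xs p) (Ys p) (Zs p)
    \<le> ennreal A * (ennreal (mesh \<pi>) + tloss \<pi> p + tres \<pi> p)
      + ennreal ((1 + \<delta>)\<^sup>2 * ((1 + K_F T L) * K_B T L)) * pres \<pi> p"
    using iterate_error[OF \<delta>(1), of q] unfolding p by blast
  have G: "0 \<le> (1 + K_F T L) * K_B T L"
    using T_pos by (auto simp: K_F_def K_B_def kappa_y_def kappa_z_def max_def intro!: mult_nonneg_nonneg add_nonneg_nonneg)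
  have two: "2 * (ennreal a * u) = ennreal (2 * a) * u" if "0 \<le> a" for a u
    using that by (simp add: ennreal_mult mult.assoc)
  have "err_sq M T (Xpi \<pi> p) (Ypi \<pi> p) (Zpi \<pi> p) X Y Z
    \<le> ennreal (2 * A + 1) * (ennreal (mesh \<pi>) + tloss \<pi> p + tres \<pi> p)
      + ennreal (Gamma_const T L \<zeta>) * pres \<pi> p
      + 2 * err_sq M T (Xs p) (Ys p) (Zs p) X Y Z" if \<pi>: "is_partition T \<pi>" for \<pi>
  proof -
    let ?S = "ennreal (mesh \<pi>) + tloss \<pi> p + tres \<pi> p"
      and ?r = "pres \<pi> p" and ?e = "err_sq M T (Xs p) (Ys p) (Zs p) X Y Z"
    have "err_sq M T (Xpi \<pi> p) (Ypi \<pi> p) (Zpi \<pi> p) X Y Z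
      \<le> 2 * err_sq M T (Xpi \<pi> p) (Ypi \<pi> p) (Zpi \<pi> p) (Xs p) (Ys p) (Zs p) + 2 * ?e"
      unfolding p by (rule err_sq_triangle[OF \<pi>])
    also have "\<dots> \<le> 2 * (ennreal A * ?S + ennreal ((1 + \<delta>)\<^sup>2 * ((1 + K_F T L) * K_B T L)) * ?r) + 2 * ?e"
      by (intro add_right_mono mult_left_mono A(2)[OF \<pi>]) simp
    also have "2 * (ennreal A * ?S + ennreal ((1 + \<delta>)\<^sup>2 * ((1 + K_F T L) * K_B T L)) * ?r)
      = ennreal (2 * A) * ?S + ennreal (Gamma_const T L \<zeta>) * ?r"
    proof -
      have "0 \<le> (1 + \<zeta>) * ((1 + K_F T L) * K_B T L)" using G assms(1) by simp
      moreover have "2 * ((1 + \<zeta>) * ((1 + K_F T L) * K_B T L)) = Gamma_const T L \<zeta>"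
        unfolding Gamma_const_def by (simp only: ac_simps)
      ultimately have "2 * (ennreal ((1 + \<zeta>) * ((1 + K_F T L) * K_B T L)) * ?r) = ennreal (Gamma_const T L \<zeta>) * ?r"
        using two by metis
      with two[OF A(1), of ?S] show ?thesis unfolding \<delta>(2) by (simp only: distrib_left[where a = "2::ennreal" and b = "ennreal A * ?S"])
    qed
    also have "\<dots> \<le> ennreal (2 * A + 1) * ?S + ennreal (Gamma_const T L \<zeta>) * ?r"
      by (intro add_right_mono mult_right_mono ennreal_leI) auto
    finally show ?thesis by (simp add: add_right_mono)
  qed
  then show thesis using that[of "2 * A + 1"] A(1) by simp
qed

end

theorem theorem5p1:
  fixes M :: "'a measure"
    and W :: "real \<Rightarrow> 'a \<Rightarrow> real^'d"
    and P :: "('d::finite, 'm::finite) fbsde"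
    and L :: reg_consts
    and X :: "real \<Rightarrow> 'a \<Rightarrow> real^'d" and Y :: "real \<Rightarrow> 'a \<Rightarrow> real^'m" and Z :: "real \<Rightarrow> 'a \<Rightarrow> real^'d^'m"
    and R\<^sub>0 :: "real \<Rightarrow> 'a \<Rightarrow> real^'d"
    and Xs :: "nat \<Rightarrow> real \<Rightarrow> 'a \<Rightarrow> real^'d"
    and Ys :: "nat \<Rightarrow> real \<Rightarrow> 'a \<Rightarrow> real^'m"
    and Zs :: "nat \<Rightarrow> real \<Rightarrow> 'a \<Rightarrow> real^'d^'m"
    and \<phi> :: "real list \<Rightarrow> nat \<Rightarrow> nat \<Rightarrow> real^'d \<Rightarrow> real^'m"
    and \<theta> :: "real list \<Rightarrow> nat \<Rightarrow> real^'m"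
  assumes "prob_space M" and "complete_measure M"
    and "0 < horizon P"
    and "brownian_motion M (horizon P) W"
    and "measurable_coefficients P"
    and C: "coefficient_regularity P L"
    and WP: "well_posedness M W P X Y Z R\<^sub>0 Xs Ys Zs"
    and N: "uniform_neural_bounds (horizon P) \<phi> \<theta>"
  shows "(\<forall>p\<ge>1. \<exists>\<Lambda>>0. \<forall>\<pi>. is_partition (horizon P) \<pi> \<longrightarrow>
      err_sq M (horizon P) (X_pi P W \<phi> \<theta> \<pi> p) (Y_pi P W \<phi> \<theta> \<pi> p) (Z_pi P W \<phi> \<theta> \<pi> p) X Y Z
      \<le> ennreal \<Lambda> * (ennreal (mesh \<pi>) + terminal_loss M P W \<phi> \<theta> \<pi> p
            + terminal_residual M P W \<phi> \<theta> \<pi> p + path_residual M P W \<phi> \<theta> R\<^sub>0 Xs \<pi> p)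
          + 2 * err_sq M (horizon P) (Xs p) (Ys p) (Zs p) X Y Z)
    \<and> (\<forall>\<zeta>>0. \<exists>A :: nat \<Rightarrow> real. (\<forall>p\<ge>1. 0 < A p) \<and>
      (\<forall>\<pi>. is_partition (horizon P) \<pi> \<longrightarrow> (\<forall>p\<ge>1.
        err_sq M (horizon P) (X_pi P W \<phi> \<theta> \<pi> p) (Y_pi P W \<phi> \<theta> \<pi> p) (Z_pi P W \<phi> \<theta> \<pi> p) X Y Z
        \<le> ennreal (A p) * (ennreal (mesh \<pi>) + terminal_loss M P W \<phi> \<theta> \<pi> p
              + terminal_residual M P W \<phi> \<theta> \<pi> p)
            + ennreal (Gamma_const (horizon P) L \<zeta> / real p)
                * (\<Sum>j<p. forward_error M P W \<phi> \<theta> R\<^sub>0 Xs \<pi> j)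
            + 2 * err_sq M (horizon P) (Xs p) (Ys p) (Zs p) X Y Z)))"
proof -
  let ?T = "horizon P"
  interpret fbsde_approximation M W P L X Y Z R\<^sub>0 Xs Ys Zs \<phi> \<theta>
  proof (intro fbsde_approximation.intro fbsde_setting.intro brownian.intro brownian_axioms.intro
      fbsde_setting_axioms.intro fbsde_approximation_axioms.intro)
  qed (fact assms)+
  let ?err = "\<lambda>\<pi> p. err_sq M ?T (X_pi P W \<phi> \<theta> \<pi> p) (Y_pi P W \<phi> \<theta> \<pi> p) (Z_pi P W \<phi> \<theta> \<pi> p) X Y Z"
    and ?S = "\<lambda>\<pi> p. ennreal (mesh \<pi>) + terminal_loss M P W \<phi> \<theta> \<pi> p + terminal_residual M P W \<phi> \<theta> \<pi> p"
    and ?dec = "\<lambda>p. 2 * err_sq M ?T (Xs p) (Ys p) (Zs p) X Y Z"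
    and ?R = "path_residual M P W \<phi> \<theta> R\<^sub>0 Xs"
  show ?thesis
  proof (intro conjI allI impI)
    fix p :: nat assume p: "1 \<le> p"
    obtain A where A: "0 < A" "\<And>\<pi>. is_partition ?T \<pi> \<Longrightarrow>
      ?err \<pi> p \<le> ennreal A * ?S \<pi> p + ennreal (Gamma_const ?T L 1) * ?R \<pi> p + ?dec p"
      using total_error[OF zero_less_one p] by blast
    define \<Lambda> where "\<Lambda> = max A (Gamma_const ?T L 1)"
    have "?err \<pi> p \<le> ennreal \<Lambda> * (?S \<pi> p + ?R \<pi> p) + ?dec p" if \<pi>: "is_partition ?T \<pi>" for \<pi>
    proof -
      have "ennreal A * ?S \<pi> p + ennreal (Gamma_const ?T L 1) * ?R \<pi> p \<le> ennreal \<Lambda> * ?S \<pi> p + ennreal \<Lambda> * ?R \<pi> p"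
        by (intro add_mono mult_right_mono ennreal_leI) (auto simp: \<Lambda>_def)
      then have "ennreal A * ?S \<pi> p + ennreal (Gamma_const ?T L 1) * ?R \<pi> p + ?dec p \<le> ennreal \<Lambda> * (?S \<pi> p + ?R \<pi> p) + ?dec p"
        unfolding distrib_left by (rule add_right_mono)
      with A(2)[OF \<pi>] show ?thesis by (rule order_trans)
    qed
    moreover have "0 < \<Lambda>" using A(1) by (simp add: \<Lambda>_def)
    ultimately show "\<exists>\<Lambda>>0. \<forall>\<pi>. is_partition ?T \<pi> \<longrightarrow> ?err \<pi> p \<le> ennreal \<Lambda> * (?S \<pi> p + ?R \<pi> p) + ?dec p"
      by blast
  next
    fix \<zeta> :: real assume \<zeta>: "0 < \<zeta>"
    have G: "0 \<le> Gamma_const ?T L \<zeta>"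
      using T_pos \<zeta> by (auto simp: Gamma_const_def K_F_def K_B_def kappa_y_def kappa_z_def max_def intro!: mult_nonneg_nonneg add_nonneg_nonneg)
    have "\<exists>A>0. \<forall>\<pi>. is_partition ?T \<pi> \<longrightarrow> ?err \<pi> p \<le> ennreal A * ?S \<pi> p
        + ennreal (Gamma_const ?T L \<zeta> / real p) * (\<Sum>j<p. forward_error M P W \<phi> \<theta> R\<^sub>0 Xs \<pi> j) + ?dec p" if p: "1 \<le> p" for p
    proof -
      obtain A where A: "0 < A" "\<And>\<pi>. is_partition ?T \<pi> \<Longrightarrow>
        ?err \<pi> p \<le> ennreal A * ?S \<pi> p + ennreal (Gamma_const ?T L \<zeta>) * ?R \<pi> p + ?dec p"
        using total_error[OF \<zeta> p] by blast
      have "?err \<pi> p \<le> ennreal A * ?S \<pi> p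
        + ennreal (Gamma_const ?T L \<zeta> / real p) * (\<Sum>j<p. forward_error M P W \<phi> \<theta> R\<^sub>0 Xs \<pi> j) + ?dec p" if \<pi>: "is_partition ?T \<pi>" for \<pi>
      proof (rule order_trans[OF A(2)[OF \<pi>]], intro add_right_mono add_left_mono)
        obtain q where q: "p = Suc q" using p by (cases p) auto
        have "ennreal (Gamma_const ?T L \<zeta>) * ?R \<pi> p
          \<le> ennreal (Gamma_const ?T L \<zeta>) * (ennreal (1 / real p) * (\<Sum>j<p. forward_error M P W \<phi> \<theta> R\<^sub>0 Xs \<pi> j))"
          using path_residual_le_average[OF \<pi>, of q] unfolding q by (rule mult_left_mono) simp
        also have "\<dots> = ennreal (Gamma_const ?T L \<zeta> / real p) * (\<Sum>j<p. forward_error M P W \<phi> \<theta> R\<^sub>0 Xs \<pi> j)"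
          using G by (simp add: ennreal_mult[symmetric] mult.assoc[symmetric])
        finally show "ennreal (Gamma_const ?T L \<zeta>) * ?R \<pi> p
          \<le> ennreal (Gamma_const ?T L \<zeta> / real p) * (\<Sum>j<p. forward_error M P W \<phi> \<theta> R\<^sub>0 Xs \<pi> j)" .
      qed
      with A(1) show ?thesis by blast
    qed
    then have "\<exists>A. \<forall>p. 1 \<le> p \<longrightarrow> 0 < A p \<and> (\<forall>\<pi>. is_partition ?T \<pi> \<longrightarrow> ?err \<pi> p \<le> ennreal (A p) * ?S \<pi> p
        + ennreal (Gamma_const ?T L \<zeta> / real p) * (\<Sum>j<p. forward_error M P W \<phi> \<theta> R\<^sub>0 Xs \<pi> j) + ?dec p)"
      by (intro choice) blast
    then show "\<exists>A. (\<forall>p\<ge>1. 0 < A p) \<and> (\<forall>\<pi>. is_partition ?T \<pi> \<longrightarrow> (\<forall>p\<ge>1. ?err \<pi> p \<le> ennreal (A p) * ?S \<pi> p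
        + ennreal (Gamma_const ?T L \<zeta> / real p) * (\<Sum>j<p. forward_error M P W \<phi> \<theta> R\<^sub>0 Xs \<pi> j) + ?dec p))"
      by blast
  qed
qed

end
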